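(* Let $V$ be a simple vertex algebra of countable dimension, $G$ a finite group of automorphisms of $V$, and $\sigma$ an element of the center of $G$. Let $\mathcal{S}$ be a finite $G$-stable set of pairwise inequivalent irreducible $\sigma$-twisted $V$-modules, let $\mathcal{M}=\bigoplus_{M\in\mathcal{S}}M$, and let $\mathcal{A}_\alpha(G,\mathcal{S})$, $J$, $M^j$, $\Lambda_j$, $W^j_\lambda$, $M^j_\lambda$ be as defined in the context. Then the decomposition of $\mathcal{A}_\alpha(G,\mathcal{S})\otimes V^G$-modules $$\mathcal{M}=\bigoplus_{j\in J,\ \lambda\in\Lambda_j}W^j_\lambda\otimes M^j_\lambda$$ gives a dual pair $(\mathcal{A}_\alpha(G,\mathcal{S}),V^G)$ on $\mathcal{M}$, that is: (1) $M^j_\lambda$ is nonzero for all $j\in J$ and $\lambda\in\Lambda_j$. (2) Each $M^j_\lambda$ is an irreducible $V^G$-module. (3) $M^{j_1}_{\lambda_1}$ and $M^{j_2}_{\lambda_2}$ are isomorphic $V^G$-modules if and only if $j_1=j_2$ and $\lambda_1=\lambda_2$. In particular, every irreducible $\sigma$-twisted $V$-module is a direct sum of finitely many irreducible $V^G$-modules.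
   Context: All vector spaces are over $\mathbb{C}$ and $\otimes=\otimes_{\mathbb{C}}$ unless indicated; $\delta(z)=\sum_{n\in\mathbb{Z}}z^n$ and binomials are expanded in nonnegative powers of the second variable. A vertex algebra is a vector space $V$ with a vector $\mathbf{1}\in V$ and a linear map $v\mapsto Y(v,z)=\sum_{n\in\mathbb{Z}}v_nz^{-n-1}\in(\mathrm{End}\,V)[[z,z^{-1}]]$ such that $u_nv=0$ for $n$ large, $Y(\mathbf{1},z)=\mathrm{Id}_V$, $Y(v,z)\mathbf{1}\in V[[z]]$ with constant term $v$, and the Jacobi identity holds: $$z_0^{-1}\delta\left(\tfrac{z_1-z_2}{z_0}\right)Y(u,z_1)Y(v,z_2)-z_0^{-1}\delta\left(\tfrac{z_2-z_1}{-z_0}\right)Y(v,z_2)Y(u,z_1)=z_2^{-1}\delta\left(\tfrac{z_1-z_0}{z_2}\right)Y(Y(u,z_0)v,z_2).$$ An automorphism is an invertible linear map $g$ with $g\mathbf{1}=\mathbf{1}$ and $gY(u,z)g^{-1}=Y(gu,z)$ for all $u\in V$. For a group $G$ of automorphisms, $V^G=\{v\in V: gv=v\ \forall g\in G\}$, a vertex subalgebra. Let $\sigma$ be an automorphism of finite order $T$ and $V^r=\{v\in V:\sigma v=e^{-2\pi i r/T}v\}$, $0\le r\le T-1$. A $\sigma$-twisted $V$-module is a vector space $M$ with a linear map $v\mapsto Y_M(v,z)=\sum_{n\in\frac1T\mathbb{Z}}v_nz^{-n-1}$, $v_n\in\mathrm{End}\,M$, such that for $u\in V^r$, $v\in V$,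 $w\in M$: $Y_M(u,z)=\sum_{n\in \frac rT+\mathbb{Z}}u_nz^{-n-1}$; $u_lw=0$ for $l$ large; $Y_M(\mathbf{1},z)=\mathrm{Id}_M$; and $$z_0^{-1}\delta\left(\tfrac{z_1-z_2}{z_0}\right)Y_M(u,z_1)Y_M(v,z_2)-z_0^{-1}\delta\left(\tfrac{z_2-z_1}{-z_0}\right)Y_M(v,z_2)Y_M(u,z_1)=z_2^{-1}\left(\tfrac{z_1-z_0}{z_2}\right)^{-r/T}\delta\left(\tfrac{z_1-z_0}{z_2}\right)Y_M(Y(u,z_0)v,z_2).$$ For $\sigma=1$ this is the notion of a $V$-module. Submodules are subspaces stable under all operators $v_n$; isomorphisms (equivalences) are linear bijections commuting with all $v_n$; irreducible (simple) means nonzero with no proper nonzero submodule. $V$ is simple if it is irreducible as a module over itself. A $\sigma$-twisted $V$-module is by restriction a $V^G$-module when $\sigma\in G$. For a $\sigma$-twisted $V$-module $M$ and $g\in G$ (with $\sigma$ central in $G$), $M\cdot g$ is the $\sigma$-twisted module with underlying space $M$ and $Y_{M\cdot g}(v,z)=Y_M(gv,z)$. The set $\mathcal{S}$ is $G$-stable if for every $M\in\mathcal{S}$, $h\in G$ there is $N\in\mathcal{S}$ with $N\cong M\cdot h$; this $N$ is unique and, as an element of $\mathcal{S}$, is again denoted $M\cdot h$, giving a right action of $G$ on the set $\mathcal{S}$. For each $N\in\mathcal{S}$ and $h\in G$, with $M=N\cdot h^{-1}\in\mathcal{S}$, fix a linear isomorphism $\phi_N(h):N\to M$ with $\phi_N(h)Y_N(u,z)=Y_M(hu,z)\phi_N(h)$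 for all $u\in V$, taking $\phi_N(1)=\mathrm{Id}_N$. By Schur's lemma there are $\alpha_N(g,h)\in\mathbb{C}^*$ with $\phi_M(g)\phi_N(h)=\alpha_N(g,h)\phi_N(gh)$ for $g,h\in G$, $M=N\cdot h^{-1}$. $\mathcal{A}_\alpha(G,\mathcal{S})$ is the associative algebra with basis $g\otimes e(M)$ ($g\in G$, $M\in\mathcal{S}$), product $(g\otimes e(M))(h\otimes e(N))=\alpha_N(g,h)\,gh\otimes e(M\cdot h)e(N)$, where $e(M)e(N)=\delta_{M,N}e(N)$, and identity $\sum_{M}1\otimes e(M)$; it is finite dimensional and semisimple. It acts on $\mathcal{M}$ by $(g\otimes e(M))w=\delta_{M,N}\phi_N(g)w$ for $w\in N\in\mathcal{S}$, and this action commutes with that of $V^G$. For $M\in\mathcal{S}$ put $G_M=\{g\in G:M\cdot g\cong M\}$, $S(M)=\mathrm{Span}\{g\otimes e(M):g\in G_M\}$, $D(M)=\mathrm{Span}\{g\otimes e(M):g\in G\}$. $D(M)$ is a left ideal of $\mathcal{A}_\alpha(G,\mathcal{S})$ and a right $S(M)$-module, and $S(M)$ is identified via $g\otimes e(M)\leftrightarrow\bar g$ with the twisted group algebra $\mathbb{C}^{\alpha_M}[G_M]=\bigoplus_{g\in G_M}\mathbb{C}\bar g$, $\bar g\bar h=\alpha_M(g,h)\overline{gh}$, which acts on $M$ by $\bar g\mapsto\phi_M(g)$. Let $\mathcal{S}=\bigcup_{j\in J}\mathcal{O}_j$ be the decomposition into $G$-orbits, $M^j\in\mathcal{O}_j$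 a representative, $G_j=G_{M^j}$, $\Lambda_j$ the set of irreducible characters of $\mathbb{C}^{\alpha_{M^j}}[G_j]$, and $W_{j,\lambda}$ the simple module with character $\lambda\in\Lambda_j$. Put $M^j_\lambda=\mathrm{Hom}_{\mathbb{C}^{\alpha_{M^j}}[G_j]}(W_{j,\lambda},M^j)$, a $V^{G_j}$-module (hence $V^G$-module) via $(v_nf)(w)=v_n(f(w))$, and $W^j_\lambda=D(M^j)\otimes_{S(M^j)}W_{j,\lambda}$. The modules $W^j_\lambda$ ($j\in J,\lambda\in\Lambda_j$) form a complete list of inequivalent simple $\mathcal{A}_\alpha(G,\mathcal{S})$-modules. For an associative algebra $A$ and a vertex algebra $U$, an $A\otimes U$-module is a vector space that is both an $A$-module and a $U$-module with commuting actions; for an $A$-module $W$ and a $U$-module $N$, $W\otimes N$ is an $A\otimes U$-module with $A$ acting on the first factor and $U$ on the second. For $A$ finite dimensional semisimple with simple modules $W_\lambda$, $(A,U)$ is a dual pair on an $A\otimes U$-module $\mathcal{M}$ if the multiplicity spaces $\mathrm{Hom}_A(W_\lambda,\mathcal{M})$, with the induced $U$-action, are irreducible $U$-modules for all $\lambda$ and are pairwise inequivalent for distinct $\lambda$. *)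

theory Defs
  imports
    Complex_Main
    "HOL-Library.Function_Algebras"
    "HOL-Library.Groups_Big_Fun"
    "HOL-Library.Countable_Set"
    "HOL-Algebra.Group"
begin

section \<open>Complex vector spaces\<close>

class complex_space = ab_group_add +
  fixes cscale :: "complex \<Rightarrow> 'a \<Rightarrow> 'a"
  assumes cscale_add_right: "cscale a (x + y) = cscale a x + cscale a y"
    and cscale_add_left: "cscale (a + b) x = cscale a x + cscale b x"
    and cscale_cscale: "cscale a (cscale b x) = cscale (a * b) x"
    and cscale_one: "cscale 1 x = x"

global_interpretation cv: vector_space "cscale :: complex \<Rightarrow> 'a \<Rightarrow> 'a::complex_space"
  by unfold_locales (auto simp: cscale_add_right cscale_add_left cscale_cscale cscale_one)

instantiation complex :: complex_space
begin
definition cscale_complex :: "complex \<Rightarrow> complex \<Rightarrow> complex" where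
  "cscale_complex a x = a * x"
instance by standard (auto simp: cscale_complex_def algebra_simps)
end

instantiation "fun" :: (type, complex_space) complex_space
begin
definition cscale_fun :: "complex \<Rightarrow> ('a \<Rightarrow> 'b) \<Rightarrow> 'a \<Rightarrow> 'b" where
  "cscale_fun a f = (\<lambda>x. cscale a (f x))"
instance
  by standard
    (auto simp: cscale_fun_def fun_eq_iff cscale_add_right cscale_add_left cscale_cscale cscale_one)
end

text \<open>
  All spaces below are subspaces (``carriers'') of some ambient type of class
  \<^class>\<open>complex_space\<close>; maps only matter on the carrier.
\<close>

definition lin_on :: "'a::complex_space set \<Rightarrow> 'b::complex_space set \<Rightarrow> ('a \<Rightarrow> 'b) \<Rightarrow> bool" where
  "lin_on X Z f \<longleftrightarrow>
     (\<forall>x\<in>X. f x \<in> Z) \<and>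
     (\<forall>x\<in>X. \<forall>y\<in>X. f (x + y) = f x + f y) \<and>
     (\<forall>c. \<forall>x\<in>X. f (cscale c x) = cscale c (f x))"

definition fin_dim :: "'a::complex_space set \<Rightarrow> bool" where
  "fin_dim X \<longleftrightarrow> (\<exists>B. finite B \<and> X = cv.span B)"

definition countable_dim :: "'a::complex_space set \<Rightarrow> bool" where
  "countable_dim X \<longleftrightarrow> (\<exists>B. countable B \<and> cv.independent B \<and> X = cv.span B)"

definition trace_on :: "'a::complex_space set \<Rightarrow> ('a \<Rightarrow> 'a) \<Rightarrow> complex" where
  "trace_on X f =
     (let B = (SOME B. cv.independent B \<and> cv.span B = X) in \<Sum>b\<in>B. cv.representation B (f b) b)"

definition direct_sum :: "'i set \<Rightarrow> ('i \<Rightarrow> 'a::complex_space set) \<Rightarrow> ('i \<Rightarrow> 'a) set" where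
  "direct_sum I X = {x. (\<forall>i\<in>I. x i \<in> X i) \<and> (\<forall>i. i \<notin> I \<longrightarrow> x i = 0) \<and> finite {i. x i \<noteq> 0}}"


section \<open>Formal calculus\<close>

text \<open>
  A formal series is given by its coefficients.
  \<open>binom_coeff s p q\<close> is the coefficient of \<open>x^p y^q\<close> in \<open>(x - y)^s\<close>, expanded in
  nonnegative powers of \<open>y\<close>.
\<close>

definition binom_coeff :: "rat \<Rightarrow> rat \<Rightarrow> rat \<Rightarrow> complex" where
  "binom_coeff s p q =
     (if q \<in> \<nat> \<and> p + q = s
      then (let k = nat \<lfloor>q\<rfloor> in of_rat ((-1) ^ k * (s gchoose k))) else 0)"

text \<open>
  Coefficients of \<open>z0^a z1^b z2^c\<close> in
  \<open>z0^(-1) \<delta>((z1 - z2) / z0) = (\<Sum>n\<in>\<int>. z0^(-1-n) (z1 - z2)^n)\<close>,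
  \<open>z0^(-1) \<delta>((z2 - z1) / (- z0)) = (\<Sum>n\<in>\<int>. (-1)^n z0^(-1-n) (z2 - z1)^n)\<close>, and
  \<open>z2^(-1) ((z1 - z0) / z2)^(-\<theta>) \<delta>((z1 - z0) / z2)
      = (\<Sum>s\<in>-\<theta>+\<int>. z2^(-1-s) (z1 - z0)^s)\<close>.
\<close>

definition delta12 :: "rat \<Rightarrow> rat \<Rightarrow> rat \<Rightarrow> complex" where
  "delta12 a b c = (if a \<in> \<int> then binom_coeff (-1 - a) b c else 0)"

definition delta21 :: "rat \<Rightarrow> rat \<Rightarrow> rat \<Rightarrow> complex" where
  "delta21 a b c = (if a \<in> \<int> then (-1) powi \<lfloor>-1 - a\<rfloor> * binom_coeff (-1 - a) c b else 0)"

definition delta10 :: "rat \<Rightarrow> rat \<Rightarrow> rat \<Rightarrow> rat \<Rightarrow> complex" where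
  "delta10 \<theta> a b c = (if (-1 - c) + \<theta> \<in> \<int> then binom_coeff (-1 - c) b a else 0)"

text \<open>
  The Jacobi identity, applied to a vector \<open>w\<close>, as equality of all coefficients of
  \<open>z0^a z1^b z2^c\<close>. The operators are given by their modes, \<open>Y(u, z) = (\<Sum>n. Y u n z^(-n-1))\<close>,
  so the coefficient of \<open>z^e\<close> is \<open>Y u (- e - 1)\<close>. Each \<^const>\<open>Sum_any\<close> (the sum over the
  support) is the Cauchy product with the delta series and has finite support by truncation.
\<close>

definition jacobi_identity ::
  "rat \<Rightarrow> ('v \<Rightarrow> rat \<Rightarrow> 'v \<Rightarrow> 'v) \<Rightarrow> ('v \<Rightarrow> rat \<Rightarrow> 'm::complex_space \<Rightarrow> 'm) \<Rightarrow> 'v \<Rightarrow> 'v \<Rightarrow> 'm \<Rightarrow> bool"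
where
  "jacobi_identity \<theta> Y YM u v w \<longleftrightarrow>
     (\<forall>a b c.
        Sum_any (\<lambda>(b', c'). cscale (delta12 a b' c')
                   (YM u (- (b - b') - 1) (YM v (- (c - c') - 1) w)))
      - Sum_any (\<lambda>(b', c'). cscale (delta21 a b' c')
                   (YM v (- (c - c') - 1) (YM u (- (b - b') - 1) w)))
      = Sum_any (\<lambda>(a', c'). cscale (delta10 \<theta> a' b c')
                   (YM (Y u (- (a - a') - 1) v) (- (c - c') - 1) w)))"


section \<open>Vertex algebras and automorphisms\<close>

record 'v vertex =
  vcar :: "'v set"
  vac :: 'v
  vmode :: "'v \<Rightarrow> int \<Rightarrow> 'v \<Rightarrow> 'v"

text \<open>The same operators with modes indexed by rationals, as is convenient for twisted modules.\<close>

definition rmode :: "'v::complex_space vertex \<Rightarrow> 'v \<Rightarrow> rat \<Rightarrow> 'v \<Rightarrow> 'v" where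
  "rmode V u n = (if n \<in> \<int> then vmode V u \<lfloor>n\<rfloor> else (\<lambda>_. 0))"

definition vertex_algebra :: "'v::complex_space vertex \<Rightarrow> bool" where
  "vertex_algebra V \<longleftrightarrow>
     cv.subspace (vcar V) \<and> vac V \<in> vcar V \<and>
     (\<forall>v\<in>vcar V. \<forall>n. lin_on (vcar V) (vcar V) (vmode V v n)) \<and>
     (\<forall>n. \<forall>w\<in>vcar V. lin_on (vcar V) (vcar V) (\<lambda>v. vmode V v n w)) \<and>
     (\<forall>u\<in>vcar V. \<forall>v\<in>vcar V. \<exists>N. \<forall>n\<ge>N. vmode V u n v = 0) \<and>
     (\<forall>n. \<forall>v\<in>vcar V. vmode V (vac V) n v = (if n = -1 then v else 0)) \<and>
     (\<forall>v\<in>vcar V. (\<forall>n\<ge>0. vmode V v n (vac V) = 0) \<and> vmode V v (-1) (vac V) = v) \<and>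
     (\<forall>u\<in>vcar V. \<forall>v\<in>vcar V. \<forall>w\<in>vcar V. jacobi_identity 0 (rmode V) (rmode V) u v w)"

definition automorphism :: "'v::complex_space vertex \<Rightarrow> ('v \<Rightarrow> 'v) \<Rightarrow> bool" where
  "automorphism V g \<longleftrightarrow>
     bij_betw g (vcar V) (vcar V) \<and> lin_on (vcar V) (vcar V) g \<and> g (vac V) = vac V \<and>
     (\<forall>u\<in>vcar V. \<forall>n. \<forall>v\<in>vcar V. g (vmode V u n v) = vmode V (g u) n (g v))"

text \<open>
  To be used only when \<open>vcar V = UNIV\<close>, where composition and identity of automorphisms are
  those of functions on the type.
\<close>

definition aut_group :: "'v::complex_space vertex \<Rightarrow> ('v \<Rightarrow> 'v) monoid" where
  "aut_group V = \<lparr>carrier = {g. automorphism V g}, mult = (\<circ>), one = id\<rparr>"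

definition fixed_points :: "'v vertex \<Rightarrow> ('v \<Rightarrow> 'v) set \<Rightarrow> 'v vertex" where
  "fixed_points V G = V\<lparr>vcar := {v \<in> vcar V. \<forall>g\<in>G. g v = v}\<rparr>"

definition aut_order :: "'v vertex \<Rightarrow> ('v \<Rightarrow> 'v) \<Rightarrow> nat" where
  "aut_order V \<sigma> = (LEAST T. 0 < T \<and> (\<forall>v\<in>vcar V. (\<sigma> ^^ T) v = v))"

definition eigenspace :: "'v::complex_space vertex \<Rightarrow> ('v \<Rightarrow> 'v) \<Rightarrow> nat \<Rightarrow> 'v set" where
  "eigenspace V \<sigma> r =
     {v \<in> vcar V. \<sigma> v = cscale (exp (- 2 * of_real pi * \<i> * of_nat r / of_nat (aut_order V \<sigma>))) v}"


section \<open>Twisted modules\<close>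

record ('v, 'm) vmod =
  mcar :: "'m set"
  mmode :: "'v \<Rightarrow> rat \<Rightarrow> 'm \<Rightarrow> 'm"

definition twisted_module ::
  "'v::complex_space vertex \<Rightarrow> ('v \<Rightarrow> 'v) \<Rightarrow> ('v, 'm::complex_space) vmod \<Rightarrow> bool" where
  "twisted_module V \<sigma> M \<longleftrightarrow>
     (let T = aut_order V \<sigma> in
      cv.subspace (mcar M) \<and>
      (\<forall>v\<in>vcar V. \<forall>n. lin_on (mcar M) (mcar M) (mmode M v n)) \<and>
      (\<forall>n. \<forall>w\<in>mcar M. lin_on (vcar V) (mcar M) (\<lambda>v. mmode M v n w)) \<and>
      (\<forall>n. \<forall>w\<in>mcar M. mmode M (vac V) n w = (if n = -1 then w else 0)) \<and>
      (\<forall>r<T. \<forall>u\<in>eigenspace V \<sigma> r. \<forall>w\<in>mcar M.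
         (\<forall>n. n - of_nat r / of_nat T \<notin> \<int> \<longrightarrow> mmode M u n w = 0) \<and>
         (\<exists>N. \<forall>l\<ge>N. mmode M u l w = 0) \<and>
         (\<forall>v\<in>vcar V. jacobi_identity (of_nat r / of_nat T) (rmode V) (mmode M) u v w)))"

definition va_module :: "'v::complex_space vertex \<Rightarrow> ('v, 'm::complex_space) vmod \<Rightarrow> bool" where
  "va_module V M \<longleftrightarrow> twisted_module V id M"

definition vsubmodule ::
  "'v vertex \<Rightarrow> ('v, 'm::complex_space) vmod \<Rightarrow> 'm set \<Rightarrow> bool" where
  "vsubmodule V M N \<longleftrightarrow>
     cv.subspace N \<and> N \<subseteq> mcar M \<and> (\<forall>v\<in>vcar V. \<forall>n. \<forall>w\<in>N. mmode M v n w \<in> N)"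

definition irreducible_vmod :: "'v vertex \<Rightarrow> ('v, 'm::complex_space) vmod \<Rightarrow> bool" where
  "irreducible_vmod V M \<longleftrightarrow>
     mcar M \<noteq> {0} \<and> (\<forall>N. vsubmodule V M N \<longrightarrow> N = {0} \<or> N = mcar M)"

definition irreducible_twisted_module ::
  "'v::complex_space vertex \<Rightarrow> ('v \<Rightarrow> 'v) \<Rightarrow> ('v, 'm::complex_space) vmod \<Rightarrow> bool" where
  "irreducible_twisted_module V \<sigma> M \<longleftrightarrow> twisted_module V \<sigma> M \<and> irreducible_vmod V M"

definition irreducible_va_module ::
  "'v::complex_space vertex \<Rightarrow> ('v, 'm::complex_space) vmod \<Rightarrow> bool" where
  "irreducible_va_module V M \<longleftrightarrow> va_module V M \<and> irreducible_vmod V M"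

definition vmod_hom_iso ::
  "'v vertex \<Rightarrow> ('v, 'm::complex_space) vmod \<Rightarrow> ('v, 'n::complex_space) vmod \<Rightarrow> ('m \<Rightarrow> 'n) \<Rightarrow> bool" where
  "vmod_hom_iso V M N f \<longleftrightarrow>
     bij_betw f (mcar M) (mcar N) \<and> lin_on (mcar M) (mcar N) f \<and>
     (\<forall>v\<in>vcar V. \<forall>n. \<forall>w\<in>mcar M. f (mmode M v n w) = mmode N v n (f w))"

definition vmod_iso ::
  "'v vertex \<Rightarrow> ('v, 'm::complex_space) vmod \<Rightarrow> ('v, 'n::complex_space) vmod \<Rightarrow> bool" where
  "vmod_iso V M N \<longleftrightarrow> (\<exists>f. vmod_hom_iso V M N f)"

definition adjoint_module :: "'v::complex_space vertex \<Rightarrow> ('v, 'v) vmod" where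
  "adjoint_module V = \<lparr>mcar = vcar V, mmode = rmode V\<rparr>"

definition simple_vertex_algebra :: "'v::complex_space vertex \<Rightarrow> bool" where
  "simple_vertex_algebra V \<longleftrightarrow> vertex_algebra V \<and> irreducible_vmod V (adjoint_module V)"

definition vmod_sum :: "'i set \<Rightarrow> ('i \<Rightarrow> ('v, 'm::complex_space) vmod) \<Rightarrow> ('v, 'i \<Rightarrow> 'm) vmod" where
  "vmod_sum I M =
     \<lparr>mcar = direct_sum I (\<lambda>i. mcar (M i)),
      mmode = (\<lambda>v n x i. if i \<in> I then mmode (M i) v n (x i) else 0)\<rparr>"


section \<open>Algebras and their modules\<close>

record 'a alg =
  acar :: "'a set"
  amul :: "'a \<Rightarrow> 'a \<Rightarrow> 'a"
  aone :: 'a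

definition assoc_algebra :: "'a::complex_space alg \<Rightarrow> bool" where
  "assoc_algebra A \<longleftrightarrow>
     cv.subspace (acar A) \<and> aone A \<in> acar A \<and>
     (\<forall>a\<in>acar A. lin_on (acar A) (acar A) (\<lambda>b. amul A a b)) \<and>
     (\<forall>b\<in>acar A. lin_on (acar A) (acar A) (\<lambda>a. amul A a b)) \<and>
     (\<forall>a\<in>acar A. \<forall>b\<in>acar A. \<forall>c\<in>acar A. amul A (amul A a b) c = amul A a (amul A b c)) \<and>
     (\<forall>a\<in>acar A. amul A (aone A) a = a \<and> amul A a (aone A) = a)"

record ('a, 'w) amod =
  wcar :: "'w set"
  wact :: "'a \<Rightarrow> 'w \<Rightarrow> 'w"

definition alg_module :: "'a::complex_space alg \<Rightarrow> ('a, 'w::complex_space) amod \<Rightarrow> bool" where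
  "alg_module A W \<longleftrightarrow>
     cv.subspace (wcar W) \<and>
     (\<forall>a\<in>acar A. lin_on (wcar W) (wcar W) (wact W a)) \<and>
     (\<forall>w\<in>wcar W. lin_on (acar A) (wcar W) (\<lambda>a. wact W a w)) \<and>
     (\<forall>a\<in>acar A. \<forall>b\<in>acar A. \<forall>w\<in>wcar W. wact W (amul A a b) w = wact W a (wact W b w)) \<and>
     (\<forall>w\<in>wcar W. wact W (aone A) w = w)"

definition asubmodule :: "'a alg \<Rightarrow> ('a, 'w::complex_space) amod \<Rightarrow> 'w set \<Rightarrow> bool" where
  "asubmodule A W N \<longleftrightarrow>
     cv.subspace N \<and> N \<subseteq> wcar W \<and> (\<forall>a\<in>acar A. \<forall>w\<in>N. wact W a w \<in> N)"

definition simple_amod :: "'a::complex_space alg \<Rightarrow> ('a, 'w::complex_space) amod \<Rightarrow> bool" where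
  "simple_amod A W \<longleftrightarrow>
     alg_module A W \<and> wcar W \<noteq> {0} \<and> (\<forall>N. asubmodule A W N \<longrightarrow> N = {0} \<or> N = wcar W)"

definition amod_iso ::
  "'a alg \<Rightarrow> ('a, 'w::complex_space) amod \<Rightarrow> ('a, 'x::complex_space) amod \<Rightarrow> bool" where
  "amod_iso A W X \<longleftrightarrow>
     (\<exists>f. bij_betw f (wcar W) (wcar X) \<and> lin_on (wcar W) (wcar X) f \<and>
          (\<forall>a\<in>acar A. \<forall>w\<in>wcar W. f (wact W a w) = wact X a (f w)))"

definition semisimple_algebra :: "'a::complex_space alg \<Rightarrow> bool" where
  "semisimple_algebra A \<longleftrightarrow>
     assoc_algebra A \<and>
     (let R = \<lparr>wcar = acar A, wact = amul A\<rparr> in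
      \<forall>L. asubmodule A R L \<longrightarrow>
        (\<exists>L'. asubmodule A R L' \<and> L \<inter> L' = {0} \<and> {x + y | x y. x \<in> L \<and> y \<in> L'} = acar A))"

text \<open>
  A simple module over a finite-dimensional algebra is finite dimensional, hence isomorphic to one
  whose underlying space is a subspace of \<^typ>\<open>nat \<Rightarrow> complex\<close>. So quantification over
  modules carried by this type covers all simple modules up to isomorphism.
\<close>

definition complete_simple_list ::
  "'a::complex_space alg \<Rightarrow> 'i set \<Rightarrow> ('i \<Rightarrow> ('a, 'w::complex_space) amod) \<Rightarrow> bool" where
  "complete_simple_list A I W \<longleftrightarrow>
     (\<forall>i\<in>I. simple_amod A (W i)) \<and>
     (\<forall>i\<in>I. \<forall>k\<in>I. amod_iso A (W i) (W k) \<longrightarrow> i = k) \<and>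
     (\<forall>X :: ('a, nat \<Rightarrow> complex) amod. simple_amod A X \<longrightarrow> (\<exists>i\<in>I. amod_iso A X (W i)))"

text \<open>Characters, as linear functionals on the algebra.\<close>

definition character :: "'a alg \<Rightarrow> ('a, 'w::complex_space) amod \<Rightarrow> 'a \<Rightarrow> complex" where
  "character A W = (\<lambda>a. if a \<in> acar A then trace_on (wcar W) (wact W a) else 0)"

definition irreducible_characters :: "'a::complex_space alg \<Rightarrow> ('a \<Rightarrow> complex) set" where
  "irreducible_characters A =
     {\<chi>. \<exists>W :: ('a, nat \<Rightarrow> complex) amod. simple_amod A W \<and> \<chi> = character A W}"

text \<open>Homomorphisms are extended by 0 off the carrier, so that each is represented by one function.\<close>

definition amod_hom ::
  "'a alg \<Rightarrow> ('a, 'w::complex_space) amod \<Rightarrow> ('a, 'x::complex_space) amod \<Rightarrow> ('w \<Rightarrow> 'x) set" where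
  "amod_hom A W X =
     {f. lin_on (wcar W) (wcar X) f \<and> (\<forall>w. w \<notin> wcar W \<longrightarrow> f w = 0) \<and>
         (\<forall>a\<in>acar A. \<forall>w\<in>wcar W. f (wact W a w) = wact X a (f w))}"

definition amod_sum :: "'i set \<Rightarrow> ('i \<Rightarrow> ('a, 'w::complex_space) amod) \<Rightarrow> ('a, 'i \<Rightarrow> 'w) amod" where
  "amod_sum I W =
     \<lparr>wcar = direct_sum I (\<lambda>i. wcar (W i)),
      wact = (\<lambda>a x i. if i \<in> I then wact (W i) a (x i) else 0)\<rparr>"


section \<open>Tensor products\<close>

text \<open>
  Let \<open>F\<close> be the space of all bilinear forms \<open>D \<times> W \<rightarrow> \<complex>\<close> that are balanced over an algebra
  \<open>R\<close>. The algebraic dual of \<open>D \<otimes>\<^sub>R W\<close> is \<open>F\<close>, and the canonical map from a vector space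
  to its bidual is injective; so \<open>D \<otimes>\<^sub>R W\<close> is realised as the span, in the space of
  functionals on \<open>F\<close>, of the evaluations \<open>d \<otimes> w = (\<lambda>\<beta>. \<beta> d w)\<close>. The universal property is
  \<open>tensor_universal\<close> below.
\<close>

definition bilinear_forms ::
  "'d::complex_space set \<Rightarrow> 'w::complex_space set \<Rightarrow> ('d \<Rightarrow> 'w \<Rightarrow> complex) set" where
  "bilinear_forms D W =
     {\<beta>. (\<forall>d\<in>D. lin_on W UNIV (\<lambda>w. \<beta> d w)) \<and> (\<forall>w\<in>W. lin_on D UNIV (\<lambda>d. \<beta> d w))}"

definition balanced_forms ::
  "'a alg \<Rightarrow> 'd::complex_space set \<Rightarrow> ('d \<Rightarrow> 'a \<Rightarrow> 'd) \<Rightarrow> ('a, 'w::complex_space) amod \<Rightarrow>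
   ('d \<Rightarrow> 'w \<Rightarrow> complex) set" where
  "balanced_forms R D ract W =
     {\<beta> \<in> bilinear_forms D (wcar W).
        \<forall>d\<in>D. \<forall>a\<in>acar R. \<forall>w\<in>wcar W. \<beta> (ract d a) w = \<beta> d (wact W a w)}"

definition pure_tensor ::
  "('d \<Rightarrow> 'w \<Rightarrow> complex) set \<Rightarrow> 'd \<Rightarrow> 'w \<Rightarrow> ('d \<Rightarrow> 'w \<Rightarrow> complex) \<Rightarrow> complex" where
  "pure_tensor F d w = (\<lambda>\<beta>. if \<beta> \<in> F then \<beta> d w else 0)"

definition tensor_space ::
  "('d \<Rightarrow> 'w \<Rightarrow> complex) set \<Rightarrow> 'd set \<Rightarrow> 'w set \<Rightarrow> (('d \<Rightarrow> 'w \<Rightarrow> complex) \<Rightarrow> complex) set" where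
  "tensor_space F D W = cv.span {pure_tensor F d w | d w. d \<in> D \<and> w \<in> W}"

text \<open>The map induced by \<open>f\<close> and \<open>g\<close>, sending \<open>d \<otimes> w\<close> to \<open>f d \<otimes> g w\<close>.\<close>

definition tensor_map ::
  "('d \<Rightarrow> 'w \<Rightarrow> complex) set \<Rightarrow> ('d \<Rightarrow> 'd) \<Rightarrow> ('w \<Rightarrow> 'w) \<Rightarrow>
   (('d \<Rightarrow> 'w \<Rightarrow> complex) \<Rightarrow> complex) \<Rightarrow> ('d \<Rightarrow> 'w \<Rightarrow> complex) \<Rightarrow> complex" where
  "tensor_map F f g t = (\<lambda>\<beta>. if \<beta> \<in> F then t (\<lambda>d w. \<beta> (f d) (g w)) else 0)"

lemma separating_functional:
  fixes x :: "'x::complex_space"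
  assumes "x \<noteq> 0"
  shows "\<exists>l. lin_on UNIV UNIV l \<and> l x \<noteq> (0::complex)"
proof -
  have ind: "cv.independent {x}"
    using assms by (simp add: cv.dependent_single)
  define B where "B = cv.extend_basis {x}"
  have B: "cv.independent B" "cv.span B = UNIV" "x \<in> B"
    unfolding B_def
    using cv.independent_extend_basis[OF ind] cv.span_extend_basis[OF ind]
      cv.extend_basis_superset[OF ind] by auto
  define l where "l = (\<lambda>y. cv.representation B y x)"
  have "lin_on UNIV UNIV l"
    unfolding lin_on_def l_def
    using B by (auto simp: cv.representation_add cv.representation_scale cscale_complex_def)
  moreover have "l x \<noteq> 0"
    unfolding l_def using B by (simp add: cv.representation_basis)
  ultimately show ?thesis by blast
qed

lemma lin_on_subspaceD:
  assumes "lin_on X Z f" "x \<in> X" "y \<in> X"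
  shows "f (x + y) = f x + f y" "f (cscale c x) = cscale c (f x)"
  using assms by (auto simp: lin_on_def)

lemma tensor_lift:
  fixes b :: "'d::complex_space \<Rightarrow> 'w::complex_space \<Rightarrow> 'x::complex_space"
  assumes F: "\<And>l. lin_on UNIV UNIV l \<Longrightarrow> (\<lambda>d w. l (b d w)) \<in> F"
  shows "\<exists>f. lin_on (tensor_space F D W) UNIV f \<and>
             (\<forall>d\<in>D. \<forall>w\<in>W. f (pure_tensor F d w) = b d w)"
proof -
  define P where "P = (\<lambda>t (y::'x). \<forall>l. lin_on UNIV UNIV l \<longrightarrow> l y = (t (\<lambda>d w. l (b d w)) :: complex))"
  define f where "f = (\<lambda>t. THE y. P t y)"
  have uniq: "y = y'" if "P t y" "P t y'" for t y y'
  proof (rule ccontr)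
    assume "y \<noteq> y'"
    then obtain l where l: "lin_on UNIV UNIV l" "l (y - y') \<noteq> (0::complex)"
      using separating_functional[of "y - y'"] by auto
    have "l y = l (y - y') + l y'"
      using l(1) lin_on_subspaceD(1)[OF l(1), of "y - y'" y'] by simp
    moreover have "l y = l y'"
      using that l(1) unfolding P_def by metis
    ultimately show False using l(2) by simp
  qed
  have fP: "f t = y" if "P t y" for t y
    unfolding f_def using that uniq by (intro the_equality) auto
  have pure: "P (pure_tensor F d w) (b d w)" for d w
    using F by (auto simp: P_def pure_tensor_def)
  have add: "P (t + t') (y + y')" if "P t y" "P t' y'" for t t' y y'
    using that by (auto simp: P_def lin_on_def)
  have scale: "P (cscale c t) (cscale c y)" if "P t y" for c t y
    using that by (auto simp: P_def lin_on_def cscale_fun_def cscale_complex_def)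
  have zero: "P 0 0"
  proof -
    have "l 0 = (0::complex)" if "lin_on UNIV UNIV l" for l :: "'x \<Rightarrow> complex"
      using lin_on_subspaceD(1)[OF that, of 0 0] by simp
    then show ?thesis by (simp add: P_def)
  qed
  have "\<exists>y. P t y" if "t \<in> tensor_space F D W" for t
    using that unfolding tensor_space_def
  proof (induction rule: cv.span_induct_alt)
    case base
    then show ?case using zero by blast
  next
    case (step c x y)
    then show ?case using add scale pure by blast
  qed
  then have "P t (f t)" if "t \<in> tensor_space F D W" for t
    using fP that by metis
  then have "lin_on (tensor_space F D W) UNIV f"
    unfolding lin_on_def using fP add scale by blast
  moreover have "f (pure_tensor F d w) = b d w" for d w
    using fP pure by blast
  ultimately show ?thesis by blast
qed

lemma tensor_maps_unique:
  assumes f: "lin_on (tensor_space F D W) UNIV f" and f': "lin_on (tensor_space F D W) UNIV f'"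
    and eq: "\<And>d w. d \<in> D \<Longrightarrow> w \<in> W \<Longrightarrow> f (pure_tensor F d w) = f' (pure_tensor F d w)"
    and "t \<in> tensor_space F D W"
  shows "f t = (f' t :: 'x::complex_space)"
proof -
  let ?T = "tensor_space F D W"
  have T: "cv.subspace ?T"
    by (simp add: tensor_space_def cv.subspace_span)
  have "cv.subspace {t \<in> ?T. f t = f' t}"
  proof (rule cv.subspaceI)
    have 0: "0 \<in> ?T"
      using T by (rule cv.subspace_0)
    have "f 0 = 0" "f' 0 = 0"
      using lin_on_subspaceD(2)[OF f 0 0, of 0] lin_on_subspaceD(2)[OF f' 0 0, of 0]
      by (simp_all only: cv.scale_zero_left)
    with 0 show "0 \<in> {t \<in> ?T. f t = f' t}" by (simp del: zero_fun_apply)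
  qed (use T f f' in \<open>auto simp: lin_on_def cv.subspace_add cv.subspace_scale\<close>)
  moreover have "pure_tensor F d w \<in> {t \<in> ?T. f t = f' t}" if "d \<in> D" "w \<in> W" for d w
    using that eq unfolding tensor_space_def by (auto intro: cv.span_base)
  ultimately have "?T \<subseteq> {t \<in> ?T. f t = f' t}"
    unfolding tensor_space_def by (intro cv.span_minimal) auto
  with assms(4) show ?thesis by blast
qed

theorem tensor_universal:
  fixes b :: "'d::complex_space \<Rightarrow> 'w::complex_space \<Rightarrow> 'x::complex_space"
  assumes "\<And>d. d \<in> D \<Longrightarrow> lin_on (wcar W) UNIV (\<lambda>w. b d w)"
    and "\<And>w. w \<in> wcar W \<Longrightarrow> lin_on D UNIV (\<lambda>d. b d w)"
    and "\<And>d a w. d \<in> D \<Longrightarrow> a \<in> acar R \<Longrightarrow> w \<in> wcar W \<Longrightarrow> b (ract d a) w = b d (wact W a w)"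
  defines "F \<equiv> balanced_forms R D ract W"
  shows "\<exists>f. lin_on (tensor_space F D (wcar W)) UNIV f \<and>
             (\<forall>d\<in>D. \<forall>w\<in>wcar W. f (pure_tensor F d w) = b d w) \<and>
             (\<forall>f'. lin_on (tensor_space F D (wcar W)) UNIV f' \<and>
                   (\<forall>d\<in>D. \<forall>w\<in>wcar W. f' (pure_tensor F d w) = b d w) \<longrightarrow>
                   (\<forall>t\<in>tensor_space F D (wcar W). f' t = f t))"
proof -
  have "(\<lambda>d w. l (b d w)) \<in> F" if "lin_on UNIV UNIV l" for l :: "'x \<Rightarrow> complex"
  proof -
    have "lin_on (wcar W) UNIV (\<lambda>w. l (b d w))" if "d \<in> D" for d
      using assms(1)[OF that] \<open>lin_on UNIV UNIV l\<close> by (simp add: lin_on_def)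
    moreover have "lin_on D UNIV (\<lambda>d. l (b d w))" if "w \<in> wcar W" for w
      using assms(2)[OF that] \<open>lin_on UNIV UNIV l\<close> by (simp add: lin_on_def)
    ultimately show ?thesis
      using assms(3) by (simp add: F_def balanced_forms_def bilinear_forms_def)
  qed
  from tensor_lift[of b F D "wcar W", OF this] obtain f where
    f: "lin_on (tensor_space F D (wcar W)) UNIV f"
       "\<forall>d\<in>D. \<forall>w\<in>wcar W. f (pure_tensor F d w) = b d w"
    by blast
  have "f' t = f t"
    if "lin_on (tensor_space F D (wcar W)) UNIV f'"
      and "\<forall>d\<in>D. \<forall>w\<in>wcar W. f' (pure_tensor F d w) = b d w"
      and "t \<in> tensor_space F D (wcar W)" for f' t
    using tensor_maps_unique[OF that(1) f(1) _ that(3)] that(2) f(2) by simp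
  with f show ?thesis by blast
qed

lemma pure_tensor_balanced:
  assumes "F = balanced_forms R D ract W"
    and "d \<in> D" "a \<in> acar R" "w \<in> wcar W"
  shows "pure_tensor F (ract d a) w = pure_tensor F d (wact W a w)"
  unfolding assms(1) using assms(2-4) by (simp add: pure_tensor_def balanced_forms_def fun_eq_iff)


section \<open>Modules over an algebra and a vertex algebra; dual pairs\<close>

text \<open>An \<open>A \<otimes> U\<close>-module is given by two module structures on one carrier.\<close>

definition au_module ::
  "'a::complex_space alg \<Rightarrow> 'v::complex_space vertex \<Rightarrow>
   ('a, 'x::complex_space) amod \<Rightarrow> ('v, 'x) vmod \<Rightarrow> bool" where
  "au_module A U X N \<longleftrightarrow>
     wcar X = mcar N \<and> alg_module A X \<and> va_module U N \<and>
     (\<forall>a\<in>acar A. \<forall>v\<in>vcar U. \<forall>n. \<forall>x\<in>wcar X.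
        wact X a (mmode N v n x) = mmode N v n (wact X a x))"

definition au_iso ::
  "'a::complex_space alg \<Rightarrow> 'v::complex_space vertex \<Rightarrow>
   ('a, 'x::complex_space) amod \<Rightarrow> ('v, 'x) vmod \<Rightarrow>
   ('a, 'y::complex_space) amod \<Rightarrow> ('v, 'y) vmod \<Rightarrow> bool" where
  "au_iso A U X N X' N' \<longleftrightarrow>
     (\<exists>f. vmod_hom_iso U N N' f \<and>
          (\<forall>a\<in>acar A. \<forall>x\<in>wcar X. f (wact X a x) = wact X' a (f x)))"

definition tensor_amod ::
  "('a, 'w::complex_space) amod \<Rightarrow> ('v, 'm::complex_space) vmod \<Rightarrow>
   ('a, ('w \<Rightarrow> 'm \<Rightarrow> complex) \<Rightarrow> complex) amod" where
  "tensor_amod W N =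
     (let F = bilinear_forms (wcar W) (mcar N) in
      \<lparr>wcar = tensor_space F (wcar W) (mcar N), wact = (\<lambda>a. tensor_map F (wact W a) id)\<rparr>)"

definition tensor_vmod ::
  "('a, 'w::complex_space) amod \<Rightarrow> ('v, 'm::complex_space) vmod \<Rightarrow>
   ('v, ('w \<Rightarrow> 'm \<Rightarrow> complex) \<Rightarrow> complex) vmod" where
  "tensor_vmod W N =
     (let F = bilinear_forms (wcar W) (mcar N) in
      \<lparr>mcar = tensor_space F (wcar W) (mcar N), mmode = (\<lambda>v n. tensor_map F id (mmode N v n))\<rparr>)"

text \<open>The multiplicity space \<open>Hom_A(W, X)\<close> with the action \<open>(v_n f)(w) = v_n (f w)\<close>.\<close>

definition hom_vmod ::
  "'a alg \<Rightarrow> ('a, 'w::complex_space) amod \<Rightarrow> ('a, 'x::complex_space) amod \<Rightarrow> ('v, 'x) vmod \<Rightarrow>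
   ('v, 'w \<Rightarrow> 'x) vmod" where
  "hom_vmod A W X N =
     \<lparr>mcar = amod_hom A W X,
      mmode = (\<lambda>v n f w. if w \<in> wcar W then mmode N v n (f w) else 0)\<rparr>"

definition dual_pair ::
  "'a::complex_space alg \<Rightarrow> 'v::complex_space vertex \<Rightarrow>
   ('a, 'x::complex_space) amod \<Rightarrow> ('v, 'x) vmod \<Rightarrow>
   'i set \<Rightarrow> ('i \<Rightarrow> ('a, 'w::complex_space) amod) \<Rightarrow> bool" where
  "dual_pair A U X N I W \<longleftrightarrow>
     fin_dim (acar A) \<and> semisimple_algebra A \<and> complete_simple_list A I W \<and> au_module A U X N \<and>
     (\<forall>i\<in>I. irreducible_va_module U (hom_vmod A (W i) X N)) \<and>
     (\<forall>i\<in>I. \<forall>k\<in>I. vmod_iso U (hom_vmod A (W i) X N) (hom_vmod A (W k) X N) \<longrightarrow> i = k)"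


section \<open>The action of G on a stable set of twisted modules\<close>

definition twist :: "('v, 'm) vmod \<Rightarrow> ('v \<Rightarrow> 'v) \<Rightarrow> ('v, 'm) vmod" where
  "twist M g = \<lparr>mcar = mcar M, mmode = (\<lambda>v. mmode M (g v))\<rparr>"

definition G_stable ::
  "'v vertex \<Rightarrow> ('v \<Rightarrow> 'v) set \<Rightarrow> ('v, 'm::complex_space) vmod set \<Rightarrow> bool" where
  "G_stable V G S \<longleftrightarrow> (\<forall>M\<in>S. \<forall>h\<in>G. \<exists>N\<in>S. vmod_iso V N (twist M h))"

definition mact ::
  "'v vertex \<Rightarrow> ('v, 'm::complex_space) vmod set \<Rightarrow> ('v, 'm) vmod \<Rightarrow> ('v \<Rightarrow> 'v) \<Rightarrow> ('v, 'm) vmod"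
where
  "mact V S M h = (THE N. N \<in> S \<and> vmod_iso V N (twist M h))"

abbreviation finv :: "('v \<Rightarrow> 'v) \<Rightarrow> 'v \<Rightarrow> 'v" where
  "finv h \<equiv> inv_into UNIV h"

definition stabilizer ::
  "'v vertex \<Rightarrow> ('v \<Rightarrow> 'v) set \<Rightarrow> ('v, 'm::complex_space) vmod \<Rightarrow> ('v \<Rightarrow> 'v) set" where
  "stabilizer V G M = {g \<in> G. vmod_iso V (twist M g) M}"

definition orbits ::
  "'v vertex \<Rightarrow> ('v \<Rightarrow> 'v) set \<Rightarrow> ('v, 'm::complex_space) vmod set \<Rightarrow> ('v, 'm) vmod set set" where
  "orbits V G S = (\<lambda>M. (\<lambda>h. mact V S M h) ` G) ` S"

definition intertwining_system ::
  "'v vertex \<Rightarrow> ('v \<Rightarrow> 'v) set \<Rightarrow> ('v, 'm::complex_space) vmod set \<Rightarrow>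
   (('v, 'm) vmod \<Rightarrow> ('v \<Rightarrow> 'v) \<Rightarrow> 'm \<Rightarrow> 'm) \<Rightarrow> bool" where
  "intertwining_system V G S \<phi> \<longleftrightarrow>
     (\<forall>N\<in>S. \<forall>h\<in>G.
        (let M = mact V S N (finv h) in
         bij_betw (\<phi> N h) (mcar N) (mcar M) \<and> lin_on (mcar N) (mcar M) (\<phi> N h) \<and>
         (\<forall>u\<in>vcar V. \<forall>n. \<forall>w\<in>mcar N. \<phi> N h (mmode N u n w) = mmode M (h u) n (\<phi> N h w)))) \<and>
     (\<forall>N\<in>S. \<forall>w\<in>mcar N. \<phi> N id w = w)"

definition cocycle ::
  "'v vertex \<Rightarrow> ('v, 'm::complex_space) vmod set \<Rightarrow>
   (('v, 'm) vmod \<Rightarrow> ('v \<Rightarrow> 'v) \<Rightarrow> 'm \<Rightarrow> 'm) \<Rightarrow>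
   ('v, 'm) vmod \<Rightarrow> ('v \<Rightarrow> 'v) \<Rightarrow> ('v \<Rightarrow> 'v) \<Rightarrow> complex" where
  "cocycle V S \<phi> N g h =
     (THE c. \<forall>w\<in>mcar N. \<phi> (mact V S N (finv h)) g (\<phi> N h w) = cscale c (\<phi> N (g \<circ> h) w))"


section \<open>The algebra of G and S\<close>

type_synonym ('v, 'm) gs = "('v \<Rightarrow> 'v) \<times> ('v, 'm) vmod \<Rightarrow> complex"

text \<open>The basis element \<open>g \<otimes> e(M)\<close>.\<close>

definition gs_basis :: "('v \<Rightarrow> 'v) \<Rightarrow> ('v, 'm) vmod \<Rightarrow> ('v, 'm) gs" where
  "gs_basis g M = (\<lambda>p. if p = (g, M) then 1 else 0)"

definition gs_algebra ::
  "'v vertex \<Rightarrow> ('v \<Rightarrow> 'v) set \<Rightarrow> ('v, 'm::complex_space) vmod set \<Rightarrow>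
   (('v, 'm) vmod \<Rightarrow> ('v \<Rightarrow> 'v) \<Rightarrow> 'm \<Rightarrow> 'm) \<Rightarrow> ('v, 'm) gs alg" where
  "gs_algebra V G S \<phi> =
     \<lparr>acar = {a. \<forall>g M. a (g, M) \<noteq> 0 \<longrightarrow> g \<in> G \<and> M \<in> S},
      amul = (\<lambda>a b. \<Sum>g\<in>G. \<Sum>M\<in>S. \<Sum>h\<in>G. \<Sum>N\<in>S. cscale (a (g, M) * b (h, N))
                (if mact V S M h = N then cscale (cocycle V S \<phi> N g h) (gs_basis (g \<circ> h) N) else 0)),
      aone = (\<Sum>M\<in>S. gs_basis id M)\<rparr>"

text \<open>The \<open>A\<^sub>\<alpha>(G, S)\<close>-module structure of the direct sum of the members of \<open>S\<close>.\<close>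

definition gs_module ::
  "'v vertex \<Rightarrow> ('v \<Rightarrow> 'v) set \<Rightarrow> ('v, 'm::complex_space) vmod set \<Rightarrow>
   (('v, 'm) vmod \<Rightarrow> ('v \<Rightarrow> 'v) \<Rightarrow> 'm \<Rightarrow> 'm) \<Rightarrow> (('v, 'm) gs, ('v, 'm) vmod \<Rightarrow> 'm) amod" where
  "gs_module V G S \<phi> =
     \<lparr>wcar = direct_sum S mcar,
      wact = (\<lambda>a x K. \<Sum>g\<in>G. \<Sum>N\<in>S.
                if mact V S N (finv g) = K then cscale (a (g, N)) (\<phi> N g (x N)) else 0)\<rparr>"

definition gs_D :: "('v \<Rightarrow> 'v) set \<Rightarrow> ('v, 'm) vmod \<Rightarrow> ('v, 'm) gs set" where
  "gs_D G M = cv.span ((\<lambda>g. gs_basis g M) ` G)"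

text \<open>
  The twisted group algebra of the stabilizer of \<open>M\<close>: functions on \<open>G\<^sub>M\<close> with twisted
  convolution. It is identified with \<open>S(M)\<close> via \<open>gs_embed M\<close>, which maps the basis vector at
  \<open>g\<close> to \<open>g \<otimes> e(M)\<close>.
\<close>

definition twisted_group_algebra ::
  "'v vertex \<Rightarrow> ('v \<Rightarrow> 'v) set \<Rightarrow> ('v, 'm::complex_space) vmod set \<Rightarrow>
   (('v, 'm) vmod \<Rightarrow> ('v \<Rightarrow> 'v) \<Rightarrow> 'm \<Rightarrow> 'm) \<Rightarrow> ('v, 'm) vmod \<Rightarrow> (('v \<Rightarrow> 'v) \<Rightarrow> complex) alg"
where
  "twisted_group_algebra V G S \<phi> M =
     (let H = stabilizer V G M in
      \<lparr>acar = {a. \<forall>g. a g \<noteq> 0 \<longrightarrow> g \<in> H},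
       amul = (\<lambda>a b. \<Sum>g\<in>H. \<Sum>h\<in>H. cscale (a g * b h * cocycle V S \<phi> M g h)
                 (\<lambda>k. if k = g \<circ> h then 1 else 0)),
       aone = (\<lambda>k. if k = id then 1 else 0)\<rparr>)"

definition gs_embed :: "('v, 'm) vmod \<Rightarrow> (('v \<Rightarrow> 'v) \<Rightarrow> complex) \<Rightarrow> ('v, 'm) gs" where
  "gs_embed M a = (\<lambda>(g, N). if N = M then a g else 0)"

text \<open>\<open>M\<close> as a module over the twisted group algebra, \<open>g\<close> acting by \<open>\<phi>\<^sub>M(g)\<close>.\<close>

definition tga_module ::
  "'v vertex \<Rightarrow> ('v \<Rightarrow> 'v) set \<Rightarrow>
   (('v, 'm::complex_space) vmod \<Rightarrow> ('v \<Rightarrow> 'v) \<Rightarrow> 'm \<Rightarrow> 'm) \<Rightarrow> ('v, 'm) vmod \<Rightarrow>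
   (('v \<Rightarrow> 'v) \<Rightarrow> complex, 'm) amod" where
  "tga_module V G \<phi> M =
     \<lparr>wcar = mcar M, wact = (\<lambda>a w. \<Sum>g\<in>stabilizer V G M. cscale (a g) (\<phi> M g w))\<rparr>"

text \<open>\<open>Hom(W, M)\<close> over the twisted group algebra of the stabilizer of \<open>M\<close>.\<close>

definition mult_module ::
  "'v vertex \<Rightarrow> ('v \<Rightarrow> 'v) set \<Rightarrow> ('v, 'm::complex_space) vmod set \<Rightarrow>
   (('v, 'm) vmod \<Rightarrow> ('v \<Rightarrow> 'v) \<Rightarrow> 'm \<Rightarrow> 'm) \<Rightarrow> ('v, 'm) vmod \<Rightarrow>
   (('v \<Rightarrow> 'v) \<Rightarrow> complex, 'w::complex_space) amod \<Rightarrow> ('v, 'w \<Rightarrow> 'm) vmod" where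
  "mult_module V G S \<phi> M W =
     hom_vmod (twisted_group_algebra V G S \<phi> M) W (tga_module V G \<phi> M) M"

text \<open>The induced module \<open>D(M) \<otimes> W\<close>, tensored over \<open>S(M)\<close>.\<close>

definition induced_module ::
  "'v vertex \<Rightarrow> ('v \<Rightarrow> 'v) set \<Rightarrow> ('v, 'm::complex_space) vmod set \<Rightarrow>
   (('v, 'm) vmod \<Rightarrow> ('v \<Rightarrow> 'v) \<Rightarrow> 'm \<Rightarrow> 'm) \<Rightarrow> ('v, 'm) vmod \<Rightarrow>
   (('v \<Rightarrow> 'v) \<Rightarrow> complex, 'w::complex_space) amod \<Rightarrow>
   (('v, 'm) gs, (('v, 'm) gs \<Rightarrow> 'w \<Rightarrow> complex) \<Rightarrow> complex) amod" where
  "induced_module V G S \<phi> M W =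
     (let A = gs_algebra V G S \<phi>;
          F = balanced_forms (twisted_group_algebra V G S \<phi> M) (gs_D G M)
                (\<lambda>d a. amul A d (gs_embed M a)) W
      in \<lparr>wcar = tensor_space F (gs_D G M) (wcar W), wact = (\<lambda>a. tensor_map F (amul A a) id)\<rparr>)"

definition tga_irr_chars ::
  "'v vertex \<Rightarrow> ('v \<Rightarrow> 'v) set \<Rightarrow> ('v, 'm::complex_space) vmod set \<Rightarrow>
   (('v, 'm) vmod \<Rightarrow> ('v \<Rightarrow> 'v) \<Rightarrow> 'm \<Rightarrow> 'm) \<Rightarrow> ('v, 'm) vmod \<Rightarrow>
   ((('v \<Rightarrow> 'v) \<Rightarrow> complex) \<Rightarrow> complex) set" where
  "tga_irr_chars V G S \<phi> M = irreducible_characters (twisted_group_algebra V G S \<phi> M)"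

end

theory Submission
  imports
    Defs
    "HOL-Computational_Algebra.Fundamental_Theorem_Algebra"
    "HOL-Analysis.Continuum_Not_Denumerable"
begin

text \<open>
  By Schur's lemma in countable dimension and Jacobson's density theorem, the modes of \<open>V\<close> act
  densely on finite sums of inequivalent irreducible twisted modules. Density on \<open>V\<close> itself shows that
  \<open>\<Sum> Y(v\<^sub>i, z) w\<^sub>i\<close> determines \<open>\<Sum> v\<^sub>i \<otimes> w\<^sub>i\<close>, and hence that the algebra \<open>A\<close> of \<open>G\<close> and \<open>S\<close> acts
  faithfully on the direct sum of \<open>S\<close>, so that all of its simple modules occur there. Averaging over
  \<open>G\<close> turns density into: every \<open>A\<close>-linear map on a finite-dimensional \<open>A\<close>-submodule is a combination of
  modes of the fixed points. Since \<open>A\<close> is semisimple by Maschke's argument, this makes the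
  spaces \<open>Hom\<^sub>A(Y, -)\<close> irreducible and pairwise inequivalent for simple \<open>Y\<close>. The simple \<open>Y\<close> are the
  modules induced from the stabilizers, and Frobenius reciprocity identifies their multiplicity spaces.

  For the finite decomposition of an irreducible module \<open>N\<close>, let \<open>S\<close> represent the twists of \<open>N\<close> by \<open>G\<close>.
  Writing the unit of \<open>A\<close> as a sum of elements of minimal left ideals \<open>L\<close> exhibits \<open>N\<close> as a finite
  sum of images of the irreducible modules \<open>Hom\<^sub>A(L, -)\<close>.
\<close>

section \<open>Linear algebra on carriers\<close>

text \<open>Modes of a twisted module obey no plain product formula, since the Jacobi identity ties
  three sums together. The way out is an index \<open>m\<close> so large that the modes of
  \<open>u\<close> from \<open>m\<close> on kill \<open>w\<close>: one of the two products then
  drops out. Solved for its leading left term, the rest writes \<open>u_p v_q w\<close> by single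
  modes of \<open>w\<close>, so that single modes already span a submodule; solved for its leading
  right term, it moves \<open>u\<close> onto the first factor of a tensor. Both are done for
  eigenvectors \<open>u\<close> of \<sigma>, where the identity is given, and extended by linearity.

  Countable dimension enters through Schur's lemma, by playing a countable basis against the
  uncountable field.

  The cocycle identity is never computed: associativity of \<open>A\<close> and the inverses of its
  basis elements come from composing operators on a faithful module. Irreducibility and
  inequivalence are proved for the multiplicity spaces of \<open>A\<close>, where Maschke and
  density apply directly; the stabilizers come in through induction. Since the labels are
  characters, traces must tell simple modules apart, and density in \<open>A\<close> provides this
  as well.\<close>

global_interpretation cvp: vector_space_pair
  "cscale :: complex \<Rightarrow> 'a \<Rightarrow> 'a::complex_space" "cscale :: complex \<Rightarrow> 'b \<Rightarrow> 'b::complex_space"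
  by unfold_locales

lemma sum_fun_apply: "(\<Sum>i\<in>I. f i) x = (\<Sum>i\<in>I. f i x)"
  for f :: "'i \<Rightarrow> 'a \<Rightarrow> 'b::comm_monoid_add"
  by (induction I rule: infinite_finite_induct) auto

lemma cscale_fun_apply [simp]: "cscale c f x = cscale c (f x)"
  by (simp add: cscale_fun_def)

lemma lin_onI:
  assumes "\<And>x. x \<in> X \<Longrightarrow> f x \<in> Z" "\<And>x y. x \<in> X \<Longrightarrow> y \<in> X \<Longrightarrow> f (x + y) = f x + f y"
    "\<And>c x. x \<in> X \<Longrightarrow> f (cscale c x) = cscale c (f x)"
  shows "lin_on X Z f"
  using assms by (auto simp: lin_on_def)

lemma
  assumes "lin_on X Z f"
  shows lin_on_in: "x \<in> X \<Longrightarrow> f x \<in> Z"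
    and lin_on_add: "x \<in> X \<Longrightarrow> y \<in> X \<Longrightarrow> f (x + y) = f x + f y"
    and lin_on_scale: "x \<in> X \<Longrightarrow> f (cscale c x) = cscale c (f x)"
  using assms by (auto simp: lin_on_def)

lemma lin_on_zero:
  assumes "lin_on X Z f" "cv.subspace X"
  shows "f 0 = 0"
  using lin_on_scale[OF assms(1) cv.subspace_0[OF assms(2)], of 0] by simp

lemma lin_on_uminus:
  assumes "lin_on X Z f" "x \<in> X"
  shows "f (- x) = - f x"
  using lin_on_scale[OF assms, of "-1"] by simp

lemma lin_on_diff:
  assumes "lin_on X Z f" "cv.subspace X" "x \<in> X" "y \<in> X"
  shows "f (x - y) = f x - f y"
  using lin_on_add[OF assms(1,3) cv.subspace_neg[OF assms(2,4)]] lin_on_uminus[OF assms(1,4)] by simp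

lemma lin_on_sum:
  assumes "lin_on X Z f" "cv.subspace X" "\<And>i. i \<in> I \<Longrightarrow> g i \<in> X"
  shows "f (\<Sum>i\<in>I. g i) = (\<Sum>i\<in>I. f (g i))"
  using assms(3)
proof (induction I rule: infinite_finite_induct)
  case (insert i I)
  then show ?case
    using lin_on_add[OF assms(1), of "g i" "sum g I"] cv.subspace_sum[OF assms(2), of I g] by simp
qed (use lin_on_zero[OF assms(1,2)] in auto)

lemma lin_on_compose: "lin_on X Y f \<Longrightarrow> lin_on Y Z g \<Longrightarrow> lin_on X Z (\<lambda>x. g (f x))"
  by (auto simp: lin_on_def)

lemma lin_on_mono: "lin_on X Y f \<Longrightarrow> X' \<subseteq> X \<Longrightarrow> (\<And>x. x \<in> X' \<Longrightarrow> f x \<in> Y') \<Longrightarrow> lin_on X' Y' f"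
  by (simp add: lin_on_def subset_iff)

lemma subspace_image:
  assumes f: "lin_on X Y f" and X: "cv.subspace X"
  shows "cv.subspace (f ` X)"
proof (rule cv.subspaceI)
  show "0 \<in> f ` X"
    by (rule image_eqI[of _ _ 0]) (simp_all add: lin_on_zero[OF f X] cv.subspace_0[OF X])
  show "x + y \<in> f ` X" if *: "x \<in> f ` X" "y \<in> f ` X" for x y
  proof -
    obtain a b where "a \<in> X" "b \<in> X" "x = f a" "y = f b" using * by blast
    then show ?thesis
      by (intro image_eqI[of _ _ "a + b"]) (simp_all add: lin_on_add[OF f] cv.subspace_add[OF X])
  qed
  show "cscale c x \<in> f ` X" if *: "x \<in> f ` X" for c x
  proof -
    obtain a where "a \<in> X" "x = f a" using * by blast
    then show ?thesis
      by (intro image_eqI[of _ _ "cscale c a"])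
        (simp_all add: lin_on_scale[OF f] cv.subspace_scale[OF X])
  qed
qed

lemma lin_on_inv_into:
  assumes "bij_betw f X Y" "lin_on X Y f" "cv.subspace X"
  shows "lin_on Y X (inv_into X f)"
proof (rule lin_onI)
  have f: "f (inv_into X f y) = y" "inv_into X f y \<in> X" if "y \<in> Y" for y
    using assms(1) that by (auto simp: bij_betw_def f_inv_into_f inv_into_into)
  have g: "inv_into X f (f x) = x" if "x \<in> X" for x
    using assms(1) that by (auto simp: bij_betw_def)
  show "inv_into X f y \<in> X" if "y \<in> Y" for y
    using f that by blast
  show "inv_into X f (y + z) = inv_into X f y + inv_into X f z" if "y \<in> Y" "z \<in> Y" for y z
    using f[OF that(1)] f[OF that(2)] g lin_on_add[OF assms(2)] cv.subspace_add[OF assms(3)] by metis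
  show "inv_into X f (cscale c y) = cscale c (inv_into X f y)" if "y \<in> Y" for c y
    using f[OF that(1)] g lin_on_scale[OF assms(2)] cv.subspace_scale[OF assms(3)] by metis
qed

lemma inj_on_lin_on:
  assumes "lin_on X Y f" "cv.subspace X" "\<And>x. x \<in> X \<Longrightarrow> f x = 0 \<Longrightarrow> x = 0"
  shows "inj_on f X"
proof (rule inj_onI)
  fix x y assume "x \<in> X" "y \<in> X" "f x = f y"
  then show "x = y"
    using assms(3)[of "x - y"] lin_on_diff[OF assms(1,2)] cv.subspace_diff[OF assms(2)] by simp
qed

lemma lin_on_span_eq:
  assumes f: "lin_on (cv.span B) Y f" and g: "lin_on (cv.span B) Z g"
    and eq: "\<And>b. b \<in> B \<Longrightarrow> f b = g b" and "x \<in> cv.span B"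
  shows "f x = g x"
proof -
  have "x \<in> cv.span B \<and> f x = g x"
    using assms(4)
  proof (induction rule: cv.span_induct_alt)
    case base
    then show ?case using lin_on_zero[OF f] lin_on_zero[OF g] by (simp add: cv.span_zero)
  next
    case (step c x y)
    then have "y \<in> cv.span B" "x \<in> cv.span B" "cscale c x \<in> cv.span B"
      by (auto intro: cv.span_base cv.span_scale)
    with step show ?case
      by (simp add: eq lin_on_add[OF f] lin_on_add[OF g] lin_on_scale[OF f] lin_on_scale[OF g]
          cv.span_add)
  qed
  then show ?thesis ..
qed

lemma lin_on_span_in:
  assumes f: "lin_on (cv.span B) Z f" and "cv.subspace Y"
    and "\<And>b. b \<in> B \<Longrightarrow> f b \<in> Y" and "x \<in> cv.span B"
  shows "f x \<in> Y"
proof -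
  have "x \<in> cv.span B \<and> f x \<in> Y"
    using assms(4)
  proof (induction rule: cv.span_induct_alt)
    case base
    then show ?case using lin_on_zero[OF f] cv.subspace_0[OF assms(2)] by (simp add: cv.span_zero)
  next
    case (step c x y)
    then have "y \<in> cv.span B" "x \<in> cv.span B" "cscale c x \<in> cv.span B"
      by (auto intro: cv.span_base cv.span_scale)
    with step show ?case
      by (simp add: assms(3) lin_on_add[OF f] lin_on_scale[OF f] cv.span_add
          cv.subspace_add[OF assms(2)] cv.subspace_scale[OF assms(2)])
  qed
  then show ?thesis ..
qed

lemma linear_lin_on: "Vector_Spaces.linear cscale cscale f \<longleftrightarrow> lin_on UNIV UNIV f"
  by (auto simp: Vector_Spaces.linear_iff lin_on_def intro: cv.vector_space_axioms)

lemma lin_extend: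
  fixes f :: "'a::complex_space \<Rightarrow> 'b::complex_space"
  assumes "cv.independent B"
  shows "\<exists>g. lin_on UNIV UNIV g \<and> (\<forall>b\<in>B. g b = f b)"
  using cvp.linear_independent_extend[OF assms, of f] by (simp add: linear_lin_on)

lemma subspace_basis:
  assumes "cv.subspace X"
  obtains B where "B \<subseteq> X" "cv.independent B" "cv.span B = X"
proof -
  obtain B where B: "B \<subseteq> X" "cv.independent B" "X \<subseteq> cv.span B"
    using cv.maximal_independent_subset[of X] by blast
  with cv.span_minimal[OF B(1) assms] that show thesis by blast
qed

text \<open>Extend a basis of \<open>Y\<close> to the whole type and send the new basis vectors to
  0. Maschke's averaging starts from this projection.\<close>

lemma exists_linear_projection:
  fixes Y :: "'a::complex_space set"
  assumes "cv.subspace Y"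
  shows "\<exists>p. lin_on UNIV Y p \<and> (\<forall>y\<in>Y. p y = y)"
proof -
  obtain B where B: "B \<subseteq> Y" "cv.independent B" "cv.span B = Y"
    by (rule subspace_basis[OF assms])
  let ?E = "cv.extend_basis B"
  have E: "cv.independent ?E" "cv.span ?E = UNIV" "B \<subseteq> ?E"
    using cv.independent_extend_basis[OF B(2)] cv.span_extend_basis[OF B(2)]
      cv.extend_basis_superset[OF B(2)] by auto
  from lin_extend[OF E(1), of "\<lambda>b. if b \<in> B then b else 0"]
  obtain p where p: "lin_on UNIV UNIV p" "\<forall>b\<in>?E. p b = (if b \<in> B then b else 0)"
    by blast
  have Y: "p b \<in> Y" if "b \<in> ?E" for b
    using p(2) that B(1) cv.subspace_0[OF assms] by auto
  have pE: "lin_on (cv.span ?E) UNIV p"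
    using p(1) by (simp add: E(2))
  have "p x \<in> Y" for x
    by (rule lin_on_span_in[OF pE assms Y]) (simp_all add: E(2))
  moreover have "p y = y" if "y \<in> Y" for y
  proof (rule lin_on_span_eq[of B UNIV p UNIV "\<lambda>x. x"])
    show "lin_on (cv.span B) UNIV p" using p(1) by (simp add: lin_on_def)
    show "p b = b" if "b \<in> B" for b using that p(2) E(3) by auto
  qed (use that B(3) in \<open>simp_all add: lin_on_def\<close>)
  ultimately show ?thesis
    using p(1) by (intro exI[of _ p]) (simp add: lin_on_def)
qed

section \<open>Finite and countable dimension\<close>

lemma fin_dim_basis:
  assumes "fin_dim X"
  obtains B where "finite B" "B \<subseteq> X" "cv.independent B" "cv.span B = X"
proof -
  obtain C where C: "finite C" "X = cv.span C"
    using assms by (auto simp: fin_dim_def)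
  obtain B where B: "B \<subseteq> C" "cv.independent B" "C \<subseteq> cv.span B"
    using cv.maximal_independent_subset[of C] by blast
  have "cv.span B = X"
    using B C cv.span_mono cv.span_minimal[OF B(3)] by blast
  moreover from this have "B \<subseteq> X"
    using cv.span_superset by blast
  moreover have "finite B"
    using B(1) C(1) by (rule finite_subset)
  ultimately show thesis
    using B(2) by (intro that)
qed

lemma fin_dim_independent_finite:
  assumes "fin_dim X" "cv.independent B" "B \<subseteq> X"
  shows "finite B"
  using assms cv.independent_span_bound unfolding fin_dim_def by blast

lemma fin_dim_subspace:
  assumes "fin_dim X" "cv.subspace Y" "Y \<subseteq> X"
  shows "fin_dim Y"
proof -
  obtain B where B: "B \<subseteq> Y" "cv.independent B" "cv.span B = Y"
    by (rule subspace_basis[OF assms(2)])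
  then have "finite B"
    using fin_dim_independent_finite[OF assms(1)] assms(3) by blast
  with B show ?thesis by (auto simp: fin_dim_def)
qed

lemma image_span:
  assumes f: "lin_on (cv.span B) Y f"
  shows "f ` cv.span B = cv.span (f ` B)"
proof
  show "f ` cv.span B \<subseteq> cv.span (f ` B)"
    using lin_on_span_in[OF f, of "cv.span (f ` B)"] by (auto intro: cv.span_base)
  show "cv.span (f ` B) \<subseteq> f ` cv.span B"
    by (rule cv.span_minimal)
      (auto intro: cv.span_base subspace_image[OF f])
qed

lemma fin_dim_image:
  assumes "fin_dim X" "lin_on X Y f"
  shows "fin_dim (f ` X)"
  using assms image_span[of _ Y f] unfolding fin_dim_def by blast

lemma countable_dimI:
  assumes "countable C"
  shows "countable_dim (cv.span C)"
proof -
  obtain B where B: "B \<subseteq> C" "cv.independent B" "C \<subseteq> cv.span B"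
    using cv.maximal_independent_subset[of C] by blast
  then have "cv.span B = cv.span C"
    using cv.span_mono cv.span_minimal[OF B(3)] by blast
  with B assms show ?thesis
    unfolding countable_dim_def by (metis countable_subset)
qed

lemma fin_dim_countable_dim: "fin_dim X \<Longrightarrow> countable_dim X"
  unfolding fin_dim_def using countable_dimI countable_finite by blast

text \<open>Each vector of \<open>S\<close> lies in the span of one of the countably many finite
  subsets of a countable basis, and each such span holds only finitely many independent
  vectors.\<close>

lemma countable_dim_independent:
  assumes "countable_dim X" "cv.independent S" "S \<subseteq> X"
  shows "countable S"
proof -
  obtain B where B: "countable B" "X = cv.span B"
    using assms(1) by (auto simp: countable_dim_def)
  let ?F = "{F. F \<subseteq> B \<and> finite F}"
  have "s \<in> (\<Union>F\<in>?F. S \<inter> cv.span F)" if "s \<in> S" for s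
  proof -
    from that have "s \<in> cv.span B" using assms B by blast
    then obtain F r where F: "finite F" "F \<subseteq> B" "s = (\<Sum>a\<in>F. cscale (r a) a)"
      unfolding cv.span_explicit by blast
    then have "s \<in> cv.span F"
      by (simp add: cv.span_sum cv.span_scale cv.span_base)
    with F that show ?thesis by blast
  qed
  then have "S = (\<Union>F\<in>?F. S \<inter> cv.span F)" by auto
  moreover have "finite (S \<inter> cv.span F)" if "F \<in> ?F" for F
    using that fin_dim_independent_finite[of "cv.span F" "S \<inter> cv.span F"] assms(2)
      cv.independent_mono[of S] by (auto simp: fin_dim_def)
  moreover have "countable ?F"
    using countable_Collect_finite_subset[OF B(1)] by (simp add: conj_commute)
  ultimately show ?thesis
    by (metis (no_types, lifting) countable_UN countable_finite)
qed

section \<open>Schur's lemma in countable dimension\<close>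

text \<open>The vector \<open>p(f) w\<close>. Since \<open>f\<close> is linear only on a carrier,
  polynomials in \<open>f\<close> are evaluated vector by vector instead of in an endomorphism
  ring.\<close>

definition poly_op :: "('a::complex_space \<Rightarrow> 'a) \<Rightarrow> complex poly \<Rightarrow> 'a \<Rightarrow> 'a" where
  "poly_op f p w = (\<Sum>i\<le>degree p. cscale (coeff p i) ((f ^^ i) w))"

lemma poly_op_bound:
  assumes "degree p \<le> n"
  shows "poly_op f p w = (\<Sum>i\<le>n. cscale (coeff p i) ((f ^^ i) w))"
  unfolding poly_op_def
  by (rule sum.mono_neutral_left) (use assms in \<open>auto simp: coeff_eq_0\<close>)

lemma poly_op_0 [simp]: "poly_op f 0 w = 0"
  by (simp add: poly_op_def)

lemma poly_op_add: "poly_op f (p + q) w = poly_op f p w + poly_op f q w"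
proof -
  let ?n = "max (degree p) (degree q)"
  have "degree (p + q) \<le> ?n" by (rule degree_add_le) auto
  then show ?thesis
    by (simp add: poly_op_bound[of _ ?n] cscale_add_left sum.distrib)
qed

lemma poly_op_smult: "poly_op f (smult a p) w = cscale a (poly_op f p w)"
  using poly_op_bound[of "smult a p" "degree p" f w] degree_smult_le[of a p]
  by (simp add: poly_op_def cv.scale_sum_right cscale_cscale)

lemma poly_op_sum: "poly_op f (\<Sum>i\<in>I. p i) w = (\<Sum>i\<in>I. poly_op f (p i) w)"
  by (induction I rule: infinite_finite_induct) (auto simp: poly_op_add)

context
  fixes f :: "'a::complex_space \<Rightarrow> 'a" and X
  assumes f: "lin_on X X f" and X: "cv.subspace X"
begin

lemma funpow_in: "w \<in> X \<Longrightarrow> (f ^^ i) w \<in> X"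
  by (induction i) (auto intro: lin_on_in[OF f])

lemma poly_op_in: "w \<in> X \<Longrightarrow> poly_op f p w \<in> X"
  unfolding poly_op_def by (intro cv.subspace_sum[OF X] cv.subspace_scale[OF X] funpow_in)

lemma poly_op_pCons:
  assumes "w \<in> X"
  shows "poly_op f (pCons a p) w = cscale a w + f (poly_op f p w)"
proof -
  have "poly_op f (pCons a p) w
      = (\<Sum>i\<le>Suc (degree p). cscale (coeff (pCons a p) i) ((f ^^ i) w))"
    by (rule poly_op_bound) (simp add: degree_pCons_le)
  also have "\<dots> = cscale a w + (\<Sum>i\<le>degree p. cscale (coeff p i) (f ((f ^^ i) w)))"
    by (subst sum.atMost_Suc_shift) simp
  also have "(\<Sum>i\<le>degree p. cscale (coeff p i) (f ((f ^^ i) w))) = f (poly_op f p w)"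
    unfolding poly_op_def using assms
    by (subst lin_on_sum[OF f X])
      (auto simp: lin_on_scale[OF f funpow_in] intro: cv.subspace_scale[OF X] funpow_in)
  finally show ?thesis .
qed

lemma poly_op_lin: "lin_on X X (poly_op f p)"
proof (rule lin_onI)
  show "poly_op f p x \<in> X" if "x \<in> X" for x using that by (rule poly_op_in)
  show "poly_op f p (x + y) = poly_op f p x + poly_op f p y" if "x \<in> X" "y \<in> X" for x y
    using that
    by (induction p) (simp_all add: poly_op_pCons cv.subspace_add[OF X] cscale_add_right
        lin_on_add[OF f] poly_op_in)
  show "poly_op f p (cscale c x) = cscale c (poly_op f p x)" if "x \<in> X" for c x
    using that
    by (induction p) (simp_all add: poly_op_pCons cv.subspace_scale[OF X] cscale_add_right
        lin_on_scale[OF f] poly_op_in cscale_cscale mult.commute)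
qed

lemma poly_op_mult: "w \<in> X \<Longrightarrow> poly_op f (p * q) w = poly_op f p (poly_op f q w)"
  by (induction p) (simp_all add: poly_op_pCons poly_op_in poly_op_add poly_op_smult)

lemma poly_op_root: "w \<in> X \<Longrightarrow> poly_op f [:- c, 1:] w = f w - cscale c w"
  using lin_on_zero[OF f X] by (simp add: poly_op_pCons)

text \<open>
  Dixmier's argument: if no \<open>f - c\<close> vanishes, the vectors \<open>(f - c)^(-1) w\<close> for complex \<open>c\<close>
  are linearly independent.
\<close>

lemma countable_dim_scalar:
  assumes cnt: "countable_dim X" and nz: "X \<noteq> {0}"
    and alt: "\<And>c. (\<forall>x\<in>X. f x = cscale c x) \<or> bij_betw (\<lambda>x. f x - cscale c x) X X"
  shows "\<exists>c. \<forall>x\<in>X. f x = cscale c x"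
proof (rule ccontr)
  assume "\<not> ?thesis"
  then have bij: "bij_betw (\<lambda>x. f x - cscale c x) X X" for c
    using alt by blast
  have nzmap: "f x - cscale c x \<noteq> 0" if "x \<in> X" "x \<noteq> 0" for x c
    using bij[of c] that cv.subspace_0[OF X] lin_on_zero[OF f X]
    unfolding bij_betw_def inj_on_def by (metis cv.scale_zero_right diff_zero)
  obtain w where w: "w \<in> X" "w \<noteq> 0"
    using nz cv.subspace_0[OF X] by blast
  \<comment> \<open>Over \<complex> the polynomial loses one linear factor at a time, and by
    \<open>nzmap\<close> no factor \<open>f - z\<close> kills a nonzero vector.\<close>
  have pnz: "poly_op f p w \<noteq> 0" if "p \<noteq> 0" for p
    using that
  proof (induction "degree p" arbitrary: p)
    case 0
    then obtain a where "p = [:a:]" "a \<noteq> 0"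
      by (metis degree_eq_zeroE pCons_0_0)
    with w lin_on_zero[OF f X] show ?case by (simp add: poly_op_pCons)
  next
    case (Suc n)
    then obtain z where "poly p z = 0"
      using fundamental_theorem_of_algebra_alt[of p] by (metis degree_pCons_0 nat.distinct(1))
    then obtain q where q: "p = [:- z, 1:] * q"
      by (metis poly_eq_0_iff_dvd dvdE)
    with Suc.hyps(2) have "q \<noteq> 0" by (metis mult_zero_right degree_0 nat.distinct(1))
    moreover from this q have "degree p = Suc (degree q)"
      by (simp add: degree_mult_eq del: mult_pCons_left)
    ultimately show ?case
      using Suc q w nzmap by (simp add: poly_op_mult poly_op_root poly_op_in del: mult_pCons_left)
  qed
  define x where "x = (\<lambda>c. inv_into X (\<lambda>x. f x - cscale c x) w)"
  have x: "x c \<in> X" "f (x c) - cscale c (x c) = w" for c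
    using bij[of c] w unfolding x_def bij_betw_def
    by (auto intro: inv_into_into f_inv_into_f[where f = "\<lambda>x. f x - cscale c x"])
  have indep: "a c = 0" if C: "finite C" "c \<in> C" and rel: "(\<Sum>c\<in>C. cscale (a c) (x c)) = 0" for a C c
  proof -
    \<comment> \<open>Applying the product of all \<open>f - c\<close> clears the denominators of
      the relation: the vector \<open>x c\<close> becomes \<open>P (C - {c})\<close> applied to
      \<open>w\<close>.\<close>
    define P where "P = (\<lambda>D. \<Prod>c\<in>D. [:- c, 1:] :: complex poly)"
    have "poly_op f (P C) (x c) = poly_op f (P (C - {c})) w" if "c \<in> C" for c
    proof -
      have "P C = P (C - {c}) * [:- c, 1:]"
        unfolding P_def using C(1) that by (simp add: prod.remove del: mult_pCons_left mult_pCons_right)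
      then show ?thesis
        using x[of c] by (simp add: poly_op_mult poly_op_root del: mult_pCons_left mult_pCons_right)
    qed
    then have "0 = (\<Sum>c\<in>C. cscale (a c) (poly_op f (P (C - {c})) w))"
      using arg_cong[OF rel, of "poly_op f (P C)"] lin_on_zero[OF poly_op_lin X]
      by (subst (asm) lin_on_sum[OF poly_op_lin X])
        (auto simp: x lin_on_scale[OF poly_op_lin] intro: cv.subspace_scale[OF X])
    also have "\<dots> = poly_op f (\<Sum>c\<in>C. smult (a c) (P (C - {c}))) w"
      by (simp add: poly_op_sum poly_op_smult)
    finally have "(\<Sum>c\<in>C. smult (a c) (P (C - {c}))) = 0"
      using pnz by metis
    \<comment> \<open>At the point \<open>c\<close> every summand except that of \<open>c\<close>
      itself contains the factor \<open>c - c\<close>.\<close>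
    then have "0 = poly (\<Sum>c\<in>C. smult (a c) (P (C - {c}))) c" by simp
    also have "\<dots> = (\<Sum>d\<in>C. a d * (\<Prod>e\<in>C - {d}. c - e))"
      by (simp add: poly_sum P_def poly_prod)
    also have "\<dots> = (\<Sum>d\<in>{c}. a d * (\<Prod>e\<in>C - {d}. c - e))"
      by (rule sum.mono_neutral_right) (use C in \<open>auto intro!: prod_zero\<close>)
    finally show ?thesis
      using C by auto
  qed
  have "inj x"
  proof (rule injI, rule ccontr)
    fix c d assume "x c = x d" "c \<noteq> d"
    then show False
      using indep[of "{c, d}" c "\<lambda>e. if e = c then 1 else - 1"] by simp
  qed
  have "cv.independent (range x)"
    unfolding cv.independent_explicit_finite_subsets
  proof (intro allI impI ballI)
    fix S u v assume S: "S \<subseteq> range x" "finite S" "(\<Sum>v\<in>S. cscale (u v) v) = 0" "v \<in> S"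
    obtain C where C: "S = x ` C" "finite C"
      using S(1,2) by (meson finite_subset_image)
    have "(\<Sum>c\<in>C. cscale (u (x c)) (x c)) = 0"
      using S(3) C \<open>inj x\<close> by (simp add: sum.reindex inj_on_subset)
    with indep[OF C(2), of _ "\<lambda>c. u (x c)"] C S(4) show "u v = 0" by auto
  qed
  with x(1) countable_dim_independent[OF cnt] have "countable (range x)" by blast
  then have "countable (UNIV :: complex set)"
    using \<open>inj x\<close> countable_image_inj_on by blast
  then have "countable (range complex_of_real)"
    by (rule countable_subset[rotated]) simp
  then have "countable (UNIV :: real set)"
    by (rule countable_image_inj_on) (simp add: inj_on_def)
  then show False
    using uncountable_UNIV_real by blast
qed

end

section \<open>Simple modules over a set of operators and the density theorem\<close>

text \<open>Only the indexed family of operators matters here. Algebra elements acting on modules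
  and pairs of a vector and a mode index are both instances, so Schur's lemma and the density
  theorem are proved once for all of them.\<close>

definition stable :: "'o set \<Rightarrow> ('o \<Rightarrow> 'm \<Rightarrow> 'm) \<Rightarrow> 'm::complex_space set \<Rightarrow> bool" where
  "stable Ops act N \<longleftrightarrow> cv.subspace N \<and> (\<forall>s\<in>Ops. \<forall>x\<in>N. act s x \<in> N)"

definition simple_ops :: "'o set \<Rightarrow> ('o \<Rightarrow> 'm \<Rightarrow> 'm) \<Rightarrow> 'm::complex_space set \<Rightarrow> bool" where
  "simple_ops Ops act X \<longleftrightarrow>
     cv.subspace X \<and> (\<forall>s\<in>Ops. lin_on X X (act s)) \<and> X \<noteq> {0} \<and>
     (\<forall>N. stable Ops act N \<longrightarrow> N \<subseteq> X \<longrightarrow> N = {0} \<or> N = X)"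

definition ops_hom :: "'o set \<Rightarrow> 'm::complex_space set \<Rightarrow> ('o \<Rightarrow> 'm \<Rightarrow> 'm) \<Rightarrow>
    'n::complex_space set \<Rightarrow> ('o \<Rightarrow> 'n \<Rightarrow> 'n) \<Rightarrow> ('m \<Rightarrow> 'n) \<Rightarrow> bool" where
  "ops_hom Ops X act Y act' f \<longleftrightarrow> lin_on X Y f \<and> (\<forall>s\<in>Ops. \<forall>x\<in>X. f (act s x) = act' s (f x))"

lemma stableI:
  assumes "cv.subspace N" "\<And>s x. s \<in> Ops \<Longrightarrow> x \<in> N \<Longrightarrow> act s x \<in> N"
  shows "stable Ops act N"
  using assms by (auto simp: stable_def)

lemma simple_opsD:
  assumes "simple_ops Ops act X"
  shows "cv.subspace X" "s \<in> Ops \<Longrightarrow> lin_on X X (act s)" "X \<noteq> {0}"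
    "stable Ops act N \<Longrightarrow> N \<subseteq> X \<Longrightarrow> N = {0} \<or> N = X"
  using assms by (auto simp: simple_ops_def)

lemma ops_hom_kernel_stable:
  assumes f: "ops_hom Ops X act Y act' f" and "cv.subspace X" "cv.subspace Y"
    and "\<And>s. s \<in> Ops \<Longrightarrow> lin_on X X (act s)" "\<And>s. s \<in> Ops \<Longrightarrow> lin_on Y Y (act' s)"
  shows "stable Ops act {x \<in> X. f x = 0}"
proof (rule stableI)
  have l: "lin_on X Y f" using f by (simp add: ops_hom_def)
  show "cv.subspace {x \<in> X. f x = 0}"
    by (rule cv.subspaceI)
      (simp_all add: lin_on_zero[OF l assms(2)] lin_on_add[OF l] lin_on_scale[OF l]
        cv.subspace_0[OF assms(2)] cv.subspace_add[OF assms(2)] cv.subspace_scale[OF assms(2)])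
  show "act s x \<in> {x \<in> X. f x = 0}" if "s \<in> Ops" "x \<in> {x \<in> X. f x = 0}" for s x
    using that f lin_on_in[OF assms(4)] lin_on_zero[OF assms(5) assms(3)]
    by (auto simp: ops_hom_def)
qed

lemma ops_hom_image_stable:
  assumes f: "ops_hom Ops X act Y act' f" and "stable Ops act N" "N \<subseteq> X"
  shows "stable Ops act' (f ` N)"
proof (rule stableI)
  have l: "lin_on N Y f"
    using f assms(3) by (simp add: ops_hom_def lin_on_def subset_iff)
  show "cv.subspace (f ` N)"
    using subspace_image[OF l] assms(2) by (simp add: stable_def)
  show "act' s x \<in> f ` N" if "s \<in> Ops" "x \<in> f ` N" for s x
    using that f assms(2,3) by (auto simp: ops_hom_def stable_def) (metis imageI subsetD)
qed

text \<open>Schur's dichotomy: kernel and image are stable, so each is zero or everything.\<close>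

lemma simple_ops_hom_cases:
  assumes X: "simple_ops Ops act X" and Y: "simple_ops Ops act' Y" and f: "ops_hom Ops X act Y act' f"
  shows "(\<forall>x\<in>X. f x = 0) \<or> bij_betw f X Y"
proof -
  have l: "lin_on X Y f" using f by (simp add: ops_hom_def)
  have sX: "stable Ops act X"
    using simple_opsD(1,2)[OF X] by (auto intro: stableI lin_on_in)
  have "stable Ops act {x \<in> X. f x = 0}"
    by (rule ops_hom_kernel_stable[OF f]) (use simple_opsD[OF X] simple_opsD[OF Y] in auto)
  then consider "{x \<in> X. f x = 0} = X" | "{x \<in> X. f x = 0} = {0}"
    using simple_opsD(4)[OF X] by blast
  then show ?thesis
  proof cases
    case 2
    then have "inj_on f X"
      by (intro inj_on_lin_on[OF l simple_opsD(1)[OF X]]) blast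
    moreover have "f ` X = {0} \<or> f ` X = Y"
      using simple_opsD(4)[OF Y ops_hom_image_stable[OF f sX]] lin_on_in[OF l] by blast
    moreover have "f ` X \<noteq> {0}"
      using 2 simple_opsD(3)[OF X] cv.subspace_0[OF simple_opsD(1)[OF X]] by blast
    ultimately show ?thesis by (auto simp: bij_betw_def)
  qed blast
qed

lemma ops_hom_inv:
  assumes "ops_hom Ops X act Y act' f" "bij_betw f X Y" "cv.subspace X"
    and "\<And>s x. s \<in> Ops \<Longrightarrow> x \<in> X \<Longrightarrow> act s x \<in> X"
  shows "ops_hom Ops Y act' X act (inv_into X f)"
  unfolding ops_hom_def
proof (intro conjI ballI)
  show "lin_on Y X (inv_into X f)"
    using assms by (auto intro: lin_on_inv_into simp: ops_hom_def)
  fix s y assume s: "s \<in> Ops" "y \<in> Y"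
  obtain x where x: "x \<in> X" "y = f x"
    using assms(2) s(2) by (auto simp: bij_betw_def)
  then have "act' s y = f (act s x)"
    using assms(1) s by (simp add: ops_hom_def)
  then show "inv_into X f (act' s y) = act s (inv_into X f y)"
    using assms(2,4) s x by (simp add: bij_betw_def)
qed

text \<open>For every scalar \<open>c\<close> the map \<open>f - c\<close> is again a homomorphism,
  so Schur's dichotomy yields the alternative that \<open>countable_dim_scalar\<close> asks
  for.\<close>

lemma simple_ops_scalar:
  assumes X: "simple_ops Ops act X" and cnt: "countable_dim X" and f: "ops_hom Ops X act X act f"
  shows "\<exists>c. \<forall>x\<in>X. f x = cscale c x"
proof (rule countable_dim_scalar[of X])
  note sub = simple_opsD(1)[OF X]
  show l: "lin_on X X f" using f by (simp add: ops_hom_def)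
  show "cv.subspace X" "countable_dim X" "X \<noteq> {0}"
    using X cnt by (auto simp: simple_ops_def)
  show "(\<forall>x\<in>X. f x = cscale c x) \<or> bij_betw (\<lambda>x. f x - cscale c x) X X" for c
  proof -
    have "lin_on X X (\<lambda>x. f x - cscale c x)"
      by (rule lin_onI) (simp_all add: lin_on_in[OF l] lin_on_add[OF l] lin_on_scale[OF l]
          cv.subspace_diff[OF sub] cv.subspace_scale[OF sub] cscale_add_right cscale_cscale
          cv.scale_right_diff_distrib mult.commute)
    then have "ops_hom Ops X act X act (\<lambda>x. f x - cscale c x)"
      using f lin_on_diff[OF simple_opsD(2)[OF X] sub] lin_on_scale[OF simple_opsD(2)[OF X]]
        lin_on_in[OF l] cv.subspace_scale[OF sub]
      by (auto simp: ops_hom_def)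
    from simple_ops_hom_cases[OF X X this] show ?thesis by auto
  qed
qed

text \<open>In place of an algebra there is a space \<open>P\<close> of tuples that contains
  \<open>w\<close> and is closed under the diagonal action; this fits spans of modes, which are not
  known to be closed under composition. Independence of the \<open>w i\<close> is demanded only
  among indices with the same module, because different modules admit no nonzero homomorphisms.

  The proof adds one index \<open>k\<close> at a time to a set \<open>J\<close>. The
  \<open>k\<close>-th coordinates of tuples in \<open>P\<close> that vanish on \<open>J\<close> form
  a submodule of \<open>X k\<close>. If it is everything, the coordinate at \<open>k\<close> can be
  corrected at will. If it is zero, the coordinate at \<open>k\<close> is a function of those in
  \<open>J\<close>, a sum of homomorphisms and so by Schur of scalars, and the tuple
  \<open>w\<close> itself becomes linearly dependent.\<close>

theorem jacobson_density:
  fixes X :: "'i \<Rightarrow> 'm::complex_space set" and act :: "'i \<Rightarrow> 'o \<Rightarrow> 'm \<Rightarrow> 'm"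
  assumes "finite I"
    and simple: "\<And>i. i \<in> I \<Longrightarrow> simple_ops Ops (act i) (X i)"
    and cnt: "\<And>i. i \<in> I \<Longrightarrow> countable_dim (X i)"
    and rel: "\<And>i k. i \<in> I \<Longrightarrow> k \<in> I \<Longrightarrow> X i = X k \<and> act i = act k \<or>
           (\<forall>f. ops_hom Ops (X i) (act i) (X k) (act k) f \<longrightarrow> (\<forall>x\<in>X i. f x = 0))"
    and wX: "\<And>i. i \<in> I \<Longrightarrow> w i \<in> X i"
    and indep: "\<And>c k. k \<in> I \<Longrightarrow> (\<And>i. i \<in> I \<Longrightarrow> c i \<noteq> 0 \<Longrightarrow> X i = X k \<and> act i = act k) \<Longrightarrow>
           (\<Sum>i\<in>I. cscale (c i) (w i)) = 0 \<Longrightarrow> \<forall>i\<in>I. c i = 0"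
    and P: "cv.subspace P"
    and PX: "\<And>x i. x \<in> P \<Longrightarrow> i \<in> I \<Longrightarrow> x i \<in> X i"
    and Pact: "\<And>x s. x \<in> P \<Longrightarrow> s \<in> Ops \<Longrightarrow> \<exists>y\<in>P. \<forall>i\<in>I. y i = act i s (x i)"
    and Pw: "\<exists>y\<in>P. \<forall>i\<in>I. y i = w i"
    and "\<And>i. i \<in> I \<Longrightarrow> y i \<in> X i"
  shows "\<exists>x\<in>P. \<forall>i\<in>I. x i = y i"
proof -
  have "I' \<subseteq> I \<longrightarrow> (\<forall>y. (\<forall>i\<in>I'. y i \<in> X i) \<longrightarrow> (\<exists>x\<in>P. \<forall>i\<in>I'. x i = y i))" if "finite I'" for I'
    using that
proof (induction I' rule: finite_induct)
  case empty
  then show ?case using cv.subspace_0[OF P] by blast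
next
  case (insert k J)
  show ?case
  proof (intro impI allI)
  fix y assume sub: "insert k J \<subseteq> I" and yX: "\<forall>i\<in>insert k J. y i \<in> X i"
  have k: "k \<in> I" and J: "\<And>i. i \<in> J \<Longrightarrow> i \<in> I" using sub by auto
  have IH: "\<exists>x\<in>P. \<forall>i\<in>J. x i = y i" if "\<And>i. i \<in> J \<Longrightarrow> y i \<in> X i" for y
    using insert.IH sub that by blast
  define Z where "Z = {x k | x. x \<in> P \<and> (\<forall>i\<in>J. x i = 0)}"
  have Z: "stable Ops (act k) Z"
  proof (rule stableI)
    show "cv.subspace Z"
    proof (rule cv.subspaceI)
      show "0 \<in> Z" using cv.subspace_0[OF P] unfolding Z_def
        by (intro CollectI exI[of _ 0]) simp
      show "x + y \<in> Z" if *: "x \<in> Z" "y \<in> Z" for x y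
      proof -
        obtain x' y' where "x' \<in> P" "y' \<in> P" "\<forall>i\<in>J. x' i = 0" "\<forall>i\<in>J. y' i = 0" "x = x' k" "y = y' k"
          using * unfolding Z_def by blast
        then show ?thesis unfolding Z_def
          by (intro CollectI exI[of _ "x' + y'"]) (auto intro: cv.subspace_add[OF P])
      qed
      show "cscale c x \<in> Z" if *: "x \<in> Z" for x c
      proof -
        obtain x' where "x' \<in> P" "\<forall>i\<in>J. x' i = 0" "x = x' k"
          using * unfolding Z_def by blast
        then show ?thesis unfolding Z_def
          by (intro CollectI exI[of _ "cscale c x'"]) (auto intro: cv.subspace_scale[OF P])
      qed
    qed
    show "act k s x \<in> Z" if s: "s \<in> Ops" and x: "x \<in> Z" for s x
    proof -
      obtain x' where x': "x' \<in> P" "\<forall>i\<in>J. x' i = 0" "x = x' k"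
        using x unfolding Z_def by blast
      obtain y where y: "y \<in> P" "\<forall>i\<in>I. y i = act i s (x' i)"
        using Pact[OF x'(1) s] by blast
      have "act i s 0 = 0" if "i \<in> I" for i
        using lin_on_zero[OF simple_opsD(2)[OF simple s] simple_opsD(1)[OF simple]] that by blast
      with x' y(2) have "\<forall>i\<in>J. y i = 0" "y k = act k s x" by (simp_all add: J k)
      with y(1) show ?thesis unfolding Z_def by (intro CollectI exI[of _ y]) simp
    qed
  qed
  have "Z \<subseteq> X k" using PX k unfolding Z_def by blast
  with simple_opsD(4)[OF simple[OF k] Z] consider "Z = X k" | "Z = {0}" by blast
  then show "\<exists>x\<in>P. \<forall>i\<in>insert k J. x i = y i"
  proof cases
    case 1
    obtain x where x: "x \<in> P" "\<forall>i\<in>J. x i = y i"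
      using IH yX by blast
    have "y k - x k \<in> Z"
      using 1 cv.subspace_diff[OF simple_opsD(1)[OF simple[OF k]]] yX PX[OF x(1) k] by blast
    then obtain z where z: "z \<in> P" "\<forall>i\<in>J. z i = 0" "y k - x k = z k"
      unfolding Z_def by blast
    then have "\<forall>i\<in>insert k J. (x + z) i = y i"
      using x by (simp flip: z(3))
    with x z show ?thesis using cv.subspace_add[OF P] by blast
  next
    case 2
    have determined: "x k = x' k" if "x \<in> P" "x' \<in> P" "\<And>i. i \<in> J \<Longrightarrow> x i = x' i" for x x'
    proof -
      have "(x - x') k \<in> Z"
        using that cv.subspace_diff[OF P] unfolding Z_def by fastforce
      with 2 show ?thesis by simp
    qed
    \<comment> \<open>\<open>h i t\<close> is the \<open>k\<close>-th coordinate of any tuple in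
      \<open>P\<close> with \<open>t\<close> at \<open>i\<close> and 0 elsewhere on
      \<open>J\<close>; by \<open>determined\<close> the choice of the tuple is immaterial, which
      makes \<open>h i\<close> a homomorphism.\<close>
    define R where "R = (\<lambda>i t x. x \<in> P \<and> (\<forall>l\<in>J. x l = (if l = i then t else 0)))"
    define h where "h = (\<lambda>i t. (SOME x. R i t x) k)"
    have ex: "\<exists>x. R i t x" if "i \<in> J" "t \<in> X i" for i t
    proof -
      have "(if l = i then t else 0) \<in> X l" if "l \<in> J" for l
        using that \<open>t \<in> X i\<close> cv.subspace_0[OF simple_opsD(1)[OF simple[OF J[OF that]]]] by simp
      from IH[of "\<lambda>l. if l = i then t else 0", OF this] show ?thesis
        unfolding R_def by blast
    qed
    have h: "h i t = x k" if "R i t x" for i t x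
    proof -
      define y where "y = (SOME x. R i t x)"
      have "R i t y" unfolding y_def using someI[of "R i t", OF that] .
      then have y: "y \<in> P" "\<forall>l\<in>J. y l = (if l = i then t else 0)"
        unfolding R_def by blast+
      have x: "x \<in> P" "\<forall>l\<in>J. x l = (if l = i then t else 0)"
        using that unfolding R_def by blast+
      have "y k = x k"
      proof (rule determined[OF y(1) x(1)])
        fix l assume l: "l \<in> J"
        show "y l = x l"
          by (rule trans[OF bspec[OF y(2) l] sym[OF bspec[OF x(2) l]]])
      qed
      then show ?thesis unfolding h_def y_def .
    qed
    have hhom: "ops_hom Ops (X i) (act i) (X k) (act k) (h i)" if i: "i \<in> J" for i
      unfolding ops_hom_def
    proof (intro conjI lin_onI ballI)
      show "h i t \<in> X k" if t: "t \<in> X i" for t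
      proof -
        obtain x where x: "R i t x" using ex[OF i t] by blast
        then have "x \<in> P" unfolding R_def by blast
        then show ?thesis unfolding h[OF x] by (rule PX[OF _ k])
      qed
      show "h i (t + t') = h i t + h i t'" if t: "t \<in> X i" "t' \<in> X i" for t t'
      proof -
        obtain x where x: "R i t x" using ex[OF i t(1)] by blast
        obtain x' where x': "R i t' x'" using ex[OF i t(2)] by blast
        from x x' have "R i (t + t') (x + x')"
          unfolding R_def by (simp add: cv.subspace_add[OF P])
        then show ?thesis unfolding h[OF x] h[OF x'] by (simp add: h)
      qed
      show "h i (cscale c t) = cscale c (h i t)" if t: "t \<in> X i" for t c
      proof -
        obtain x where x: "R i t x" using ex[OF i t] by blast
        then have "R i (cscale c t) (cscale c x)"
          unfolding R_def by (simp add: cv.subspace_scale[OF P])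
        then show ?thesis unfolding h[OF x] by (simp add: h)
      qed
      show "h i (act i s t) = act k s (h i t)" if s: "s \<in> Ops" and t: "t \<in> X i" for s t
      proof -
        obtain x where x: "R i t x" using ex[OF i t] by blast
        then have "x \<in> P" unfolding R_def by blast
        from Pact[OF this s]
        obtain y where y: "y \<in> P" "\<forall>l\<in>I. y l = act l s (x l)" by blast
        have "act l s 0 = 0" if "l \<in> I" for l
          using lin_on_zero[OF simple_opsD(2)[OF simple s] simple_opsD(1)[OF simple]] that by blast
        with x y have "R i (act i s t) y" unfolding R_def by (simp add: J)
        from h[OF this] y(2) k show ?thesis unfolding h[OF x] by simp
      qed
    qed
    have scalar: "\<exists>c. (\<forall>t\<in>X i. h i t = cscale c t) \<and> (c \<noteq> 0 \<longrightarrow> X i = X k \<and> act i = act k)"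
      if i: "i \<in> J" for i
    proof (cases "X i = X k \<and> act i = act k")
      case True
      then show ?thesis
        using simple_ops_scalar[OF simple[OF k] cnt[OF k], of "h i"] hhom[OF i] by auto
    next
      case False
      then have "\<forall>t\<in>X i. h i t = 0"
        using rel[OF J[OF i] k] hhom[OF i] by blast
      then show ?thesis by (intro exI[of _ 0]) simp
    qed
    then obtain c where c: "\<And>i t. i \<in> J \<Longrightarrow> t \<in> X i \<Longrightarrow> h i t = cscale (c i) t"
        "\<And>i. i \<in> J \<Longrightarrow> c i \<noteq> 0 \<Longrightarrow> X i = X k \<and> act i = act k"
      by metis
    have "\<forall>i\<in>J. \<exists>x. R i (w i) x"
      using ex wX J by blast
    from bchoice[OF this] obtain x where x: "\<forall>i\<in>J. R i (w i) (x i)" by blast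
    obtain z where z: "z \<in> P" "\<forall>i\<in>I. z i = w i" using Pw by blast
    have "(\<Sum>i\<in>J. x i) l = w l" if "l \<in> J" for l
      using x that insert.hyps(1) unfolding R_def by (simp add: sum_fun_apply)
    moreover have "(\<Sum>i\<in>J. x i) \<in> P"
      using x unfolding R_def by (intro cv.subspace_sum[OF P]) auto
    ultimately have "w k = (\<Sum>i\<in>J. x i) k"
      using determined[of z "\<Sum>i\<in>J. x i"] z J k by simp
    also have "\<dots> = (\<Sum>i\<in>J. cscale (c i) (w i))"
      unfolding sum_fun_apply
    proof (rule sum.cong)
      fix i assume i: "i \<in> J"
      then have "x i k = h i (w i)" using h[of i "w i" "x i"] x by simp
      then show "x i k = cscale (c i) (w i)" using c(1)[OF i] wX[OF J[OF i]] by simp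
    qed simp
    finally have "w k = (\<Sum>i\<in>J. cscale (c i) (w i))" .
    \<comment> \<open>The entry -1 at \<open>k\<close> turns the expression for \<open>w k\<close>
      into a relation among the \<open>w i\<close> that cannot be trivial, against
      \<open>indep\<close>.\<close>
    moreover define d where "d i = (if i = k then - 1 else if i \<in> J then c i else 0)" for i
    have "(\<Sum>i\<in>I. cscale (d i) (w i)) = (\<Sum>i\<in>insert k J. cscale (d i) (w i))"
      by (rule sum.mono_neutral_right) (use sub \<open>finite I\<close> in \<open>auto simp: d_def\<close>)
    moreover have "(\<Sum>i\<in>J. cscale (d i) (w i)) = (\<Sum>i\<in>J. cscale (c i) (w i))"
      by (rule sum.cong) (use insert.hyps in \<open>auto simp: d_def\<close>)
    ultimately have "(\<Sum>i\<in>I. cscale (d i) (w i)) = 0"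
      using insert.hyps by (simp add: d_def)
    moreover have "X i = X k \<and> act i = act k" if "d i \<noteq> 0" for i
      using that c(2)[of i] by (auto simp: d_def split: if_splits)
    ultimately have "\<forall>i\<in>I. d i = 0"
      using indep[OF k, of d] by blast
    from bspec[OF this k] show ?thesis by (simp add: d_def)
  qed
  qed
qed
  from spec[OF mp[OF this[OF \<open>finite I\<close>] subset_refl], of y] assms(11) show ?thesis by simp
qed

section \<open>Finite-dimensional algebras and characters\<close>

lemma fin_dim_subspaceI: "fin_dim X \<Longrightarrow> cv.subspace X"
  by (auto simp: fin_dim_def)

lemma lin_on_extend:
  fixes f :: "'a::complex_space \<Rightarrow> 'b::complex_space"
  assumes "lin_on X Y f" "cv.subspace X"
  shows "\<exists>g. lin_on UNIV UNIV g \<and> (\<forall>x\<in>X. g x = f x)"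
proof -
  obtain B where B: "B \<subseteq> X" "cv.independent B" "cv.span B = X"
    by (rule subspace_basis[OF assms(2)])
  from lin_extend[OF B(2), of f] obtain g where g: "lin_on UNIV UNIV g" "\<forall>b\<in>B. g b = f b"
    by blast
  have "g x = f x" if "x \<in> X" for x
  proof (rule lin_on_span_eq[of B UNIV g Y])
    show "lin_on (cv.span B) UNIV g" using g(1) by (simp add: lin_on_def)
    show "lin_on (cv.span B) Y f" using assms(1) B(3) by simp
  qed (use g(2) that B(3) in simp_all)
  with g(1) show ?thesis by blast
qed

lemma independent_image:
  assumes f: "lin_on X Y f" and "cv.subspace X" "inj_on f X" and B: "cv.independent B" "B \<subseteq> X"
  shows "cv.independent (f ` B)"
proof -
  from lin_on_extend[OF f assms(2)]
  obtain g where g: "lin_on UNIV UNIV g" "\<forall>x\<in>X. g x = f x"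
    by blast
  have "cv.span B \<subseteq> X"
    by (rule cv.span_minimal[OF B(2) assms(2)])
  then have "inj_on g (cv.span B)"
    using assms(3) g(2) by (simp add: inj_on_def subset_iff)
  moreover have "g ` B = f ` B"
    using g(2) B(2) by (intro image_cong) auto
  ultimately show ?thesis
    using cvp.linear_independent_injective_image[of g B] g(1) B(1) by (simp add: linear_lin_on)
qed

text \<open>Coordinates with respect to a finite basis. This leads into the type over which simple
  modules are quantified in \<open>irreducible_characters\<close>.\<close>

lemma fin_dim_embedding:
  fixes X :: "'a::complex_space set"
  assumes "fin_dim X"
  shows "\<exists>f :: 'a \<Rightarrow> nat \<Rightarrow> complex. lin_on X UNIV f \<and> inj_on f X"
proof -
  obtain B where B: "finite B" "B \<subseteq> X" "cv.independent B" "cv.span B = X"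
    by (rule fin_dim_basis[OF assms])
  obtain e where e: "bij_betw e {..<card B} B"
    using B(1) bij_betw_from_nat_into_finite by blast
  define f where "f = (\<lambda>x n. if n < card B then cv.representation B x (e n) else 0)"
  have f: "lin_on X UNIV f"
    using B by (intro lin_onI)
      (auto simp: f_def fun_eq_iff cv.representation_add cv.representation_scale cscale_complex_def)
  have "inj_on f X"
  proof (rule inj_on_lin_on[OF f fin_dim_subspaceI[OF assms]])
    fix x assume x: "x \<in> X" "f x = 0"
    have "cv.representation B x b = 0" if "b \<in> B" for b
    proof -
      obtain n where n: "n < card B" "b = e n"
        using e \<open>b \<in> B\<close> unfolding bij_betw_def by blast
      with fun_cong[OF x(2), of n] show ?thesis by (simp add: f_def)
    qed
    then have "(\<Sum>b\<in>B. cscale (cv.representation B x b) b) = 0" by simp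
    with cv.sum_representation_eq[OF B(3), of x B] x(1) B show "x = 0" by simp
  qed
  with f show ?thesis by blast
qed

text \<open>A nonzero stable subspace of least dimension is simple.\<close>

lemma fin_dim_simple_submodule:
  assumes "fin_dim X" and X: "stable Ops act X" "X \<noteq> {0}"
    and lin: "\<And>s. s \<in> Ops \<Longrightarrow> lin_on X X (act s)"
  shows "\<exists>N\<subseteq>X. simple_ops Ops act N"
proof -
  let ?Q = "\<lambda>N. stable Ops act N \<and> N \<subseteq> X \<and> N \<noteq> {0}"
  obtain N where N: "?Q N" and least: "\<And>N'. ?Q N' \<Longrightarrow> cv.dim N \<le> cv.dim N'"
    using ex_has_least_nat[of ?Q X cv.dim] X by blast
  have fN: "fin_dim N"
    using fin_dim_subspace[OF assms(1)] N by (simp add: stable_def)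
  obtain B where B: "finite B" "B \<subseteq> N" "cv.independent B" "cv.span B = N"
    by (rule fin_dim_basis[OF fN])
  have dimN: "cv.dim N = card B"
    using cv.dim_span_eq_card_independent[OF B(3)] B(4) by simp
  have "N' = N" if N': "stable Ops act N'" "N' \<subseteq> N" "N' \<noteq> {0}" for N'
  proof (rule ccontr)
    assume "N' \<noteq> N"
    then obtain x where x: "x \<in> N" "x \<notin> N'" using N'(2) by blast
    have "fin_dim N'"
      using fin_dim_subspace[OF fN] N' by (simp add: stable_def)
    then obtain B' where B': "finite B'" "B' \<subseteq> N'" "cv.independent B'" "cv.span B' = N'"
      by (rule fin_dim_basis)
    have "cv.independent (insert x B')"
      using x B' by (intro cv.independent_insertI) auto
    moreover have "insert x B' \<subseteq> cv.span B"
      using x B' B(4) N'(2) by auto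
    ultimately have "card (insert x B') \<le> card B"
      using cv.independent_span_bound[OF B(1)] by blast
    moreover have "x \<notin> B'" using x B'(2) by blast
    moreover have "cv.dim N' = card B'"
      using cv.dim_span_eq_card_independent[OF B'(3)] B'(4) by simp
    moreover have "cv.dim N \<le> cv.dim N'"
      using N N' by (intro least) auto
    ultimately show False
      using dimN B'(1) by simp
  qed
  moreover have "lin_on N N (act s)" if "s \<in> Ops" for s
    by (rule lin_on_mono[OF lin[OF that]]) (use N that in \<open>auto simp: stable_def\<close>)
  ultimately have "simple_ops Ops act N"
    using N unfolding simple_ops_def stable_def by blast
  with N show ?thesis by blast
qed

text \<open>Products matter through the module axiom for \<open>amul\<close>, so the results below
  apply to \<open>A\<close> and to the twisted group algebras as soon as closure and finite
  dimension are known.\<close>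

definition fd_alg :: "'a::complex_space alg \<Rightarrow> bool" where
  "fd_alg A \<longleftrightarrow> fin_dim (acar A) \<and> aone A \<in> acar A \<and>
     (\<forall>a\<in>acar A. \<forall>b\<in>acar A. amul A a b \<in> acar A)"

lemma alg_moduleD:
  assumes "alg_module A W"
  shows "cv.subspace (wcar W)"
    "a \<in> acar A \<Longrightarrow> lin_on (wcar W) (wcar W) (wact W a)"
    "w \<in> wcar W \<Longrightarrow> lin_on (acar A) (wcar W) (\<lambda>a. wact W a w)"
    "a \<in> acar A \<Longrightarrow> b \<in> acar A \<Longrightarrow> w \<in> wcar W \<Longrightarrow> wact W (amul A a b) w = wact W a (wact W b w)"
    "w \<in> wcar W \<Longrightarrow> wact W (aone A) w = w"
  using assms by (auto simp: alg_module_def)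

lemma asubmodule_stable: "asubmodule A W N \<longleftrightarrow> stable (acar A) (wact W) N \<and> N \<subseteq> wcar W"
  by (auto simp: asubmodule_def stable_def)

lemma simple_amod_ops:
  "simple_amod A W \<longleftrightarrow> alg_module A W \<and> simple_ops (acar A) (wact W) (wcar W)"
  by (auto simp: simple_amod_def simple_ops_def asubmodule_stable alg_module_def)

lemma amod_iso_ops:
  "amod_iso A W X \<longleftrightarrow> (\<exists>f. bij_betw f (wcar W) (wcar X) \<and>
     ops_hom (acar A) (wcar W) (wact W) (wcar X) (wact X) f)"
  unfolding amod_iso_def ops_hom_def by blast

lemma amod_iso_sym:
  assumes "alg_module A W" "amod_iso A W X"
  shows "amod_iso A X W"
proof -
  obtain f where f: "bij_betw f (wcar W) (wcar X)"
      "ops_hom (acar A) (wcar W) (wact W) (wcar X) (wact X) f"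
    using assms(2) unfolding amod_iso_ops by blast
  have "ops_hom (acar A) (wcar X) (wact X) (wcar W) (wact W) (inv_into (wcar W) f)"
    by (rule ops_hom_inv[OF f(2,1)])
      (use alg_moduleD(1,2)[OF assms(1)] lin_on_in in blast)+
  moreover have "bij_betw (inv_into (wcar W) f) (wcar X) (wcar W)"
    using f(1) by (rule bij_betw_inv_into)
  ultimately show ?thesis unfolding amod_iso_ops by blast
qed

lemma ops_hom_compose:
  assumes "ops_hom Ops X a Y b f" "ops_hom Ops Y b Z c g"
  shows "ops_hom Ops X a Z c (\<lambda>x. g (f x))"
  using assms by (simp add: ops_hom_def lin_on_def)

lemma amod_iso_trans:
  assumes "amod_iso A W X" "amod_iso A X Y"
  shows "amod_iso A W Y"
proof -
  obtain f where f: "bij_betw f (wcar W) (wcar X)"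
      "ops_hom (acar A) (wcar W) (wact W) (wcar X) (wact X) f"
    using assms(1) unfolding amod_iso_ops by blast
  obtain g where g: "bij_betw g (wcar X) (wcar Y)"
      "ops_hom (acar A) (wcar X) (wact X) (wcar Y) (wact Y) g"
    using assms(2) unfolding amod_iso_ops by blast
  have "bij_betw (\<lambda>x. g (f x)) (wcar W) (wcar Y)"
    using bij_betw_trans[OF f(1) g(1)] by (simp add: comp_def)
  with ops_hom_compose[OF f(2) g(2)] show ?thesis unfolding amod_iso_ops by blast
qed

lemma
  assumes A: "fd_alg A" and W: "alg_module A W" and w: "w \<in> wcar W"
  shows cyclic_stable: "stable (acar A) (wact W) ((\<lambda>a. wact W a w) ` acar A)"
    and cyclic_in: "w \<in> (\<lambda>a. wact W a w) ` acar A"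
    and cyclic_sub: "(\<lambda>a. wact W a w) ` acar A \<subseteq> wcar W"
    and cyclic_fin_dim: "fin_dim ((\<lambda>a. wact W a w) ` acar A)"
proof -
  have fd: "fin_dim (acar A)" using A by (simp add: fd_alg_def)
  note l = alg_moduleD(3)[OF W w]
  show "stable (acar A) (wact W) ((\<lambda>a. wact W a w) ` acar A)"
  proof (rule stableI)
    show "cv.subspace ((\<lambda>a. wact W a w) ` acar A)"
      by (rule subspace_image[OF l fin_dim_subspaceI[OF fd]])
    fix s x assume s: "s \<in> acar A" and "x \<in> (\<lambda>a. wact W a w) ` acar A"
    then obtain a where a: "a \<in> acar A" "x = wact W a w" by blast
    with s A have "amul A s a \<in> acar A" "wact W s x = wact W (amul A s a) w"
      by (simp_all add: fd_alg_def alg_moduleD(4)[OF W _ _ w])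
    then show "wact W s x \<in> (\<lambda>a. wact W a w) ` acar A" by blast
  qed
  show "w \<in> (\<lambda>a. wact W a w) ` acar A"
    using A alg_moduleD(5)[OF W w] by (intro image_eqI[of _ _ "aone A"]) (simp_all add: fd_alg_def)
  show "(\<lambda>a. wact W a w) ` acar A \<subseteq> wcar W"
    using lin_on_in[OF l] by blast
  show "fin_dim ((\<lambda>a. wact W a w) ` acar A)"
    by (rule fin_dim_image[OF fd l])
qed

lemma simple_amod_cyclic:
  assumes "fd_alg A" "simple_amod A W" "w \<in> wcar W" "w \<noteq> 0"
  shows "wcar W = (\<lambda>a. wact W a w) ` acar A"
proof -
  have W: "alg_module A W" using assms(2) by (simp add: simple_amod_def)
  note c = cyclic_stable[OF assms(1) W assms(3)] cyclic_in[OF assms(1) W assms(3)]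
    cyclic_sub[OF assms(1) W assms(3)]
  have "(\<lambda>a. wact W a w) ` acar A = {0} \<or> (\<lambda>a. wact W a w) ` acar A = wcar W"
    using assms(2) c(1,3) by (simp add: simple_amod_def asubmodule_stable)
  with c(2) assms(4) show ?thesis by auto
qed

lemma simple_amod_nonzero:
  assumes "simple_amod A W"
  obtains w where "w \<in> wcar W" "w \<noteq> 0"
proof -
  have "wcar W \<noteq> {0}" "0 \<in> wcar W"
    using assms by (auto simp: simple_amod_def alg_module_def cv.subspace_0)
  then show thesis using that by blast
qed

lemma simple_amod_fin_dim:
  assumes "fd_alg A" "simple_amod A W"
  shows "fin_dim (wcar W)"
proof -
  obtain w where w: "w \<in> wcar W" "w \<noteq> 0" by (rule simple_amod_nonzero[OF assms(2)])
  have "alg_module A W" using assms(2) by (simp add: simple_amod_def)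
  from cyclic_fin_dim[OF assms(1) this w(1)] simple_amod_cyclic[OF assms w] show ?thesis by simp
qed

lemma simple_amod_hom_iso:
  assumes "simple_amod A W" "simple_amod A X"
    and "ops_hom (acar A) (wcar W) (wact W) (wcar X) (wact X) f" "w \<in> wcar W" "f w \<noteq> 0"
  shows "bij_betw f (wcar W) (wcar X)" "amod_iso A W X"
proof -
  show "bij_betw f (wcar W) (wcar X)"
    using simple_ops_hom_cases[of "acar A" "wact W" "wcar W" "wact X" "wcar X" f] assms
    by (auto simp: simple_amod_ops)
  with assms(3) show "amod_iso A W X" unfolding amod_iso_ops by blast
qed

text \<open>The tuples of all \<open>a w_i\<close>, with \<open>a\<close> in the algebra, form the
  space \<open>P\<close> of the density theorem. Simple modules are cyclic, hence finite
  dimensional, which settles the countability hypothesis.\<close>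

theorem algebra_density:
  fixes W :: "'i \<Rightarrow> ('a::complex_space, 'w::complex_space) amod"
  assumes A: "fd_alg A" and "finite I"
    and simple: "\<And>i. i \<in> I \<Longrightarrow> simple_amod A (W i)"
    and iso: "\<And>i k. i \<in> I \<Longrightarrow> k \<in> I \<Longrightarrow> amod_iso A (W i) (W k) \<Longrightarrow> W i = W k"
    and w: "\<And>i. i \<in> I \<Longrightarrow> w i \<in> wcar (W i)"
    and indep: "\<And>c k. k \<in> I \<Longrightarrow> (\<And>i. i \<in> I \<Longrightarrow> c i \<noteq> 0 \<Longrightarrow> W i = W k) \<Longrightarrow>
           (\<Sum>i\<in>I. cscale (c i) (w i)) = 0 \<Longrightarrow> \<forall>i\<in>I. c i = 0"
    and y: "\<And>i. i \<in> I \<Longrightarrow> y i \<in> wcar (W i)"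
  shows "\<exists>a\<in>acar A. \<forall>i\<in>I. wact (W i) a (w i) = y i"
proof -
  let ?f = "\<lambda>a i. if i \<in> I then wact (W i) a (w i) else 0"
  have mod: "alg_module A (W i)" if "i \<in> I" for i
    using simple[OF that] by (simp add: simple_amod_def)
  have eq: "W i = W k \<longleftrightarrow> wcar (W i) = wcar (W k) \<and> wact (W i) = wact (W k)" for i k
    by (cases "W i"; cases "W k") simp
  have f: "lin_on (acar A) UNIV ?f"
  proof (rule lin_onI)
    show "?f (a + b) = ?f a + ?f b" if "a \<in> acar A" "b \<in> acar A" for a b
      using lin_on_add[OF alg_moduleD(3)[OF mod w] that] by (auto simp: fun_eq_iff)
    show "?f (cscale c a) = cscale c (?f a)" if "a \<in> acar A" for c a
      using lin_on_scale[OF alg_moduleD(3)[OF mod w] that] by (auto simp: fun_eq_iff)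
  qed simp
  have "\<exists>x\<in>?f ` acar A. \<forall>i\<in>I. x i = y i"
  proof (rule jacobson_density[where Ops = "acar A" and act = "\<lambda>i. wact (W i)"
        and X = "\<lambda>i. wcar (W i)" and w = w])
    show "finite I" by fact
    show "simple_ops (acar A) (wact (W i)) (wcar (W i))" if "i \<in> I" for i
      using simple[OF that] by (simp add: simple_amod_ops)
    show "countable_dim (wcar (W i))" if "i \<in> I" for i
      using simple_amod_fin_dim[OF A simple[OF that]] by (rule fin_dim_countable_dim)
    show "wcar (W i) = wcar (W k) \<and> wact (W i) = wact (W k) \<or>
       (\<forall>f. ops_hom (acar A) (wcar (W i)) (wact (W i)) (wcar (W k)) (wact (W k)) f \<longrightarrow>
            (\<forall>x\<in>wcar (W i). f x = 0))" if "i \<in> I" "k \<in> I" for i k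
    proof (cases "W i = W k")
      case False
      then have "\<not> amod_iso A (W i) (W k)" using iso that by blast
      then show ?thesis
        using simple_amod_hom_iso(2)[OF simple[OF that(1)] simple[OF that(2)]] by blast
    qed simp
    show "w i \<in> wcar (W i)" if "i \<in> I" for i using w that .
    show "\<forall>i\<in>I. c i = 0" if "k \<in> I"
      "\<And>i. i \<in> I \<Longrightarrow> c i \<noteq> 0 \<Longrightarrow> wcar (W i) = wcar (W k) \<and> wact (W i) = wact (W k)"
      "(\<Sum>i\<in>I. cscale (c i) (w i)) = 0" for c k
      using that by (intro indep[of k]) (simp_all add: eq)
    show "cv.subspace (?f ` acar A)"
      by (rule subspace_image[OF f]) (use A in \<open>simp add: fd_alg_def fin_dim_subspaceI\<close>)
    show "x i \<in> wcar (W i)" if "x \<in> ?f ` acar A" "i \<in> I" for x i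
      using that lin_on_in[OF alg_moduleD(3)[OF mod w]] by auto
    show "\<exists>y\<in>?f ` acar A. \<forall>i\<in>I. y i = wact (W i) s (x i)" if x: "x \<in> ?f ` acar A" and s: "s \<in> acar A" for x s
    proof -
      obtain a where a: "a \<in> acar A" "x = ?f a" using x by blast
      have "?f (amul A s a) \<in> ?f ` acar A"
        using A s a(1) by (intro imageI) (simp add: fd_alg_def)
      moreover have "\<forall>i\<in>I. ?f (amul A s a) i = wact (W i) s (x i)"
        using a s alg_moduleD(4)[OF mod _ _ w] by simp
      ultimately show ?thesis by (intro bexI[of _ "?f (amul A s a)"])
    qed
    show "\<exists>y\<in>?f ` acar A. \<forall>i\<in>I. y i = w i"
      using A alg_moduleD(5)[OF mod w] by (intro bexI[of _ "?f (aone A)"]) (simp_all add: fd_alg_def)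
    show "y i \<in> wcar (W i)" if "i \<in> I" for i using y that .
  qed
  then show ?thesis by auto
qed

definition transport_amod :: "('w::complex_space \<Rightarrow> 'x::complex_space) \<Rightarrow> ('a, 'w) amod \<Rightarrow> ('a, 'x) amod" where
  "transport_amod f W =
     \<lparr>wcar = f ` wcar W, wact = (\<lambda>a y. f (wact W a (inv_into (wcar W) f y)))\<rparr>"

lemma transport_amod:
  assumes W: "simple_amod A W" and f: "lin_on (wcar W) Y f" "inj_on f (wcar W)"
  shows "simple_amod A (transport_amod f W)" "amod_iso A W (transport_amod f W)"
proof -
  let ?X = "wcar W" and ?g = "inv_into (wcar W) f"
  have mod: "alg_module A W"
    using W by (simp add: simple_amod_def)
  note sub = alg_moduleD(1)[OF mod]
  have f': "lin_on ?X (f ` ?X) f" using f(1) by (simp add: lin_on_def)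
  have bij: "bij_betw f ?X (f ` ?X)" using f(2) by (simp add: bij_betw_def)
  have gf: "?g (f x) = x" if "x \<in> ?X" for x using f(2) that by simp
  have g: "lin_on (f ` ?X) ?X ?g" by (rule lin_on_inv_into[OF bij f' sub])
  have act: "wact W a x \<in> ?X" if "a \<in> acar A" "x \<in> ?X" for a x
    using lin_on_in[OF alg_moduleD(2)[OF mod that(1)] that(2)] .
  have hom: "ops_hom (acar A) ?X (wact W) (f ` ?X) (\<lambda>a y. f (wact W a (?g y))) f"
    using f' by (simp add: ops_hom_def gf)
  then show "amod_iso A W (transport_amod f W)"
    using bij unfolding amod_iso_ops transport_amod_def by auto
  have "alg_module A (transport_amod f W)"
    unfolding alg_module_def transport_amod_def amod.simps
  proof (intro conjI ballI)
    show "cv.subspace (f ` ?X)" by (rule subspace_image[OF f(1) sub])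
    show "lin_on (f ` ?X) (f ` ?X) (\<lambda>y. f (wact W a (?g y)))" if "a \<in> acar A" for a
      using lin_on_compose[OF lin_on_compose[OF g alg_moduleD(2)[OF mod that]] f'] .
    show "lin_on (acar A) (f ` ?X) (\<lambda>a. f (wact W a (?g w)))" if "w \<in> f ` ?X" for w
      using lin_on_compose[OF alg_moduleD(3)[OF mod lin_on_in[OF g that]] f'] .
    show "f (wact W (amul A a b) (?g w)) = f (wact W a (?g (f (wact W b (?g w)))))"
      if "a \<in> acar A" "b \<in> acar A" "w \<in> f ` ?X" for a b w
      using that lin_on_in[OF g that(3)] by (simp add: gf act alg_moduleD(4)[OF mod])
    show "f (wact W (aone A) (?g w)) = w" if "w \<in> f ` ?X" for w
      using that by (auto simp: gf alg_moduleD(5)[OF mod])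
  qed
  moreover have "simple_ops (acar A) (\<lambda>a y. f (wact W a (?g y))) (f ` ?X)"
    unfolding simple_ops_def
  proof (intro conjI ballI allI impI)
    show "cv.subspace (f ` ?X)" by (rule subspace_image[OF f(1) sub])
    show "lin_on (f ` ?X) (f ` ?X) (\<lambda>y. f (wact W a (?g y)))" if "a \<in> acar A" for a
      using lin_on_compose[OF lin_on_compose[OF g alg_moduleD(2)[OF mod that]] f'] .
    show "f ` ?X \<noteq> {0}"
    proof -
      obtain w where w: "w \<in> ?X" "w \<noteq> 0" by (rule simple_amod_nonzero[OF W])
      have "f w \<noteq> f 0"
        using w f(2) cv.subspace_0[OF sub] by (simp add: inj_on_eq_iff)
      with w lin_on_zero[OF f(1) sub] show ?thesis by auto
    qed
    fix N assume N: "stable (acar A) (\<lambda>a y. f (wact W a (?g y))) N" "N \<subseteq> f ` ?X"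
    have "ops_hom (acar A) (f ` ?X) (\<lambda>a y. f (wact W a (?g y))) ?X (wact W) ?g"
      by (rule ops_hom_inv[OF hom bij sub act])
    from ops_hom_image_stable[OF this N] have "stable (acar A) (wact W) (?g ` N)" .
    moreover have "?g ` N \<subseteq> ?X" using N(2) lin_on_in[OF g] by blast
    ultimately have "?g ` N = {0} \<or> ?g ` N = ?X"
      using W by (simp add: simple_amod_def asubmodule_stable)
    then have "f ` ?g ` N = {0} \<or> f ` ?g ` N = f ` ?X"
      using lin_on_zero[OF f(1) sub] by (metis image_empty image_insert)
    moreover have "f ` ?g ` N = N"
    proof -
      have "f (?g y) = y" if "y \<in> N" for y using that N(2) by (auto simp: gf)
      then show ?thesis by (simp add: image_image)
    qed
    ultimately show "N = {0} \<or> N = f ` ?X" by simp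
  qed
  ultimately show "simple_amod A (transport_amod f W)"
    by (simp add: simple_amod_ops transport_amod_def)
qed

lemma simple_amod_nat_model:
  fixes W :: "('a::complex_space, 'w::complex_space) amod"
  assumes "fd_alg A" "simple_amod A W"
  shows "\<exists>X :: ('a, nat \<Rightarrow> complex) amod. simple_amod A X \<and> amod_iso A W X"
proof -
  from fin_dim_embedding[OF simple_amod_fin_dim[OF assms]]
  obtain f :: "'w \<Rightarrow> nat \<Rightarrow> complex" where "lin_on (wcar W) UNIV f" "inj_on f (wcar W)" by blast
  from transport_amod[OF assms(2) this] show ?thesis by blast
qed

text \<open>The basis inside \<open>trace_on\<close> is an arbitrary choice. Expanding each of the
  two bases in the other and exchanging the double sum shows that the choice does not affect the
  value.\<close>

lemma trace_on_basis:
  assumes f: "lin_on X X f" and C: "finite C" "cv.independent C" "cv.span C = X"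
  shows "trace_on X f = (\<Sum>c\<in>C. cv.representation C (f c) c)"
proof -
  define B where "B = (SOME B. cv.independent B \<and> cv.span B = X)"
  have B: "cv.independent B" "cv.span B = X"
    using someI[of "\<lambda>B. cv.independent B \<and> cv.span B = X" C] C unfolding B_def by auto
  have X: "cv.subspace X" using C(3) by (auto simp: cv.subspace_span)
  have BX: "b \<in> X" if "b \<in> B" for b using that B cv.span_base by blast
  have CX: "c \<in> X" if "c \<in> C" for c using that C cv.span_base by blast
  have "finite B"
    using cv.independent_span_bound[OF C(1) B(1)] BX C(3) by blast
  have expand: "f x = (\<Sum>c\<in>C. cscale (cv.representation C x c) (f c))" if "x \<in> X" for x
  proof -
    have "x = (\<Sum>c\<in>C. cscale (cv.representation C x c) c)"
      using cv.sum_representation_eq[OF C(2), of x C] C that by simp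
    then have "f x = f (\<Sum>c\<in>C. cscale (cv.representation C x c) c)" by simp
    also have "\<dots> = (\<Sum>c\<in>C. f (cscale (cv.representation C x c) c))"
      by (rule lin_on_sum[OF f X]) (use CX in \<open>auto intro: cv.subspace_scale[OF X]\<close>)
    finally show ?thesis by (simp add: lin_on_scale[OF f CX])
  qed
  have repB: "cv.representation B (\<Sum>c\<in>C. cscale (u c) (f c)) b
      = (\<Sum>c\<in>C. u c * cv.representation B (f c) b)" for u b
    by (subst cv.representation_sum[OF B(1)])
      (simp_all add: B cv.representation_scale CX lin_on_in[OF f] cv.span_scale
        cv.subspace_scale[OF X])
  have repC: "cv.representation C (\<Sum>b\<in>B. cscale (u b) b) c
      = (\<Sum>b\<in>B. u b * cv.representation C b c)" for u c
    by (subst cv.representation_sum[OF C(2)])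
      (simp_all add: C cv.representation_scale BX cv.subspace_scale[OF X])
  have "trace_on X f = (\<Sum>b\<in>B. cv.representation B (f b) b)"
    by (simp add: trace_on_def B_def Let_def)
  also have "\<dots> = (\<Sum>b\<in>B. \<Sum>c\<in>C. cv.representation C b c * cv.representation B (f c) b)"
  proof (rule sum.cong)
    fix b assume "b \<in> B"
    show "cv.representation B (f b) b = (\<Sum>c\<in>C. cv.representation C b c * cv.representation B (f c) b)"
      by (subst expand[OF BX[OF \<open>b \<in> B\<close>]]) (rule repB)
  qed simp
  also have "\<dots> = (\<Sum>c\<in>C. \<Sum>b\<in>B. cv.representation B (f c) b * cv.representation C b c)"
    by (subst sum.swap) (simp add: mult.commute)
  also have "\<dots> = (\<Sum>c\<in>C. cv.representation C (f c) c)"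
  proof (rule sum.cong)
    fix c assume c: "c \<in> C"
    have "(\<Sum>b\<in>B. cscale (cv.representation B (f c) b) b) = f c"
      using cv.sum_representation_eq[OF B(1), of "f c" B] lin_on_in[OF f CX[OF c]] B(2) \<open>finite B\<close>
      by simp
    then show "(\<Sum>b\<in>B. cv.representation B (f c) b * cv.representation C b c)
        = cv.representation C (f c) c"
      using repC[of "cv.representation B (f c)" c] by simp
  qed simp
  finally show ?thesis .
qed

lemma trace_on_iso:
  assumes h: "bij_betw h X Y" "lin_on X Y h" and "fin_dim X"
    and f: "lin_on X X f" and f': "lin_on Y Y f'" and comm: "\<And>x. x \<in> X \<Longrightarrow> h (f x) = f' (h x)"
  shows "trace_on X f = trace_on Y f'"
proof -
  obtain B where B: "finite B" "B \<subseteq> X" "cv.independent B" "cv.span B = X"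
    by (rule fin_dim_basis[OF assms(3)])
  have X: "cv.subspace X" using assms(3) by (rule fin_dim_subspaceI)
  have inj: "inj_on h X" and Y: "Y = h ` X" using h(1) by (auto simp: bij_betw_def)
  have hB: "cv.independent (h ` B)"
    by (rule independent_image[OF h(2) X inj B(3,2)])
  have span: "cv.span (h ` B) = Y"
    using image_span[of B Y h] h(2) B(4) Y by simp
  have injB: "inj_on h B" using inj B(2) by (rule inj_on_subset)
  have rep: "cv.representation (h ` B) (h x) (h b) = cv.representation B x b"
    if "x \<in> X" "b \<in> B" for x b
  proof -
    have "x = (\<Sum>b\<in>B. cscale (cv.representation B x b) b)"
      using cv.sum_representation_eq[OF B(3), of x B] B that by simp
    then have "h x = h (\<Sum>b\<in>B. cscale (cv.representation B x b) b)" by simp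
    also have "\<dots> = (\<Sum>b\<in>B. cscale (cv.representation B x b) (h b))"
      using B(2) by (subst lin_on_sum[OF h(2) X])
        (auto simp: lin_on_scale[OF h(2)] subset_iff intro: cv.subspace_scale[OF X])
    finally have "cv.representation (h ` B) (h x) (h b)
        = (\<Sum>d\<in>B. cv.representation B x d * cv.representation (h ` B) (h d) (h b))"
      by (simp add: cv.representation_sum[OF hB] cv.representation_scale[OF hB]
          cv.span_base cv.span_scale)
    also have "\<dots> = (\<Sum>d\<in>B. if d = b then cv.representation B x d else 0)"
      by (rule sum.cong)
        (use that(2) in \<open>auto simp: cv.representation_basis[OF hB] inj_on_eq_iff[OF injB]\<close>)
    also have "\<dots> = cv.representation B x b" using B(1) that(2) by simp
    finally show ?thesis .
  qed
  have "trace_on Y f' = (\<Sum>c\<in>h ` B. cv.representation (h ` B) (f' c) c)"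
    by (rule trace_on_basis[OF f' _ hB span]) (use B(1) in simp)
  also have "\<dots> = (\<Sum>b\<in>B. cv.representation (h ` B) (h (f b)) (h b))"
    unfolding sum.reindex[OF injB] comp_def by (rule sum.cong) (use comm B(2) in auto)
  also have "\<dots> = (\<Sum>b\<in>B. cv.representation B (f b) b)"
    by (rule sum.cong) (use rep B(2) lin_on_in[OF f] in auto)
  also have "\<dots> = trace_on X f"
    by (rule trace_on_basis[OF f B(1,3,4), symmetric])
  finally show ?thesis by simp
qed

lemma character_iso:
  assumes A: "fd_alg A" and W: "simple_amod A W" and X: "alg_module A X" and "amod_iso A W X"
  shows "character A W = character A X"
proof -
  obtain f where f: "bij_betw f (wcar W) (wcar X)"
      "ops_hom (acar A) (wcar W) (wact W) (wcar X) (wact X) f"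
    using assms(4) unfolding amod_iso_ops by blast
  have W': "alg_module A W" using W by (simp add: simple_amod_def)
  have "trace_on (wcar W) (wact W a) = trace_on (wcar X) (wact X a)" if "a \<in> acar A" for a
    by (rule trace_on_iso[OF f(1) _ simple_amod_fin_dim[OF A W] alg_moduleD(2)[OF W' that]
          alg_moduleD(2)[OF X that]])
      (use f(2) that in \<open>simp_all add: ops_hom_def\<close>)
  then show ?thesis by (auto simp: character_def fun_eq_iff)
qed

text \<open>
  By density, if the modules were not isomorphic, some element would act as the identity on the
  first and as 0 on the second, hence with different traces.
\<close>

lemma same_character_iso_aux:
  fixes W X :: "('a::complex_space, 'w::complex_space) amod"
  assumes A: "fd_alg A" and W: "simple_amod A W" and X: "simple_amod A X"
    and char: "character A W = character A X"
  shows "amod_iso A W X"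
proof (rule ccontr)
  assume neg: "\<not> amod_iso A W X"
  then have neg': "\<not> amod_iso A X W"
    using amod_iso_sym[of A X W] X by (auto simp: simple_amod_def)
  have fW: "fin_dim (wcar W)" and fX: "fin_dim (wcar X)"
    using simple_amod_fin_dim[OF A] W X by auto
  obtain B where B: "finite B" "B \<subseteq> wcar W" "cv.independent B" "cv.span B = wcar W"
    by (rule fin_dim_basis[OF fW])
  obtain C where C: "finite C" "C \<subseteq> wcar X" "cv.independent C" "cv.span C = wcar X"
    by (rule fin_dim_basis[OF fX])
  \<comment> \<open>The Boolean tag keeps \<open>B\<close> as part of \<open>W\<close> and
    \<open>C\<close> as part of \<open>X\<close> apart even where the two sets share
    vectors.\<close>
  define M where "M = (\<lambda>(t, b :: 'w). if t then W else X)"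
  let ?I = "{True} \<times> B \<union> {False} \<times> C"
  have WX: "W \<noteq> X"
  proof
    assume "W = X"
    moreover have "amod_iso A W W"
      unfolding amod_iso_ops by (intro exI[of _ "\<lambda>x. x"]) (simp add: ops_hom_def lin_on_def bij_betw_def)
    ultimately show False using neg by simp
  qed
  have "\<exists>a\<in>acar A. \<forall>i\<in>?I. wact (M i) a (snd i) = (if fst i then snd i else 0)"
  proof (rule algebra_density[OF A])
    show "finite ?I" using B C by simp
    show "simple_amod A (M i)" if "i \<in> ?I" for i
      using W X by (auto simp: M_def split: prod.splits)
    show "M i = M k" if "amod_iso A (M i) (M k)" for i k
      using that neg neg' by (auto simp: M_def split: prod.splits if_splits)
    show "snd i \<in> wcar (M i)" if "i \<in> ?I" for i
      using that B(2) C(2) by (auto simp: M_def)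
    show "(if fst i then snd i else 0) \<in> wcar (M i)" if "i \<in> ?I" for i
      using that B(2) C(2) fin_dim_subspaceI[OF fX] by (auto simp: M_def cv.subspace_0)
    show "\<forall>i\<in>?I. c i = 0"
      if k: "k \<in> ?I" and supp: "\<And>i. i \<in> ?I \<Longrightarrow> c i \<noteq> 0 \<Longrightarrow> M i = M k"
        and rel: "(\<Sum>i\<in>?I. cscale (c i) (snd i)) = 0" for c k
    proof -
      have sum: "(\<Sum>b\<in>B. cscale (c (True, b)) b) + (\<Sum>b\<in>C. cscale (c (False, b)) b) = 0"
      proof -
        have tag: "{t} \<times> D = Pair t ` D" for t :: bool and D :: "'w set" by auto
        have "(\<Sum>i\<in>?I. cscale (c i) (snd i))
            = (\<Sum>i\<in>{True} \<times> B. cscale (c i) (snd i)) + (\<Sum>i\<in>{False} \<times> C. cscale (c i) (snd i))"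
          using B(1) C(1) by (intro sum.union_disjoint) auto
        also have "\<dots> = (\<Sum>b\<in>B. cscale (c (True, b)) b) + (\<Sum>b\<in>C. cscale (c (False, b)) b)"
          unfolding tag[of True] tag[of False] by (simp add: sum.reindex inj_on_def)
        finally show ?thesis using rel by simp
      qed
      have zero: "u b = 0" if "cv.independent D" "finite D" "(\<Sum>b\<in>D. cscale (u b) b) = 0" "b \<in> D"
        for u b and D :: "'w set"
        using that cv.independentD[of D D u b] by auto
      show ?thesis
      proof (cases "fst k")
        case True
        then have C0: "c (False, b) = 0" if "b \<in> C" for b
          using supp[of "(False, b)"] that WX True by (cases k) (auto simp: M_def)
        then have "(\<Sum>b\<in>B. cscale (c (True, b)) b) = 0" using sum by simp
        with C0 zero[OF B(3,1)] show ?thesis by auto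
      next
        case False
        then have B0: "c (True, b) = 0" if "b \<in> B" for b
          using supp[of "(True, b)"] that WX False by (cases k) (auto simp: M_def)
        then have "(\<Sum>b\<in>C. cscale (c (False, b)) b) = 0" using sum by simp
        with B0 zero[OF C(3,1)] show ?thesis by auto
      qed
    qed
  qed
  then obtain a where a0: "a \<in> acar A"
      "\<forall>i\<in>?I. wact (M i) a (snd i) = (if fst i then snd i else 0)" by blast
  have "wact W a b = b" if "b \<in> B" for b
    using bspec[OF a0(2), of "(True, b)"] that by (simp add: M_def)
  moreover have "wact X a b = 0" if "b \<in> C" for b
    using bspec[OF a0(2), of "(False, b)"] that by (simp add: M_def)
  ultimately have a: "a \<in> acar A" "\<forall>b\<in>B. wact W a b = b" "\<forall>b\<in>C. wact X a b = 0"
    using a0(1) by blast+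
  have "alg_module A W" "alg_module A X" using W X by (auto simp: simple_amod_def)
  then have "trace_on (wcar W) (wact W a) = (\<Sum>b\<in>B. cv.representation B (wact W a b) b)"
    and "trace_on (wcar X) (wact X a) = (\<Sum>b\<in>C. cv.representation C (wact X a b) b)"
    using a(1) B C by (auto intro!: trace_on_basis alg_moduleD(2))
  moreover have "(\<Sum>b\<in>B. cv.representation B (wact W a b) b) = of_nat (card B)"
    using a(2) by (simp add: cv.representation_basis[OF B(3)])
  moreover have "(\<Sum>b\<in>C. cv.representation C (wact X a b) b) = 0"
    using a(3) by (simp add: cv.representation_zero)
  moreover have "card B \<noteq> 0"
    using B W by (auto simp: simple_amod_def)
  ultimately show False
    using fun_cong[OF char, of a] a(1) by (simp add: character_def)
qed

text \<open>Density needs all modules in one ambient type, so both are first replaced by models in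
  \<open>nat => complex\<close>, which have the same characters.\<close>

lemma same_character_iso:
  fixes W :: "('a::complex_space, 'w::complex_space) amod" and X :: "('a, 'x::complex_space) amod"
  assumes A: "fd_alg A" and W: "simple_amod A W" and X: "simple_amod A X"
    and char: "character A W = character A X"
  shows "amod_iso A W X"
proof -
  obtain W' :: "('a, nat \<Rightarrow> complex) amod" where W': "simple_amod A W'" "amod_iso A W W'"
    using simple_amod_nat_model[OF A W] by blast
  obtain X' :: "('a, nat \<Rightarrow> complex) amod" where X': "simple_amod A X'" "amod_iso A X X'"
    using simple_amod_nat_model[OF A X] by blast
  have "alg_module A X" "alg_module A W'" "alg_module A X'"
    using X W'(1) X'(1) by (auto simp: simple_amod_def)
  then have "character A W' = character A X'"
    using character_iso[OF A W _ W'(2)] character_iso[OF A X _ X'(2)] char by simp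
  from same_character_iso_aux[OF A W'(1) X'(1) this] have "amod_iso A W' X'" .
  from amod_iso_trans[OF amod_iso_trans[OF W'(2) this] amod_iso_sym[OF \<open>alg_module A X\<close> X'(2)]]
  show ?thesis .
qed

section \<open>Modes of twisted modules\<close>

text \<open>The coefficient of \<open>x^(s-k) y^k\<close> in \<open>(x - y)^s\<close>.\<close>

definition jcoeff :: "rat \<Rightarrow> nat \<Rightarrow> complex" where
  "jcoeff s k = of_rat ((-1) ^ k * (s gchoose k))"

lemma jcoeff_0 [simp]: "jcoeff s 0 = 1"
  by (simp add: jcoeff_def)

lemma binom_coeff_of_nat:
  "binom_coeff s p (of_nat k) = (if p + of_nat k = s then jcoeff s k else 0)"
  by (simp add: binom_coeff_def jcoeff_def)

lemma binom_coeff_nonzero: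
  assumes "binom_coeff s p q \<noteq> 0"
  obtains k where "q = of_nat k" "p = s - of_nat k"
  using assms by (auto simp: binom_coeff_def algebra_simps elim!: Nats_cases split: if_splits)

text \<open>The support of each product with a delta series lies on a line indexed by natural
  numbers, and truncation leaves finitely many of its points.\<close>

lemma Sum_any_nat:
  fixes f :: "'b \<Rightarrow> 'c::comm_monoid_add" and e :: "nat \<Rightarrow> 'b"
  assumes "inj e" "\<And>x. f x \<noteq> 0 \<Longrightarrow> x \<in> range e" "\<And>k. K \<le> k \<Longrightarrow> f (e k) = 0"
  shows "Sum_any f = (\<Sum>k<K. f (e k))"
proof -
  have "{x. f x \<noteq> 0} \<subseteq> e ` {..<K}"
  proof
    fix x assume "x \<in> {x. f x \<noteq> 0}"
    then obtain k where k: "x = e k" "f (e k) \<noteq> 0" using assms(2) by blast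
    have "k < K"
    proof (rule ccontr)
      assume "\<not> k < K"
      then have "K \<le> k" by simp
      with k(2) assms(3) show False by blast
    qed
    with k show "x \<in> e ` {..<K}" by blast
  qed
  then have "Sum_any f = sum f (e ` {..<K})"
    by (intro Sum_any.expand_superset) simp
  then show ?thesis
    using assms(1) by (simp add: sum.reindex inj_on_subset)
qed

text \<open>
  The coefficient of \<open>z0^(-1-s) z1^(-1-m) z2^(-1-n)\<close> of the Jacobi identity, every series being
  cut off at a \<open>K\<close> beyond which all of its terms vanish.
\<close>

definition borcherds_identity ::
  "rat \<Rightarrow> 'v::complex_space vertex \<Rightarrow> ('v \<Rightarrow> rat \<Rightarrow> 'm::complex_space \<Rightarrow> 'm) \<Rightarrow> 'v \<Rightarrow> 'v \<Rightarrow> 'm \<Rightarrow> bool"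
where
  "borcherds_identity \<theta> V YM u v w \<longleftrightarrow>
     (\<forall>s m n K. (\<forall>k\<ge>K. YM v (n + of_nat k) w = 0 \<and> YM u (m + of_nat k) w = 0 \<and>
                        vmode V u (s + int k) v = 0) \<longrightarrow>
        (\<Sum>k<K. cscale (jcoeff (of_int s) k) (YM u (m + of_int s - of_nat k) (YM v (n + of_nat k) w)))
      - (\<Sum>k<K. cscale ((-1) powi s * jcoeff (of_int s) k)
                   (YM v (n + of_int s - of_nat k) (YM u (m + of_nat k) w)))
      = (\<Sum>k<K. cscale (if m - \<theta> \<in> \<int> then jcoeff (of_nat k - m - 1) k else 0)
                   (YM (vmode V u (s + int k) v) (m + n - of_nat k) w)))"

lemma rmode_of_int [simp]: "rmode V u (of_int s) = vmode V u s"
  by (simp add: rmode_def)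

text \<open>With exponents \<open>-1-s\<close>, \<open>-1-m\<close>, \<open>-1-n\<close>, each of
  the three delta series ties all exponents to one summation index \<open>k\<close>, which gives the
  three finite sums. When the exponent of \<open>z0\<close> is not an integer, the delta factors on
  the left vanish and the mode of \<open>V\<close> on the right does, so nothing is lost by taking
  \<open>s\<close> integral.\<close>

lemma jacobi_iff_borcherds:
  assumes zu: "\<And>p. YM u p 0 = 0" and zv: "\<And>p. YM v p 0 = 0" and z0: "\<And>p. YM 0 p w = 0"
    and tv: "\<exists>N. \<forall>l\<ge>N. YM v l w = 0" and tu: "\<exists>N. \<forall>l\<ge>N. YM u l w = 0"
    and tV: "\<exists>N. \<forall>n\<ge>N. vmode V u n v = 0"
  shows "jacobi_identity \<theta> (rmode V) YM u v w \<longleftrightarrow> borcherds_identity \<theta> V YM u v w"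
proof -
  define L1 where "L1 = (\<lambda>a b c. Sum_any (\<lambda>(b', c'). cscale (delta12 a b' c')
                   (YM u (- (b - b') - 1) (YM v (- (c - c') - 1) w))))"
  define L2 where "L2 = (\<lambda>a b c. Sum_any (\<lambda>(b', c'). cscale (delta21 a b' c')
                   (YM v (- (c - c') - 1) (YM u (- (b - b') - 1) w))))"
  define L3 where "L3 = (\<lambda>a b c. Sum_any (\<lambda>(a', c'). cscale (delta10 \<theta> a' b c')
                   (YM (rmode V u (- (a - a') - 1) v) (- (c - c') - 1) w)))"
  define cut where "cut s m n K \<longleftrightarrow> (\<forall>k\<ge>K. YM v (n + of_nat k) w = 0 \<and>
      YM u (m + of_nat k) w = 0 \<and> vmode V u (s + int k) v = 0)" for s m n K
  have jac: "jacobi_identity \<theta> (rmode V) YM u v w \<longleftrightarrow> (\<forall>a b c. L1 a b c - L2 a b c = L3 a b c)"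
    by (simp add: jacobi_identity_def L1_def L2_def L3_def)
  have s1: "L1 (- 1 - of_int s) (- m - 1) (- n - 1)
      = (\<Sum>k<K. cscale (jcoeff (of_int s) k) (YM u (m + of_int s - of_nat k) (YM v (n + of_nat k) w)))"
    if "cut s m n K" for s m n K
  proof -
    let ?e = "\<lambda>k. (of_int s - of_nat k, of_nat k) :: rat \<times> rat"
    have "L1 (- 1 - of_int s) (- m - 1) (- n - 1) = (\<Sum>k<K. (\<lambda>(b', c').
        cscale (delta12 (- 1 - of_int s) b' c')
          (YM u (- (- m - 1 - b') - 1) (YM v (- (- n - 1 - c') - 1) w))) (?e k))"
      unfolding L1_def
    proof (rule Sum_any_nat)
      show "inj ?e" by (auto simp: inj_on_def)
      show "x \<in> range ?e" if "(case x of (b', c') \<Rightarrow> cscale (delta12 (- 1 - of_int s) b' c')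
          (YM u (- (- m - 1 - b') - 1) (YM v (- (- n - 1 - c') - 1) w))) \<noteq> 0" for x
        using that by (auto simp: delta12_def elim: binom_coeff_nonzero split: prod.splits)
    qed (use that zu in \<open>auto simp: cut_def algebra_simps\<close>)
    then show ?thesis
      by (simp add: delta12_def binom_coeff_of_nat algebra_simps)
  qed
  have s2: "L2 (- 1 - of_int s) (- m - 1) (- n - 1)
      = (\<Sum>k<K. cscale ((-1) powi s * jcoeff (of_int s) k)
                   (YM v (n + of_int s - of_nat k) (YM u (m + of_nat k) w)))"
    if "cut s m n K" for s m n K
  proof -
    let ?e = "\<lambda>k. (of_nat k, of_int s - of_nat k) :: rat \<times> rat"
    have "L2 (- 1 - of_int s) (- m - 1) (- n - 1) = (\<Sum>k<K. (\<lambda>(b', c').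
        cscale (delta21 (- 1 - of_int s) b' c')
          (YM v (- (- n - 1 - c') - 1) (YM u (- (- m - 1 - b') - 1) w))) (?e k))"
      unfolding L2_def
    proof (rule Sum_any_nat)
      show "inj ?e" by (auto simp: inj_on_def)
      show "x \<in> range ?e" if "(case x of (b', c') \<Rightarrow> cscale (delta21 (- 1 - of_int s) b' c')
          (YM v (- (- n - 1 - c') - 1) (YM u (- (- m - 1 - b') - 1) w))) \<noteq> 0" for x
        using that by (auto simp: delta21_def elim: binom_coeff_nonzero split: prod.splits)
    qed (use that zv in \<open>auto simp: cut_def algebra_simps\<close>)
    then show ?thesis
      by (simp add: delta21_def binom_coeff_of_nat algebra_simps)
  qed
  have s3: "L3 (- 1 - of_int s) (- m - 1) (- n - 1)
      = (\<Sum>k<K. cscale (if m - \<theta> \<in> \<int> then jcoeff (of_nat k - m - 1) k else 0)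
                   (YM (vmode V u (s + int k) v) (m + n - of_nat k) w))"
    if "cut s m n K" for s m n K
  proof -
    let ?e = "\<lambda>k. (of_nat k, m - of_nat k) :: rat \<times> rat"
    have int: "rmode V u (of_int s + of_nat k) = vmode V u (s + int k)" for k
      using rmode_of_int[of V u "s + int k"] by simp
    have Z: "of_nat k - m - 1 + \<theta> \<in> \<int> \<longleftrightarrow> m - \<theta> \<in> \<int>" for k
    proof -
      have "of_nat k - m - 1 + \<theta> = of_int (int k - 1) - (m - \<theta>)" by simp
      also have "\<dots> \<in> \<int> \<longleftrightarrow> m - \<theta> \<in> \<int>"
        by (metis Ints_diff Ints_of_int diff_diff_eq2 add_diff_cancel_left')
      finally show ?thesis .
    qed
    have "L3 (- 1 - of_int s) (- m - 1) (- n - 1) = (\<Sum>k<K. (\<lambda>(a', c').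
        cscale (delta10 \<theta> a' (- m - 1) c')
          (YM (rmode V u (- (- 1 - of_int s - a') - 1) v) (- (- n - 1 - c') - 1) w)) (?e k))"
      unfolding L3_def
    proof (rule Sum_any_nat)
      show "inj ?e" by (auto simp: inj_on_def)
      show "x \<in> range ?e" if "(case x of (a', c') \<Rightarrow> cscale (delta10 \<theta> a' (- m - 1) c')
          (YM (rmode V u (- (- 1 - of_int s - a') - 1) v) (- (- n - 1 - c') - 1) w)) \<noteq> 0" for x
      proof -
        obtain a' c' where x: "x = (a', c')" by (cases x)
        with that have "binom_coeff (- 1 - c') (- m - 1) a' \<noteq> 0"
          by (auto simp: delta10_def split: if_splits)
        then obtain k where "a' = of_nat k" "- m - 1 = - 1 - c' - of_nat k"
          by (rule binom_coeff_nonzero)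
        with x show ?thesis by (auto simp: algebra_simps)
      qed
    qed (use that z0 in \<open>auto simp: cut_def algebra_simps int\<close>)
    also have "\<dots> = (\<Sum>k<K. cscale (if m - \<theta> \<in> \<int> then jcoeff (of_nat k - m - 1) k else 0)
                   (YM (vmode V u (s + int k) v) (m + n - of_nat k) w))"
    proof (rule sum.cong)
      fix k
      have "delta10 \<theta> (of_nat k) (- m - 1) (m - of_nat k)
          = (if m - \<theta> \<in> \<int> then jcoeff (of_nat k - m - 1) k else 0)"
        using Z[of k] by (simp add: delta10_def binom_coeff_of_nat algebra_simps)
      moreover have "- (- 1 - of_int s - of_nat k) - 1 = of_int s + (of_nat k :: rat)"
        "- (- n - 1 - (m - of_nat k)) - 1 = m + n - of_nat k" by simp_all
      ultimately show "(\<lambda>(a', c'). cscale (delta10 \<theta> a' (- m - 1) c')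
          (YM (rmode V u (- (- 1 - of_int s - a') - 1) v) (- (- n - 1 - c') - 1) w)) (?e k)
        = cscale (if m - \<theta> \<in> \<int> then jcoeff (of_nat k - m - 1) k else 0)
                   (YM (vmode V u (s + int k) v) (m + n - of_nat k) w)"
        by (simp only: prod.case int)
    qed simp
    finally show ?thesis .
  qed
  have bor: "borcherds_identity \<theta> V YM u v w \<longleftrightarrow> (\<forall>s m n K. cut s m n K \<longrightarrow>
      L1 (- 1 - of_int s) (- m - 1) (- n - 1) - L2 (- 1 - of_int s) (- m - 1) (- n - 1)
        = L3 (- 1 - of_int s) (- m - 1) (- n - 1))"
    unfolding borcherds_identity_def cut_def[symmetric]
    by (intro all_cong1 imp_cong[OF refl] arg_cong2[where f = "(=)"] arg_cong2[where f = "(-)"];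
        erule s1[symmetric] s2[symmetric] s3[symmetric])
  have cut_ex: "\<exists>K. cut s m n K" for s m n
  proof -
    obtain N1 N2 N3 where N: "\<forall>l\<ge>N1. YM v l w = 0" "\<forall>l\<ge>N2. YM u l w = 0" "\<forall>n\<ge>N3. vmode V u n v = 0"
      using tv tu tV by blast
    define K where "K = nat \<lceil>N1 - n\<rceil> + nat \<lceil>N2 - m\<rceil> + nat (N3 - s)"
    have "N1 \<le> n + of_nat k" "N2 \<le> m + of_nat k" "N3 \<le> s + int k" if "K \<le> k" for k
    proof -
      have "nat \<lceil>N1 - n\<rceil> \<le> k" "nat \<lceil>N2 - m\<rceil> \<le> k" "nat (N3 - s) \<le> k"
        using that by (simp_all add: K_def)
      then show "N1 \<le> n + of_nat k" "N2 \<le> m + of_nat k" "N3 \<le> s + int k"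
        by (simp_all add: nat_le_iff ceiling_le_iff algebra_simps)
    qed
    with N have "cut s m n K" unfolding cut_def by blast
    then show ?thesis ..
  qed
  have nonint: "L1 a b c - L2 a b c = L3 a b c" if "a \<notin> \<int>" for a b c
  proof -
    have L12: "L1 a b c = 0" "L2 a b c = 0"
      using that by (simp_all add: L1_def L2_def delta12_def delta21_def split_def)
    have terms: "cscale (delta10 \<theta> a' b c') (YM (rmode V u (- (a - a') - 1) v) (- (c - c') - 1) w) = 0"
      for a' c'
    proof (cases "delta10 \<theta> a' b c' = 0")
      case False
      then have "binom_coeff (- 1 - c') b a' \<noteq> 0" by (auto simp: delta10_def split: if_splits)
      then obtain k where k: "a' = of_nat k" by (rule binom_coeff_nonzero)
      have "- (a - a') - 1 \<notin> \<int>"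
      proof
        assume "- (a - a') - 1 \<in> \<int>"
        then have "of_int (int k - 1) - (- (a - a') - 1) \<in> \<int>" by (intro Ints_diff) simp_all
        with k that show False by simp
      qed
      then show ?thesis by (simp add: rmode_def z0)
    qed simp
    have "L3 a b c = 0"
      unfolding L3_def split_def terms by simp
    with L12 show ?thesis by simp
  qed
  show ?thesis
    unfolding jac bor
  proof
    assume *: "\<forall>s m n K. cut s m n K \<longrightarrow>
      L1 (- 1 - of_int s) (- m - 1) (- n - 1) - L2 (- 1 - of_int s) (- m - 1) (- n - 1)
        = L3 (- 1 - of_int s) (- m - 1) (- n - 1)"
    show "\<forall>a b c. L1 a b c - L2 a b c = L3 a b c"
    proof (intro allI)
      fix a b c
      show "L1 a b c - L2 a b c = L3 a b c"
      proof (cases "a \<in> \<int>")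
        case True
        then obtain z where z: "a = of_int z" by (rule Ints_cases)
        obtain K where "cut (- 1 - z) (- b - 1) (- c - 1) K" using cut_ex by blast
        with * have "L1 (- 1 - of_int (- 1 - z)) (- (- b - 1) - 1) (- (- c - 1) - 1)
            - L2 (- 1 - of_int (- 1 - z)) (- (- b - 1) - 1) (- (- c - 1) - 1)
            = L3 (- 1 - of_int (- 1 - z)) (- (- b - 1) - 1) (- (- c - 1) - 1)" by blast
        then show ?thesis by (simp add: z)
      qed (rule nonint)
    qed
  qed blast
qed

section \<open>Twisted modules defined coordinatewise\<close>

lemma twisted_moduleD:
  assumes "twisted_module V \<sigma> M"
  shows "cv.subspace (mcar M)"
    "v \<in> vcar V \<Longrightarrow> lin_on (mcar M) (mcar M) (mmode M v n)"
    "w \<in> mcar M \<Longrightarrow> lin_on (vcar V) (mcar M) (\<lambda>v. mmode M v n w)"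
    "w \<in> mcar M \<Longrightarrow> mmode M (vac V) n w = (if n = -1 then w else 0)"
    "r < aut_order V \<sigma> \<Longrightarrow> u \<in> eigenspace V \<sigma> r \<Longrightarrow> w \<in> mcar M \<Longrightarrow>
       n - of_nat r / of_nat (aut_order V \<sigma>) \<notin> \<int> \<Longrightarrow> mmode M u n w = 0"
    "r < aut_order V \<sigma> \<Longrightarrow> u \<in> eigenspace V \<sigma> r \<Longrightarrow> w \<in> mcar M \<Longrightarrow>
       \<exists>N. \<forall>l\<ge>N. mmode M u l w = 0"
    "r < aut_order V \<sigma> \<Longrightarrow> u \<in> eigenspace V \<sigma> r \<Longrightarrow> w \<in> mcar M \<Longrightarrow> v \<in> vcar V \<Longrightarrow>
       jacobi_identity (of_nat r / of_nat (aut_order V \<sigma>)) (rmode V) (mmode M) u v w"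
  using assms unfolding twisted_module_def Let_def by blast+

text \<open>Serves families of vectors, the direct sum of \<open>S\<close> and Hom spaces alike. The
  infinite sums of the Jacobi identity cannot be compared coordinate by coordinate directly, but
  their finite form can: a cut-off for the family is one for each coordinate. Uniform truncation
  guarantees that a cut-off for the family exists.\<close>

lemma pointwise_twisted_module:
  fixes M :: "'i \<Rightarrow> ('v::complex_space, 'm::complex_space) vmod"
  assumes V: "cv.subspace (vcar V)" "vac V \<in> vcar V"
    and Vtrunc: "\<And>u v. u \<in> vcar V \<Longrightarrow> v \<in> vcar V \<Longrightarrow> \<exists>N. \<forall>n\<ge>N. vmode V u n v = 0"
    and M: "\<And>i. i \<in> I \<Longrightarrow> twisted_module V \<sigma> (M i)"
    and X: "cv.subspace X" "\<And>x i. x \<in> X \<Longrightarrow> i \<in> I \<Longrightarrow> x i \<in> mcar (M i)"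
      "\<And>x i. x \<in> X \<Longrightarrow> i \<notin> I \<Longrightarrow> x i = 0"
    and closed: "\<And>v n x. v \<in> vcar V \<Longrightarrow> x \<in> X \<Longrightarrow> (\<lambda>i. if i \<in> I then mmode (M i) v n (x i) else 0) \<in> X"
    and trunc: "\<And>v x. v \<in> vcar V \<Longrightarrow> x \<in> X \<Longrightarrow> \<exists>N. \<forall>l\<ge>N. \<forall>i\<in>I. mmode (M i) v l (x i) = 0"
  shows "twisted_module V \<sigma>
     \<lparr>mcar = X, mmode = (\<lambda>v n x i. if i \<in> I then mmode (M i) v n (x i) else 0)\<rparr>"
proof -
  let ?Y = "\<lambda>v n x i. if i \<in> I then mmode (M i) v n (x i) else 0"
  let ?T = "aut_order V \<sigma>"
  note D = twisted_moduleD[OF M]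
  have z1: "mmode (M i) v n 0 = 0" if "i \<in> I" "v \<in> vcar V" for i v n
    using lin_on_zero[OF D(2)[OF that] D(1)[OF that(1)]] .
  have z2: "mmode (M i) 0 n w = 0" if "i \<in> I" "w \<in> mcar (M i)" for i n w
    using lin_on_zero[OF D(3)[OF that] V(1)] .
  have lin: "lin_on X X (?Y v n)" if "v \<in> vcar V" for v n
  proof (rule lin_onI)
    show "?Y v n x \<in> X" if "x \<in> X" for x using closed[OF \<open>v \<in> vcar V\<close> that] .
    show "?Y v n (x + y) = ?Y v n x + ?Y v n y" if "x \<in> X" "y \<in> X" for x y
      using lin_on_add[OF D(2)[OF _ \<open>v \<in> vcar V\<close>]] X(2) that by (auto simp: fun_eq_iff)
    show "?Y v n (cscale c x) = cscale c (?Y v n x)" if "x \<in> X" for c x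
      using lin_on_scale[OF D(2)[OF _ \<open>v \<in> vcar V\<close>]] X(2) that by (auto simp: fun_eq_iff)
  qed
  have linv: "lin_on (vcar V) X (\<lambda>v. ?Y v n w)" if "w \<in> X" for n w
  proof (rule lin_onI)
    show "?Y v n w \<in> X" if "v \<in> vcar V" for v using closed[OF that \<open>w \<in> X\<close>] .
    show "?Y (u + v) n w = ?Y u n w + ?Y v n w" if "u \<in> vcar V" "v \<in> vcar V" for u v
      using lin_on_add[OF D(3)[OF _ X(2)[OF \<open>w \<in> X\<close>]] that] by (auto simp: fun_eq_iff)
    show "?Y (cscale c v) n w = cscale c (?Y v n w)" if "v \<in> vcar V" for c v
      using lin_on_scale[OF D(3)[OF _ X(2)[OF \<open>w \<in> X\<close>]] that] by (auto simp: fun_eq_iff)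
  qed
  have vac: "?Y (vac V) n w = (if n = -1 then w else 0)" if "w \<in> X" for n w
    using D(4)[OF _ X(2)[OF that]] X(3)[OF that] by (auto simp: fun_eq_iff)
  have zero: "?Y u n w = 0" if "r < ?T" "u \<in> eigenspace V \<sigma> r" "w \<in> X" "n - of_nat r / of_nat ?T \<notin> \<int>"
    for r u n w
    using D(5)[OF _ that(1,2) X(2)[OF that(3)] that(4)] by (auto simp: fun_eq_iff)
  have tr: "\<exists>N. \<forall>l\<ge>N. ?Y u l w = 0" if uw: "u \<in> vcar V" "w \<in> X" for u w
  proof -
    obtain N where "\<forall>l\<ge>N. \<forall>i\<in>I. mmode (M i) u l (w i) = 0" using trunc[OF uw] by blast
    then show ?thesis by (intro exI[of _ N]) (auto simp: fun_eq_iff)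
  qed
  have jac: "jacobi_identity (of_nat r / of_nat ?T) (rmode V) ?Y u v w"
    if r: "r < ?T" and u: "u \<in> eigenspace V \<sigma> r" and w: "w \<in> X" and v: "v \<in> vcar V" for r u v w
  proof -
    let ?\<theta> = "of_nat r / of_nat ?T :: rat"
    have u': "u \<in> vcar V" using u by (simp add: eigenspace_def)
    have bor: "borcherds_identity ?\<theta> V (mmode (M i)) u v (w i)" if i: "i \<in> I" for i
    proof -
      have "\<exists>N. \<forall>l\<ge>N. mmode (M i) v l (w i) = 0" "\<exists>N. \<forall>l\<ge>N. mmode (M i) u l (w i) = 0"
        using trunc[OF v w] trunc[OF u' w] i by blast+
      then have "jacobi_identity ?\<theta> (rmode V) (mmode (M i)) u v (w i) \<longleftrightarrow>
          borcherds_identity ?\<theta> V (mmode (M i)) u v (w i)"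
        by (intro jacobi_iff_borcherds z1[OF i u'] z1[OF i v] z2[OF i X(2)[OF w i]] Vtrunc[OF u' v])
      then show ?thesis using D(7)[OF i r u X(2)[OF w i] v] by simp
    qed
    have "borcherds_identity ?\<theta> V ?Y u v w"
      unfolding borcherds_identity_def
    proof (intro allI impI)
      fix s m n K
      assume cut: "\<forall>k\<ge>K. ?Y v (n + of_nat k) w = 0 \<and> ?Y u (m + of_nat k) w = 0 \<and> vmode V u (s + int k) v = 0"
      have cuti: "\<forall>k\<ge>K. mmode (M i) v (n + of_nat k) (w i) = 0 \<and> mmode (M i) u (m + of_nat k) (w i) = 0 \<and>
          vmode V u (s + int k) v = 0" if i: "i \<in> I" for i
      proof (intro allI impI)
        fix k assume "K \<le> k"
        with cut have c: "?Y v (n + of_nat k) w = 0" "?Y u (m + of_nat k) w = 0" "vmode V u (s + int k) v = 0"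
          by blast+
        from fun_cong[OF c(1), of i] fun_cong[OF c(2), of i] c(3) i
        show "mmode (M i) v (n + of_nat k) (w i) = 0 \<and> mmode (M i) u (m + of_nat k) (w i) = 0 \<and>
          vmode V u (s + int k) v = 0" by simp
      qed
      show "(\<Sum>k<K. cscale (jcoeff (of_int s) k) (?Y u (m + of_int s - of_nat k) (?Y v (n + of_nat k) w)))
          - (\<Sum>k<K. cscale ((-1) powi s * jcoeff (of_int s) k)
                   (?Y v (n + of_int s - of_nat k) (?Y u (m + of_nat k) w)))
          = (\<Sum>k<K. cscale (if m - ?\<theta> \<in> \<int> then jcoeff (of_nat k - m - 1) k else 0)
                   (?Y (vmode V u (s + int k) v) (m + n - of_nat k) w))" (is "?l1 - ?l2 = ?l3")
      proof
        fix i
        show "(?l1 - ?l2) i = ?l3 i"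
        proof (cases "i \<in> I")
          case True
          then show ?thesis
            using bor[OF True, unfolded borcherds_identity_def, rule_format, of K n m s] cuti[OF True]
            by (simp add: sum_fun_apply)
        qed (simp add: sum_fun_apply)
      qed
    qed
    moreover have "jacobi_identity ?\<theta> (rmode V) ?Y u v w \<longleftrightarrow> borcherds_identity ?\<theta> V ?Y u v w"
    proof (intro jacobi_iff_borcherds tr[OF v w] tr[OF u' w] Vtrunc[OF u' v])
      show "?Y u p 0 = 0" "?Y v p 0 = 0" "?Y 0 p w = 0" for p
        using z1[OF _ u'] z1[OF _ v] z2[OF _ X(2)[OF w]] by (auto simp: fun_eq_iff)
    qed
    ultimately show ?thesis by simp
  qed
  show ?thesis
    unfolding twisted_module_def Let_def vmod.simps
  proof (intro conjI ballI allI impI)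
    show "\<exists>N. \<forall>l\<ge>N. ?Y u l w = 0" if "u \<in> eigenspace V \<sigma> r" "w \<in> X" for r u w
      using tr[OF _ that(2), of u] that(1) by (simp add: eigenspace_def)
  qed (use X(1) lin linv vac zero jac in blast)+
qed

text \<open>The modes as one family of operators, in the shape that \<open>simple_ops\<close>
  expects.\<close>

definition vact :: "('v, 'm) vmod \<Rightarrow> 'v \<times> rat \<Rightarrow> 'm \<Rightarrow> 'm" where
  "vact M = (\<lambda>(v, n). mmode M v n)"

lemma vact_simp [simp]: "vact M (v, n) = mmode M v n"
  by (simp add: vact_def)

section \<open>Products of modes and the submodule generated by a vector\<close>

locale finite_order_aut =
  fixes V :: "'v::complex_space vertex" and \<sigma> :: "'v \<Rightarrow> 'v"
  assumes va: "vertex_algebra V" and UNIV_V: "vcar V = UNIV" and aut: "automorphism V \<sigma>"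
    and fin_order: "\<exists>T>0. \<sigma> ^^ T = id"
begin

abbreviation "T \<equiv> aut_order V \<sigma>"

lemma T: "0 < T" "(\<sigma> ^^ T) v = v"
proof -
  have "\<exists>T>0. \<forall>v\<in>vcar V. (\<sigma> ^^ T) v = v" using fin_order by auto
  from LeastI_ex[OF this] show "0 < T" "(\<sigma> ^^ T) v = v"
    by (auto simp: aut_order_def UNIV_V)
qed

lemma sigma_lin: "lin_on UNIV UNIV \<sigma>"
  using aut by (simp add: automorphism_def UNIV_V)

lemma vmode_lin: "lin_on UNIV UNIV (vmode V v n)" "lin_on UNIV UNIV (\<lambda>v. vmode V v n w)"
  using va by (simp_all add: vertex_algebra_def UNIV_V)

lemma V_trunc: "\<exists>N. \<forall>n\<ge>N. vmode V u n v = 0"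
  using va by (simp add: vertex_algebra_def UNIV_V)

text \<open>The projections are the averages of the powers of \<sigma> weighted by powers of the
  root of unity \<open>\<eta> r\<close>; orthogonality of roots of unity makes them add up to the
  identity.\<close>

lemma eigen_decomposition:
  "\<exists>f. (\<forall>r<T. f r \<in> eigenspace V \<sigma> r) \<and> u = (\<Sum>r<T. f r)"
proof -
  define \<eta> where "\<eta> = (\<lambda>k. cis (2 * pi * real k / real T))"
  have \<eta>T: "\<eta> r ^ T = 1" for r
    using T(1) by (simp add: \<eta>_def DeMoivre cis_multiple_2pi)
  define g where "g = (\<lambda>r k. cscale (\<eta> r ^ k) ((\<sigma> ^^ k) u))"
  define f where "f = (\<lambda>r. cscale (1 / of_nat T) (\<Sum>k<T. g r k))"
  have "f r \<in> eigenspace V \<sigma> r" for r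
  proof -
    have e: "exp (- 2 * of_real pi * \<i> * of_nat r / of_nat T) * \<eta> r = 1"
      by (simp add: \<eta>_def cis_conv_exp flip: exp_add)
    \<comment> \<open>A cyclic shift of the summation index: the summands at 0 and at
      \<open>T\<close> agree since both \<sigma> and \<open>\<eta> r\<close> have
      \<open>T\<close>-th power 1.\<close>
    have "(\<Sum>k<T. g r (Suc k)) + g r 0 = (\<Sum>k<T. g r k) + g r T"
      by (simp add: add.commute flip: sum.lessThan_Suc_shift)
    moreover have "g r T = g r 0" by (simp add: g_def \<eta>T T(2))
    ultimately have shift: "(\<Sum>k<T. g r (Suc k)) = (\<Sum>k<T. g r k)" by simp
    have "\<sigma> (g r k) = cscale (exp (- 2 * of_real pi * \<i> * of_nat r / of_nat T)) (g r (Suc k))" for k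
    proof -
      have "\<sigma> (g r k) = cscale (\<eta> r ^ k) ((\<sigma> ^^ Suc k) u)"
        by (simp add: g_def lin_on_scale[OF sigma_lin])
      also have "\<eta> r ^ k = exp (- 2 * of_real pi * \<i> * of_nat r / of_nat T) * \<eta> r ^ Suc k"
        using e by (simp add: mult.assoc[symmetric] del: exp_minus)
      finally show ?thesis by (simp only: g_def cscale_cscale)
    qed
    then have "\<sigma> (f r) = cscale (exp (- 2 * of_real pi * \<i> * of_nat r / of_nat T)) (f r)"
      by (simp add: f_def lin_on_scale[OF sigma_lin] lin_on_sum[OF sigma_lin] shift mult.commute
          cscale_cscale flip: cv.scale_sum_right)
    then show ?thesis by (simp add: eigenspace_def UNIV_V)
  qed
  moreover have "(\<Sum>r<T. f r) = u"
  proof -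
    have sum: "(\<Sum>r<T. \<eta> r ^ k) = (if k = 0 then of_nat T else 0)" if "k < T" for k
    proof (cases "k = 0")
      case False
      \<comment> \<open>Exchanging the roles of \<open>r\<close> and \<open>k\<close> turns the sum
        into a geometric one whose ratio \<open>\<eta> k\<close> differs from 1.\<close>
      have pw: "\<eta> r ^ k = \<eta> k ^ r" for r
        by (simp add: \<eta>_def DeMoivre mult_ac)
      have "\<eta> k \<noteq> \<eta> 0"
        using bij_betw_roots_unity[OF T(1)] that False T(1)
        unfolding \<eta>_def bij_betw_def inj_on_def by blast
      then have "\<eta> k \<noteq> 1" by (simp add: \<eta>_def)
      then show ?thesis
        using False by (simp add: pw sum_gp_strict \<eta>T)
    qed simp
    have "(\<Sum>r<T. f r) = cscale (1 / of_nat T) (\<Sum>k<T. \<Sum>r<T. g r k)"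
      by (subst sum.swap) (simp add: f_def cv.scale_sum_right)
    also have "(\<Sum>k<T. \<Sum>r<T. g r k) = (\<Sum>k<T. cscale (if k = 0 then of_nat T else 0) ((\<sigma> ^^ k) u))"
      by (rule sum.cong) (simp_all add: g_def sum flip: cv.scale_sum_left)
    also have "\<dots> = (\<Sum>k<T. if k = 0 then cscale (of_nat T) u else 0)"
      by (rule sum.cong) auto
    also have "\<dots> = cscale (of_nat T) u" using T(1) by simp
    finally show ?thesis using T(1) by (simp add: cscale_cscale cscale_one)
  qed
  ultimately show ?thesis by metis
qed

context
  fixes M :: "('v, 'm::complex_space) vmod"
  assumes tm: "twisted_module V \<sigma> M"
begin

lemma mmode_lin: "lin_on (mcar M) (mcar M) (mmode M v n)"
  using twisted_moduleD(2)[OF tm] by (simp add: UNIV_V)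

lemma mmode_lin_v: "w \<in> mcar M \<Longrightarrow> lin_on UNIV (mcar M) (\<lambda>v. mmode M v n w)"
  using twisted_moduleD(3)[OF tm] by (simp add: UNIV_V)

lemmas mcar_subspace = twisted_moduleD(1)[OF tm]

lemma mmode_in: "w \<in> mcar M \<Longrightarrow> mmode M v n w \<in> mcar M"
  by (rule lin_on_in[OF mmode_lin])

lemma mmode_zero: "mmode M v n 0 = 0"
  by (rule lin_on_zero[OF mmode_lin mcar_subspace])

lemma mmode_zero_v: "w \<in> mcar M \<Longrightarrow> mmode M 0 n w = 0"
  by (rule lin_on_zero[OF mmode_lin_v]) auto

lemma mmode_sum_v: "w \<in> mcar M \<Longrightarrow> mmode M (\<Sum>i\<in>I. f i) n w = (\<Sum>i\<in>I. mmode M (f i) n w)"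
  by (rule lin_on_sum[OF mmode_lin_v]) auto

text \<open>The axiom truncates eigenvectors of \<sigma>; a general \<open>v\<close> is a finite sum
  of these, and the largest of their bounds works.\<close>

lemma mmode_trunc:
  assumes "w \<in> mcar M"
  shows "\<exists>N. \<forall>l\<ge>N. mmode M v l w = 0"
proof -
  obtain f where f: "\<And>r. r < T \<Longrightarrow> f r \<in> eigenspace V \<sigma> r" "v = (\<Sum>r<T. f r)"
    using eigen_decomposition by blast
  have "\<forall>r\<in>{..<T}. \<exists>N. \<forall>l\<ge>N. mmode M (f r) l w = 0"
    using twisted_moduleD(6)[OF tm _ f(1) assms] by blast
  from bchoice[OF this] obtain N where N: "\<forall>r\<in>{..<T}. \<forall>l\<ge>N r. mmode M (f r) l w = 0" by blast
  define N' where "N' = Max (N ` {..<T})"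
  have "N r \<le> N'" if "r < T" for r
    unfolding N'_def using that by (intro Max_ge) auto
  with N have "mmode M (f r) l w = 0" if "l \<ge> N'" "r < T" for l r
    using that order_trans by blast
  then have "mmode M v l w = 0" if "l \<ge> N'" for l
    unfolding f(2) mmode_sum_v[OF assms] using that by (intro sum.neutral) simp
  then show ?thesis by blast
qed

lemma borcherds:
  assumes "r < T" "u \<in> eigenspace V \<sigma> r" "w \<in> mcar M"
  shows "borcherds_identity (of_nat r / of_nat T) V (mmode M) u v w"
proof -
  have "jacobi_identity (of_nat r / of_nat T) (rmode V) (mmode M) u v w \<longleftrightarrow>
      borcherds_identity (of_nat r / of_nat T) V (mmode M) u v w"
    by (rule jacobi_iff_borcherds)
      (simp_all add: mmode_zero mmode_zero_v mmode_trunc V_trunc assms)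
  then show ?thesis
    using twisted_moduleD(7)[OF tm assms, of v] by (simp add: UNIV_V)
qed

text \<open>
  For \<open>m\<close> so large that the modes \<open>u_m, u_(m+1), ...\<close> kill \<open>w\<close>, only two of the three terms of
  the identity survive.
\<close>

lemma borcherds_annihilated:
  assumes "r < T" "u \<in> eigenspace V \<sigma> r" "w \<in> mcar M"
    and m: "m - of_nat r / of_nat T \<in> \<int>" "\<And>l. m \<le> l \<Longrightarrow> mmode M u l w = 0"
    and cut: "\<And>k. K \<le> k \<Longrightarrow> mmode M v (n + of_nat k) w = 0"
      "\<And>k. K \<le> k \<Longrightarrow> vmode V u (s + int k) v = 0"
  shows "(\<Sum>k<K. cscale (jcoeff (of_int s) k) (mmode M u (m + of_int s - of_nat k) (mmode M v (n + of_nat k) w)))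
      = (\<Sum>k<K. cscale (jcoeff (of_nat k - m - 1) k) (mmode M (vmode V u (s + int k) v) (m + n - of_nat k) w))"
proof -
  have "\<forall>k\<ge>K. mmode M v (n + of_nat k) w = 0 \<and> mmode M u (m + of_nat k) w = 0 \<and> vmode V u (s + int k) v = 0"
    using cut m(2) by simp
  with borcherds[OF assms(1-3), of v, unfolded borcherds_identity_def] have
    "(\<Sum>k<K. cscale (jcoeff (of_int s) k) (mmode M u (m + of_int s - of_nat k) (mmode M v (n + of_nat k) w)))
      - (\<Sum>k<K. cscale ((-1) powi s * jcoeff (of_int s) k)
                   (mmode M v (n + of_int s - of_nat k) (mmode M u (m + of_nat k) w)))
      = (\<Sum>k<K. cscale (if m - of_nat r / of_nat T \<in> \<int> then jcoeff (of_nat k - m - 1) k else 0)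
                   (mmode M (vmode V u (s + int k) v) (m + n - of_nat k) w))" by blast
  then show ?thesis using m by (simp add: mmode_zero)
qed

lemma eigen_index_above: "\<exists>m. N \<le> m \<and> m - of_nat r / of_nat T \<in> \<int>" for N :: rat
proof (intro exI conjI)
  show "N \<le> of_int \<lceil>N - of_nat r / of_nat T\<rceil> + of_nat r / of_nat T"
    using le_of_int_ceiling[of "N - of_nat r / of_nat T"] by linarith
qed simp

text \<open>By \<open>modes_span_stable\<close> this is the submodule generated by \<open>w\<close>,
  although no product of modes occurs in it.\<close>

definition modes_span :: "'m \<Rightarrow> 'm set" where
  "modes_span w = cv.span {mmode M v n w | v n. True}"

lemma mode_in_modes_span: "mmode M v n w \<in> modes_span w"
  unfolding modes_span_def by (rule cv.span_base) blast

lemma modes_span_subset: "w \<in> mcar M \<Longrightarrow> modes_span w \<subseteq> mcar M"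
  unfolding modes_span_def by (rule cv.span_minimal) (auto simp: mmode_in mcar_subspace)

lemma in_modes_span: "w \<in> mcar M \<Longrightarrow> w \<in> modes_span w"
  using mode_in_modes_span[of "vac V" "-1" w] twisted_moduleD(4)[OF tm, of w "-1"] by simp

lemma subspace_modes_span: "cv.subspace (modes_span w)"
  by (simp add: modes_span_def cv.subspace_span)

text \<open>Induction on how far \<open>q\<close> lies below the bound \<open>N\<close> from which
  on the modes of \<open>v\<close> kill \<open>w\<close>. In \<open>borcherds_annihilated\<close>
  the left term with \<open>k = 0\<close> is the product wanted, those with \<open>k > 0\<close>
  have a mode index of \<open>v\<close> closer to \<open>N\<close>, and the right-hand side consists
  of single modes of \<open>w\<close>.\<close>

lemma mode_mode_in_modes_span:
  assumes r: "r < T" "u \<in> eigenspace V \<sigma> r" and w: "w \<in> mcar M"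
  shows "mmode M u p (mmode M v q w) \<in> modes_span w"
proof -
  obtain N where N: "\<forall>l\<ge>N. mmode M v l w = 0" using mmode_trunc[OF w] by blast
  obtain N' where N': "\<forall>l\<ge>N'. mmode M u l w = 0" using mmode_trunc[OF w] by blast
  obtain m where m: "N' \<le> m" "m - of_nat r / of_nat T \<in> \<int>" using eigen_index_above by blast
  have S: "cv.subspace (modes_span w)" by (rule subspace_modes_span)
  have main: "\<forall>p q. N - of_nat j \<le> q \<longrightarrow> mmode M u p (mmode M v q w) \<in> modes_span w" for j :: nat
  proof (induction j)
    case 0
    then show ?case using N by (simp add: mmode_zero cv.subspace_0[OF S])
  next
    case (Suc j)
    show ?case
    proof (intro allI impI)
      fix p q assume q: "N - of_nat (Suc j) \<le> q"
      show "mmode M u p (mmode M v q w) \<in> modes_span w"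
      \<comment> \<open>Outside \<open>r/T\<close> plus the integers the mode \<open>u_p\<close> is
        zero; inside, \<open>p\<close> differs from \<open>m\<close> by the integer \<open>s\<close>
        that the identity requires.\<close>
      proof (cases "p - of_nat r / of_nat T \<in> \<int>")
        case False
        then show ?thesis
          using twisted_moduleD(5)[OF tm r mmode_in[OF w]] by (simp add: cv.subspace_0[OF S])
      next
        case True
        then have "(p - of_nat r / of_nat T) - (m - of_nat r / of_nat T) \<in> \<int>"
          using m(2) by (rule Ints_diff)
        then obtain s where s: "p = m + of_int s"
          by (auto elim!: Ints_cases simp: algebra_simps)
        obtain N3 where N3: "\<forall>n\<ge>N3. vmode V u n v = 0" using V_trunc by blast
        \<comment> \<open>The sums will run up to \<open>Suc K\<close>, so that the term with
          \<open>k = 0\<close> is always there to be split off.\<close>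
        define K where "K = nat \<lceil>N - q\<rceil> + nat (N3 - s)"
        have cut: "mmode M v (q + of_nat k) w = 0" "vmode V u (s + int k) v = 0" if "Suc K \<le> k" for k
        proof -
          have "nat \<lceil>N - q\<rceil> \<le> k" "nat (N3 - s) \<le> k" using that by (simp_all add: K_def)
          then have "N \<le> q + of_nat k" "N3 \<le> s + int k"
            by (simp_all add: nat_le_iff ceiling_le_iff algebra_simps)
          with N N3 show "mmode M v (q + of_nat k) w = 0" "vmode V u (s + int k) v = 0" by blast+
        qed
        let ?L = "\<lambda>k. cscale (jcoeff (of_int s) k) (mmode M u (m + of_int s - of_nat k) (mmode M v (q + of_nat k) w))"
        have "(\<Sum>k<Suc K. ?L k) = (\<Sum>k<Suc K. cscale (jcoeff (of_nat k - m - 1) k)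
             (mmode M (vmode V u (s + int k) v) (m + q - of_nat k) w))"
        proof (rule borcherds_annihilated[OF r w m(2)])
          show "mmode M u l w = 0" if "m \<le> l" for l
            using N' m(1) that by (metis order_trans)
        qed (fact cut)+
        also have "\<dots> \<in> modes_span w"
          by (intro cv.subspace_sum[OF S] cv.subspace_scale[OF S] mode_in_modes_span)
        finally have sum: "?L 0 + (\<Sum>k<K. ?L (Suc k)) \<in> modes_span w"
          by (simp only: sum.lessThan_Suc_shift)
        have "?L (Suc k) \<in> modes_span w" for k
        proof -
          have "N - of_nat j \<le> q + of_nat (Suc k)" using q by simp
          with Suc.IH show ?thesis by (intro cv.subspace_scale[OF S]) blast
        qed
        then have "(\<Sum>k<K. ?L (Suc k)) \<in> modes_span w" by (intro cv.subspace_sum[OF S])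
        from cv.subspace_diff[OF S sum this] have "?L 0 \<in> modes_span w"
          unfolding add_diff_cancel_right' .
        then show ?thesis by (simp add: s cscale_one)
      qed
    qed
  qed
  have "N - of_nat (nat \<lceil>N - q\<rceil>) \<le> q"
  proof -
    have "N - q \<le> of_int \<lceil>N - q\<rceil>" by (rule le_of_int_ceiling)
    also have "\<dots> \<le> of_int (int (nat \<lceil>N - q\<rceil>))" unfolding of_int_le_iff by simp
    finally have "N - q \<le> of_nat (nat \<lceil>N - q\<rceil>)" by (simp only: of_int_of_nat_eq)
    then show ?thesis by linarith
  qed
  with main show ?thesis by blast
qed

theorem modes_span_stable:
  assumes w: "w \<in> mcar M" and x: "x \<in> modes_span w"
  shows "mmode M u p x \<in> modes_span w"
proof -
  have S: "cv.subspace (modes_span w)" by (rule subspace_modes_span)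
  obtain f where f: "\<And>r. r < T \<Longrightarrow> f r \<in> eigenspace V \<sigma> r" "u = (\<Sum>r<T. f r)"
    using eigen_decomposition by blast
  have "lin_on (cv.span {mmode M v n w | v n. True}) (mcar M) (mmode M u p)"
    using modes_span_subset[OF w] mmode_in
    by (intro lin_on_mono[OF mmode_lin]) (auto simp: modes_span_def)
  then show ?thesis
  proof (rule lin_on_span_in[OF _ S])
    fix b assume "b \<in> {mmode M v n w | v n. True}"
    then obtain v n where b: "b = mmode M v n w" by blast
    show "mmode M u p b \<in> modes_span w"
      unfolding b f(2) mmode_sum_v[OF mmode_in[OF w]]
      by (intro cv.subspace_sum[OF S] mode_mode_in_modes_span[OF _ f(1) w]) auto
  qed (use x in \<open>simp add: modes_span_def\<close>)
qed

text \<open>Scalars are absorbed into the vectors of \<open>V\<close>, so that density yields plain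
  sums of modes.\<close>

lemma modes_span_sum:
  assumes w: "w \<in> mcar M" and "x \<in> modes_span w"
  shows "\<exists>(K::nat) v n. x = (\<Sum>k<K. mmode M (v k) (n k) w)"
  using assms(2) unfolding modes_span_def
proof (induction rule: cv.span_induct_alt)
  case base
  show ?case by (intro exI[of _ 0]) simp
next
  case (step c y x)
  then obtain K v n u p where *: "x = (\<Sum>k<K::nat. mmode M (v k) (n k) w)" "y = mmode M u p w" by blast
  have "cscale c y = mmode M (cscale c u) p w"
    using lin_on_scale[OF mmode_lin_v[OF w]] by (simp add: *)
  then have "cscale c y + x = (\<Sum>k<Suc K. mmode M ((v(K := cscale c u)) k) ((n(K := p)) k) w)"
    by (simp add: * add.commute)
  then show ?case by blast
qed

text \<open>Descending induction on \<open>p\<close>, from the bound \<open>A3\<close> beyond which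
  \<open>u_p\<close> kills every \<open>v i\<close>. With \<open>m\<close> above the truncation
  bounds of \<open>u\<close> on all \<open>w i\<close>, the left-hand sides of
  \<open>borcherds_annihilated\<close> add up to modes of \<open>u\<close> applied to the vanishing
  sums \<open>ann\<close>. On the right, the terms with \<open>k > 0\<close> carry a larger
  \<open>p\<close> and vanish by induction, which leaves the term with \<open>k = 0\<close>.\<close>

theorem annihilating_tensor_stable:
  assumes I: "finite I" and w: "\<And>i. i \<in> I \<Longrightarrow> w i \<in> mcar M"
    and ann: "\<And>n. (\<Sum>i\<in>I. mmode M (v i) n (w i)) = 0"
  shows "(\<Sum>i\<in>I. mmode M (vmode V u p (v i)) n (w i)) = 0"
proof -
  have eig: "(\<Sum>i\<in>I. mmode M (vmode V u p (v i)) n (w i)) = 0"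
    if r: "r < T" "u \<in> eigenspace V \<sigma> r" for r u p n
  proof -
    have "\<forall>i\<in>I. \<exists>N. \<forall>l\<ge>N. mmode M u l (w i) = 0" using mmode_trunc[OF w] by blast
    from bchoice[OF this] obtain N1 where N1: "\<forall>i\<in>I. \<forall>l\<ge>N1 i. mmode M u l (w i) = 0" by blast
    have "\<forall>i\<in>I. \<exists>N. \<forall>l\<ge>N. mmode M (v i) l (w i) = 0" using mmode_trunc[OF w] by blast
    from bchoice[OF this] obtain N2 where N2: "\<forall>i\<in>I. \<forall>l\<ge>N2 i. mmode M (v i) l (w i) = 0" by blast
    have "\<forall>i\<in>I. \<exists>N. \<forall>n\<ge>N. vmode V u n (v i) = 0" using V_trunc by blast
    from bchoice[OF this] obtain N3 where N3: "\<forall>i\<in>I. \<forall>n\<ge>N3 i. vmode V u n (v i) = 0" by blast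
    define A1 where "A1 = Max (insert 0 (N1 ` I))"
    define A2 where "A2 = Max (insert 0 (N2 ` I))"
    define A3 where "A3 = Max (insert 0 (N3 ` I))"
    have A: "N1 i \<le> A1" "N2 i \<le> A2" "N3 i \<le> A3" if "i \<in> I" for i
      unfolding A1_def A2_def A3_def using that I by (auto intro!: Max_ge)
    obtain m where m: "A1 \<le> m" "m - of_nat r / of_nat T \<in> \<int>" using eigen_index_above by blast
    have main: "\<forall>p n. A3 - int j \<le> p \<longrightarrow> (\<Sum>i\<in>I. mmode M (vmode V u p (v i)) n (w i)) = 0" for j
    proof (induction j)
      case 0
      show ?case
      proof (intro allI impI sum.neutral ballI)
        fix p n i assume "A3 - int 0 \<le> p" "i \<in> I"
        then have "N3 i \<le> p" using A(3)[of i] by simp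
        then have "vmode V u p (v i) = 0" using N3 \<open>i \<in> I\<close> by blast
        then show "mmode M (vmode V u p (v i)) n (w i) = 0" using w \<open>i \<in> I\<close> by (simp add: mmode_zero_v)
      qed
    next
      case (Suc j)
      show ?case
      proof (intro allI impI)
        fix p n assume p: "A3 - int (Suc j) \<le> p"
        define K where "K = nat \<lceil>A2 - (n - m)\<rceil> + nat (A3 - p)"
        \<comment> \<open>The mode index of \<open>v i\<close> is started at \<open>n - m\<close>,
          so that the right-hand term with \<open>k = 0\<close> has mode index
          \<open>n\<close>.\<close>
        let ?R = "\<lambda>i k. cscale (jcoeff (of_nat k - m - 1) k)
             (mmode M (vmode V u (p + int k) (v i)) (m + (n - m) - of_nat k) (w i))"
        let ?L = "\<lambda>i k. cscale (jcoeff (of_int p) k)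
             (mmode M u (m + of_int p - of_nat k) (mmode M (v i) (n - m + of_nat k) (w i)))"
        have eq: "(\<Sum>k<Suc K. ?L i k) = (\<Sum>k<Suc K. ?R i k)" if i: "i \<in> I" for i
        proof (rule borcherds_annihilated[OF r w[OF i] m(2)])
          show "mmode M u l (w i) = 0" if "m \<le> l" for l
          proof -
            have "N1 i \<le> l" using that m(1) A(1)[OF i] by simp
            then show ?thesis using N1 i by blast
          qed
          fix k assume "Suc K \<le> k"
          then have "nat \<lceil>A2 - (n - m)\<rceil> \<le> k" "nat (A3 - p) \<le> k" by (simp_all add: K_def)
          then have "A2 \<le> n - m + of_nat k" "A3 \<le> p + int k"
            by (simp_all add: nat_le_iff ceiling_le_iff algebra_simps)
          then have "N2 i \<le> n - m + of_nat k" "N3 i \<le> p + int k"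
            using A[OF i] by simp_all
          then show "mmode M (v i) (n - m + of_nat k) (w i) = 0" "vmode V u (p + int k) (v i) = 0"
            using N2 N3 i by blast+
        qed
        have "(\<Sum>i\<in>I. \<Sum>k<Suc K. ?L i k) = (\<Sum>k<Suc K. \<Sum>i\<in>I. ?L i k)" by (rule sum.swap)
        also have "\<dots> = (\<Sum>k<Suc K. cscale (jcoeff (of_int p) k)
             (mmode M u (m + of_int p - of_nat k) (\<Sum>i\<in>I. mmode M (v i) (n - m + of_nat k) (w i))))"
          by (intro sum.cong refl)
            (subst lin_on_sum[OF mmode_lin mcar_subspace], auto simp: cv.scale_sum_right mmode_in w)
        also have "\<dots> = 0" by (simp add: ann mmode_zero)
        finally have "(\<Sum>i\<in>I. \<Sum>k<Suc K. ?R i k) = 0" using eq by simp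
        then have "(\<Sum>k<Suc K. \<Sum>i\<in>I. ?R i k) = 0" by (subst sum.swap)
        then have "(\<Sum>i\<in>I. ?R i 0) + (\<Sum>k<K. \<Sum>i\<in>I. ?R i (Suc k)) = 0"
          by (simp only: sum.lessThan_Suc_shift)
        moreover have "(\<Sum>i\<in>I. ?R i (Suc k)) = 0" for k
        proof -
          have "A3 - int j \<le> p + int (Suc k)" using p by simp
          with Suc.IH have "(\<Sum>i\<in>I. mmode M (vmode V u (p + int (Suc k)) (v i)) (m + (n - m) - of_nat (Suc k)) (w i)) = 0"
            by blast
          then show ?thesis by (simp only: cv.scale_sum_right[symmetric] cv.scale_zero_right)
        qed
        ultimately show "(\<Sum>i\<in>I. mmode M (vmode V u p (v i)) n (w i)) = 0" by (simp add: cscale_one)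
      qed
    qed
    have "A3 - int (nat (A3 - p)) \<le> p" by simp
    with main show ?thesis by blast
  qed
  obtain f where f: "\<And>r. r < T \<Longrightarrow> f r \<in> eigenspace V \<sigma> r" "u = (\<Sum>r<T. f r)"
    using eigen_decomposition by blast
  have "(\<Sum>i\<in>I. mmode M (vmode V u p (v i)) n (w i))
      = (\<Sum>i\<in>I. \<Sum>r<T. mmode M (vmode V (f r) p (v i)) n (w i))"
    by (rule sum.cong) (simp_all add: f(2) lin_on_sum[OF vmode_lin(2)] mmode_sum_v w)
  also have "\<dots> = (\<Sum>r<T. \<Sum>i\<in>I. mmode M (vmode V (f r) p (v i)) n (w i))" by (rule sum.swap)
  also have "\<dots> = 0" using eig f(1) by (intro sum.neutral) blast
  finally show ?thesis .
qed

end

section \<open>Density for irreducible twisted modules\<close>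

lemma irreducible_simple_ops:
  assumes "irreducible_twisted_module V \<sigma> M"
  shows "simple_ops UNIV (vact M) (mcar M)"
proof -
  have tm: "twisted_module V \<sigma> M" and irr: "irreducible_vmod V M"
    using assms by (auto simp: irreducible_twisted_module_def)
  have "vsubmodule V M N" if "stable UNIV (vact M) N" "N \<subseteq> mcar M" for N
    using that by (force simp: vsubmodule_def stable_def UNIV_V)
  with irr tm show ?thesis
    by (auto simp: simple_ops_def irreducible_vmod_def mcar_subspace mmode_lin)
qed

lemma irreducible_modes_span:
  assumes "irreducible_twisted_module V \<sigma> M" "w \<in> mcar M" "w \<noteq> 0"
  shows "modes_span M w = mcar M"
proof -
  have tm: "twisted_module V \<sigma> M"
    using assms(1) by (simp add: irreducible_twisted_module_def)
  have "stable UNIV (vact M) (modes_span M w)"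
    using modes_span_stable[OF tm assms(2)] subspace_modes_span[OF tm]
    by (auto simp: stable_def)
  from simple_opsD(4)[OF irreducible_simple_ops[OF assms(1)] this modes_span_subset[OF tm assms(2)]]
  show ?thesis using in_modes_span[OF tm assms(2)] assms(3) by auto
qed

lemma irreducible_nonzero:
  assumes "irreducible_twisted_module V \<sigma> M"
  obtains w where "w \<in> mcar M" "w \<noteq> 0"
proof -
  have "mcar M \<noteq> {0}" "0 \<in> mcar M"
    using assms by (auto simp: irreducible_twisted_module_def irreducible_vmod_def
        intro!: cv.subspace_0 twisted_moduleD(1))
  then show thesis using that by blast
qed

text \<open>One nonzero vector \<open>w\<close> generates, so the modes \<open>b_n w\<close> span,
  with \<open>b\<close> in a countable basis of \<open>V\<close> and \<open>n\<close>
  rational.\<close>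

lemma irreducible_countable_dim:
  assumes "irreducible_twisted_module V \<sigma> M" and cnt: "countable_dim (UNIV :: 'v set)"
  shows "countable_dim (mcar M)"
proof -
  have tm: "twisted_module V \<sigma> M"
    using assms(1) by (simp add: irreducible_twisted_module_def)
  obtain w where w: "w \<in> mcar M" "w \<noteq> 0" by (rule irreducible_nonzero[OF assms(1)])
  obtain B :: "'v set" where B: "countable B" "UNIV = cv.span B"
    using cnt unfolding countable_dim_def by blast
  let ?C = "(\<lambda>(b, n). mmode M b n w) ` (B \<times> UNIV)"
  have "mmode M v n w \<in> cv.span ?C" for v n
  proof (rule lin_on_span_in[of B "mcar M" "\<lambda>v. mmode M v n w"])
    show "lin_on (cv.span B) (mcar M) (\<lambda>v. mmode M v n w)"
      using mmode_lin_v[OF tm w(1)] B(2) by simp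
    show "mmode M b n w \<in> cv.span ?C" if "b \<in> B" for b
      using that by (intro cv.span_base image_eqI[of _ _ "(b, n)"]) auto
    show "v \<in> cv.span B" using B(2) by blast
  qed (rule cv.subspace_span)
  then have "modes_span M w \<subseteq> cv.span ?C"
    unfolding modes_span_def[OF tm] by (intro cv.span_minimal) (auto simp: cv.subspace_span)
  moreover have "cv.span ?C \<subseteq> mcar M"
    using mmode_in[OF tm w(1)] by (intro cv.span_minimal mcar_subspace[OF tm]) auto
  ultimately have "mcar M = cv.span ?C"
    using irreducible_modes_span[OF assms(1) w] by blast
  moreover have "countable ?C" using B(1) by simp
  ultimately show ?thesis using countable_dimI by metis
qed

lemma irreducible_hom_cases:
  assumes M: "irreducible_twisted_module V \<sigma> M" and N: "irreducible_twisted_module V \<sigma> N"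
    and f: "ops_hom UNIV (mcar M) (vact M) (mcar N) (vact N) f"
  shows "(\<forall>x\<in>mcar M. f x = 0) \<or> vmod_hom_iso V M N f"
proof -
  have "vmod_hom_iso V M N f" if "bij_betw f (mcar M) (mcar N)"
    using f that by (auto simp: vmod_hom_iso_def ops_hom_def)
  with simple_ops_hom_cases[OF irreducible_simple_ops[OF M] irreducible_simple_ops[OF N] f]
  show ?thesis by blast
qed

lemma irreducible_scalar:
  assumes M: "irreducible_twisted_module V \<sigma> M" and cnt: "countable_dim (UNIV :: 'v set)"
    and f: "lin_on (mcar M) (mcar M) f"
      "\<And>v n w. w \<in> mcar M \<Longrightarrow> f (mmode M v n w) = mmode M v n (f w)"
  shows "\<exists>c. \<forall>w\<in>mcar M. f w = cscale c w"
  by (rule simple_ops_scalar[OF irreducible_simple_ops[OF M] irreducible_countable_dim[OF M cnt]])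
    (use f in \<open>auto simp: ops_hom_def\<close>)

text \<open>
  Density already holds for sums of single modes, since these span the submodule generated by a
  tuple of vectors.
\<close>

theorem mode_density:
  fixes N :: "'i \<Rightarrow> ('v, 'm::complex_space) vmod"
  assumes cnt: "countable_dim (UNIV :: 'v set)" and I: "finite I"
    and N: "\<And>i. i \<in> I \<Longrightarrow> irreducible_twisted_module V \<sigma> (N i)"
    and iso: "\<And>i k. i \<in> I \<Longrightarrow> k \<in> I \<Longrightarrow> vmod_iso V (N i) (N k) \<Longrightarrow> N i = N k"
    and w: "\<And>i. i \<in> I \<Longrightarrow> w i \<in> mcar (N i)"
    and indep: "\<And>c k. k \<in> I \<Longrightarrow> (\<And>i. i \<in> I \<Longrightarrow> c i \<noteq> 0 \<Longrightarrow> N i = N k) \<Longrightarrow>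
           (\<Sum>i\<in>I. cscale (c i) (w i)) = 0 \<Longrightarrow> \<forall>i\<in>I. c i = 0"
    and y: "\<And>i. i \<in> I \<Longrightarrow> y i \<in> mcar (N i)"
  shows "\<exists>(K::nat) v n. \<forall>i\<in>I. (\<Sum>k<K. mmode (N i) (v k) (n k) (w i)) = y i"
proof -
  have tm: "twisted_module V \<sigma> (N i)" if "i \<in> I" for i
    using N[OF that] by (simp add: irreducible_twisted_module_def)
  define X where "X = {x. (\<forall>i\<in>I. x i \<in> mcar (N i)) \<and> (\<forall>i. i \<notin> I \<longrightarrow> x i = 0)}"
  define P where "P = \<lparr>mcar = X, mmode = (\<lambda>v n x i. if i \<in> I then mmode (N i) v n (x i) else 0)\<rparr>"
  have X: "cv.subspace X"
    unfolding X_def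
    by (rule cv.subspaceI)
      (auto intro: cv.subspace_0 cv.subspace_add cv.subspace_scale mcar_subspace[OF tm])
  have P: "twisted_module V \<sigma> P"
    unfolding P_def
  proof (rule pointwise_twisted_module[OF _ _ V_trunc tm X])
    show "\<exists>M. \<forall>l\<ge>M. \<forall>i\<in>I. mmode (N i) v l (x i) = 0" if "x \<in> X" for v x
    proof -
      have "\<forall>i\<in>I. \<exists>M. \<forall>l\<ge>M. mmode (N i) v l (x i) = 0"
        using mmode_trunc[OF tm] that unfolding X_def by blast
      from bchoice[OF this] obtain M where M: "\<forall>i\<in>I. \<forall>l\<ge>M i. mmode (N i) v l (x i) = 0" by blast
      have "M i \<le> Max (insert 0 (M ` I))" if "i \<in> I" for i using that I by (intro Max_ge) auto
      then show ?thesis using M by (meson order_trans)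
    qed
    show "(\<lambda>i. if i \<in> I then mmode (N i) v n (x i) else 0) \<in> X" if "x \<in> X" for v n x
      using that mmode_in[OF tm] by (simp add: X_def)
  qed (auto simp: UNIV_V X_def)
  define w' where "w' = (\<lambda>i. if i \<in> I then w i else 0)"
  have w': "w' \<in> mcar P" using w by (simp add: w'_def P_def X_def)
  have eq: "N i = N k \<longleftrightarrow> mcar (N i) = mcar (N k) \<and> vact (N i) = vact (N k)" for i k
  proof
    assume *: "mcar (N i) = mcar (N k) \<and> vact (N i) = vact (N k)"
    then have "mmode (N i) v n = mmode (N k) v n" for v n
      by (metis vact_simp)
    then have "mmode (N i) = mmode (N k)" by blast
    with * show "N i = N k" by (cases "N i"; cases "N k") simp
  qed simp
  have "\<exists>x\<in>modes_span P w'. \<forall>i\<in>I. x i = y i"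
  proof (rule jacobson_density[where Ops = UNIV and act = "\<lambda>i. vact (N i)"
        and X = "\<lambda>i. mcar (N i)" and w = w])
    show "simple_ops UNIV (vact (N i)) (mcar (N i))" if "i \<in> I" for i
      using irreducible_simple_ops[OF N[OF that]] .
    show "countable_dim (mcar (N i))" if "i \<in> I" for i
      using irreducible_countable_dim[OF N[OF that] cnt] .
    show "mcar (N i) = mcar (N k) \<and> vact (N i) = vact (N k) \<or>
        (\<forall>f. ops_hom UNIV (mcar (N i)) (vact (N i)) (mcar (N k)) (vact (N k)) f \<longrightarrow>
            (\<forall>x\<in>mcar (N i). f x = 0))" if i: "i \<in> I" and k: "k \<in> I" for i k
    proof (cases "N i = N k")
      case False
      then have "\<not> vmod_iso V (N i) (N k)" using iso i k by blast
      with irreducible_hom_cases[OF N[OF i] N[OF k]] show ?thesis unfolding vmod_iso_def by blast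
    qed simp
    show "\<forall>i\<in>I. c i = 0" if "k \<in> I"
      "\<And>i. i \<in> I \<Longrightarrow> c i \<noteq> 0 \<Longrightarrow> mcar (N i) = mcar (N k) \<and> vact (N i) = vact (N k)"
      "(\<Sum>i\<in>I. cscale (c i) (w i)) = 0" for c k
      using that by (intro indep[of k]) (simp_all add: eq)
    show "cv.subspace (modes_span P w')" by (rule subspace_modes_span[OF P])
    show "x i \<in> mcar (N i)" if "x \<in> modes_span P w'" "i \<in> I" for x i
      using modes_span_subset[OF P w'] that by (auto simp: P_def X_def)
    show "\<exists>y\<in>modes_span P w'. \<forall>i\<in>I. y i = vact (N i) s (x i)" if x: "x \<in> modes_span P w'" for x s
    proof -
      obtain v n where s: "s = (v, n)" by (cases s)
      have "mmode P v n x \<in> modes_span P w'" by (rule modes_span_stable[OF P w' x])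
      moreover have "\<forall>i\<in>I. mmode P v n x i = vact (N i) s (x i)" by (simp add: P_def s)
      ultimately show ?thesis by (intro bexI[of _ "mmode P v n x"])
    qed
    show "\<exists>y\<in>modes_span P w'. \<forall>i\<in>I. y i = w i"
      using in_modes_span[OF P w'] by (intro bexI[of _ w']) (simp_all add: w'_def)
  qed (use I w y in auto)
  then obtain x where x: "x \<in> modes_span P w'" "\<forall>i\<in>I. x i = y i" by blast
  from modes_span_sum[OF P w' x(1)] obtain K v n where
    "x = (\<Sum>k<K::nat. mmode P (v k) (n k) w')" by blast
  then have "\<forall>i\<in>I. (\<Sum>k<K. mmode (N i) (v k) (n k) (w i)) = y i"
    using x(2) by (auto simp: sum_fun_apply P_def w'_def)
  then show ?thesis by blast
qed

end

section \<open>The vertex algebra as a module over itself\<close>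

lemma aut_order_id [simp]: "aut_order V id = 1"
  unfolding aut_order_def by (rule Least_equality) auto

lemma eigenspace_id_0 [simp]: "eigenspace V id 0 = vcar V"
  by (auto simp: eigenspace_def cscale_one)

lemma adjoint_twisted_module:
  assumes "vertex_algebra V"
  shows "twisted_module V id (adjoint_module V)"
proof -
  have sub: "cv.subspace (vcar V)" using assms by (simp add: vertex_algebra_def)
  have zero: "lin_on (vcar V) (vcar V) (\<lambda>_. 0)"
    using sub by (simp add: lin_on_def cv.subspace_0)
  have trunc: "\<exists>N. \<forall>l\<ge>N. rmode V u l w = 0" if "u \<in> vcar V" "w \<in> vcar V" for u w
  proof -
    obtain N where N: "\<forall>n\<ge>N. vmode V u n w = 0"
      using assms \<open>u \<in> vcar V\<close> \<open>w \<in> vcar V\<close> unfolding vertex_algebra_def by blast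
    have "rmode V u l w = 0" if "of_int N \<le> l" for l
      using N that by (auto simp: rmode_def le_floor_iff)
    then show ?thesis by blast
  qed
  show ?thesis
    unfolding twisted_module_def Let_def adjoint_module_def vmod.simps aut_order_id
  proof (intro conjI ballI allI impI)
    show "lin_on (vcar V) (vcar V) (rmode V v n)" if "v \<in> vcar V" for v n
      using assms that zero by (simp add: rmode_def vertex_algebra_def)
    show "lin_on (vcar V) (vcar V) (\<lambda>v. rmode V v n w)" if "w \<in> vcar V" for n w
    proof (cases "n \<in> \<int>")
      case True
      then have "(\<lambda>v. rmode V v n w) = (\<lambda>v. vmode V v \<lfloor>n\<rfloor> w)" by (simp add: rmode_def)
      then show ?thesis using assms that by (simp add: vertex_algebra_def)
    next
      case False
      then have "(\<lambda>v. rmode V v n w) = (\<lambda>_. 0)" by (simp add: rmode_def)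
      then show ?thesis using zero by simp
    qed
    show "rmode V (vac V) n w = (if n = -1 then w else 0)" if "w \<in> vcar V" for n w
    proof (cases "n \<in> \<int>")
      case True
      then obtain k where k: "n = of_int k" by (rule Ints_cases)
      have "n = -1 \<longleftrightarrow> k = -1" unfolding k using of_int_eq_iff[of k "-1", where ?'a = rat] by simp
      moreover have "vmode V (vac V) k w = (if k = -1 then w else 0)"
        using assms that unfolding vertex_algebra_def by blast
      ultimately show ?thesis by (simp add: k)
    next
      case False
      then show ?thesis by (auto simp: rmode_def)
    qed
    show "rmode V u n w = 0" if "r < 1" "n - of_nat r / of_nat 1 \<notin> \<int>" for r u n w
      using that by (simp add: rmode_def)
    show "\<exists>N. \<forall>l\<ge>N. rmode V u l w = 0" if "u \<in> eigenspace V id r" "w \<in> vcar V" for r u w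
      using that by (intro trunc) (auto simp: eigenspace_def)
    show "jacobi_identity (of_nat r / of_nat 1) (rmode V) (rmode V) u v w"
      if "r < 1" "u \<in> eigenspace V id r" "w \<in> vcar V" "v \<in> vcar V" for r u v w
      using assms that by (simp add: vertex_algebra_def)
  qed (rule sub)
qed

context finite_order_aut
begin

text \<open>
  \<open>\<Sum> v_i \<otimes> w_i\<close> is determined by \<open>\<Sum> Y(v_i, z) w_i\<close>: the tensors with zero image are stable under the
  modes of \<open>V\<close> acting on the first factor, and density on \<open>V\<close> moves one \<open>v_i\<close> to the vacuum.
\<close>

theorem mode_tensor_injective:
  fixes M :: "('v, 'm::complex_space) vmod"
  assumes simple: "simple_vertex_algebra V" and cnt: "countable_dim (UNIV :: 'v set)"
    and tm: "twisted_module V \<sigma> M" and I: "finite I" and w: "\<And>i. i \<in> I \<Longrightarrow> w i \<in> mcar M"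
    and ann: "\<And>n. (\<Sum>i\<in>I. mmode M (v i) n (w i)) = 0"
    and l: "lin_on UNIV UNIV (l :: 'v \<Rightarrow> complex)"
  shows "(\<Sum>i\<in>I. cscale (l (v i)) (w i)) = 0"
proof -
  interpret ad: finite_order_aut V id
    by unfold_locales
      (auto simp: va UNIV_V automorphism_def lin_on_def intro: exI[of _ 1])
  have irr: "irreducible_twisted_module V id (adjoint_module V)"
    using simple adjoint_twisted_module[OF va]
    by (simp add: irreducible_twisted_module_def simple_vertex_algebra_def)
  have "fin_dim (cv.span (v ` I))" using I by (auto simp: fin_dim_def)
  then obtain B where B: "finite B" "cv.independent B" "cv.span B = cv.span (v ` I)"
    by (rule fin_dim_basis)
  \<comment> \<open>The tensor is rewritten as a sum of \<open>b\<close> \<otimes>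
    \<open>w' b\<close> with linearly independent first factors; the task becomes to show that every
    \<open>w' b\<close> is zero.\<close>
  define r where "r = (\<lambda>i. cv.representation B (v i))"
  have v: "v i = (\<Sum>b\<in>B. cscale (r i b) b)" if "i \<in> I" for i
    using cv.sum_representation_eq[OF B(2), of "v i" B] B that
    by (simp add: r_def cv.span_base)
  define w' where "w' = (\<lambda>b. \<Sum>i\<in>I. cscale (r i b) (w i))"
  have w': "w' b \<in> mcar M" for b
    unfolding w'_def using w
    by (intro cv.subspace_sum cv.subspace_scale mcar_subspace[OF tm]) auto
  have ann': "(\<Sum>b\<in>B. mmode M b n (w' b)) = 0" for n
  proof -
    have "(\<Sum>b\<in>B. mmode M b n (w' b)) = (\<Sum>b\<in>B. \<Sum>i\<in>I. cscale (r i b) (mmode M b n (w i)))"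
    proof (rule sum.cong)
      fix b
      show "mmode M b n (w' b) = (\<Sum>i\<in>I. cscale (r i b) (mmode M b n (w i)))"
        unfolding w'_def using w
        by (subst lin_on_sum[OF mmode_lin[OF tm] mcar_subspace[OF tm]])
          (auto simp: lin_on_scale[OF mmode_lin[OF tm]] intro: cv.subspace_scale[OF mcar_subspace[OF tm]])
    qed simp
    also have "\<dots> = (\<Sum>i\<in>I. \<Sum>b\<in>B. cscale (r i b) (mmode M b n (w i)))" by (rule sum.swap)
    also have "\<dots> = (\<Sum>i\<in>I. mmode M (v i) n (w i))"
    proof (rule sum.cong)
      fix i assume i: "i \<in> I"
      show "(\<Sum>b\<in>B. cscale (r i b) (mmode M b n (w i))) = mmode M (v i) n (w i)"
        by (simp add: v[OF i] mmode_sum_v[OF tm w[OF i]] lin_on_scale[OF mmode_lin_v[OF tm w[OF i]]])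
    qed simp
    finally show ?thesis using ann by simp
  qed
  have "w' b0 = 0" if b0: "b0 \<in> B" for b0
  proof -
    have "\<exists>(K::nat) u p. \<forall>b\<in>B. (\<Sum>k<K. mmode (adjoint_module V) (u k) (p k) b) = (if b = b0 then vac V else 0)"
    proof (rule ad.mode_density[OF cnt B(1), where N = "\<lambda>_. adjoint_module V"])
      show "\<forall>i\<in>B. c i = 0" if "(\<Sum>i\<in>B. cscale (c i) i) = 0" for c
        using cv.independentD[OF B(2,1) subset_refl that] by blast
    qed (use irr in \<open>auto simp: adjoint_module_def UNIV_V\<close>)
    then obtain K u p where K: "\<And>b. b \<in> B \<Longrightarrow>
        (\<Sum>k<K::nat. rmode V (u k) (p k) b) = (if b = b0 then vac V else 0)"
      unfolding adjoint_module_def vmod.simps by blast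
    have "(\<Sum>b\<in>B. mmode M (rmode V u p b) n (w' b)) = 0" for u p n
    proof (cases "p \<in> \<int>")
      case True
      then show ?thesis
        using annihilating_tensor_stable[OF tm B(1) w' ann', of u "\<lfloor>p\<rfloor>" n] by (simp add: rmode_def)
    qed (simp add: rmode_def mmode_zero_v[OF tm w'])
    \<comment> \<open>After density has turned \<open>b0\<close> into the vacuum and the other
      \<open>b\<close> into 0, mode -1 reads off \<open>w' b0\<close>, because it is the identity
      for the vacuum.\<close>
    then have "0 = (\<Sum>k<K. \<Sum>b\<in>B. mmode M (rmode V (u k) (p k) b) (-1) (w' b))" by simp
    also have "\<dots> = (\<Sum>b\<in>B. \<Sum>k<K. mmode M (rmode V (u k) (p k) b) (-1) (w' b))" by (rule sum.swap)
    also have "\<dots> = (\<Sum>b\<in>B. mmode M (if b = b0 then vac V else 0) (-1) (w' b))"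
      by (rule sum.cong) (simp_all add: K flip: mmode_sum_v[OF tm w'])
    also have "\<dots> = (\<Sum>b\<in>B. if b = b0 then w' b else 0)"
      by (rule sum.cong) (simp_all add: mmode_zero_v[OF tm w'] twisted_moduleD(4)[OF tm w'])
    also have "\<dots> = w' b0" using B(1) b0 by simp
    finally show ?thesis by simp
  qed
  \<comment> \<open>Vanishing of the tensor is expressed by applying the functional \<open>l\<close>
    to its first factor.\<close>
  then have "0 = (\<Sum>b\<in>B. cscale (l b) (w' b))" by simp
  also have "\<dots> = (\<Sum>b\<in>B. \<Sum>i\<in>I. cscale (l b * r i b) (w i))"
    by (simp add: w'_def cv.scale_sum_right cscale_cscale)
  also have "\<dots> = (\<Sum>i\<in>I. \<Sum>b\<in>B. cscale (l b * r i b) (w i))" by (rule sum.swap)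
  also have "\<dots> = (\<Sum>i\<in>I. cscale (l (v i)) (w i))"
  proof (rule sum.cong)
    fix i assume i: "i \<in> I"
    have "l (v i) = (\<Sum>b\<in>B. r i b * l b)"
      unfolding v[OF i] by (subst lin_on_sum[OF l]) (auto simp: lin_on_scale[OF l] cscale_complex_def)
    then show "(\<Sum>b\<in>B. cscale (l b * r i b) (w i)) = cscale (l (v i)) (w i)"
      by (simp add: mult.commute flip: cv.scale_sum_left)
  qed simp
  finally show ?thesis by simp
qed

end

section \<open>The algebra of G and S acting on the direct sum\<close>

lemma vmod_iso_refl: "vmod_iso V M M"
  unfolding vmod_iso_def vmod_hom_iso_def
  by (intro exI[of _ "\<lambda>x. x"]) (simp add: lin_on_def bij_betw_def)

lemma vmod_hom_iso_ops:
  "vmod_hom_iso V M N f \<longleftrightarrow> bij_betw f (mcar M) (mcar N) \<and>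
     ops_hom (vcar V \<times> UNIV) (mcar M) (vact M) (mcar N) (vact N) f"
  by (auto simp: vmod_hom_iso_def ops_hom_def)

lemma vmod_hom_iso_inv:
  assumes f: "vmod_hom_iso V M N f" and "cv.subspace (mcar M)"
    and "\<And>v n w. v \<in> vcar V \<Longrightarrow> w \<in> mcar M \<Longrightarrow> mmode M v n w \<in> mcar M"
  shows "vmod_hom_iso V N M (inv_into (mcar M) f)"
  unfolding vmod_hom_iso_ops
proof
  show "bij_betw (inv_into (mcar M) f) (mcar N) (mcar M)"
    using f by (simp add: vmod_hom_iso_def bij_betw_inv_into)
  show "ops_hom (vcar V \<times> UNIV) (mcar N) (vact N) (mcar M) (vact M) (inv_into (mcar M) f)"
    by (rule ops_hom_inv) (use assms in \<open>auto simp: vmod_hom_iso_ops\<close>)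
qed

lemma vmod_hom_iso_trans:
  assumes "vmod_hom_iso V M N f" "vmod_hom_iso V N P g"
  shows "vmod_hom_iso V M P (\<lambda>x. g (f x))"
  using assms bij_betw_trans[of f "mcar M" "mcar N" g "mcar P"]
    ops_hom_compose[of "vcar V \<times> UNIV" "mcar M" "vact M" "mcar N" "vact N" f "mcar P" "vact P" g]
  by (simp add: vmod_hom_iso_ops comp_def)

lemma vmod_iso_trans: "vmod_iso V M N \<Longrightarrow> vmod_iso V N P \<Longrightarrow> vmod_iso V M P"
  unfolding vmod_iso_def using vmod_hom_iso_trans by blast

lemma vmod_iso_sym:
  assumes "vmod_iso V M N" "cv.subspace (mcar M)"
    and "\<And>v n w. v \<in> vcar V \<Longrightarrow> w \<in> mcar M \<Longrightarrow> mmode M v n w \<in> mcar M"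
  shows "vmod_iso V N M"
  using assms vmod_hom_iso_inv unfolding vmod_iso_def by blast

section \<open>The finite group and its fixed points\<close>

locale automorphism_subgroup =
  fixes V :: "'v::complex_space vertex" and G :: "('v \<Rightarrow> 'v) set" and \<sigma> :: "'v \<Rightarrow> 'v"
  assumes VU: "vcar V = UNIV" and simpleV: "simple_vertex_algebra V"
    and cntV: "countable_dim (vcar V)"
    and subG: "subgroup G (aut_group V)" and finG: "finite G" and sG: "\<sigma> \<in> G"
    and central: "\<forall>g\<in>G. g \<circ> \<sigma> = \<sigma> \<circ> g"
begin

lemma G_id: "id \<in> G"
  using subgroup.one_closed[OF subG] by (simp add: aut_group_def)

lemma G_comp: "g \<in> G \<Longrightarrow> h \<in> G \<Longrightarrow> g \<circ> h \<in> G"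
  using subgroup.m_closed[OF subG] by (simp add: aut_group_def)

lemma G_aut: "g \<in> G \<Longrightarrow> automorphism V g"
  using subgroup.subset[OF subG] by (auto simp: aut_group_def)

lemma G_bij: "g \<in> G \<Longrightarrow> bij g"
  using G_aut[of g] by (simp add: automorphism_def VU)

lemma G_lin: "g \<in> G \<Longrightarrow> lin_on UNIV UNIV g"
  using G_aut[of g] by (simp add: automorphism_def VU)

lemma G_mode: "g \<in> G \<Longrightarrow> g (vmode V u n v) = vmode V (g u) n (g v)"
  using G_aut[of g] by (simp add: automorphism_def VU)

lemma G_fin_order:
  assumes "g \<in> G"
  shows "\<exists>T>0. g ^^ T = id"
proof -
  have pow: "g ^^ n \<in> G" for n
    using assms by (induction n) (simp_all add: G_id G_comp)
  have "finite (range (\<lambda>n. g ^^ n))"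
    using pow finG by (meson finite_subset image_subset_iff)
  then have "\<not> inj (\<lambda>n. g ^^ n)"
    using finite_imageD[of "\<lambda>n. g ^^ n" UNIV] by auto
  then obtain i j where ij: "i < j" "g ^^ i = g ^^ j"
    unfolding inj_def by (metis linorder_neqE_nat)
  have "g ^^ i \<circ> g ^^ (j - i) = g ^^ (i + (j - i))" by (simp only: funpow_add)
  also have "\<dots> = g ^^ i \<circ> id" using ij by simp
  finally have "g ^^ i \<circ> g ^^ (j - i) = g ^^ i \<circ> id" .
  moreover have "inj (g ^^ i)"
    using G_bij[OF pow] by (rule bij_is_inj)
  ultimately have "g ^^ (j - i) = id"
    by (simp add: fun.inj_map_strong fun_eq_iff inj_eq)
  with ij show ?thesis by (intro exI[of _ "j - i"]) simp
qed

text \<open>The inverse is a power of \<open>g\<close>, so closure under composition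
  suffices.\<close>

lemma G_inv: "g \<in> G \<Longrightarrow> finv g \<in> G"
proof -
  assume g: "g \<in> G"
  have pow: "g ^^ n \<in> G" for n
    using g by (induction n) (simp_all add: G_id G_comp)
  obtain T where T: "T > 0" "g ^^ T = id" using G_fin_order[OF g] by blast
  then obtain n where n: "T = Suc n" by (cases T) auto
  have "g \<circ> g ^^ n = id" "g ^^ n \<circ> g = id"
    using T(2) n by (simp_all add: funpow_swap1 fun_eq_iff)
  then have "finv g = g ^^ n" by (rule inv_unique_comp)
  then show ?thesis using pow by simp
qed

lemma G_inv_comp [simp]: "g \<in> G \<Longrightarrow> g \<circ> finv g = id" "g \<in> G \<Longrightarrow> finv g \<circ> g = id"
  using G_bij[of g] by (simp_all add: surj_iff[symmetric] inj_iff[symmetric] bij_is_surj bij_is_inj)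

lemma G_inv_inv [simp]: "g \<in> G \<Longrightarrow> finv (finv g) = g"
  using G_bij[of g] by (simp add: inv_inv_eq)

lemma G_inv_distrib: "g \<in> G \<Longrightarrow> h \<in> G \<Longrightarrow> finv (g \<circ> h) = finv h \<circ> finv g"
  using G_bij[of g] G_bij[of h] by (simp add: o_inv_distrib)

end

sublocale automorphism_subgroup \<subseteq> finite_order_aut V \<sigma>
  using VU simpleV G_aut[OF sG] G_fin_order[OF sG]
  by unfold_locales (auto simp: simple_vertex_algebra_def)

context automorphism_subgroup
begin

abbreviation "U \<equiv> fixed_points V G"

lemma cntU: "countable_dim (UNIV :: 'v set)"
  using cntV by (simp add: VU)

lemma U_car: "v \<in> vcar U \<longleftrightarrow> (\<forall>g\<in>G. g v = v)"
  by (simp add: fixed_points_def VU)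

lemma U_simps [simp]: "vmode U = vmode V" "vac U = vac V" "rmode U = rmode V"
  by (simp_all add: fixed_points_def rmode_def fun_eq_iff)

lemma U_subspace: "cv.subspace (vcar U)"
proof (rule cv.subspaceI)
  show "0 \<in> vcar U" using lin_on_zero[OF G_lin cv.subspace_UNIV] by (simp add: U_car)
  show "x + y \<in> vcar U" if "x \<in> vcar U" "y \<in> vcar U" for x y
    unfolding U_car
  proof
    fix g assume "g \<in> G"
    then have "g x = x" "g y = y" using that by (simp_all only: U_car)
    with \<open>g \<in> G\<close> show "g (x + y) = x + y" using lin_on_add[OF G_lin, of g x y] by simp
  qed
  show "cscale c x \<in> vcar U" if "x \<in> vcar U" for c x
    unfolding U_car
  proof
    fix g assume "g \<in> G"
    then have "g x = x" using that by (simp only: U_car)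
    with \<open>g \<in> G\<close> show "g (cscale c x) = cscale c x" using lin_on_scale[OF G_lin, of g x c] by simp
  qed
qed

lemma U_vac: "vac V \<in> vcar U"
  using G_aut by (simp add: U_car automorphism_def)

lemma aut_order_pos: "0 < aut_order V \<sigma>" by (rule T(1))

lemma vmod_hom_iso_fixed: "vmod_hom_iso V M N f \<Longrightarrow> vmod_hom_iso U M N f"
  by (simp add: vmod_hom_iso_def VU)

text \<open>As \<sigma> lies in \<open>G\<close>, fixed vectors belong to the eigenspace with
  \<open>r = 0\<close>, where the twisted axioms are the untwisted ones.\<close>

lemma twisted_va_module:
  fixes M :: "('v, 'm::complex_space) vmod"
  assumes tm: "twisted_module V \<sigma> M"
  shows "va_module U M"
proof -
  have e0: "u \<in> eigenspace V \<sigma> 0" if "u \<in> vcar U" for u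
    using that sG by (simp add: eigenspace_def U_car VU cscale_one)
  show ?thesis
    unfolding va_module_def twisted_module_def Let_def aut_order_id U_simps
  proof (intro conjI ballI allI impI)
    show "cv.subspace (mcar M)" by (rule mcar_subspace[OF tm])
    show "lin_on (mcar M) (mcar M) (mmode M v n)" for v n by (rule mmode_lin[OF tm])
    show "lin_on (vcar U) (mcar M) (\<lambda>v. mmode M v n w)" if "w \<in> mcar M" for n w
      by (rule lin_on_mono[OF mmode_lin_v[OF tm that]]) (simp_all add: mmode_in[OF tm that])
    show "mmode M (vac V) n w = (if n = - 1 then w else 0)" if "w \<in> mcar M" for n w
      by (rule twisted_moduleD(4)[OF tm that])
    show "mmode M u n w = 0"
      if "r < 1" "u \<in> eigenspace U id r" "w \<in> mcar M" "n - of_nat r / of_nat 1 \<notin> \<int>" for r u n w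
      using that e0 twisted_moduleD(5)[OF tm aut_order_pos, of u w n] by simp
    show "\<exists>N. \<forall>l\<ge>N. mmode M u l w = 0" if "w \<in> mcar M" for u w
      by (rule mmode_trunc[OF tm that])
    show "jacobi_identity (of_nat r / of_nat 1) (rmode V) (mmode M) u v w"
      if "r < 1" "u \<in> eigenspace U id r" "w \<in> mcar M" for r u v w
      using that e0 twisted_moduleD(7)[OF tm aut_order_pos, of u w v] by (simp add: VU)
  qed
qed

end

section \<open>Twists and the action of the group on S\<close>

lemma mcar_twist [simp]: "mcar (twist M g) = mcar M"
  and mmode_twist [simp]: "mmode (twist M g) v = mmode M (g v)"
  by (simp_all add: twist_def)

lemma twist_twist: "twist (twist M g) h = twist M (g \<circ> h)"
  by (simp add: twist_def comp_def)

lemma twist_id [simp]: "twist M id = M"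
  by (cases M) (simp add: twist_def)

lemma (in automorphism_subgroup) vmod_iso_twist:
  "vmod_iso V M N \<Longrightarrow> vmod_iso V (twist M h) (twist N h)"
  by (auto simp: vmod_iso_def vmod_hom_iso_def VU)

definition single :: "'i \<Rightarrow> 'm::zero \<Rightarrow> 'i \<Rightarrow> 'm" where
  "single N w = (\<lambda>K. if K = N then w else 0)"

lemma single_same [simp]: "single N w N = w"
  and single_other: "K \<noteq> N \<Longrightarrow> single N w K = 0"
  by (simp_all add: single_def)

lemma single_0 [simp]: "single N 0 = 0"
  by (simp add: single_def fun_eq_iff)

lemma single_add: "single N (v + w) = single N v + single N w" for v :: "'m::monoid_add"
  by (simp add: single_def fun_eq_iff)

lemma single_scale: "single N (cscale c w) = cscale c (single N w)"
  by (simp add: single_def fun_eq_iff)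

lemma single_inject: "single N v = single N w \<Longrightarrow> v = w"
  by (metis single_same)

locale stable_modules = automorphism_subgroup V G \<sigma>
  for V :: "'v::complex_space vertex" and G \<sigma> +
  fixes S :: "('v, 'm::complex_space) vmod set"
  assumes finS: "finite S" and irrS: "\<forall>M\<in>S. irreducible_twisted_module V \<sigma> M"
    and ineqS: "\<forall>M\<in>S. \<forall>N\<in>S. vmod_iso V M N \<longrightarrow> M = N"
    and stableS: "G_stable V G S"
begin

lemma tmS: "M \<in> S \<Longrightarrow> twisted_module V \<sigma> M"
  using irrS by (simp add: irreducible_twisted_module_def)

lemma irr: "M \<in> S \<Longrightarrow> irreducible_twisted_module V \<sigma> M"
  using irrS by blast

lemma iso_symS: "N \<in> S \<Longrightarrow> vmod_iso V N P \<Longrightarrow> vmod_iso V P N"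
  by (erule vmod_iso_sym) (simp_all add: mcar_subspace[OF tmS] mmode_in[OF tmS])

lemma iso_sym_twist: "M \<in> S \<Longrightarrow> vmod_iso V (twist M g) P \<Longrightarrow> vmod_iso V P (twist M g)"
  by (erule vmod_iso_sym) (simp_all add: mcar_subspace[OF tmS] mmode_in[OF tmS])

lemma mact_ex1:
  assumes "M \<in> S" "h \<in> G"
  shows "\<exists>!N. N \<in> S \<and> vmod_iso V N (twist M h)"
proof (rule ex_ex1I)
  show "\<exists>N. N \<in> S \<and> vmod_iso V N (twist M h)"
    using stableS assms by (auto simp: G_stable_def)
  fix N N' assume N: "N \<in> S \<and> vmod_iso V N (twist M h)" "N' \<in> S \<and> vmod_iso V N' (twist M h)"
  then have "vmod_iso V (twist M h) N'" using iso_symS by blast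
  then have "vmod_iso V N N'" using N vmod_iso_trans by blast
  then show "N = N'" using ineqS N by blast
qed

lemma mact_in: "M \<in> S \<Longrightarrow> h \<in> G \<Longrightarrow> mact V S M h \<in> S"
  and mact_iso: "M \<in> S \<Longrightarrow> h \<in> G \<Longrightarrow> vmod_iso V (mact V S M h) (twist M h)"
  using theI'[OF mact_ex1, of M h] by (simp_all add: mact_def)

lemma mact_eqI: "M \<in> S \<Longrightarrow> h \<in> G \<Longrightarrow> N \<in> S \<Longrightarrow> vmod_iso V N (twist M h) \<Longrightarrow> mact V S M h = N"
  unfolding mact_def using mact_ex1 by (intro the1_equality) auto

lemma mact_id: "M \<in> S \<Longrightarrow> mact V S M id = M"
  by (rule mact_eqI) (auto simp: G_id vmod_iso_refl)

lemma mact_mact: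
  assumes "M \<in> S" "g \<in> G" "h \<in> G"
  shows "mact V S (mact V S M g) h = mact V S M (g \<circ> h)"
proof (rule mact_eqI[symmetric])
  let ?P = "mact V S M g"
  have P: "?P \<in> S" using mact_in assms by blast
  have "vmod_iso V (mact V S ?P h) (twist ?P h)" by (rule mact_iso[OF P assms(3)])
  moreover have "vmod_iso V (twist ?P h) (twist (twist M g) h)"
    by (rule vmod_iso_twist[OF mact_iso[OF assms(1,2)]])
  ultimately show "vmod_iso V (mact V S ?P h) (twist M (g \<circ> h))"
    using vmod_iso_trans by (simp only: twist_twist)
  show "mact V S ?P h \<in> S" using mact_in P assms by blast
qed (use assms G_comp in auto)

text \<open>The target of \<open>\<phi> N h\<close>. Passing to inverses turns the right action on
  \<open>S\<close> into a left action, the direction in which the intertwiners compose.\<close>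

definition tgt :: "('v, 'm) vmod \<Rightarrow> ('v \<Rightarrow> 'v) \<Rightarrow> ('v, 'm) vmod" where
  "tgt N h = mact V S N (finv h)"

lemma tgt_in: "N \<in> S \<Longrightarrow> h \<in> G \<Longrightarrow> tgt N h \<in> S"
  by (simp add: tgt_def mact_in G_inv)

lemma tgt_id [simp]: "N \<in> S \<Longrightarrow> tgt N id = N"
  by (simp add: tgt_def mact_id)

lemma tgt_tgt: "N \<in> S \<Longrightarrow> g \<in> G \<Longrightarrow> h \<in> G \<Longrightarrow> tgt (tgt N h) g = tgt N (g \<circ> h)"
  by (simp add: tgt_def mact_mact G_inv G_inv_distrib)

lemma tgt_inv: "N \<in> S \<Longrightarrow> g \<in> G \<Longrightarrow> tgt (tgt N g) (finv g) = N"
  "N \<in> S \<Longrightarrow> g \<in> G \<Longrightarrow> tgt (tgt N (finv g)) g = N"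
  by (simp_all add: tgt_tgt G_inv)

lemma mact_tgt: "M \<in> S \<Longrightarrow> h \<in> G \<Longrightarrow> mact V S M h = tgt M (finv h)"
  by (simp add: tgt_def)

lemma mact_eq_iff: "M \<in> S \<Longrightarrow> N \<in> S \<Longrightarrow> h \<in> G \<Longrightarrow> mact V S M h = N \<longleftrightarrow> M = tgt N h"
  using tgt_inv by (auto simp: mact_tgt)

lemma stabilizer_iff:
  assumes "M \<in> S"
  shows "g \<in> stabilizer V G M \<longleftrightarrow> g \<in> G \<and> tgt M g = M"
proof -
  have "vmod_iso V (twist M g) M \<longleftrightarrow> mact V S M g = M" if g: "g \<in> G"
  proof
    assume "vmod_iso V (twist M g) M"
    then have "vmod_iso V M (twist M g)" by (rule iso_sym_twist[OF assms])
    then show "mact V S M g = M" using mact_eqI assms g by blast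
  next
    assume "mact V S M g = M"
    then have "vmod_iso V M (twist M g)" using mact_iso[OF assms g] by simp
    then show "vmod_iso V (twist M g) M" by (rule iso_symS[OF assms])
  qed
  moreover have "mact V S M g = M \<longleftrightarrow> tgt M g = M" if "g \<in> G"
    using mact_eq_iff[OF assms assms that] by auto
  ultimately show ?thesis by (auto simp: stabilizer_def)
qed

end

section \<open>Intertwiners and their cocycle\<close>

locale orbifold = stable_modules V G \<sigma> S
  for V :: "'v::complex_space vertex" and G \<sigma> and S :: "('v, 'm::complex_space) vmod set" +
  fixes \<phi> :: "('v, 'm) vmod \<Rightarrow> ('v \<Rightarrow> 'v) \<Rightarrow> 'm \<Rightarrow> 'm"
  assumes inter: "intertwining_system V G S \<phi>"
begin

lemma
  assumes "N \<in> S" "h \<in> G"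
  shows phi_bij: "bij_betw (\<phi> N h) (mcar N) (mcar (tgt N h))"
    and phi_lin: "lin_on (mcar N) (mcar (tgt N h)) (\<phi> N h)"
    and phi_mode: "w \<in> mcar N \<Longrightarrow> \<phi> N h (mmode N u n w) = mmode (tgt N h) (h u) n (\<phi> N h w)"
  using inter assms unfolding intertwining_system_def Let_def tgt_def by (auto simp: VU)

lemma phi_id: "N \<in> S \<Longrightarrow> w \<in> mcar N \<Longrightarrow> \<phi> N id w = w"
  using inter by (simp add: intertwining_system_def)

lemma phi_in: "N \<in> S \<Longrightarrow> h \<in> G \<Longrightarrow> w \<in> mcar N \<Longrightarrow> \<phi> N h w \<in> mcar (tgt N h)"
  by (rule lin_on_in[OF phi_lin])

lemma subS: "N \<in> S \<Longrightarrow> cv.subspace (mcar N)"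
  by (rule mcar_subspace[OF tmS])

lemma phi_0: "N \<in> S \<Longrightarrow> h \<in> G \<Longrightarrow> \<phi> N h 0 = 0"
  by (rule lin_on_zero[OF phi_lin subS])

lemma phi_nonzero: "N \<in> S \<Longrightarrow> h \<in> G \<Longrightarrow> w \<in> mcar N \<Longrightarrow> w \<noteq> 0 \<Longrightarrow> \<phi> N h w \<noteq> 0"
  using phi_bij[of N h] phi_0[of N h] cv.subspace_0[OF subS[of N]]
  unfolding bij_betw_def inj_on_def by metis

abbreviation \<alpha> where "\<alpha> \<equiv> cocycle V S \<phi>"

text \<open>The composite of two intertwiners followed by the inverse of the intertwiner of
  \<open>g \<circ> h\<close> commutes with all modes, so by Schur's lemma it is a scalar. A nonzero
  vector makes that scalar unique, which is what the definite description in \<open>cocycle\<close>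
  calls for.\<close>

lemma
  assumes N: "N \<in> S" and g: "g \<in> G" and h: "h \<in> G"
  shows alpha: "w \<in> mcar N \<Longrightarrow> \<phi> (tgt N h) g (\<phi> N h w) = cscale (\<alpha> N g h) (\<phi> N (g \<circ> h) w)"
    and alpha_nonzero: "\<alpha> N g h \<noteq> 0"
proof -
  let ?P = "\<lambda>c. \<forall>w\<in>mcar N. \<phi> (tgt N h) g (\<phi> N h w) = cscale c (\<phi> N (g \<circ> h) w)"
  let ?K = "tgt N (g \<circ> h)" and ?i = "inv_into (mcar N) (\<phi> N (g \<circ> h))"
  have gh: "g \<circ> h \<in> G" using G_comp g h .
  have K: "tgt (tgt N h) g = ?K" using tgt_tgt N g h by simp
  have hN: "tgt N h \<in> S" using tgt_in N h .
  have comp: "lin_on (mcar N) (mcar ?K) (\<lambda>w. \<phi> (tgt N h) g (\<phi> N h w))"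
    using lin_on_compose[OF phi_lin[OF N h] phi_lin[OF hN g]] by (simp add: K)
  have ilin: "lin_on (mcar ?K) (mcar N) ?i"
    by (rule lin_on_inv_into[OF phi_bij[OF N gh] phi_lin[OF N gh] subS[OF N]])
  have i1: "\<phi> N (g \<circ> h) (?i z) = z" if "z \<in> mcar ?K" for z
    using phi_bij[OF N gh] that by (simp add: bij_betw_def f_inv_into_f)
  have i2: "?i (\<phi> N (g \<circ> h) w) = w" if "w \<in> mcar N" for w
    using phi_bij[OF N gh] that by (simp add: bij_betw_def)
  have imode: "?i (mmode ?K ((g \<circ> h) v) n z) = mmode N v n (?i z)" if z: "z \<in> mcar ?K" for v n z
  proof -
    have "mmode ?K ((g \<circ> h) v) n z = \<phi> N (g \<circ> h) (mmode N v n (?i z))"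
      using phi_mode[OF N gh lin_on_in[OF ilin z]] by (simp add: i1[OF z])
    then show ?thesis by (simp add: i2 mmode_in[OF tmS[OF N]] lin_on_in[OF ilin z])
  qed
  have "\<exists>c. \<forall>w\<in>mcar N. ?i (\<phi> (tgt N h) g (\<phi> N h w)) = cscale c w"
  proof (rule irreducible_scalar[OF irr[OF N] cntU])
    show "lin_on (mcar N) (mcar N) (\<lambda>w. ?i (\<phi> (tgt N h) g (\<phi> N h w)))"
      by (rule lin_on_compose[OF comp ilin])
    fix v n w assume w: "w \<in> mcar N"
    have "\<phi> (tgt N h) g (\<phi> N h (mmode N v n w)) = mmode ?K ((g \<circ> h) v) n (\<phi> (tgt N h) g (\<phi> N h w))"
      using w by (simp add: phi_mode N hN g h phi_in K)
    then show "?i (\<phi> (tgt N h) g (\<phi> N h (mmode N v n w))) = mmode N v n (?i (\<phi> (tgt N h) g (\<phi> N h w)))"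
      using imode lin_on_in[OF comp w] by simp
  qed
  then obtain c where c: "\<And>w. w \<in> mcar N \<Longrightarrow> ?i (\<phi> (tgt N h) g (\<phi> N h w)) = cscale c w" by blast
  have Pc: "?P c"
  proof
    fix w assume w: "w \<in> mcar N"
    have "\<phi> (tgt N h) g (\<phi> N h w) = \<phi> N (g \<circ> h) (?i (\<phi> (tgt N h) g (\<phi> N h w)))"
      using i1 lin_on_in[OF comp w] by simp
    also have "\<dots> = cscale c (\<phi> N (g \<circ> h) w)"
      using c[OF w] lin_on_scale[OF phi_lin[OF N gh] w] by simp
    finally show "\<phi> (tgt N h) g (\<phi> N h w) = cscale c (\<phi> N (g \<circ> h) w)" .
  qed
  obtain w0 where w0: "w0 \<in> mcar N" "w0 \<noteq> 0" by (rule irreducible_nonzero[OF irr[OF N]])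
  have uniq: "d = c" if "?P d" for d
    using Pc that w0 phi_nonzero[OF N gh w0] by (metis cv.scale_cancel_right)
  have "\<alpha> N g h = c"
    unfolding cocycle_def tgt_def[symmetric] using Pc uniq by (rule the_equality)
  then show "w \<in> mcar N \<Longrightarrow> \<phi> (tgt N h) g (\<phi> N h w) = cscale (\<alpha> N g h) (\<phi> N (g \<circ> h) w)"
    using Pc by simp
  show "\<alpha> N g h \<noteq> 0"
  proof
    assume "\<alpha> N g h = 0"
    then have "\<phi> (tgt N h) g (\<phi> N h w0) = 0" using Pc w0 \<open>\<alpha> N g h = c\<close> by simp
    then show False
      using phi_nonzero[OF hN g phi_in[OF N h w0(1)] phi_nonzero[OF N h w0]] by simp
  qed
qed

section \<open>The algebra and its faithful action on the direct sum\<close>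

abbreviation "A \<equiv> gs_algebra V G S \<phi>"
abbreviation "MA \<equiv> gs_module V G S \<phi>"
abbreviation "MV \<equiv> vmod_sum S (\<lambda>M. M)"
abbreviation b where "b \<equiv> gs_basis"

lemma MV_car: "mcar MV = {x. (\<forall>N\<in>S. x N \<in> mcar N) \<and> (\<forall>N. N \<notin> S \<longrightarrow> x N = 0)}"
proof -
  have "finite {N. x N \<noteq> 0}" if "\<forall>N. N \<notin> S \<longrightarrow> x N = 0" for x :: "('v, 'm) vmod \<Rightarrow> 'm"
    by (rule finite_subset[OF _ finS]) (use that in auto)
  then show ?thesis by (auto simp: vmod_sum_def direct_sum_def)
qed

lemma MV_mode: "mmode MV v n x = (\<lambda>N. if N \<in> S then mmode N v n (x N) else 0)"
  by (simp add: vmod_sum_def)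

lemma MA_car: "wcar MA = mcar MV"
  by (simp add: gs_module_def vmod_sum_def)

lemma MV_subspace: "cv.subspace (mcar MV)"
  unfolding MV_car
  by (rule cv.subspaceI)
    (auto intro: cv.subspace_0[OF subS] cv.subspace_add[OF subS] cv.subspace_scale[OF subS])

lemma MV_twisted: "twisted_module V \<sigma> MV"
proof -
  have "MV = \<lparr>mcar = mcar MV, mmode = (\<lambda>v n x N. if N \<in> S then mmode N v n (x N) else 0)\<rparr>"
    by (simp add: vmod_sum_def)
  moreover have "twisted_module V \<sigma>
      \<lparr>mcar = mcar MV, mmode = (\<lambda>v n x N. if N \<in> S then mmode N v n (x N) else 0)\<rparr>"
  proof (rule pointwise_twisted_module[OF _ _ V_trunc tmS MV_subspace])
    show "(\<lambda>N. if N \<in> S then mmode N v n (x N) else 0) \<in> mcar MV" if "x \<in> mcar MV" for v n x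
      using that mmode_in[OF tmS] by (simp add: MV_car)
    show "\<exists>N. \<forall>l\<ge>N. \<forall>K\<in>S. mmode K v l (x K) = 0" if "x \<in> mcar MV" for v x
    proof -
      have "\<forall>K\<in>S. \<exists>N. \<forall>l\<ge>N. mmode K v l (x K) = 0"
        using mmode_trunc[OF tmS] that unfolding MV_car by blast
      from bchoice[OF this] obtain N where N: "\<forall>K\<in>S. \<forall>l\<ge>N K. mmode K v l (x K) = 0" by blast
      have "N K \<le> Max (insert 0 (N ` S))" if "K \<in> S" for K using that finS by (intro Max_ge) auto
      then show ?thesis using N by (meson order_trans)
    qed
  qed (auto simp: VU MV_car)
  ultimately show ?thesis by metis
qed

lemma single_in: "N \<in> S \<Longrightarrow> w \<in> mcar N \<Longrightarrow> single N w \<in> mcar MV"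
  by (auto simp: MV_car single_def cv.subspace_0 subS)

lemma MV_mode_single: "N \<in> S \<Longrightarrow> mmode MV v n (single N w) = single N (mmode N v n w)"
  using mmode_zero[OF tmS] by (auto simp: MV_mode single_def fun_eq_iff)

lemma MV_comp: "x \<in> mcar MV \<Longrightarrow> N \<in> S \<Longrightarrow> x N \<in> mcar N"
  by (simp add: MV_car)

lemma MV_expand: "x \<in> mcar MV \<Longrightarrow> x = (\<Sum>N\<in>S. single N (x N))"
  using finS by (auto simp: MV_car fun_eq_iff sum_fun_apply single_def)

lemma wact_expand:
  "wact MA a x = (\<Sum>(g, N)\<in>G \<times> S. cscale (a (g, N)) (single (tgt N g) (\<phi> N g (x N))))"
  unfolding gs_module_def amod.simps tgt_def[symmetric]
  by (rule ext)
    (auto simp: sum_fun_apply split_def single_def sum.cartesian_product intro!: sum.cong)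

lemma wact_lin_alg: "lin_on UNIV UNIV (\<lambda>a. wact MA a x)"
  by (rule lin_onI)
    (simp_all add: wact_expand split_def cscale_add_left sum.distrib cv.scale_sum_right cscale_cscale
      cscale_complex_def)

lemma wact_in:
  assumes "x \<in> mcar MV"
  shows "wact MA a x \<in> mcar MV"
  unfolding wact_expand split_def using assms
  by (intro cv.subspace_sum[OF MV_subspace] cv.subspace_scale[OF MV_subspace])
    (simp add: mem_Times_iff single_in tgt_in phi_in MV_comp)

lemma wact_lin: "lin_on (mcar MV) (mcar MV) (wact MA a)"
proof (rule lin_onI)
  show "wact MA a (x + y) = wact MA a x + wact MA a y" if "x \<in> mcar MV" "y \<in> mcar MV" for x y
    unfolding wact_expand split_def sum.distrib[symmetric]
    by (rule sum.cong)
      (use that in \<open>auto simp: lin_on_add[OF phi_lin] MV_comp single_add cscale_add_right\<close>)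
  show "wact MA a (cscale c x) = cscale c (wact MA a x)" if "x \<in> mcar MV" for c x
    unfolding wact_expand split_def cv.scale_sum_right
    by (rule sum.cong)
      (use that in \<open>auto simp: lin_on_scale[OF phi_lin] MV_comp single_scale cscale_cscale mult.commute\<close>)
qed (rule wact_in)

lemma wact_basis:
  assumes "g \<in> G" "N \<in> S"
  shows "wact MA (b g N) x = single (tgt N g) (\<phi> N g (x N))"
proof -
  have "wact MA (b g N) x = (\<Sum>p\<in>G \<times> S. if p = (g, N) then single (tgt N g) (\<phi> N g (x N)) else 0)"
    unfolding wact_expand by (rule sum.cong) (auto simp: gs_basis_def cscale_one)
  then show ?thesis using assms finG finS by simp
qed

definition prod_basis :: "('v \<Rightarrow> 'v) \<times> ('v, 'm) vmod \<Rightarrow> ('v \<Rightarrow> 'v) \<times> ('v, 'm) vmod \<Rightarrow> ('v, 'm) gs" where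
  "prod_basis p q = (if snd p = tgt (snd q) (fst q)
     then cscale (\<alpha> (snd q) (fst p) (fst q)) (b (fst p \<circ> fst q) (snd q)) else 0)"

lemma amul_expand:
  "amul A x y = (\<Sum>p\<in>G \<times> S. \<Sum>q\<in>G \<times> S. cscale (x p * y q) (prod_basis p q))"
proof -
  have "amul A x y = (\<Sum>g\<in>G. \<Sum>M\<in>S. \<Sum>h\<in>G. \<Sum>N\<in>S. cscale (x (g, M) * y (h, N)) (prod_basis (g, M) (h, N)))"
    unfolding gs_algebra_def alg.simps
    by (intro sum.cong refl) (auto simp: prod_basis_def mact_eq_iff)
  then show ?thesis by (simp only: sum.cartesian_product')
qed

lemma acar_iff: "a \<in> acar A \<longleftrightarrow> (\<forall>g M. a (g, M) \<noteq> 0 \<longrightarrow> g \<in> G \<and> M \<in> S)"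
  by (simp add: gs_algebra_def)

lemma basis_in: "g \<in> G \<Longrightarrow> M \<in> S \<Longrightarrow> b g M \<in> acar A"
  by (auto simp: acar_iff gs_basis_def)

lemma acar_subspace: "cv.subspace (acar A)"
proof -
  have "acar A = {a. \<forall>p. p \<notin> G \<times> S \<longrightarrow> a p = 0}" by (force simp: acar_iff)
  then show ?thesis by (simp add: cv.subspace_def)
qed

lemma acar_span: "acar A = cv.span ((\<lambda>(g, M). b g M) ` (G \<times> S))"
proof
  show "cv.span ((\<lambda>(g, M). b g M) ` (G \<times> S)) \<subseteq> acar A"
    by (rule cv.span_minimal[OF _ acar_subspace]) (auto simp: basis_in)
  show "acar A \<subseteq> cv.span ((\<lambda>(g, M). b g M) ` (G \<times> S))"
  proof
    fix a assume a: "a \<in> acar A"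
    have "a = (\<Sum>p\<in>G \<times> S. cscale (a p) (b (fst p) (snd p)))"
    proof
      fix p
      have "(\<Sum>q\<in>G \<times> S. cscale (a q) (b (fst q) (snd q))) p = (\<Sum>q\<in>G \<times> S. if q = p then a p else 0)"
        unfolding sum_fun_apply by (rule sum.cong) (auto simp: gs_basis_def cscale_complex_def)
      also have "\<dots> = a p"
        using a finG finS by (cases p) (auto simp: acar_iff)
      finally show "a p = (\<Sum>q\<in>G \<times> S. cscale (a q) (b (fst q) (snd q))) p" by simp
    qed
    also have "\<dots> \<in> cv.span ((\<lambda>(g, M). b g M) ` (G \<times> S))"
      by (intro cv.span_sum cv.span_scale cv.span_base) auto
    finally show "a \<in> cv.span ((\<lambda>(g, M). b g M) ` (G \<times> S))" .
  qed
qed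

lemma acar_fin_dim: "fin_dim (acar A)"
  unfolding fin_dim_def acar_span
  by (intro exI[of _ "(\<lambda>(g, M). b g M) ` (G \<times> S)"]) (simp add: finG finS)

lemma prod_basis_in: "p \<in> G \<times> S \<Longrightarrow> q \<in> G \<times> S \<Longrightarrow> prod_basis p q \<in> acar A"
  by (simp add: prod_basis_def mem_Times_iff cv.subspace_0[OF acar_subspace]
      cv.subspace_scale[OF acar_subspace] basis_in G_comp)

lemma amul_in: "amul A x y \<in> acar A"
  unfolding amul_expand
  by (intro cv.subspace_sum[OF acar_subspace] cv.subspace_scale[OF acar_subspace] prod_basis_in)

lemma amul_lin_right: "lin_on UNIV (acar A) (\<lambda>y. amul A x y)"
proof (rule lin_onI)
  show "amul A x (y + z) = amul A x y + amul A x z" for y z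
    by (simp add: amul_expand distrib_left cscale_add_left sum.distrib)
  show "amul A x (cscale c y) = cscale c (amul A x y)" for c y
    by (simp add: amul_expand cv.scale_sum_right cscale_cscale cscale_complex_def mult_ac)
qed (rule amul_in)

lemma amul_lin_left: "lin_on UNIV (acar A) (\<lambda>x. amul A x y)"
proof (rule lin_onI)
  show "amul A (x + z) y = amul A x y + amul A z y" for x z
    by (simp add: amul_expand distrib_right cscale_add_left sum.distrib)
  show "amul A (cscale c x) y = cscale c (amul A x y)" for c x
    by (simp add: amul_expand cv.scale_sum_right cscale_cscale cscale_complex_def mult_ac)
qed (rule amul_in)

lemma amul_basis:
  assumes "g \<in> G" "h \<in> G" "M \<in> S" "N \<in> S"
  shows "amul A (b g M) (b h N) = (if M = tgt N h then cscale (\<alpha> N g h) (b (g \<circ> h) N) else 0)"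
proof -
  have "amul A (b g M) (b h N) = (\<Sum>p\<in>G \<times> S. \<Sum>q\<in>G \<times> S.
      if q = (h, N) then if p = (g, M) then prod_basis p q else 0 else 0)"
    unfolding amul_expand by (intro sum.cong refl) (auto simp: gs_basis_def cscale_one)
  also have "\<dots> = prod_basis (g, M) (h, N)" using assms finG finS by simp
  finally show ?thesis by (simp add: prod_basis_def)
qed

lemma aone_eq: "aone A = (\<Sum>M\<in>S. b id M)"
  by (simp add: gs_algebra_def)

lemma aone_in: "aone A \<in> acar A"
  unfolding aone_eq by (intro cv.subspace_sum[OF acar_subspace] basis_in G_id)

lemma fd_alg_A: "fd_alg A"
  by (simp add: fd_alg_def acar_fin_dim aone_in amul_in)

lemma acar_eqI:
  assumes "lin_on (acar A) X f" "lin_on (acar A) Y h" "a \<in> acar A"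
    and "\<And>g M. g \<in> G \<Longrightarrow> M \<in> S \<Longrightarrow> f (b g M) = h (b g M)"
  shows "f a = h a"
proof (rule lin_on_span_eq[of "(\<lambda>(g, M). b g M) ` (G \<times> S)" X f Y h a])
  show "lin_on (cv.span ((\<lambda>(g, M). b g M) ` (G \<times> S))) X f"
    "lin_on (cv.span ((\<lambda>(g, M). b g M) ` (G \<times> S))) Y h"
    "a \<in> cv.span ((\<lambda>(g, M). b g M) ` (G \<times> S))"
    using assms(1-3) by (simp_all only: acar_span)
  show "f c = h c" if "c \<in> (\<lambda>(g, M). b g M) ` (G \<times> S)" for c
    using that assms(4) by auto
qed

text \<open>Bilinearity reduces the claim to basis elements, where it is the defining relation of
  the cocycle.\<close>

lemma wact_amul:
  assumes a: "a \<in> acar A" and c: "c \<in> acar A" and x: "x \<in> mcar MV"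
  shows "wact MA (amul A a c) x = wact MA a (wact MA c x)"
proof -
  have l: "lin_on (acar A) UNIV (\<lambda>a. wact MA a y)" for y
    by (rule lin_on_mono[OF wact_lin_alg]) auto
  have bas: "wact MA (amul A (b g M) (b h N)) x = wact MA (b g M) (wact MA (b h N) x)"
    if "g \<in> G" "h \<in> G" "M \<in> S" "N \<in> S" for g h M N
  proof (cases "M = tgt N h")
    case True
    have "wact MA (b g M) (wact MA (b h N) x) = single (tgt N (g \<circ> h)) (\<phi> (tgt N h) g (\<phi> N h (x N)))"
      using that by (simp add: wact_basis True tgt_tgt)
    also have "\<dots> = cscale (\<alpha> N g h) (wact MA (b (g \<circ> h) N) x)"
      using that x by (simp add: alpha MV_comp wact_basis G_comp single_scale)
    finally show ?thesis
      using that by (simp add: amul_basis True lin_on_scale[OF wact_lin_alg])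
  next
    case False
    then show ?thesis
      using that lin_on_zero[OF wact_lin_alg]
      by (simp add: amul_basis wact_basis single_other phi_0)
  qed
  have 1: "wact MA (amul A (b g M) c) x = wact MA (b g M) (wact MA c x)" if g: "g \<in> G" "M \<in> S" for g M
  proof (rule acar_eqI[OF _ _ c])
    show "lin_on (acar A) UNIV (\<lambda>c. wact MA (amul A (b g M) c) x)"
      using lin_on_compose[OF amul_lin_right l] by (rule lin_on_mono) auto
    show "lin_on (acar A) (mcar MV) (\<lambda>c. wact MA (b g M) (wact MA c x))"
      by (rule lin_on_compose[OF _ wact_lin]) (rule lin_on_mono[OF wact_lin_alg], use x wact_in in auto)
  qed (use bas g in auto)
  show ?thesis
  proof (rule acar_eqI[OF _ l a])
    show "lin_on (acar A) UNIV (\<lambda>a. wact MA (amul A a c) x)"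
      using lin_on_compose[OF amul_lin_left l] by (rule lin_on_mono) auto
  qed (use 1 in auto)
qed

lemma wact_one:
  assumes "x \<in> mcar MV"
  shows "wact MA (aone A) x = x"
proof -
  have "wact MA (aone A) x = (\<Sum>M\<in>S. wact MA (b id M) x)"
    unfolding aone_eq by (rule lin_on_sum[OF wact_lin_alg]) auto
  also have "\<dots> = (\<Sum>M\<in>S. single M (x M))"
    using assms by (intro sum.cong refl) (simp add: wact_basis G_id phi_id MV_comp)
  finally show ?thesis using MV_expand[OF assms] by simp
qed

lemma alg_module_MA: "alg_module A MA"
  unfolding alg_module_def MA_car
proof (intro conjI ballI)
  show "lin_on (acar A) (mcar MV) (\<lambda>a. wact MA a w)" if "w \<in> mcar MV" for w
    by (rule lin_on_mono[OF wact_lin_alg]) (use that wact_in in auto)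
qed (use MV_subspace wact_lin wact_amul wact_one in blast)+

lemma wact_basis_mode:
  assumes "g \<in> G" "N \<in> S" "x \<in> mcar MV"
  shows "wact MA (b g N) (mmode MV v n x) = mmode MV (g v) n (wact MA (b g N) x)"
  using assms by (simp add: wact_basis MV_mode_single tgt_in) (simp add: MV_mode phi_mode MV_comp)

lemma wact_fixed_mode:
  assumes a: "a \<in> acar A" and v: "v \<in> vcar U" and x: "x \<in> mcar MV"
  shows "wact MA a (mmode MV v n x) = mmode MV v n (wact MA a x)"
proof (rule acar_eqI[OF _ _ a])
  show "lin_on (acar A) UNIV (\<lambda>a. wact MA a (mmode MV v n x))"
    by (rule lin_on_mono[OF wact_lin_alg]) auto
  show "lin_on (acar A) (mcar MV) (\<lambda>a. mmode MV v n (wact MA a x))"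
    by (rule lin_on_compose[OF _ mmode_lin[OF MV_twisted]], rule lin_on_mono[OF wact_lin_alg])
      (use x wact_in in auto)
  fix g M assume g: "g \<in> G" "M \<in> S"
  then have "g v = v" using v by (simp only: U_car)
  with g x show "wact MA (b g M) (mmode MV v n x) = mmode MV v n (wact MA (b g M) x)"
    by (simp add: wact_basis_mode)
qed

text \<open>
  The annihilator of the direct sum in the algebra is stable under multiplying coefficients by
  matrix coefficients \<open>l(g v)\<close> of \<open>G\<close> on \<open>V\<close>; these separate the elements of \<open>G\<close>.
\<close>

lemma annihilator_matrix_coeff:
  assumes a: "\<And>x. x \<in> mcar MV \<Longrightarrow> wact MA a x = 0" and l: "lin_on UNIV UNIV (l :: 'v \<Rightarrow> complex)"
    and x: "x \<in> mcar MV"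
  shows "wact MA (\<lambda>(g, N). a (g, N) * l (g v)) x = 0"
proof -
  let ?w = "\<lambda>p. cscale (a p) (single (tgt (snd p) (fst p)) (\<phi> (snd p) (fst p) (x (snd p))))"
  have w: "?w p \<in> mcar MV" if "p \<in> G \<times> S" for p
    using that x by (simp add: mem_Times_iff cv.subspace_scale[OF MV_subspace] single_in tgt_in phi_in MV_comp)
  have "(\<Sum>p\<in>G \<times> S. cscale (l (fst p v)) (?w p)) = 0"
  proof (rule mode_tensor_injective[OF simpleV cntU MV_twisted _ w _ l])
    show "finite (G \<times> S)" using finG finS by simp
    fix n
    have "(\<Sum>p\<in>G \<times> S. mmode MV (fst p v) n (?w p)) = wact MA a (mmode MV v n x)"
      unfolding wact_expand split_def
    proof (rule sum.cong)
      fix p assume p: "p \<in> G \<times> S"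
      then have "mmode MV (fst p v) n (?w p) = cscale (a p) (single (tgt (snd p) (fst p))
          (mmode (tgt (snd p) (fst p)) (fst p v) n (\<phi> (snd p) (fst p) (x (snd p)))))"
        using x by (simp add: mem_Times_iff lin_on_scale[OF mmode_lin[OF MV_twisted]] single_in
            tgt_in phi_in MV_comp MV_mode_single)
      with p x show "mmode MV (fst p v) n (?w p)
          = cscale (a (fst p, snd p)) (single (tgt (snd p) (fst p)) (\<phi> (snd p) (fst p) (mmode MV v n x (snd p))))"
        by (simp add: mem_Times_iff phi_mode MV_mode MV_comp)
    qed simp
    then show "(\<Sum>p\<in>G \<times> S. mmode MV (fst p v) n (?w p)) = 0"
      using a[OF mmode_in[OF MV_twisted x]] by simp
  qed
  moreover have "(\<Sum>p\<in>G \<times> S. cscale (l (fst p v)) (?w p)) = wact MA (\<lambda>(g, N). a (g, N) * l (g v)) x"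
    unfolding wact_expand split_def by (intro sum.cong refl) (simp add: cscale_cscale mult.commute)
  ultimately show ?thesis by simp
qed

text \<open>Take a nonzero annihilating element of smallest support. Its support involves a single
  module, since restricting it to one column annihilates too. It involves a single group element as
  well: if \<open>h \<noteq> g\<close> both occur, they differ at some \<open>v\<close>, and
  multiplying the coefficient at each \<open>k\<close> by \<open>l (k v) - l (h v)\<close> removes
  \<open>h\<close> but keeps \<open>g\<close>. A multiple of one basis element, however, acts by an
  injective intertwiner.\<close>

theorem MA_faithful:
  assumes "a \<in> acar A" "\<And>x. x \<in> mcar MV \<Longrightarrow> wact MA a x = 0"
  shows "a = 0"
proof (rule ccontr)
  define Z where "Z = {a \<in> acar A. \<forall>x\<in>mcar MV. wact MA a x = 0}"
  have Z: "cv.subspace Z"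
    unfolding Z_def
    by (rule cv.subspaceI)
      (auto simp: lin_on_zero[OF wact_lin_alg] lin_on_add[OF wact_lin_alg] lin_on_scale[OF wact_lin_alg]
        intro: cv.subspace_0[OF acar_subspace] cv.subspace_add[OF acar_subspace] cv.subspace_scale[OF acar_subspace])
  have supp: "finite {p. a p \<noteq> 0}" if "a \<in> acar A" for a
    by (rule finite_subset[of _ "G \<times> S"]) (use that finG finS in \<open>auto simp: acar_iff\<close>)
  assume "a \<noteq> 0"
  then have "a \<in> Z \<and> a \<noteq> 0" using assms by (simp add: Z_def)
  from ex_has_least_nat[of "\<lambda>a. a \<in> Z \<and> a \<noteq> 0", OF this, of "\<lambda>a. card {p. a p \<noteq> 0}"]
  obtain a where a: "a \<in> Z" "a \<noteq> 0"
    and least: "\<And>c. c \<in> Z \<Longrightarrow> c \<noteq> 0 \<Longrightarrow> card {p. a p \<noteq> 0} \<le> card {p. c p \<noteq> 0}" by blast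
  have aA: "a \<in> acar A" and a0: "\<And>x. x \<in> mcar MV \<Longrightarrow> wact MA a x = 0"
    using a(1) by (auto simp: Z_def)
  have smaller: False if "c \<in> Z" "c \<noteq> 0" "\<And>p. c p \<noteq> 0 \<Longrightarrow> a p \<noteq> 0" "a q \<noteq> 0" "c q = 0" for c q
  proof -
    have "{p. c p \<noteq> 0} \<subset> {p. a p \<noteq> 0}" using that by blast
    then have "card {p. c p \<noteq> 0} < card {p. a p \<noteq> 0}" by (rule psubset_card_mono[OF supp[OF aA]])
    with least[OF that(1,2)] show False by simp
  qed
  obtain g M where gM: "a (g, M) \<noteq> 0" using a(2) by (auto simp: fun_eq_iff)
  then have g: "g \<in> G" "M \<in> S" using aA by (auto simp: acar_iff)
  have col: "N = M" if hN: "a (h, N) \<noteq> 0" for h N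
  proof (rule ccontr)
    assume NM: "N \<noteq> M"
    \<comment> \<open>On any vector the column of \<open>M\<close> acts as \<open>a\<close> acts on
      the summand at \<open>M\<close> alone, so the column annihilates as well.\<close>
    let ?c = "\<lambda>(k, K). if K = M then a (k, K) else 0"
    have "wact MA ?c x = wact MA a (single M (x M))" for x
      unfolding wact_expand split_def
      by (rule sum.cong) (use g in \<open>auto simp: single_other phi_0\<close>)
    then have "?c \<in> Z"
      using aA a0 single_in[OF g(2) MV_comp[OF _ g(2)]] by (auto simp: Z_def acar_iff)
    moreover have "?c \<noteq> 0" using gM by (auto simp: fun_eq_iff)
    moreover have "a p \<noteq> 0" if "?c p \<noteq> 0" for p
      using that by (cases p) (auto split: if_splits)
    ultimately show False
      using smaller[of ?c "(h, N)"] hN NM by simp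
  qed
  have one: "h = g" if hM: "a (h, M) \<noteq> 0" for h
  proof (rule ccontr)
    assume "h \<noteq> g"
    then obtain v where "g v \<noteq> h v" by (metis ext)
    then have "g v - h v \<noteq> 0" by simp
    then obtain l where l: "lin_on UNIV UNIV l" "l (g v - h v) \<noteq> (0 :: complex)"
      using separating_functional by blast
    let ?d = "\<lambda>(k, K). a (k, K) * l (k v)"
    have "?d \<in> Z"
      using annihilator_matrix_coeff[OF a0 l(1)] aA by (auto simp: Z_def acar_iff)
    then have c: "?d - cscale (l (h v)) a \<in> Z"
      using a(1) by (intro cv.subspace_diff[OF Z] cv.subspace_scale[OF Z])
    have val: "(?d - cscale (l (h v)) a) (k, K) = a (k, K) * (l (k v) - l (h v))" for k K
      by (simp add: cscale_complex_def algebra_simps)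
    have "(?d - cscale (l (h v)) a) (g, M) \<noteq> 0"
      unfolding val using gM l lin_on_diff[OF l(1)] by simp
    then have "?d - cscale (l (h v)) a \<noteq> 0" by (metis zero_fun_apply)
    moreover have "a p \<noteq> 0" if "(?d - cscale (l (h v)) a) p \<noteq> 0" for p
      using that val[of "fst p" "snd p"] by auto
    moreover have "(?d - cscale (l (h v)) a) (h, M) = 0" unfolding val by simp
    ultimately show False using smaller[OF c _ _ hM] by blast
  qed
  obtain w where w: "w \<in> mcar M" "w \<noteq> 0" by (rule irreducible_nonzero[OF irr[OF g(2)]])
  have "wact MA a (single M w) = (\<Sum>p\<in>G \<times> S. if p = (g, M) then cscale (a (g, M)) (single (tgt M g) (\<phi> M g w)) else 0)"
    unfolding wact_expand
  proof (rule sum.cong)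
    fix p assume "p \<in> G \<times> S"
    obtain k K where p: "p = (k, K)" by (cases p)
    show "(case p of (h, N) \<Rightarrow> cscale (a (h, N)) (single (tgt N h) (\<phi> N h (single M w N))))
        = (if p = (g, M) then cscale (a (g, M)) (single (tgt M g) (\<phi> M g w)) else 0)"
      using col[of k K] one[of k] by (cases "a p = 0") (auto simp: p)
  qed simp
  also have "\<dots> = cscale (a (g, M)) (single (tgt M g) (\<phi> M g w))" using g finG finS by simp
  finally have "single (tgt M g) (\<phi> M g w) = 0"
    using a0[OF single_in[OF g(2) w(1)]] gM by simp
  then show False
    using single_inject[of "tgt M g" "\<phi> M g w" 0] phi_nonzero[OF g(2,1) w] by simp
qed

lemma A_eqI:
  assumes "a \<in> acar A" "c \<in> acar A" "\<And>x. x \<in> mcar MV \<Longrightarrow> wact MA a x = wact MA c x"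
  shows "a = c"
proof -
  have "a - c = 0"
    using assms lin_on_diff[OF wact_lin_alg] by (intro MA_faithful) (auto intro: cv.subspace_diff[OF acar_subspace])
  then show ?thesis by simp
qed

text \<open>Composition of operators is associative and the action is faithful; this replaces a
  computation with the cocycle identity.\<close>

lemma amul_assoc:
  assumes "x \<in> acar A" "y \<in> acar A" "z \<in> acar A"
  shows "amul A (amul A x y) z = amul A x (amul A y z)"
  by (rule A_eqI) (use assms in \<open>simp_all add: amul_in wact_amul wact_in\<close>)

lemma amul_one: "x \<in> acar A \<Longrightarrow> amul A (aone A) x = x" "x \<in> acar A \<Longrightarrow> amul A x (aone A) = x"
  by (rule A_eqI; simp add: amul_in wact_amul wact_in aone_in wact_one)+

lemma assoc_algebra_A: "assoc_algebra A"
  unfolding assoc_algebra_def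
  using acar_subspace aone_in amul_assoc amul_one lin_on_mono[OF amul_lin_left] lin_on_mono[OF amul_lin_right]
  by (simp add: amul_in)

end

section \<open>Partial inverses, semisimplicity, and density of the fixed points\<close>

context orbifold
begin

lemma amul_scale: "amul A (cscale c x) y = cscale c (amul A x y)" "amul A x (cscale c y) = cscale c (amul A x y)"
  using lin_on_scale[OF amul_lin_left] lin_on_scale[OF amul_lin_right] by auto

lemma amul_zero [simp]: "amul A 0 y = 0" "amul A x 0 = 0"
  using lin_on_zero[OF amul_lin_left cv.subspace_UNIV] lin_on_zero[OF amul_lin_right cv.subspace_UNIV] by auto

lemma basis_nonzero: "b g M \<noteq> 0"
  by (metis gs_basis_def zero_fun_apply zero_neq_one)

lemma alpha_id:
  assumes N: "N \<in> S" and g: "g \<in> G"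
  shows "\<alpha> N id g = 1" "\<alpha> N g id = 1"
proof -
  obtain w where w: "w \<in> mcar N" "w \<noteq> 0" by (rule irreducible_nonzero[OF irr[OF N]])
  note nz = phi_nonzero[OF N g w]
  have "\<phi> N g w = cscale (\<alpha> N id g) (\<phi> N g w)"
    using alpha[OF N G_id g w(1)] phi_id[OF tgt_in[OF N g] phi_in[OF N g w(1)]] by simp
  with nz show "\<alpha> N id g = 1"
    by (metis cscale_one cv.scale_cancel_right)
  have "\<phi> N g w = cscale (\<alpha> N g id) (\<phi> N g w)"
    using alpha[OF N g G_id w(1)] phi_id[OF N w(1)] N by simp
  with nz show "\<alpha> N g id = 1"
    by (metis cscale_one cv.scale_cancel_right)
qed

lemma idem_mult_left:
  "N \<in> S \<Longrightarrow> K \<in> S \<Longrightarrow> g \<in> G \<Longrightarrow> amul A (b id K) (b g N) = (if K = tgt N g then b g N else 0)"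
  by (simp add: amul_basis G_id alpha_id cscale_one)

lemma idem_mult_right:
  "N \<in> S \<Longrightarrow> K \<in> S \<Longrightarrow> g \<in> G \<Longrightarrow> amul A (b g N) (b id K) = (if N = K then b g N else 0)"
  by (auto simp: amul_basis G_id alpha_id cscale_one)

text \<open>The scalar is chosen so that multiplying by \<open>b g N\<close> on the right gives
  exactly the idempotent at \<open>N\<close>.\<close>

definition binv where
  "binv g N = cscale (1 / \<alpha> N (finv g) g) (b (finv g) (tgt N g))"

lemma binv_in: "g \<in> G \<Longrightarrow> N \<in> S \<Longrightarrow> binv g N \<in> acar A"
  unfolding binv_def by (intro cv.subspace_scale[OF acar_subspace] basis_in G_inv tgt_in)

lemma binv_left: "g \<in> G \<Longrightarrow> N \<in> S \<Longrightarrow> amul A (binv g N) (b g N) = b id N"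
  using alpha_nonzero[of N "finv g" g]
  by (simp add: binv_def amul_scale amul_basis G_inv tgt_in cscale_cscale cscale_one)

lemma binv_idem: "g \<in> G \<Longrightarrow> N \<in> S \<Longrightarrow> amul A (binv g N) (b id (tgt N g)) = binv g N"
  by (simp add: binv_def amul_scale idem_mult_right G_inv tgt_in)

lemma basis_binv:
  assumes "g \<in> G" "N \<in> S" "h \<in> G" "K \<in> S"
  shows "amul A (b h K) (binv g N) = (if K = N then amul A (b h N) (binv g N) else 0)"
  using assms by (auto simp: binv_def amul_scale amul_basis G_inv tgt_in tgt_inv)

text \<open>The product is a scalar \<open>c\<close> times the idempotent at \<open>tgt N g\<close>.
  Bracketing \<open>b g N\<close>, \<open>binv g N\<close>, \<open>b g N\<close> in two ways forces
  \<open>c = 1\<close>.\<close>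

lemma binv_right:
  assumes g: "g \<in> G" and N: "N \<in> S"
  shows "amul A (b g N) (binv g N) = b id (tgt N g)"
proof -
  define c where "c = 1 / \<alpha> N (finv g) g * \<alpha> (tgt N g) g (finv g)"
  have c: "amul A (b g N) (binv g N) = cscale c (b id (tgt N g))"
    using g N by (simp add: c_def binv_def amul_scale amul_basis G_inv tgt_in tgt_inv cscale_cscale)
  have "cscale c (b g N) = amul A (amul A (b g N) (binv g N)) (b g N)"
    unfolding c using g N by (simp add: amul_scale idem_mult_left tgt_in)
  also have "\<dots> = amul A (b g N) (amul A (binv g N) (b g N))"
    using g N by (intro amul_assoc basis_in binv_in)
  also have "\<dots> = b g N"
    using g N by (simp add: binv_left idem_mult_right)
  finally have "c = 1"
    using basis_nonzero by (metis cscale_one cv.scale_cancel_right)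
  then show ?thesis using c by (simp add: cscale_one)
qed

text \<open>This allows an algebra element to be moved out of the Maschke average. Both sides agree
  after right multiplication by \<open>b (g \<circ> h) K\<close>, and that can be undone by
  \<open>binv (g \<circ> h) K\<close>.\<close>

lemma basis_binv_comp:
  assumes g: "g \<in> G" and h: "h \<in> G" and K: "K \<in> S"
  shows "amul A (b h K) (binv (g \<circ> h) K) = cscale (\<alpha> K g h) (binv g (tgt K h))"
proof -
  have gh: "g \<circ> h \<in> G" and hK: "tgt K h \<in> S" using G_comp tgt_in assms by auto
  let ?x = "amul A (b h K) (binv (g \<circ> h) K)" and ?y = "cscale (\<alpha> K g h) (binv g (tgt K h))"
  let ?e = "b id (tgt K (g \<circ> h))"
  have in1: "?x \<in> acar A" "?y \<in> acar A"
    using g hK by (auto intro!: amul_in cv.subspace_scale[OF acar_subspace] binv_in)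
  note in2 = basis_in[OF h K] basis_in[OF gh K] basis_in[OF g hK] binv_in[OF gh K] binv_in[OF g hK]
  have "amul A ?x (b (g \<circ> h) K) = b h K"
    using gh h K by (simp add: amul_assoc in2 binv_left idem_mult_right)
  moreover have "amul A ?y (b (g \<circ> h) K) = b h K"
  proof -
    have "amul A ?y (b (g \<circ> h) K) = amul A (binv g (tgt K h)) (amul A (b g (tgt K h)) (b h K))"
      using g h K hK by (simp add: amul_scale amul_basis)
    also have "\<dots> = amul A (b id (tgt K h)) (b h K)"
      using g hK by (simp add: binv_left in2 flip: amul_assoc)
    finally show ?thesis using h K hK by (simp add: idem_mult_left)
  qed
  ultimately have eq: "amul A (amul A ?x (b (g \<circ> h) K)) (binv (g \<circ> h) K)
      = amul A (amul A ?y (b (g \<circ> h) K)) (binv (g \<circ> h) K)" by simp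
  have "amul A ?x ?e = amul A ?y ?e"
    using eq amul_assoc[OF in1(1) in2(2,4)] amul_assoc[OF in1(2) in2(2,4)] binv_right[OF gh K] by simp
  moreover have "amul A ?x ?e = ?x"
    using amul_assoc[OF in2(1,4) basis_in[OF G_id tgt_in[OF K gh]]] binv_idem[OF gh K] by simp
  moreover have "amul A ?y ?e = ?y"
    using binv_idem[OF g hK] tgt_tgt[OF K g h] by (simp add: amul_scale)
  ultimately show ?thesis by simp
qed

lemma sum_G_comp:
  assumes "h \<in> G"
  shows "(\<Sum>g\<in>G. f (g \<circ> h)) = (\<Sum>g\<in>G. f g)" "(\<Sum>g\<in>G. f (h \<circ> g)) = (\<Sum>g\<in>G. f g)"
proof -
  have "bij_betw (\<lambda>g. g \<circ> h) G G"
    by (rule bij_betw_byWitness[of _ "\<lambda>g. g \<circ> finv h"])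
      (use assms in \<open>auto simp: G_comp G_inv comp_assoc\<close>)
  then show "(\<Sum>g\<in>G. f (g \<circ> h)) = (\<Sum>g\<in>G. f g)" by (rule sum.reindex_bij_betw)
  have "bij_betw (\<lambda>g. h \<circ> g) G G"
    by (rule bij_betw_byWitness[of _ "\<lambda>g. finv h \<circ> g"])
      (use assms in \<open>auto simp: G_comp G_inv comp_assoc[symmetric]\<close>)
  then show "(\<Sum>g\<in>G. f (h \<circ> g)) = (\<Sum>g\<in>G. f g)" by (rule sum.reindex_bij_betw)
qed

lemma card_G: "(of_nat (card G) :: complex) \<noteq> 0"
  using finG G_id by auto

text \<open>Maschke's averaging; \<open>g \<otimes> e(N)\<close> has the partial inverse \<open>binv g N\<close>.\<close>

theorem maschke:
  fixes X :: "(('v, 'm) gs, 'x::complex_space) amod"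
  assumes X: "alg_module A X" and Y: "asubmodule A X Y"
  shows "\<exists>p. lin_on (wcar X) Y p \<and> (\<forall>y\<in>Y. p y = y) \<and>
    (\<forall>a\<in>acar A. \<forall>x\<in>wcar X. p (wact X a x) = wact X a (p x))"
proof -
  have YX: "cv.subspace Y" "Y \<subseteq> wcar X" "\<And>a y. a \<in> acar A \<Longrightarrow> y \<in> Y \<Longrightarrow> wact X a y \<in> Y"
    using Y by (auto simp: asubmodule_def)
  have subX: "cv.subspace (wcar X)" by (rule alg_moduleD(1)[OF X])
  obtain p0 where p0: "lin_on UNIV Y p0" "\<forall>y\<in>Y. p0 y = y"
    using exists_linear_projection[OF YX(1)] by blast
  define q where "q = (\<lambda>g N x. wact X (binv g N) (p0 (wact X (b g N) x)))"
  define p where "p = (\<lambda>x. cscale (1 / of_nat (card G)) (\<Sum>g\<in>G. \<Sum>N\<in>S. q g N x))"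
  have act: "wact X a x \<in> wcar X" if "a \<in> acar A" "x \<in> wcar X" for a x
    using lin_on_in[OF alg_moduleD(2)[OF X that(1)] that(2)] .
  have p0X: "p0 x \<in> wcar X" for x using lin_on_in[OF p0(1)] YX(2) by blast
  have qlin: "lin_on (wcar X) Y (q g N)" if g: "g \<in> G" "N \<in> S" for g N
  proof (rule lin_onI)
    note l1 = alg_moduleD(2)[OF X basis_in[OF g]] and l2 = alg_moduleD(2)[OF X binv_in[OF g]]
    show "q g N x \<in> Y" for x
      unfolding q_def by (intro YX(3) binv_in g lin_on_in[OF p0(1)]) simp
    show "q g N (x + y) = q g N x + q g N y" if "x \<in> wcar X" "y \<in> wcar X" for x y
      unfolding q_def using that p0X by (simp add: lin_on_add[OF l1] lin_on_add[OF p0(1)] lin_on_add[OF l2])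
    show "q g N (cscale c x) = cscale c (q g N x)" if "x \<in> wcar X" for c x
      unfolding q_def using that p0X by (simp add: lin_on_scale[OF l1] lin_on_scale[OF p0(1)] lin_on_scale[OF l2])
  qed
  have plin: "lin_on (wcar X) Y p"
  proof (rule lin_onI)
    show "p x \<in> Y" if "x \<in> wcar X" for x
      unfolding p_def
      by (intro cv.subspace_scale[OF YX(1)] cv.subspace_sum[OF YX(1)] lin_on_in[OF qlin] that)
    show "p (x + y) = p x + p y" if "x \<in> wcar X" "y \<in> wcar X" for x y
      unfolding p_def using that by (simp add: lin_on_add[OF qlin] sum.distrib cscale_add_right)
    show "p (cscale c x) = cscale c (p x)" if "x \<in> wcar X" for c x
      unfolding p_def using that
      by (simp add: lin_on_scale[OF qlin] cscale_cscale mult.commute flip: cv.scale_sum_right)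
  qed
  have one: "(\<Sum>N\<in>S. wact X (b id N) x) = x" if "x \<in> wcar X" for x
    using lin_on_sum[OF alg_moduleD(3)[OF X that] acar_subspace, of S "b id"] basis_in[OF G_id]
      alg_moduleD(5)[OF X that] by (simp add: aone_eq)
  have pid: "p y = y" if y: "y \<in> Y" for y
  proof -
    have yX: "y \<in> wcar X" using y YX(2) by blast
    have "q g N y = wact X (b id N) y" if g: "g \<in> G" "N \<in> S" for g N
    proof -
      have "p0 (wact X (b g N) y) = wact X (b g N) y" using p0(2) YX(3)[OF basis_in[OF g] y] by blast
      then show ?thesis
        unfolding q_def using alg_moduleD(4)[OF X binv_in[OF g] basis_in[OF g] yX] binv_left[OF g] by simp
    qed
    then have "(\<Sum>g\<in>G. \<Sum>N\<in>S. q g N y) = (\<Sum>g\<in>G. y)" by (simp add: one[OF yX])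
    then show ?thesis
      unfolding p_def using card_G by (simp add: cv.sum_constant_scale cscale_cscale cscale_one)
  qed
  have pact: "p (wact X (b h K) x) = wact X (b h K) (p x)"
    if h: "h \<in> G" and K: "K \<in> S" and x: "x \<in> wcar X" for h K x
  proof -
    have hK: "tgt K h \<in> S" using tgt_in h K by simp
    note bhK = basis_in[OF h K]
    \<comment> \<open>For each \<open>g\<close> one summand survives on either side:
      \<open>N = tgt K h\<close> here, \<open>N = K\<close> in the second claim. The results differ
      by writing \<open>g \<circ> h\<close> for \<open>g\<close>, which permutes
      \<open>G\<close>.\<close>
    have 1: "(\<Sum>N\<in>S. q g N (wact X (b h K) x))
        = wact X (amul A (b h K) (binv (g \<circ> h) K)) (p0 (wact X (b (g \<circ> h) K) x))" if g: "g \<in> G" for g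
    proof -
      have gh: "g \<circ> h \<in> G" using G_comp g h .
      have "q g N (wact X (b h K) x)
          = (if N = tgt K h then wact X (amul A (b h K) (binv (g \<circ> h) K)) (p0 (wact X (b (g \<circ> h) K) x)) else 0)"
        if N: "N \<in> S" for N
      proof -
        have "wact X (b g N) (wact X (b h K) x) = wact X (amul A (b g N) (b h K)) x"
          using alg_moduleD(4)[OF X basis_in[OF g N] bhK x] by simp
        also have "\<dots> = (if N = tgt K h then cscale (\<alpha> K g h) (wact X (b (g \<circ> h) K) x) else 0)"
          using g h K N lin_on_scale[OF alg_moduleD(3)[OF X x] basis_in[OF gh K]]
            lin_on_zero[OF alg_moduleD(3)[OF X x] acar_subspace]
          by (simp add: amul_basis)
        finally have inner: "wact X (b g N) (wact X (b h K) x)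
            = (if N = tgt K h then cscale (\<alpha> K g h) (wact X (b (g \<circ> h) K) x) else 0)" .
        show ?thesis
        proof (cases "N = tgt K h")
          case True
          have "q g N (wact X (b h K) x)
              = cscale (\<alpha> K g h) (wact X (binv g (tgt K h)) (p0 (wact X (b (g \<circ> h) K) x)))"
            unfolding q_def inner using True
            by (simp add: lin_on_scale[OF p0(1)] lin_on_scale[OF alg_moduleD(2)[OF X binv_in[OF g hK]] p0X])
          also have "\<dots> = wact X (amul A (b h K) (binv (g \<circ> h) K)) (p0 (wact X (b (g \<circ> h) K) x))"
            unfolding basis_binv_comp[OF g h K]
            by (simp add: lin_on_scale[OF alg_moduleD(3)[OF X p0X] binv_in[OF g hK]])
          finally show ?thesis using True by simp
        next
          case False
          then show ?thesis
            unfolding q_def inner using lin_on_zero[OF p0(1) cv.subspace_UNIV]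
              lin_on_zero[OF alg_moduleD(2)[OF X binv_in[OF g N]] subX] by simp
        qed
      qed
      then show ?thesis using finS hK by simp
    qed
    have 2: "wact X (b h K) (\<Sum>N\<in>S. q g N x) = wact X (amul A (b h K) (binv g K)) (p0 (wact X (b g K) x))"
      if g: "g \<in> G" for g
    proof -
      have "wact X (b h K) (\<Sum>N\<in>S. q g N x) = (\<Sum>N\<in>S. wact X (b h K) (q g N x))"
        using YX(2) lin_on_in[OF qlin[OF g] x] by (intro lin_on_sum[OF alg_moduleD(2)[OF X bhK] subX]) blast
      also have "\<dots> = (\<Sum>N\<in>S. if N = K then wact X (amul A (b h K) (binv g K)) (p0 (wact X (b g K) x)) else 0)"
      proof (rule sum.cong)
        fix N assume N: "N \<in> S"
        have "wact X (b h K) (q g N x) = wact X (amul A (b h K) (binv g N)) (p0 (wact X (b g N) x))"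
          unfolding q_def using alg_moduleD(4)[OF X bhK binv_in[OF g N] p0X] by simp
        then show "wact X (b h K) (q g N x)
            = (if N = K then wact X (amul A (b h K) (binv g K)) (p0 (wact X (b g K) x)) else 0)"
          using basis_binv[OF g N h K] lin_on_zero[OF alg_moduleD(3)[OF X p0X] acar_subspace] by auto
      qed simp
      finally show ?thesis using finS K by simp
    qed
    have "(\<Sum>g\<in>G. \<Sum>N\<in>S. q g N (wact X (b h K) x))
        = (\<Sum>g\<in>G. wact X (amul A (b h K) (binv (g \<circ> h) K)) (p0 (wact X (b (g \<circ> h) K) x)))"
      using 1 by simp
    also have "\<dots> = (\<Sum>g\<in>G. wact X (amul A (b h K) (binv g K)) (p0 (wact X (b g K) x)))"
      by (rule sum_G_comp(1)[OF h, of "\<lambda>g. wact X (amul A (b h K) (binv g K)) (p0 (wact X (b g K) x))"])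
    also have "\<dots> = (\<Sum>g\<in>G. wact X (b h K) (\<Sum>N\<in>S. q g N x))"
      using 2 by simp
    also have "\<dots> = wact X (b h K) (\<Sum>g\<in>G. \<Sum>N\<in>S. q g N x)"
      using YX(2) lin_on_in[OF qlin _ ] x
      by (intro lin_on_sum[OF alg_moduleD(2)[OF X bhK] subX, symmetric] cv.subspace_sum[OF subX]) blast
    finally have "p (wact X (b h K) x)
        = cscale (1 / of_nat (card G)) (wact X (b h K) (\<Sum>g\<in>G. \<Sum>N\<in>S. q g N x))"
      by (simp add: p_def)
    also have "\<dots> = wact X (b h K) (p x)"
      unfolding p_def
    proof (rule lin_on_scale[OF alg_moduleD(2)[OF X bhK], symmetric])
      show "(\<Sum>g\<in>G. \<Sum>N\<in>S. q g N x) \<in> wcar X"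
        using YX(2) lin_on_in[OF qlin] x by (intro cv.subspace_sum[OF subX]) blast
    qed
    finally show ?thesis .
  qed
  have "p (wact X a x) = wact X a (p x)" if a: "a \<in> acar A" and x: "x \<in> wcar X" for a x
  proof (rule acar_eqI[OF _ _ a])
    show "lin_on (acar A) Y (\<lambda>a. p (wact X a x))"
      by (rule lin_on_compose[OF alg_moduleD(3)[OF X x] plin])
    show "lin_on (acar A) (wcar X) (\<lambda>a. wact X a (p x))"
      using lin_on_in[OF plin x] YX(2) by (intro alg_moduleD(3)[OF X]) blast
  qed (rule pact[OF _ _ x])
  with plin pid show ?thesis by blast
qed

lemma maschke_complement:
  fixes X :: "(('v, 'm) gs, 'x::complex_space) amod"
  assumes X: "alg_module A X" and Y: "asubmodule A X Y"
  shows "\<exists>Y'. asubmodule A X Y' \<and> Y \<inter> Y' = {0} \<and> {x + y | x y. x \<in> Y \<and> y \<in> Y'} = wcar X"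
proof -
  obtain p where p: "lin_on (wcar X) Y p" "\<forall>y\<in>Y. p y = y"
      "\<forall>a\<in>acar A. \<forall>x\<in>wcar X. p (wact X a x) = wact X a (p x)"
    using maschke[OF assms] by blast
  have YX: "cv.subspace Y" "Y \<subseteq> wcar X" "\<And>a y. a \<in> acar A \<Longrightarrow> y \<in> Y \<Longrightarrow> wact X a y \<in> Y"
    using Y by (auto simp: asubmodule_def)
  have subX: "cv.subspace (wcar X)" by (rule alg_moduleD(1)[OF X])
  let ?Y' = "{x \<in> wcar X. p x = 0}"
  have "ops_hom (acar A) (wcar X) (wact X) Y (wact X) p"
    using p by (simp add: ops_hom_def)
  then have "stable (acar A) (wact X) ?Y'"
  proof (rule ops_hom_kernel_stable[OF _ subX YX(1) alg_moduleD(2)[OF X]])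
    show "lin_on Y Y (wact X s)" if "s \<in> acar A" for s
      by (rule lin_on_mono[OF alg_moduleD(2)[OF X that] YX(2)]) (use YX(3) that in blast)
  qed
  then have "asubmodule A X ?Y'" by (auto simp: asubmodule_stable)
  moreover have "Y \<inter> ?Y' = {0}"
    using p(2) cv.subspace_0[OF YX(1)] YX(2) by auto
  moreover have "{x + y | x y. x \<in> Y \<and> y \<in> ?Y'} = wcar X"
  proof
    show "{x + y | x y. x \<in> Y \<and> y \<in> ?Y'} \<subseteq> wcar X"
      using YX(2) cv.subspace_add[OF subX] by blast
    show "wcar X \<subseteq> {x + y | x y. x \<in> Y \<and> y \<in> ?Y'}"
    proof
      fix x assume x: "x \<in> wcar X"
      have px: "p x \<in> Y" "p x \<in> wcar X" using lin_on_in[OF p(1) x] YX(2) by auto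
      have "x - p x \<in> ?Y'"
        using x px p(2) lin_on_diff[OF p(1) subX x px(2)] cv.subspace_diff[OF subX] by simp
      moreover have "x = p x + (x - p x)" by simp
      ultimately show "x \<in> {x + y | x y. x \<in> Y \<and> y \<in> ?Y'}" using px(1) by blast
    qed
  qed
  ultimately show ?thesis by blast
qed

lemma regular_module: "alg_module A \<lparr>wcar = acar A, wact = amul A\<rparr>"
  unfolding alg_module_def amod.simps
  using acar_subspace amul_assoc amul_one lin_on_mono[OF amul_lin_left] lin_on_mono[OF amul_lin_right]
  by (simp add: amul_in)

lemma semisimple_A: "semisimple_algebra A"
  unfolding semisimple_algebra_def Let_def
  using assoc_algebra_A maschke_complement[OF regular_module] by simp

lemma wact_idem: "N \<in> S \<Longrightarrow> x \<in> mcar MV \<Longrightarrow> wact MA (b id N) x = single N (x N)"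
  by (simp add: wact_basis G_id phi_id MV_comp)

text \<open>
  Averaging over \<open>G\<close> a combination of modes of \<open>V\<close> that realises an \<open>A\<close>-linear map does not change
  its action, and produces modes of the fixed points.
\<close>

theorem fixed_mode_density:
  assumes E: "asubmodule A MA E" and fE: "fin_dim E" and t: "lin_on E (mcar MV) t"
    and tact: "\<And>a x. a \<in> acar A \<Longrightarrow> x \<in> E \<Longrightarrow> t (wact MA a x) = wact MA a (t x)"
  shows "\<exists>(K::nat) u n. (\<forall>k<K. u k \<in> vcar U) \<and> (\<forall>x\<in>E. (\<Sum>k<K. mmode MV (u k) (n k) x) = t x)"
proof -
  have subE: "cv.subspace E" and EM: "E \<subseteq> mcar MV"
    and Eact: "\<And>a x. a \<in> acar A \<Longrightarrow> x \<in> E \<Longrightarrow> wact MA a x \<in> E"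
    using E by (auto simp: asubmodule_def MA_car)
  have comp: "single N (x N) \<in> E" if "x \<in> E" "N \<in> S" for x N
    using Eact[OF basis_in[OF G_id that(2)] that(1)] wact_idem[OF that(2)] that(1) EM by auto
  have tcomp: "t (single N (x N)) = single N (t x N)" if "x \<in> E" "N \<in> S" for x N
  proof -
    have "single N (x N) = wact MA (b id N) x" using wact_idem[OF that(2)] that(1) EM by auto
    then show ?thesis
      using tact[OF basis_in[OF G_id that(2)] that(1)] wact_idem[OF that(2) lin_on_in[OF t that(1)]] by simp
  qed
  \<comment> \<open>\<open>mode_density\<close> handles vectors that lie in one member of
    \<open>S\<close> each, so the basis of \<open>E\<close> is drawn from vectors with a single
    nonzero component.\<close>
  define Q where "Q = {single N (x N) | x N. x \<in> E \<and> N \<in> S}"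
  obtain B where B: "B \<subseteq> Q" "cv.independent B" "Q \<subseteq> cv.span B"
    using cv.maximal_independent_subset[of Q] by blast
  have QE: "Q \<subseteq> E" using comp unfolding Q_def by blast
  then have BE: "B \<subseteq> E" using B(1) by blast
  have finB: "finite B" by (rule fin_dim_independent_finite[OF fE B(2) BE])
  have spanB: "cv.span B = E"
  proof
    show "cv.span B \<subseteq> E" by (rule cv.span_minimal[OF BE subE])
    show "E \<subseteq> cv.span B"
    proof
      fix x assume x: "x \<in> E"
      then have "x = (\<Sum>N\<in>S. single N (x N))" using MV_expand EM by blast
      also have "\<dots> \<in> cv.span B"
        using x B(3) unfolding Q_def by (intro cv.span_sum) blast
      finally show "x \<in> cv.span B" .
    qed
  qed
  have "\<forall>d\<in>B. \<exists>N. N \<in> S \<and> d = single N (d N)"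
  proof
    fix d assume "d \<in> B"
    then obtain x N where "d = single N (x N)" "N \<in> S" using B(1) unfolding Q_def by blast
    then show "\<exists>N. N \<in> S \<and> d = single N (d N)" by (intro exI[of _ N]) simp
  qed
  from bchoice[OF this] obtain nb where nb: "\<And>d. d \<in> B \<Longrightarrow> nb d \<in> S" "\<And>d. d \<in> B \<Longrightarrow> d = single (nb d) (d (nb d))"
    by blast
  have dM: "d \<in> mcar MV" if "d \<in> B" for d using BE EM that by blast
  have "\<exists>(K::nat) v n. \<forall>d\<in>B. (\<Sum>k<K. mmode (nb d) (v k) (n k) (d (nb d))) = t d (nb d)"
  proof (rule mode_density[OF cntU finB])
    show "irreducible_twisted_module V \<sigma> (nb d)" if "d \<in> B" for d using irr nb(1) that by blast
    show "nb d = nb e" if "d \<in> B" "e \<in> B" "vmod_iso V (nb d) (nb e)" for d e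
      using ineqS nb(1) that by blast
    show "d (nb d) \<in> mcar (nb d)" if "d \<in> B" for d using MV_comp dM nb(1) that by blast
    show "t d (nb d) \<in> mcar (nb d)" if "d \<in> B" for d
      using MV_comp lin_on_in[OF t] BE nb(1) that by blast
    show "\<forall>d\<in>B. c d = 0" if e: "e \<in> B" and supp: "\<And>d. d \<in> B \<Longrightarrow> c d \<noteq> 0 \<Longrightarrow> nb d = nb e"
      and rel: "(\<Sum>d\<in>B. cscale (c d) (d (nb d))) = 0" for c e
    proof -
      have "cscale (c d) d = single (nb e) (cscale (c d) (d (nb d)))" if d: "d \<in> B" for d
      proof (cases "c d = 0")
        case False
        have "cscale (c d) d = cscale (c d) (single (nb d) (d (nb d)))"
          by (rule arg_cong[OF nb(2)[OF d]])
        with supp[OF d False] show ?thesis by (simp add: single_scale)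
      qed simp
      then have "(\<Sum>d\<in>B. cscale (c d) d) = (\<Sum>d\<in>B. single (nb e) (cscale (c d) (d (nb d))))" by simp
      also have "\<dots> = single (nb e) (\<Sum>d\<in>B. cscale (c d) (d (nb d)))"
        by (auto simp: single_def fun_eq_iff sum_fun_apply)
      also have "\<dots> = 0" by (simp add: rel)
      finally show ?thesis using cv.independentD[OF B(2) finB subset_refl] by blast
    qed
  qed
  then obtain K :: nat and v n where
    K: "\<And>d. d \<in> B \<Longrightarrow> (\<Sum>k<K. mmode (nb d) (v k) (n k) (d (nb d))) = t d (nb d)" by blast
  define L where "L = (\<lambda>g x. \<Sum>k<K. mmode MV (g (v k)) (n k) x)"
  have Llin: "lin_on (mcar MV) (mcar MV) (L g)" for g
    unfolding L_def
    by (rule lin_onI)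
      (simp_all add: cv.subspace_sum[OF MV_subspace] mmode_in[OF MV_twisted] lin_on_add[OF mmode_lin[OF MV_twisted]]
        lin_on_scale[OF mmode_lin[OF MV_twisted]] sum.distrib cv.scale_sum_right)
  have LE: "lin_on E (mcar MV) (L g)" for g
    by (rule lin_on_mono[OF Llin EM]) (use EM lin_on_in[OF Llin] in blast)
  have L1: "L id x = t x" if x: "x \<in> E" for x
  proof (rule lin_on_span_eq[of B "mcar MV" "L id" "mcar MV" t])
    show "lin_on (cv.span B) (mcar MV) (L id)" "lin_on (cv.span B) (mcar MV) t" "x \<in> cv.span B"
      using LE t x spanB by simp_all
    fix d assume d: "d \<in> B"
    have "L id d = L id (single (nb d) (d (nb d)))" using nb(2)[OF d] by simp
    also have "\<dots> = single (nb d) (\<Sum>k<K. mmode (nb d) (v k) (n k) (d (nb d)))"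
      unfolding L_def using nb(1)[OF d] by (simp add: MV_mode_single) (auto simp: single_def fun_eq_iff sum_fun_apply)
    also have "\<dots> = single (nb d) (t d (nb d))" using K[OF d] by simp
    also have "\<dots> = t (single (nb d) (d (nb d)))" using tcomp[of d "nb d"] BE d nb(1) by auto
    also have "\<dots> = t d" using nb(2)[OF d] by simp
    finally show "L id d = t d" .
  qed
  \<comment> \<open>Each basis vector \<open>d\<close> is the image under a basis element
    \<open>b g N'\<close> of some \<open>x'\<close> in \<open>E\<close>. That element turns the
    modes of \<open>v k\<close> into modes of \<open>g (v k)\<close> and commutes with
    \<open>t\<close>, so \<open>L g d\<close> is the image of \<open>L id x'\<close>, which is
    \<open>t d\<close>.\<close>
  have Lg: "L g x = t x" if g: "g \<in> G" and x: "x \<in> E" for g x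
  proof (rule lin_on_span_eq[of B "mcar MV" "L g" "mcar MV" t])
    show "lin_on (cv.span B) (mcar MV) (L g)" "lin_on (cv.span B) (mcar MV) t" "x \<in> cv.span B"
      using LE t x spanB by simp_all
    fix d assume d: "d \<in> B"
    define N' where "N' = tgt (nb d) (finv g)"
    have N': "N' \<in> S" "tgt N' g = nb d"
      using nb(1)[OF d] g by (simp_all add: N'_def tgt_in G_inv tgt_inv)
    define x' where "x' = wact MA (binv g N') d"
    have x': "x' \<in> E" unfolding x'_def using Eact binv_in[OF g N'(1)] BE d by blast
    have "wact MA (b g N') x' = wact MA (b id (nb d)) d"
      unfolding x'_def using wact_amul[OF basis_in[OF g N'(1)] binv_in[OF g N'(1)] dM[OF d]]
      by (simp add: binv_right[OF g N'(1)] N'(2))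
    also have "\<dots> = d" using wact_idem[OF nb(1)[OF d] dM[OF d]] nb(2)[OF d] by simp
    finally have d': "wact MA (b g N') x' = d" .
    have x'M: "x' \<in> mcar MV" using x' EM by blast
    have "L g d = (\<Sum>k<K. wact MA (b g N') (mmode MV (v k) (n k) x'))"
      unfolding L_def d'[symmetric] using wact_basis_mode[OF g N'(1) x'M] by simp
    also have "\<dots> = wact MA (b g N') (L id x')"
      unfolding L_def id_apply
      by (rule lin_on_sum[OF wact_lin MV_subspace, symmetric]) (rule mmode_in[OF MV_twisted x'M])
    also have "\<dots> = t d"
      using L1[OF x'] tact[OF basis_in[OF g N'(1)] x'] d' by simp
    finally show "L g d = t d" .
  qed
  define u where "u = (\<lambda>k. cscale (1 / of_nat (card G)) (\<Sum>g\<in>G. g (v k)))"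
  have "u k \<in> vcar U" for k
    unfolding U_car
  proof
    fix h assume h: "h \<in> G"
    have "h (u k) = cscale (1 / of_nat (card G)) (\<Sum>g\<in>G. (h \<circ> g) (v k))"
      unfolding u_def by (simp add: lin_on_scale[OF G_lin[OF h]] lin_on_sum[OF G_lin[OF h]])
    also have "\<dots> = u k"
      unfolding u_def using sum_G_comp(2)[OF h, of "\<lambda>g. g (v k)"] by simp
    finally show "h (u k) = u k" .
  qed
  moreover have "(\<Sum>k<K. mmode MV (u k) (n k) x) = t x" if x: "x \<in> E" for x
  proof -
    have xM: "x \<in> mcar MV" using x EM by blast
    have "(\<Sum>k<K. mmode MV (u k) (n k) x)
        = (\<Sum>k<K. cscale (1 / of_nat (card G)) (\<Sum>g\<in>G. mmode MV (g (v k)) (n k) x))"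
      unfolding u_def
      by (simp add: lin_on_scale[OF mmode_lin_v[OF MV_twisted xM]] mmode_sum_v[OF MV_twisted xM])
    also have "\<dots> = cscale (1 / of_nat (card G)) (\<Sum>g\<in>G. L g x)"
      unfolding L_def cv.scale_sum_right[symmetric] by (subst sum.swap) simp
    also have "(\<Sum>g\<in>G. L g x) = (\<Sum>g\<in>G. t x)" using Lg x by simp
    also have "cscale (1 / of_nat (card G)) \<dots> = t x"
      using card_G by (simp add: cv.sum_constant_scale cscale_cscale cscale_one)
    finally show ?thesis .
  qed
  ultimately show ?thesis by blast
qed

end

section \<open>Multiplicity spaces\<close>

lemma direct_sum_subspace:
  assumes "\<And>i. i \<in> I \<Longrightarrow> cv.subspace (X i)"
  shows "cv.subspace (direct_sum I X)"
proof (rule cv.subspaceI)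
  show "0 \<in> direct_sum I X"
    using cv.subspace_0[OF assms] by (simp add: direct_sum_def)
  show "x + y \<in> direct_sum I X" if "x \<in> direct_sum I X" "y \<in> direct_sum I X" for x y
  proof -
    have "finite {i. (x + y) i \<noteq> 0}"
      by (rule finite_subset[of _ "{i. x i \<noteq> 0} \<union> {i. y i \<noteq> 0}"])
        (use that in \<open>auto simp: direct_sum_def\<close>)
    with that show ?thesis using cv.subspace_add[OF assms] by (simp add: direct_sum_def)
  qed
  show "cscale c x \<in> direct_sum I X" if "x \<in> direct_sum I X" for c x
  proof -
    have "finite {i. (cscale c x) i \<noteq> 0}"
      by (rule finite_subset[of _ "{i. x i \<noteq> 0}"]) (use that in \<open>auto simp: direct_sum_def\<close>)
    with that show ?thesis using cv.subspace_scale[OF assms] by (simp add: direct_sum_def)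
  qed
qed

lemma pure_tensor_lin_left:
  assumes F: "F \<subseteq> bilinear_forms D W" and m: "w \<in> W"
  shows "lin_on D UNIV (\<lambda>d. pure_tensor F d w)"
proof (rule lin_onI)
  have l: "lin_on D UNIV (\<lambda>d. \<beta> d w)" if "\<beta> \<in> F" for \<beta>
  proof -
    have "\<beta> \<in> bilinear_forms D W" using F that by (rule subsetD)
    then show ?thesis using m by (simp add: bilinear_forms_def)
  qed
  show "pure_tensor F (d + d') w = pure_tensor F d w + pure_tensor F d' w" if x: "d \<in> D" "d' \<in> D" for d d'
  proof
    fix \<beta>
    show "pure_tensor F (d + d') w \<beta> = (pure_tensor F d w + pure_tensor F d' w) \<beta>"
      using lin_on_add[OF l x, of \<beta>] by (simp add: pure_tensor_def)
  qed
  show "pure_tensor F (cscale c d) w = cscale c (pure_tensor F d w)" if x: "d \<in> D" for c d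
  proof
    fix \<beta>
    show "pure_tensor F (cscale c d) w \<beta> = (cscale c (pure_tensor F d w)) \<beta>"
      using lin_on_scale[OF l x, of \<beta> c] by (simp add: pure_tensor_def)
  qed
qed simp

lemma pure_tensor_lin_right:
  assumes F: "F \<subseteq> bilinear_forms D W" and m: "d \<in> D"
  shows "lin_on W UNIV (pure_tensor F d)"
proof (rule lin_onI)
  have l: "lin_on W UNIV (\<lambda>w. \<beta> d w)" if "\<beta> \<in> F" for \<beta>
  proof -
    have "\<beta> \<in> bilinear_forms D W" using F that by (rule subsetD)
    then show ?thesis using m by (simp add: bilinear_forms_def)
  qed
  show "pure_tensor F d (w + w') = pure_tensor F d w + pure_tensor F d w'" if x: "w \<in> W" "w' \<in> W" for w w'
  proof
    fix \<beta>
    show "pure_tensor F d (w + w') \<beta> = (pure_tensor F d w + pure_tensor F d w') \<beta>"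
      using lin_on_add[OF l x, of \<beta>] by (simp add: pure_tensor_def)
  qed
  show "pure_tensor F d (cscale c w) = cscale c (pure_tensor F d w)" if x: "w \<in> W" for c w
  proof
    fix \<beta>
    show "pure_tensor F d (cscale c w) \<beta> = (cscale c (pure_tensor F d w)) \<beta>"
      using lin_on_scale[OF l x, of \<beta> c] by (simp add: pure_tensor_def)
  qed
qed simp

lemma pure_tensor_in: "d \<in> D \<Longrightarrow> w \<in> W \<Longrightarrow> pure_tensor F d w \<in> tensor_space F D W"
  unfolding tensor_space_def by (rule cv.span_base) blast

lemma tensor_space_subspace: "cv.subspace (tensor_space F D W)"
  by (simp add: tensor_space_def cv.subspace_span)

lemma tensor_map_lin: "lin_on UNIV UNIV (tensor_map F f g)"
  by (rule lin_onI) (auto simp: tensor_map_def fun_eq_iff)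

lemma tensor_map_pure:
  assumes "\<And>\<beta>. \<beta> \<in> F \<Longrightarrow> (\<lambda>d w. \<beta> (f d) (g w)) \<in> F"
  shows "tensor_map F f g (pure_tensor F d w) = pure_tensor F (f d) (g w)"
  using assms by (auto simp: tensor_map_def pure_tensor_def fun_eq_iff)

lemma tensor_space_eqI:
  assumes "lin_on (tensor_space F D W) X f" "lin_on (tensor_space F D W) Y g" "t \<in> tensor_space F D W"
    and "\<And>d w. d \<in> D \<Longrightarrow> w \<in> W \<Longrightarrow> f (pure_tensor F d w) = g (pure_tensor F d w)"
  shows "f t = g t"
proof (rule lin_on_span_eq[of "{pure_tensor F d w | d w. d \<in> D \<and> w \<in> W}" X f Y g t])
  show "lin_on (cv.span {pure_tensor F d w | d w. d \<in> D \<and> w \<in> W}) X f"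
    "lin_on (cv.span {pure_tensor F d w | d w. d \<in> D \<and> w \<in> W}) Y g"
    "t \<in> cv.span {pure_tensor F d w | d w. d \<in> D \<and> w \<in> W}"
    using assms(1-3) by (simp_all only: tensor_space_def)
  show "f b = g b" if "b \<in> {pure_tensor F d w | d w. d \<in> D \<and> w \<in> W}" for b
    using that assms(4) by blast
qed

lemma tensor_space_map_in:
  assumes "lin_on (tensor_space F D W) X f" "cv.subspace Y" "t \<in> tensor_space F D W"
    and "\<And>d w. d \<in> D \<Longrightarrow> w \<in> W \<Longrightarrow> f (pure_tensor F d w) \<in> Y"
  shows "f t \<in> Y"
proof (rule lin_on_span_in[of "{pure_tensor F d w | d w. d \<in> D \<and> w \<in> W}" X f Y t])
  show "lin_on (cv.span {pure_tensor F d w | d w. d \<in> D \<and> w \<in> W}) X f"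
    "t \<in> cv.span {pure_tensor F d w | d w. d \<in> D \<and> w \<in> W}"
    using assms(1,3) by (simp_all only: tensor_space_def)
  show "f b \<in> Y" if "b \<in> {pure_tensor F d w | d w. d \<in> D \<and> w \<in> W}" for b
    using that assms(4) by blast
qed (fact assms(2))

text \<open>Normal form over a basis of the first factor. It reduces injectivity of the evaluation
  map to density in the algebra.\<close>

lemma tensor_basis_expand:
  assumes B: "finite B" "cv.independent B" and N: "cv.subspace N"
    and "t \<in> tensor_space (bilinear_forms (cv.span B) N) (cv.span B) N"
  shows "\<exists>h. (\<forall>b\<in>B. h b \<in> N) \<and> t = (\<Sum>b\<in>B. pure_tensor (bilinear_forms (cv.span B) N) b (h b))"
proof -
  let ?F = "bilinear_forms (cv.span B) N"
  have BW: "b \<in> cv.span B" if "b \<in> B" for b using that by (rule cv.span_base)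
  from assms(4) show ?thesis
    unfolding tensor_space_def
  proof (induction rule: cv.span_induct_alt)
    case base
    show ?case
      using lin_on_zero[OF pure_tensor_lin_right[OF order_refl BW, where W = N] N] cv.subspace_0[OF N]
      by (intro exI[of _ "\<lambda>_. 0"]) simp
  next
    case (step c x y)
    then obtain h d w where h: "\<forall>b\<in>B. h b \<in> N" "y = (\<Sum>b\<in>B. pure_tensor ?F b (h b))"
      and x: "x = pure_tensor ?F d w" "d \<in> cv.span B" "w \<in> N" by blast
    let ?r = "cv.representation B d"
    have "d = (\<Sum>b\<in>B. cscale (?r b) b)"
      using cv.sum_representation_eq[OF B(2) x(2) B(1)] by simp
    then have "x = pure_tensor ?F (\<Sum>b\<in>B. cscale (?r b) b) w" using x(1) by simp
    also have "\<dots> = (\<Sum>b\<in>B. pure_tensor ?F (cscale (?r b) b) w)"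
      by (rule lin_on_sum[OF pure_tensor_lin_left[OF order_refl x(3)]])
        (auto intro: cv.span_scale BW)
    also have "\<dots> = (\<Sum>b\<in>B. cscale (?r b) (pure_tensor ?F b w))"
      by (intro sum.cong refl lin_on_scale[OF pure_tensor_lin_left[OF order_refl x(3)]] BW)
    finally have x': "x = (\<Sum>b\<in>B. cscale (?r b) (pure_tensor ?F b w))" .
    have "cscale c x + y = (\<Sum>b\<in>B. cscale c (cscale (?r b) (pure_tensor ?F b w)) + pure_tensor ?F b (h b))"
      unfolding x' h(2) by (simp add: cv.scale_sum_right sum.distrib)
    also have "\<dots> = (\<Sum>b\<in>B. pure_tensor ?F b (cscale (c * ?r b) w + h b))"
    proof (rule sum.cong)
      fix b assume b: "b \<in> B"
      note l = pure_tensor_lin_right[OF order_refl BW[OF b], where W = N]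
      show "cscale c (cscale (?r b) (pure_tensor ?F b w)) + pure_tensor ?F b (h b)
          = pure_tensor ?F b (cscale (c * ?r b) w + h b)"
        using lin_on_add[OF l cv.subspace_scale[OF N x(3)], of "h b" "c * ?r b"] lin_on_scale[OF l x(3)] h(1) b
        by (simp add: cscale_cscale)
    qed simp
    finally show ?case
      using h(1) x(3) by (intro exI[of _ "\<lambda>b. cscale (c * ?r b) w + h b"])
        (simp add: cv.subspace_add[OF N] cv.subspace_scale[OF N])
  qed
qed

lemma single_direct_sum:
  assumes "i \<in> I" "x \<in> X i" "\<And>k. k \<in> I \<Longrightarrow> 0 \<in> X k"
  shows "single i x \<in> direct_sum I X"
proof -
  have "finite {k. single i x k \<noteq> 0}"
    by (rule finite_subset[of _ "{i}"]) (auto simp: single_def)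
  with assms show ?thesis by (auto simp: direct_sum_def single_def)
qed

section \<open>Multiplicity spaces as modules over the fixed points\<close>

context orbifold
begin

abbreviation "homs Y \<equiv> hom_vmod A Y MA MV"

lemma homs_car: "mcar (homs Y) = amod_hom A Y MA"
  by (simp add: hom_vmod_def)

lemma homs_mode: "mmode (homs Y) v n f = (\<lambda>w. if w \<in> wcar Y then mmode MV v n (f w) else 0)"
  by (simp add: hom_vmod_def)

lemma homs_iff: "f \<in> amod_hom A Y MA \<longleftrightarrow>
    ops_hom (acar A) (wcar Y) (wact Y) (mcar MV) (wact MA) f \<and> (\<forall>w. w \<notin> wcar Y \<longrightarrow> f w = 0)"
  by (auto simp: amod_hom_def ops_hom_def MA_car)

lemma
  assumes "f \<in> amod_hom A Y MA"
  shows homs_lin: "lin_on (wcar Y) (mcar MV) f"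
    and homs_in: "w \<in> wcar Y \<Longrightarrow> f w \<in> mcar MV"
    and homs_off: "w \<notin> wcar Y \<Longrightarrow> f w = 0"
    and homs_act: "a \<in> acar A \<Longrightarrow> w \<in> wcar Y \<Longrightarrow> f (wact Y a w) = wact MA a (f w)"
  using assms by (auto simp: amod_hom_def MA_car lin_on_def)

lemma homsI:
  assumes "ops_hom (acar A) (wcar Y) (wact Y) (mcar MV) (wact MA) f" "alg_module A Y"
  shows "(\<lambda>w. if w \<in> wcar Y then f w else 0) \<in> amod_hom A Y MA"
  using assms unfolding homs_iff ops_hom_def
  by (simp add: lin_on_def cv.subspace_add[OF alg_moduleD(1)] cv.subspace_scale[OF alg_moduleD(1)]
      lin_on_in[OF alg_moduleD(2)])

lemma homs_subspace:
  assumes Y: "alg_module A Y"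
  shows "cv.subspace (amod_hom A Y MA)"
proof (rule cv.subspaceI)
  show "0 \<in> amod_hom A Y MA"
    using lin_on_zero[OF wact_lin MV_subspace] cv.subspace_0[OF MV_subspace]
    by (simp add: amod_hom_def MA_car lin_on_def)
  show "f + g \<in> amod_hom A Y MA" if "f \<in> amod_hom A Y MA" "g \<in> amod_hom A Y MA" for f g
    using that unfolding amod_hom_def MA_car lin_on_def
    by (simp add: cv.subspace_add[OF MV_subspace] lin_on_add[OF wact_lin] cscale_add_right)
  show "cscale c f \<in> amod_hom A Y MA" if "f \<in> amod_hom A Y MA" for c f
    using that unfolding amod_hom_def MA_car lin_on_def
    by (simp add: cv.subspace_scale[OF MV_subspace] lin_on_scale[OF wact_lin] cscale_add_right cscale_cscale mult.commute)
qed

lemma homs_mode_in: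
  assumes Y: "alg_module A Y" and v: "v \<in> vcar U" and f: "f \<in> amod_hom A Y MA"
  shows "mmode (homs Y) v n f \<in> amod_hom A Y MA"
  unfolding homs_mode
proof (rule homsI[OF _ Y], unfold ops_hom_def, intro conjI ballI)
  show "lin_on (wcar Y) (mcar MV) (\<lambda>w. mmode MV v n (f w))"
    by (rule lin_on_compose[OF homs_lin[OF f] mmode_lin[OF MV_twisted]])
  show "mmode MV v n (f (wact Y s x)) = wact MA s (mmode MV v n (f x))" if "s \<in> acar A" "x \<in> wcar Y" for s x
    using that wact_fixed_mode[OF that(1) v homs_in[OF f that(2)]] homs_act[OF f that] by simp
qed

lemma U_trunc: "\<exists>N. \<forall>n\<ge>N. vmode U u n v = 0"
  using V_trunc by simp

text \<open>A homomorphism is a family indexed by the vectors of \<open>W\<close>, on which modes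
  act value by value. Truncation uniform over all of \<open>W\<close> comes from a finite basis of
  \<open>W\<close>. The algebra \<open>R\<close> is left general so that both \<open>A\<close> and
  the twisted group algebras are covered.\<close>

theorem hom_va_module:
  fixes R :: "'a alg" and W :: "('a, 'w::complex_space) amod" and X :: "('a, 'x::complex_space) amod"
    and N :: "('v, 'x) vmod"
  assumes N: "va_module U N" and car: "wcar X = mcar N" and fin: "fin_dim (wcar W)"
    and sub: "cv.subspace (amod_hom R W X)"
    and closed: "\<And>v n f. v \<in> vcar U \<Longrightarrow> f \<in> amod_hom R W X \<Longrightarrow> mmode (hom_vmod R W X N) v n f \<in> amod_hom R W X"
  shows "va_module U (hom_vmod R W X N)"
proof -
  obtain B where B: "finite B" "B \<subseteq> wcar W" "cv.independent B" "cv.span B = wcar W"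
    by (rule fin_dim_basis[OF fin])
  have tN: "twisted_module U id N" using N by (simp only: va_module_def)
  have lin: "lin_on (wcar W) (mcar N) f" and off: "w \<notin> wcar W \<Longrightarrow> f w = 0" if "f \<in> amod_hom R W X" for f w
    using that by (auto simp: amod_hom_def car)
  have "hom_vmod R W X N = \<lparr>mcar = amod_hom R W X,
      mmode = (\<lambda>v n f w. if w \<in> wcar W then mmode N v n (f w) else 0)\<rparr>"
    by (simp add: hom_vmod_def)
  moreover have "twisted_module U id \<lparr>mcar = amod_hom R W X,
      mmode = (\<lambda>v n f w. if w \<in> wcar W then mmode N v n (f w) else 0)\<rparr>"
  proof (rule pointwise_twisted_module[OF U_subspace _ U_trunc, where M = "\<lambda>_. N"])
    show "vac U \<in> vcar U" using U_vac by simp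
    show "(\<lambda>w. if w \<in> wcar W then mmode N v n (f w) else 0) \<in> amod_hom R W X"
      if "v \<in> vcar U" "f \<in> amod_hom R W X" for v n f
      using closed[OF that] by (simp add: hom_vmod_def)
    show "\<exists>N'. \<forall>l\<ge>N'. \<forall>w\<in>wcar W. mmode N v l (f w) = 0" if v: "v \<in> vcar U" and f: "f \<in> amod_hom R W X" for v f
    proof -
      have "\<exists>N'. \<forall>l\<ge>N'. mmode N v l x = 0" if "x \<in> mcar N" for x
        using twisted_moduleD(6)[OF tN, of 0 v x] v that by simp
      then have "\<forall>w\<in>B. \<exists>N'. \<forall>l\<ge>N'. mmode N v l (f w) = 0"
        using lin_on_in[OF lin[OF f]] B(2) by blast
      from bchoice[OF this] obtain c where c: "\<forall>w\<in>B. \<forall>l\<ge>c w. mmode N v l (f w) = 0" by blast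
      define N' where "N' = Max (insert 0 (c ` B))"
      have le: "c w \<le> N'" if "w \<in> B" for w unfolding N'_def using that B(1) by (intro Max_ge) auto
      have "mmode N v l (f w) = 0" if l: "N' \<le> l" and w: "w \<in> wcar W" for l w
      proof -
        have zero: "lin_on (cv.span B) UNIV (\<lambda>_. 0 :: 'x)" by (simp add: lin_on_def)
        have comp: "lin_on (cv.span B) (mcar N) (\<lambda>w. mmode N v l (f w))"
          unfolding B(4) by (rule lin_on_compose[OF lin[OF f] twisted_moduleD(2)[OF tN v]])
        have "mmode N v l (f d) = 0" if d: "d \<in> B" for d
        proof -
          have "c d \<le> l" using le[OF d] l by simp
          then show ?thesis using c d by blast
        qed
        from lin_on_span_eq[OF comp zero this, of w] show ?thesis
          using w B(4) by simp
      qed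
      then show ?thesis by blast
    qed
    show "x i \<in> mcar N" if "x \<in> amod_hom R W X" "i \<in> wcar W" for x i using lin_on_in[OF lin] that by blast
    show "x i = 0" if "x \<in> amod_hom R W X" "i \<notin> wcar W" for x i using off that by blast
  qed (simp_all add: tN sub)
  ultimately show ?thesis unfolding va_module_def by metis
qed

lemma homs_va_module:
  assumes simple: "simple_amod A Y"
  shows "va_module U (homs Y)"
proof -
  have Y: "alg_module A Y" using simple by (simp add: simple_amod_def)
  show ?thesis
    by (rule hom_va_module[OF twisted_va_module[OF MV_twisted] MA_car
          simple_amod_fin_dim[OF fd_alg_A simple] homs_subspace[OF Y] homs_mode_in[OF Y]])
qed

text \<open>Write \<open>Y\<close> as \<open>A y\<close>. The annihilator of \<open>y\<close> is a
  left ideal with an \<open>A\<close>-linear projection \<open>p\<close>, and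
  \<open>q = 1 - p\<close> depends on \<open>a\<close> only through \<open>a y\<close>, so it embeds
  \<open>Y\<close> into \<open>A\<close>. Since \<open>q(1)\<close> is nonzero, faithfulness gives
  an \<open>x\<close> on which it acts nontrivially; sending \<open>a y\<close> to
  \<open>q(a) x\<close> is the homomorphism wanted.\<close>

theorem homs_nonzero:
  assumes simple: "simple_amod A Y"
  shows "\<exists>f\<in>amod_hom A Y MA. f \<noteq> 0"
proof -
  have Y: "alg_module A Y" using simple by (simp add: simple_amod_def)
  obtain y where y: "y \<in> wcar Y" "y \<noteq> 0" by (rule simple_amod_nonzero[OF simple])
  let ?R = "\<lparr>wcar = acar A, wact = amul A\<rparr>"
  let ?Ann = "{a \<in> acar A. wact Y a y = 0}"
  have "ops_hom (acar A) (acar A) (amul A) (wcar Y) (wact Y) (\<lambda>a. wact Y a y)"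
    using alg_moduleD(3)[OF Y y(1)] alg_moduleD(4)[OF Y _ _ y(1)] by (simp add: ops_hom_def)
  then have "stable (acar A) (amul A) ?Ann"
    by (rule ops_hom_kernel_stable)
      (auto intro: acar_subspace alg_moduleD[OF Y] lin_on_mono[OF amul_lin_right] amul_in)
  then have "asubmodule A ?R ?Ann" by (auto simp: asubmodule_stable)
  from maschke[OF regular_module this] obtain p where
    p: "lin_on (acar A) ?Ann p" "\<And>a. a \<in> ?Ann \<Longrightarrow> p a = a"
      "\<And>a c. a \<in> acar A \<Longrightarrow> c \<in> acar A \<Longrightarrow> p (amul A a c) = amul A a (p c)" by auto
  have pA: "p a \<in> acar A" if "a \<in> acar A" for a using lin_on_in[OF p(1) that] by simp
  define q where "q = (\<lambda>a. a - p a)"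
  have qA: "q a \<in> acar A" if "a \<in> acar A" for a
    unfolding q_def using that pA by (intro cv.subspace_diff[OF acar_subspace])
  have qlin: "lin_on (acar A) (acar A) q"
    by (rule lin_onI[OF qA])
      (simp_all add: q_def lin_on_add[OF p(1)] lin_on_scale[OF p(1)] cv.scale_right_diff_distrib)
  have qact: "q (amul A a c) = amul A a (q c)" if "a \<in> acar A" "c \<in> acar A" for a c
    unfolding q_def using that p(3) lin_on_diff[OF amul_lin_right cv.subspace_UNIV] by simp
  have qeq: "q a = q c" if "a \<in> acar A" "c \<in> acar A" "wact Y a y = wact Y c y" for a c
  proof -
    have "a - c \<in> ?Ann"
      using that lin_on_diff[OF alg_moduleD(3)[OF Y y(1)] acar_subspace] by (simp add: cv.subspace_diff[OF acar_subspace])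
    then have "q (a - c) = 0" unfolding q_def using p(2) by simp
    then show ?thesis using lin_on_diff[OF qlin acar_subspace that(1,2)] by simp
  qed
  have "q (aone A) \<noteq> 0"
  proof
    assume "q (aone A) = 0"
    then have "aone A = p (aone A)" by (simp add: q_def)
    then have "aone A \<in> ?Ann" using lin_on_in[OF p(1) aone_in] by simp
    then show False using alg_moduleD(5)[OF Y y(1)] y(2) by simp
  qed
  then obtain x where x: "x \<in> mcar MV" "wact MA (q (aone A)) x \<noteq> 0"
    using MA_faithful[OF qA[OF aone_in]] by blast
  have ex: "\<exists>a. a \<in> acar A \<and> wact Y a y = w" if "w \<in> wcar Y" for w
  proof -
    have "w \<in> (\<lambda>a. wact Y a y) ` acar A"
      using that simple_amod_cyclic[OF fd_alg_A simple y] by (simp only:)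
    then show ?thesis by (rule imageE) (intro exI conjI, assumption, rule sym)
  qed
  define f where "f = (\<lambda>w. wact MA (q (SOME a. a \<in> acar A \<and> wact Y a y = w)) x)"
  have f: "f (wact Y a y) = wact MA (q a) x" if "a \<in> acar A" for a
  proof -
    let ?c = "SOME c. c \<in> acar A \<and> wact Y c y = wact Y a y"
    have "?c \<in> acar A \<and> wact Y ?c y = wact Y a y"
      by (rule someI[of "\<lambda>c. c \<in> acar A \<and> wact Y c y = wact Y a y" a]) (simp add: that)
    then have "q ?c = q a" using that by (intro qeq) auto
    then show ?thesis by (simp add: f_def)
  qed
  have "ops_hom (acar A) (wcar Y) (wact Y) (mcar MV) (wact MA) f"
    unfolding ops_hom_def
  proof (intro conjI ballI lin_onI)
    fix w assume "w \<in> wcar Y"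
    then obtain a where a: "a \<in> acar A" "w = wact Y a y" using ex by blast
    show "f w \<in> mcar MV" unfolding a(2) f[OF a(1)] by (rule wact_in[OF x(1)])
    show "f (cscale c w) = cscale c (f w)" for c
      using lin_on_scale[OF alg_moduleD(3)[OF Y y(1)] a(1), of c] f[OF cv.subspace_scale[OF acar_subspace a(1), of c]]
      by (simp add: a f lin_on_scale[OF qlin] lin_on_scale[OF wact_lin_alg])
    show "f (wact Y s w) = wact MA s (f w)" if s: "s \<in> acar A" for s
      using f[OF amul_in[of s a]] alg_moduleD(4)[OF Y s a(1) y(1)] wact_amul[OF s qA[OF a(1)] x(1)]
      by (simp add: a f qact s)
    fix w' assume "w' \<in> wcar Y"
    then obtain a' where a': "a' \<in> acar A" "w' = wact Y a' y" using ex by blast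
    show "f (w + w') = f w + f w'"
      using lin_on_add[OF alg_moduleD(3)[OF Y y(1)] a(1) a'(1)] f[OF cv.subspace_add[OF acar_subspace a(1) a'(1)]]
      by (simp add: a a' f lin_on_add[OF qlin] lin_on_add[OF wact_lin_alg])
  qed
  from homsI[OF this Y] have "(\<lambda>w. if w \<in> wcar Y then f w else 0) \<in> amod_hom A Y MA" .
  moreover have "f y \<noteq> 0"
    using f[OF aone_in] alg_moduleD(5)[OF Y y(1)] x(2) by simp
  then have "(\<lambda>w. if w \<in> wcar Y then f w else 0) \<noteq> 0"
    using y(1) by (auto simp: fun_eq_iff)
  ultimately show ?thesis by blast
qed

lemma homs_injective:
  assumes simple: "simple_amod A Y" and f: "f \<in> amod_hom A Y MA" "f \<noteq> 0"
  shows "inj_on f (wcar Y)"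
proof (rule inj_on_lin_on[OF homs_lin[OF f(1)]])
  have Y: "alg_module A Y" using simple by (simp add: simple_amod_def)
  show "cv.subspace (wcar Y)" by (rule alg_moduleD(1)[OF Y])
  have "stable (acar A) (wact Y) {x \<in> wcar Y. f x = 0}"
    using f(1) by (intro ops_hom_kernel_stable[where act' = "wact MA"])
      (auto simp: homs_iff intro: alg_moduleD[OF Y] MV_subspace wact_lin)
  then have "{x \<in> wcar Y. f x = 0} = {0} \<or> {x \<in> wcar Y. f x = 0} = wcar Y"
    using simple by (auto simp: simple_amod_def asubmodule_stable)
  moreover have "{x \<in> wcar Y. f x = 0} \<noteq> wcar Y"
    using f(2) homs_off[OF f(1)] by (auto simp: fun_eq_iff)
  ultimately show "x = 0" if "x \<in> wcar Y" "f x = 0" for x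
    using that by blast
qed

lemma homs_image:
  assumes simple: "simple_amod A Y" and f: "f \<in> amod_hom A Y MA"
  shows "asubmodule A MA (f ` wcar Y)" "fin_dim (f ` wcar Y)"
proof -
  have Y: "alg_module A Y" using simple by (simp add: simple_amod_def)
  have "stable (acar A) (wact Y) (wcar Y)"
    using alg_moduleD(1,2)[OF Y] by (auto intro: stableI lin_on_in)
  with f have "stable (acar A) (wact MA) (f ` wcar Y)"
    by (intro ops_hom_image_stable[where X = "wcar Y"]) (auto simp: homs_iff)
  then show "asubmodule A MA (f ` wcar Y)"
    using homs_in[OF f] by (auto simp: asubmodule_stable MA_car)
  show "fin_dim (f ` wcar Y)"
    by (rule fin_dim_image[OF simple_amod_fin_dim[OF fd_alg_A simple] homs_lin[OF f]])
qed

text \<open>Given \<open>f \<noteq> 0\<close> in a submodule and any \<open>f'\<close>, the map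
  sending \<open>f y\<close> to \<open>f' y\<close> is well defined and \<open>A\<close>-linear on
  the finite-dimensional submodule \<open>f(Y)\<close>. By \<open>fixed_mode_density\<close> it is a
  combination of modes of \<open>U\<close>, and this combination takes \<open>f\<close> to
  \<open>f'\<close>.\<close>

theorem homs_irreducible:
  assumes simple: "simple_amod A Y"
  shows "irreducible_vmod U (homs Y)"
  unfolding irreducible_vmod_def homs_car
proof (intro conjI allI impI)
  have Y: "alg_module A Y" using simple by (simp add: simple_amod_def)
  show "amod_hom A Y MA \<noteq> {0}" using homs_nonzero[OF simple] by blast
  fix N assume N: "vsubmodule U (homs Y) N"
  then have sub: "cv.subspace N" and NH: "N \<subseteq> amod_hom A Y MA"
    and Nact: "\<And>v n f. v \<in> vcar U \<Longrightarrow> f \<in> N \<Longrightarrow> mmode (homs Y) v n f \<in> N"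
    by (auto simp: vsubmodule_def homs_car)
  show "N = {0} \<or> N = amod_hom A Y MA"
  proof (rule disjCI)
    assume "N \<noteq> amod_hom A Y MA"
    then obtain f' where f': "f' \<in> amod_hom A Y MA" "f' \<notin> N" using NH by blast
    show "N = {0}"
    proof (rule ccontr)
      assume "N \<noteq> {0}"
      then obtain f where fN: "f \<in> N" and f0: "f \<noteq> 0" using cv.subspace_0[OF sub] by blast
      have f: "f \<in> amod_hom A Y MA" using NH fN by blast
      note inj = homs_injective[OF simple f f0]
      let ?g = "inv_into (wcar Y) f"
      have bij: "bij_betw f (wcar Y) (f ` wcar Y)" using inj by (simp add: bij_betw_def)
      have fl: "lin_on (wcar Y) (f ` wcar Y) f" using homs_lin[OF f] by (simp add: lin_on_def)
      have gl: "lin_on (f ` wcar Y) (wcar Y) ?g"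
        by (rule lin_on_inv_into[OF bij fl alg_moduleD(1)[OF Y]])
      have "\<exists>(K::nat) u n. (\<forall>k<K. u k \<in> vcar U) \<and>
          (\<forall>x\<in>f ` wcar Y. (\<Sum>k<K. mmode MV (u k) (n k) x) = f' (?g x))"
      proof (rule fixed_mode_density[OF homs_image[OF simple f]])
        show "lin_on (f ` wcar Y) (mcar MV) (\<lambda>x. f' (?g x))"
          by (rule lin_on_compose[OF gl homs_lin[OF f'(1)]])
        fix a x assume a: "a \<in> acar A" and "x \<in> f ` wcar Y"
        then obtain y where y: "y \<in> wcar Y" "x = f y" by blast
        have ay: "wact Y a y \<in> wcar Y" using lin_on_in[OF alg_moduleD(2)[OF Y a] y(1)] .
        have "wact MA a x = f (wact Y a y)" using homs_act[OF f a y(1)] y(2) by simp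
        then show "f' (?g (wact MA a x)) = wact MA a (f' (?g x))"
          using inj y ay homs_act[OF f'(1) a y(1)] by simp
      qed
      then obtain K :: nat and u n where K: "\<And>k. k < K \<Longrightarrow> u k \<in> vcar U"
        "\<And>x. x \<in> f ` wcar Y \<Longrightarrow> (\<Sum>k<K. mmode MV (u k) (n k) x) = f' (?g x)" by blast
      have "(\<Sum>k<K. mmode (homs Y) (u k) (n k) f) w = f' w" for w
        using K(2)[of "f w"] inj homs_off[OF f'(1), of w]
        by (cases "w \<in> wcar Y") (simp_all add: homs_mode sum_fun_apply)
      then have "f' = (\<Sum>k<K. mmode (homs Y) (u k) (n k) f)" by (simp add: fun_eq_iff)
      also have "\<dots> \<in> N" using K(1) fN by (intro cv.subspace_sum[OF sub] Nact) auto
      finally show False using f'(2) by simp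
    qed
  qed
qed

text \<open>For an isomorphism \<open>\<psi>\<close> of multiplicity spaces put
  \<open>f' = \<psi> f\<close>. If \<open>Y\<close> and \<open>Z\<close> are not isomorphic, the
  \<open>A\<close>-linear projection onto the image of \<open>f\<close> kills the image of
  \<open>f'\<close>. Realised by modes of \<open>U\<close>, it fixes \<open>f\<close> and kills
  \<open>f'\<close>, whereas \<open>\<psi>\<close> commutes with it.\<close>

theorem homs_inequivalent:
  fixes Y :: "(('v, 'm) gs, 'y::complex_space) amod" and Z :: "(('v, 'm) gs, 'z::complex_space) amod"
  assumes simpleY: "simple_amod A Y" and simpleZ: "simple_amod A Z"
    and iso: "vmod_iso U (homs Y) (homs Z)"
  shows "amod_iso A Y Z"
proof (rule ccontr)
  assume neq: "\<not> amod_iso A Y Z"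
  have Y: "alg_module A Y" and Z: "alg_module A Z" using simpleY simpleZ by (simp_all add: simple_amod_def)
  have neq': "\<not> amod_iso A Z Y" using amod_iso_sym[OF Z] neq by blast
  obtain \<psi> where \<psi>: "vmod_hom_iso U (homs Y) (homs Z) \<psi>" using iso by (auto simp: vmod_iso_def)
  then have \<psi>l: "lin_on (amod_hom A Y MA) (amod_hom A Z MA) \<psi>"
    and \<psi>m: "\<And>v n f. v \<in> vcar U \<Longrightarrow> f \<in> amod_hom A Y MA \<Longrightarrow>
        \<psi> (mmode (homs Y) v n f) = mmode (homs Z) v n (\<psi> f)"
    by (auto simp: vmod_hom_iso_def homs_car)
  obtain f where f: "f \<in> amod_hom A Y MA" "f \<noteq> 0" using homs_nonzero[OF simpleY] by blast
  define f' where "f' = \<psi> f"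
  have f': "f' \<in> amod_hom A Z MA" using lin_on_in[OF \<psi>l f(1)] by (simp add: f'_def)
  have f'0: "f' \<noteq> 0"
  proof
    assume "f' = 0"
    moreover have "\<psi> 0 = 0" by (rule lin_on_zero[OF \<psi>l homs_subspace[OF Y]])
    moreover have "inj_on \<psi> (amod_hom A Y MA)" using \<psi> by (simp add: vmod_hom_iso_def homs_car bij_betw_def)
    ultimately show False
      using f cv.subspace_0[OF homs_subspace[OF Y]] unfolding f'_def inj_on_def by metis
  qed
  let ?E1 = "f ` wcar Y" and ?E2 = "f' ` wcar Z"
  note E1 = homs_image[OF simpleY f(1)] and E2 = homs_image[OF simpleZ f']
  have sub1: "cv.subspace ?E1" "?E1 \<subseteq> mcar MV" and sub2: "cv.subspace ?E2" "?E2 \<subseteq> mcar MV"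
    using E1(1) E2(1) by (auto simp: asubmodule_def MA_car)
  from maschke[OF alg_module_MA E1(1), unfolded MA_car] obtain p where p': "lin_on (mcar MV) ?E1 p"
    "\<forall>x\<in>?E1. p x = x" "\<forall>a\<in>acar A. \<forall>x\<in>mcar MV. p (wact MA a x) = wact MA a (p x)"
    by (elim exE conjE)
  have p: "lin_on (mcar MV) ?E1 p" "\<And>x. x \<in> ?E1 \<Longrightarrow> p x = x"
    "\<And>a x. a \<in> acar A \<Longrightarrow> x \<in> mcar MV \<Longrightarrow> p (wact MA a x) = wact MA a (p x)"
    using p'(1) bspec[OF p'(2)] bspec[OF bspec[OF p'(3)]] by simp_all
  \<comment> \<open>Otherwise \<open>f'\<close>, then \<open>p\<close>, then the inverse of
    \<open>f\<close> would compose to a nonzero homomorphism from \<open>Z\<close> to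
    \<open>Y\<close>.\<close>
  have p2: "p x = 0" if x: "x \<in> ?E2" for x
  proof -
    let ?g = "inv_into (wcar Y) f"
    have bij: "bij_betw f (wcar Y) ?E1" using homs_injective[OF simpleY f] by (simp add: bij_betw_def)
    have "ops_hom (acar A) (wcar Y) (wact Y) ?E1 (wact MA) f"
      using f(1) by (simp add: homs_iff ops_hom_def lin_on_def)
    then have g: "ops_hom (acar A) ?E1 (wact MA) (wcar Y) (wact Y) ?g"
      by (rule ops_hom_inv[OF _ bij alg_moduleD(1)[OF Y]]) (rule lin_on_in[OF alg_moduleD(2)[OF Y]])
    have h1: "ops_hom (acar A) (wcar Z) (wact Z) (mcar MV) (wact MA) f'"
      using f' by (simp add: homs_iff)
    have h2: "ops_hom (acar A) (mcar MV) (wact MA) ?E1 (wact MA) p"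
      using p(1,3) by (simp add: ops_hom_def)
    have "ops_hom (acar A) (wcar Z) (wact Z) (wcar Y) (wact Y) (\<lambda>z. ?g (p (f' z)))"
      by (rule ops_hom_compose[OF ops_hom_compose[OF h1 h2] g])
    then have zero: "?g (p (f' z)) = 0" if "z \<in> wcar Z" for z
      using simple_amod_hom_iso(2)[OF simpleZ simpleY _ that] neq' by blast
    obtain z where z: "z \<in> wcar Z" "x = f' z" using x by blast
    have "p x \<in> ?E1" using lin_on_in[OF p(1)] sub2(2) x by blast
    then have "p x = f (?g (p x))" using bij by (simp add: bij_betw_def f_inv_into_f)
    then show ?thesis using zero[OF z(1)] z(2) lin_on_zero[OF homs_lin[OF f(1)] alg_moduleD(1)[OF Y]] by simp
  qed
  \<comment> \<open>One combination of modes has to realise \<open>p\<close> on both images at once,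
    so density is applied on their sum.\<close>
  define E where "E = cv.span (?E1 \<union> ?E2)"
  have EM: "E \<subseteq> mcar MV" unfolding E_def by (rule cv.span_minimal[OF _ MV_subspace]) (use sub1 sub2 in blast)
  have Eact: "wact MA a x \<in> E" if a: "a \<in> acar A" and x: "x \<in> E" for a x
  proof (rule lin_on_span_in[of "?E1 \<union> ?E2" "mcar MV" "wact MA a" E x])
    show "lin_on (cv.span (?E1 \<union> ?E2)) (mcar MV) (wact MA a)"
      using EM unfolding E_def by (rule lin_on_mono[OF wact_lin]) (use EM wact_in in \<open>auto simp: E_def\<close>)
    show "wact MA a y \<in> E" if "y \<in> ?E1 \<union> ?E2" for y
      unfolding E_def
    proof (rule cv.span_base, rule UnE[OF that])
      have act: "\<forall>a\<in>acar A. \<forall>x\<in>?E1. wact MA a x \<in> ?E1" "\<forall>a\<in>acar A. \<forall>x\<in>?E2. wact MA a x \<in> ?E2"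
        by (fact conjunct2[OF conjunct2[OF E1(1)[unfolded asubmodule_def]]]
            conjunct2[OF conjunct2[OF E2(1)[unfolded asubmodule_def]]])+
      show "wact MA a y \<in> ?E1 \<union> ?E2" if "y \<in> ?E1"
        by (rule UnI1[OF bspec[OF bspec[OF act(1) a] that]])
      show "wact MA a y \<in> ?E1 \<union> ?E2" if "y \<in> ?E2"
        by (rule UnI2[OF bspec[OF bspec[OF act(2) a] that]])
    qed
  qed (use x in \<open>simp_all add: E_def cv.subspace_span\<close>)
  have "asubmodule A MA E"
    using Eact EM by (simp add: asubmodule_def MA_car E_def cv.subspace_span)
  moreover have "fin_dim E"
  proof -
    obtain B1 where B1: "finite B1" "?E1 = cv.span B1" using E1(2) unfolding fin_dim_def by (elim exE conjE)
    obtain B2 where B2: "finite B2" "?E2 = cv.span B2" using E2(2) unfolding fin_dim_def by (elim exE conjE)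
    have "E = cv.span (B1 \<union> B2)"
    proof
      show "E \<subseteq> cv.span (B1 \<union> B2)"
        unfolding E_def B1(2) B2(2) by (intro cv.span_minimal Un_least cv.span_mono cv.subspace_span) auto
      show "cv.span (B1 \<union> B2) \<subseteq> E"
        unfolding E_def B1(2) B2(2) using cv.span_superset[of B1] cv.span_superset[of B2]
        by (intro cv.span_mono) auto
    qed
    with B1(1) B2(1) show ?thesis
      unfolding fin_dim_def by (intro exI[of _ "B1 \<union> B2"]) simp
  qed
  moreover have "lin_on E (mcar MV) p"
    by (rule lin_on_mono[OF p(1) EM]) (use EM lin_on_in[OF p(1)] sub1(2) in blast)
  moreover have "p (wact MA a x) = wact MA a (p x)" if "a \<in> acar A" "x \<in> E" for a x
    using p(3)[OF that(1)] that(2) EM by blast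
  ultimately have "\<exists>(K::nat) u n. (\<forall>k<K. u k \<in> vcar U) \<and> (\<forall>x\<in>E. (\<Sum>k<K. mmode MV (u k) (n k) x) = p x)"
    by (rule fixed_mode_density)
  then obtain K :: nat and u n where K': "\<forall>k<K. u k \<in> vcar U"
    "\<forall>x\<in>E. (\<Sum>k<K. mmode MV (u k) (n k) x) = p x"
    by (elim exE conjE)
  have K: "\<And>k. k < K \<Longrightarrow> u k \<in> vcar U" "\<And>x. x \<in> E \<Longrightarrow> (\<Sum>k<K. mmode MV (u k) (n k) x) = p x"
    using K'(1) bspec[OF K'(2)] by simp_all
  have inE: "x \<in> E" if "x \<in> ?E1 \<union> ?E2" for x unfolding E_def using that by (rule cv.span_base)
  have "(\<Sum>k<K. mmode (homs Y) (u k) (n k) f) w = f w" for w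
  proof (cases "w \<in> wcar Y")
    case True
    then have "f w \<in> ?E1" by blast
    with K(2)[OF inE[OF UnI1[OF this]]] p(2) True show ?thesis by (simp add: homs_mode sum_fun_apply)
  qed (simp add: homs_mode sum_fun_apply homs_off[OF f(1)])
  then have "f = (\<Sum>k<K. mmode (homs Y) (u k) (n k) f)" by (simp add: fun_eq_iff)
  then have "f' = \<psi> (\<Sum>k<K. mmode (homs Y) (u k) (n k) f)" by (simp add: f'_def)
  also have "\<dots> = (\<Sum>k<K. mmode (homs Z) (u k) (n k) f')"
    using K(1) homs_mode_in[OF Y _ f(1)] by (subst lin_on_sum[OF \<psi>l homs_subspace[OF Y]]) (auto simp: \<psi>m f(1) f'_def)
  finally have sum: "f' = (\<Sum>k<K. mmode (homs Z) (u k) (n k) f')" .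
  have "(\<Sum>k<K. mmode (homs Z) (u k) (n k) f') w = 0" for w
  proof (cases "w \<in> wcar Z")
    case True
    then have "f' w \<in> ?E2" by blast
    with K(2)[OF inE[OF UnI2[OF this]]] p2 True show ?thesis by (simp add: homs_mode sum_fun_apply)
  qed (simp add: homs_mode sum_fun_apply)
  then have "(\<Sum>k<K. mmode (homs Z) (u k) (n k) f') = 0" by (intro ext) simp
  with sum f'0 show False by simp
qed

end

section \<open>Decomposition of the direct sum\<close>

context orbifold
begin

text \<open>\<open>N\<close> is known only as the target of an isomorphism; that it is a space with
  linear modes is transported from the multiplicity space.\<close>

lemma homs_iso_target:
  assumes simple: "simple_amod A Y" and \<Psi>: "vmod_hom_iso U (homs Y) N \<Psi>"
  shows "cv.subspace (mcar N)" "v \<in> vcar U \<Longrightarrow> lin_on (mcar N) (mcar N) (mmode N v n)"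
    "vmod_hom_iso U N (homs Y) (inv_into (amod_hom A Y MA) \<Psi>)"
proof -
  have Y: "alg_module A Y" using simple by (simp add: simple_amod_def)
  note sub = homs_subspace[OF Y] and closed = homs_mode_in[OF Y]
  have bij: "bij_betw \<Psi> (amod_hom A Y MA) (mcar N)" and lin: "lin_on (amod_hom A Y MA) (mcar N) \<Psi>"
    and mode: "\<And>v n f. v \<in> vcar U \<Longrightarrow> f \<in> amod_hom A Y MA \<Longrightarrow> \<Psi> (mmode (homs Y) v n f) = mmode N v n (\<Psi> f)"
    using \<Psi> by (auto simp: vmod_hom_iso_def homs_car)
  have im: "mcar N = \<Psi> ` amod_hom A Y MA" using bij by (simp add: bij_betw_def)
  show "cv.subspace (mcar N)" unfolding im by (rule subspace_image[OF lin sub])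
  have inv: "vmod_hom_iso U N (homs Y) (inv_into (mcar (homs Y)) \<Psi>)"
    by (rule vmod_hom_iso_inv[OF \<Psi>]) (simp_all only: homs_car sub closed)
  then show "vmod_hom_iso U N (homs Y) (inv_into (amod_hom A Y MA) \<Psi>)" by (simp only: homs_car)
  assume v: "v \<in> vcar U"
  have hl: "lin_on (amod_hom A Y MA) (amod_hom A Y MA) (mmode (homs Y) v n)"
    using twisted_moduleD(2)[OF homs_va_module[OF simple, unfolded va_module_def] v] by (simp only: homs_car)
  show "lin_on (mcar N) (mcar N) (mmode N v n)"
  proof (rule lin_onI)
    fix x assume "x \<in> mcar N"
    then obtain f where f: "f \<in> amod_hom A Y MA" "x = \<Psi> f" unfolding im by (rule imageE)
    note fm = closed[OF v f(1)]
    have x: "mmode N v n x = \<Psi> (mmode (homs Y) v n f)" using mode[OF v f(1)] f(2) by simp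
    show "mmode N v n x \<in> mcar N" unfolding x by (rule lin_on_in[OF lin fm])
    show "mmode N v n (cscale c x) = cscale c (mmode N v n x)" for c
    proof -
      have "mmode N v n (cscale c x) = \<Psi> (mmode (homs Y) v n (cscale c f))"
        using mode[OF v cv.subspace_scale[OF sub f(1)]] lin_on_scale[OF lin f(1)] f(2) by simp
      also have "\<dots> = cscale c (mmode N v n x)"
        unfolding x lin_on_scale[OF hl f(1)] by (rule lin_on_scale[OF lin fm])
      finally show ?thesis .
    qed
    fix y assume "y \<in> mcar N"
    then obtain g where g: "g \<in> amod_hom A Y MA" "y = \<Psi> g" unfolding im by (rule imageE)
    note gm = closed[OF v g(1)]
    have "mmode N v n (x + y) = \<Psi> (mmode (homs Y) v n (f + g))"
      using mode[OF v cv.subspace_add[OF sub f(1) g(1)]] lin_on_add[OF lin f(1) g(1)] f(2) g(2) by simp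
    also have "\<dots> = mmode N v n x + mmode N v n y"
      using lin_on_add[OF hl f(1) g(1)] lin_on_add[OF lin fm gm] x mode[OF v g(1)] g(2) by simp
    finally show "mmode N v n (x + y) = mmode N v n x + mmode N v n y" .
  qed
qed

text \<open>The isomorphism is evaluation: \<open>t\<close> \<otimes> \<open>h\<close> goes to the
  value at \<open>t\<close> of the homomorphism that corresponds to \<open>h\<close> under
  \<open>\<Psi> i\<close>. It is injective by density in \<open>A\<close>. It is onto since
  otherwise a complement of its image would contain a simple submodule, which by completeness is the
  image of a homomorphism from some \<open>Y i\<close>. Leaving \<open>N i\<close> free up to
  isomorphism lets the modules \<open>mult_module\<close> be inserted directly.\<close>

theorem multiplicity_decomposition:
  fixes I :: "'i set" and Y :: "'i \<Rightarrow> (('v, 'm) gs, 'y::complex_space) amod"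
    and N :: "'i \<Rightarrow> ('v, 'z::complex_space) vmod"
  assumes simple: "\<And>i. i \<in> I \<Longrightarrow> simple_amod A (Y i)"
    and ineq: "\<And>i k. i \<in> I \<Longrightarrow> k \<in> I \<Longrightarrow> amod_iso A (Y i) (Y k) \<Longrightarrow> i = k"
    and complete: "\<And>X :: (('v, 'm) gs, ('v, 'm) vmod \<Rightarrow> 'm) amod. simple_amod A X \<Longrightarrow>
        \<exists>i\<in>I. amod_iso A (Y i) X"
    and \<Psi>: "\<And>i. i \<in> I \<Longrightarrow> vmod_hom_iso U (homs (Y i)) (N i) (\<Psi> i)"
  shows "au_iso A U MA MV (amod_sum I (\<lambda>i. tensor_amod (Y i) (N i))) (vmod_sum I (\<lambda>i. tensor_vmod (Y i) (N i)))"
proof -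
  define F where "F i = bilinear_forms (wcar (Y i)) (mcar (N i))" for i
  define T where "T i = tensor_space (F i) (wcar (Y i)) (mcar (N i))" for i
  define e where "e i = inv_into (amod_hom A (Y i) MA) (\<Psi> i)" for i
  have Ymod: "alg_module A (Y i)" if "i \<in> I" for i using simple[OF that] by (simp add: simple_amod_def)
  note Nsub = homs_iso_target(1)[OF simple \<Psi>] and Nlin = homs_iso_target(2)[OF simple \<Psi>]
  have eiso: "vmod_hom_iso U (N i) (homs (Y i)) (e i)" if "i \<in> I" for i
    unfolding e_def by (rule homs_iso_target(3)[OF simple[OF that] \<Psi>[OF that]])
  have ebij: "bij_betw (e i) (mcar (N i)) (amod_hom A (Y i) MA)"
    and elin: "lin_on (mcar (N i)) (amod_hom A (Y i) MA) (e i)"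
    and emode: "\<And>v n h. v \<in> vcar U \<Longrightarrow> h \<in> mcar (N i) \<Longrightarrow> e i (mmode (N i) v n h) = mmode (homs (Y i)) v n (e i h)"
    if "i \<in> I" for i
    using eiso[OF that] by (auto simp: vmod_hom_iso_def homs_car)
  have eh: "e i h \<in> amod_hom A (Y i) MA" if "i \<in> I" "h \<in> mcar (N i)" for i h
    by (rule lin_on_in[OF elin[OF that(1)] that(2)])
  have Tsub: "cv.subspace (T i)" for i unfolding T_def by (rule tensor_space_subspace)
  have pure_in: "pure_tensor (F i) t h \<in> T i" if "t \<in> wcar (Y i)" "h \<in> mcar (N i)" for i t h
    unfolding T_def by (rule pure_tensor_in[OF that])

  \<comment> \<open>The value \<open>e i h t\<close> is bilinear in \<open>t\<close> and
    \<open>h\<close>, so it factors through the tensor product; this gives the evaluation maps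
    \<open>ev i\<close>.\<close>
  have "\<exists>f. lin_on (T i) UNIV f \<and> (\<forall>t\<in>wcar (Y i). \<forall>h\<in>mcar (N i). f (pure_tensor (F i) t h) = e i h t)"
    if i: "i \<in> I" for i
    unfolding T_def
  proof (rule tensor_lift)
    fix l :: "(('v, 'm) vmod \<Rightarrow> 'm) \<Rightarrow> complex" assume l: "lin_on UNIV UNIV l"
    have 1: "lin_on (mcar (N i)) UNIV (\<lambda>h. l (e i h t))" for t
      using lin_on_add[OF elin[OF i]] lin_on_scale[OF elin[OF i]] lin_on_add[OF l] lin_on_scale[OF l]
      by (intro lin_onI) simp_all
    have 2: "lin_on (wcar (Y i)) UNIV (\<lambda>t. l (e i h t))" if h: "h \<in> mcar (N i)" for h
      by (rule lin_on_compose[OF homs_lin[OF eh[OF i h]]]) (rule lin_on_mono[OF l], simp_all)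
    show "(\<lambda>t h. l (e i h t)) \<in> F i"
      unfolding F_def bilinear_forms_def using 1 2 by simp
  qed
  then have "\<forall>i\<in>I. \<exists>f. lin_on (T i) UNIV f \<and>
      (\<forall>t\<in>wcar (Y i). \<forall>h\<in>mcar (N i). f (pure_tensor (F i) t h) = e i h t)" by blast
  from bchoice[OF this] obtain ev where ev': "\<forall>i\<in>I. lin_on (T i) UNIV (ev i) \<and>
      (\<forall>t\<in>wcar (Y i). \<forall>h\<in>mcar (N i). ev i (pure_tensor (F i) t h) = e i h t)" ..
  have evl: "lin_on (T i) UNIV (ev i)"
    and evp: "\<And>t h. t \<in> wcar (Y i) \<Longrightarrow> h \<in> mcar (N i) \<Longrightarrow> ev i (pure_tensor (F i) t h) = e i h t"
    if "i \<in> I" for i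
    using bspec[OF ev' that] by simp_all
  have evM: "ev i x \<in> mcar MV" if i: "i \<in> I" and x: "x \<in> T i" for i x
    by (rule tensor_space_map_in[OF evl[OF i, unfolded T_def] MV_subspace x[unfolded T_def]])
      (simp add: evp[OF i] homs_in[OF eh[OF i]])

  define act where "act i a = tensor_map (F i) (wact (Y i) a) id" for i a
  define mode where "mode i v n = tensor_map (F i) id (mmode (N i) v n)" for i v n
  have act_pure: "act i a (pure_tensor (F i) t h) = pure_tensor (F i) (wact (Y i) a t) h"
    if i: "i \<in> I" and a: "a \<in> acar A" for i a t h
    unfolding act_def
  proof (subst tensor_map_pure)
    fix \<beta> assume "\<beta> \<in> F i"
    then have l: "\<And>d. d \<in> wcar (Y i) \<Longrightarrow> lin_on (mcar (N i)) UNIV (\<lambda>w. \<beta> d w)"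
      "\<And>w. w \<in> mcar (N i) \<Longrightarrow> lin_on (wcar (Y i)) UNIV (\<lambda>d. \<beta> d w)"
      by (simp_all add: F_def bilinear_forms_def)
    note la = alg_moduleD(2)[OF Ymod[OF i] a]
    show "(\<lambda>d w. \<beta> (wact (Y i) a d) (id w)) \<in> F i"
      unfolding F_def bilinear_forms_def id_apply using lin_on_compose[OF la l(2)] l(1)[OF lin_on_in[OF la]] by simp
  qed simp
  have mode_pure: "mode i v n (pure_tensor (F i) t h) = pure_tensor (F i) t (mmode (N i) v n h)"
    if i: "i \<in> I" and v: "v \<in> vcar U" for i v n t h
    unfolding mode_def
  proof (subst tensor_map_pure)
    fix \<beta> assume "\<beta> \<in> F i"
    then have l: "\<And>d. d \<in> wcar (Y i) \<Longrightarrow> lin_on (mcar (N i)) UNIV (\<lambda>w. \<beta> d w)"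
      "\<And>w. w \<in> mcar (N i) \<Longrightarrow> lin_on (wcar (Y i)) UNIV (\<lambda>d. \<beta> d w)"
      by (simp_all add: F_def bilinear_forms_def)
    note la = Nlin[OF i i v]
    show "(\<lambda>d w. \<beta> (id d) (mmode (N i) v n w)) \<in> F i"
      unfolding F_def bilinear_forms_def id_apply using lin_on_compose[OF la l(1)] l(2)[OF lin_on_in[OF la]] by simp
  qed simp
  have actl: "lin_on UNIV UNIV (act i a)" for i a unfolding act_def by (rule tensor_map_lin)
  have model: "lin_on UNIV UNIV (mode i v n)" for i v n unfolding mode_def by (rule tensor_map_lin)
  have Tl: "lin_on (T i) UNIV f" if "lin_on UNIV UNIV f" for i f
    by (rule lin_on_mono[OF that]) simp_all
  have act_in: "act i a x \<in> T i" if i: "i \<in> I" and a: "a \<in> acar A" and x: "x \<in> T i" for i a x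
  proof (rule tensor_space_map_in[OF Tl[OF actl, unfolded T_def] Tsub x[unfolded T_def]])
    fix t h assume th: "t \<in> wcar (Y i)" "h \<in> mcar (N i)"
    show "act i a (pure_tensor (F i) t h) \<in> T i"
      unfolding act_pure[OF i a] by (rule pure_in[OF lin_on_in[OF alg_moduleD(2)[OF Ymod[OF i] a] th(1)] th(2)])
  qed
  have mode_in: "mode i v n x \<in> T i" if i: "i \<in> I" and v: "v \<in> vcar U" and x: "x \<in> T i" for i v n x
  proof (rule tensor_space_map_in[OF Tl[OF model, unfolded T_def] Tsub x[unfolded T_def]])
    fix t h assume th: "t \<in> wcar (Y i)" "h \<in> mcar (N i)"
    show "mode i v n (pure_tensor (F i) t h) \<in> T i"
      unfolding mode_pure[OF i v] by (rule pure_in[OF th(1) lin_on_in[OF Nlin[OF i i v] th(2)]])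
  qed
  have ev_act: "ev i (act i a x) = wact MA a (ev i x)"
    if i: "i \<in> I" and a: "a \<in> acar A" and x: "x \<in> T i" for i a x
  proof (rule tensor_space_eqI[of "F i" "wcar (Y i)" "mcar (N i)" UNIV "\<lambda>x. ev i (act i a x)" "mcar MV" "\<lambda>x. wact MA a (ev i x)"])
    have "lin_on (T i) (T i) (act i a)" by (rule lin_on_mono[OF actl]) (simp_all add: act_in[OF i a])
    from lin_on_compose[OF this evl[OF i]]
    show "lin_on (tensor_space (F i) (wcar (Y i)) (mcar (N i))) UNIV (\<lambda>x. ev i (act i a x))"
      by (simp only: T_def)
    have "lin_on (T i) (mcar MV) (ev i)" by (rule lin_on_mono[OF evl[OF i]]) (simp_all add: evM[OF i])
    from lin_on_compose[OF this wact_lin]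
    show "lin_on (tensor_space (F i) (wcar (Y i)) (mcar (N i))) (mcar MV) (\<lambda>x. wact MA a (ev i x))"
      by (simp only: T_def)
    show "x \<in> tensor_space (F i) (wcar (Y i)) (mcar (N i))" using x by (simp only: T_def)
    fix t h assume th: "t \<in> wcar (Y i)" "h \<in> mcar (N i)"
    show "ev i (act i a (pure_tensor (F i) t h)) = wact MA a (ev i (pure_tensor (F i) t h))"
      using homs_act[OF eh[OF i th(2)] a th(1)] lin_on_in[OF alg_moduleD(2)[OF Ymod[OF i] a] th(1)]
      by (simp add: act_pure[OF i a] evp[OF i] th)
  qed
  have ev_mode: "ev i (mode i v n x) = mmode MV v n (ev i x)"
    if i: "i \<in> I" and v: "v \<in> vcar U" and x: "x \<in> T i" for i v n x
  proof (rule tensor_space_eqI[of "F i" "wcar (Y i)" "mcar (N i)" UNIV "\<lambda>x. ev i (mode i v n x)" "mcar MV" "\<lambda>x. mmode MV v n (ev i x)"])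
    have "lin_on (T i) (T i) (mode i v n)" by (rule lin_on_mono[OF model]) (simp_all add: mode_in[OF i v])
    from lin_on_compose[OF this evl[OF i]]
    show "lin_on (tensor_space (F i) (wcar (Y i)) (mcar (N i))) UNIV (\<lambda>x. ev i (mode i v n x))"
      by (simp only: T_def)
    have "lin_on (T i) (mcar MV) (ev i)" by (rule lin_on_mono[OF evl[OF i]]) (simp_all add: evM[OF i])
    from lin_on_compose[OF this mmode_lin[OF MV_twisted]]
    show "lin_on (tensor_space (F i) (wcar (Y i)) (mcar (N i))) (mcar MV) (\<lambda>x. mmode MV v n (ev i x))"
      by (simp only: T_def)
    show "x \<in> tensor_space (F i) (wcar (Y i)) (mcar (N i))" using x by (simp only: T_def)
    fix t h assume th: "t \<in> wcar (Y i)" "h \<in> mcar (N i)"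
    show "ev i (mode i v n (pure_tensor (F i) t h)) = mmode MV v n (ev i (pure_tensor (F i) t h))"
      using emode[OF i v th(2)] lin_on_in[OF Nlin[OF i i v] th(2)] th
      by (simp add: mode_pure[OF i v] evp[OF i] homs_mode)
  qed

  define X where "X = direct_sum I T"
  have Xsub: "cv.subspace X" unfolding X_def by (rule direct_sum_subspace[OF Tsub])
  have XT: "x i \<in> T i" if "x \<in> X" "i \<in> I" for x i using that by (simp add: X_def direct_sum_def)
  have Xoff: "x i = 0" if "x \<in> X" "i \<notin> I" for x i using that by (simp add: X_def direct_sum_def)
  have Xfin: "finite {i. x i \<noteq> 0}" "{i. x i \<noteq> 0} \<subseteq> I" if "x \<in> X" for x
    using that by (auto simp: X_def direct_sum_def)
  have ev0: "ev i 0 = 0" if "i \<in> I" for i by (rule lin_on_zero[OF evl[OF that] Tsub])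
  define \<Phi> where "\<Phi> x = (\<Sum>i | x i \<noteq> 0. ev i (x i))" for x
  have \<Phi>_sum: "\<Phi> x = (\<Sum>i\<in>J. ev i (x i))" if "finite J" "J \<subseteq> I" "{i. x i \<noteq> 0} \<subseteq> J" for x J
    unfolding \<Phi>_def by (rule sum.mono_neutral_left) (use that ev0 in auto)
  have \<Phi>lin: "lin_on X (mcar MV) \<Phi>"
  proof (rule lin_onI)
    fix x assume x: "x \<in> X"
    show "\<Phi> x \<in> mcar MV"
      unfolding \<Phi>_def using Xfin(2)[OF x] by (intro cv.subspace_sum[OF MV_subspace] evM XT[OF x]) auto
    show "\<Phi> (cscale c x) = cscale c (\<Phi> x)" for c
    proof -
      let ?J = "{i. x i \<noteq> 0}"
      have "\<Phi> (cscale c x) = (\<Sum>i\<in>?J. ev i ((cscale c x) i))"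
        by (rule \<Phi>_sum) (use Xfin[OF x] in auto)
      also have "\<dots> = (\<Sum>i\<in>?J. cscale c (ev i (x i)))"
        using Xfin(2)[OF x] by (intro sum.cong refl) (auto simp: lin_on_scale[OF evl XT[OF x]])
      finally show ?thesis by (simp add: \<Phi>_def cv.scale_sum_right)
    qed
    fix y assume y: "y \<in> X"
    let ?J = "{i. x i \<noteq> 0} \<union> {i. y i \<noteq> 0}"
    have J: "finite ?J" "?J \<subseteq> I" using Xfin[OF x] Xfin[OF y] by auto
    have "\<Phi> (x + y) = (\<Sum>i\<in>?J. ev i ((x + y) i))" by (rule \<Phi>_sum[OF J]) auto
    also have "\<dots> = (\<Sum>i\<in>?J. ev i (x i) + ev i (y i))"
      using J(2) by (intro sum.cong refl) (simp add: subset_iff lin_on_add[OF evl XT[OF x] XT[OF y]])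
    also have "\<dots> = \<Phi> x + \<Phi> y"
      unfolding sum.distrib by (subst (1 2) \<Phi>_sum[OF J]) auto
    finally show "\<Phi> (x + y) = \<Phi> x + \<Phi> y" .
  qed
  have \<Phi>_single: "\<Phi> (single i x) = ev i x" if i: "i \<in> I" for i x
    using i by (subst \<Phi>_sum[of "{i}"]) (auto simp: single_def)
  have single_X: "single i x \<in> X" if "i \<in> I" "x \<in> T i" for i x
    unfolding X_def by (rule single_direct_sum[of i I x T]) (simp_all add: that cv.subspace_0[OF Tsub])

  let ?X' = "amod_sum I (\<lambda>i. tensor_amod (Y i) (N i))" and ?N' = "vmod_sum I (\<lambda>i. tensor_vmod (Y i) (N i))"
  have X'car: "wcar ?X' = X" and N'car: "mcar ?N' = X"
    by (simp_all add: amod_sum_def vmod_sum_def tensor_amod_def tensor_vmod_def Let_def X_def T_def[abs_def] F_def)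
  have X'act: "wact ?X' a x = (\<lambda>i. if i \<in> I then act i a (x i) else 0)" for a x
    by (auto simp: amod_sum_def tensor_amod_def Let_def act_def F_def fun_eq_iff)
  have N'mode: "mmode ?N' v n x = (\<lambda>i. if i \<in> I then mode i v n (x i) else 0)" for v n x
    by (auto simp: vmod_sum_def tensor_vmod_def Let_def mode_def F_def fun_eq_iff)
  have act0: "act i a 0 = 0" for i a by (rule lin_on_zero[OF actl]) simp
  have mode0: "mode i v n 0 = 0" for i v n by (rule lin_on_zero[OF model]) simp
  have actX: "wact ?X' a x \<in> X" if a: "a \<in> acar A" and x: "x \<in> X" for a x
  proof -
    have "finite {i. (if i \<in> I then act i a (x i) else 0) \<noteq> 0}"
      by (rule finite_subset[OF _ Xfin(1)[OF x]]) (auto simp: act0)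
    then show ?thesis
      using act_in[OF _ a XT[OF x]] by (simp add: X'act X_def direct_sum_def)
  qed
  have modeX: "mmode ?N' v n x \<in> X" if v: "v \<in> vcar U" and x: "x \<in> X" for v n x
  proof -
    have "finite {i. (if i \<in> I then mode i v n (x i) else 0) \<noteq> 0}"
      by (rule finite_subset[OF _ Xfin(1)[OF x]]) (auto simp: mode0)
    then show ?thesis
      using mode_in[OF _ v XT[OF x]] by (simp add: N'mode X_def direct_sum_def)
  qed
  have \<Phi>act: "\<Phi> (wact ?X' a x) = wact MA a (\<Phi> x)" if a: "a \<in> acar A" and x: "x \<in> X" for a x
  proof -
    let ?J = "{i. x i \<noteq> 0}"
    have "\<Phi> (wact ?X' a x) = (\<Sum>i\<in>?J. ev i (wact ?X' a x i))"
      by (rule \<Phi>_sum) (use Xfin[OF x] in \<open>auto simp: X'act act0\<close>)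
    also have "\<dots> = (\<Sum>i\<in>?J. wact MA a (ev i (x i)))"
      using Xfin(2)[OF x] by (intro sum.cong refl) (auto simp: X'act subset_iff ev_act[OF _ a XT[OF x]])
    also have "\<dots> = wact MA a (\<Phi> x)"
      unfolding \<Phi>_def using Xfin(2)[OF x]
      by (intro lin_on_sum[OF wact_lin MV_subspace, symmetric] evM XT[OF x]) auto
    finally show ?thesis .
  qed
  have \<Phi>mode: "\<Phi> (mmode ?N' v n x) = mmode MV v n (\<Phi> x)" if v: "v \<in> vcar U" and x: "x \<in> X" for v n x
  proof -
    let ?J = "{i. x i \<noteq> 0}"
    have "\<Phi> (mmode ?N' v n x) = (\<Sum>i\<in>?J. ev i (mmode ?N' v n x i))"
      by (rule \<Phi>_sum) (use Xfin[OF x] in \<open>auto simp: N'mode mode0\<close>)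
    also have "\<dots> = (\<Sum>i\<in>?J. mmode MV v n (ev i (x i)))"
      using Xfin(2)[OF x] by (intro sum.cong refl) (auto simp: N'mode subset_iff ev_mode[OF _ v XT[OF x]])
    also have "\<dots> = mmode MV v n (\<Phi> x)"
      unfolding \<Phi>_def using Xfin(2)[OF x]
      by (intro lin_on_sum[OF mmode_lin[OF MV_twisted] MV_subspace, symmetric] evM XT[OF x]) auto
    finally show ?thesis .
  qed

  \<comment> \<open>In normal form, each \<open>x i\<close> is a sum over a basis of
    \<open>Y i\<close>. By density some \<open>a\<close> in \<open>A\<close> sends one basis vector
    \<open>b0\<close> to a prescribed \<open>c\<close> and kills all others, in every
    \<open>Y i\<close> involved. Applying \<open>a\<close> to the vanishing sum leaves the value at
    \<open>c\<close> of the homomorphism attached to \<open>b0\<close>.\<close>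
  have inj: "inj_on \<Phi> X"
  proof (rule inj_on_lin_on[OF \<Phi>lin Xsub])
    fix x assume x: "x \<in> X" and x0: "\<Phi> x = 0"
    let ?J = "{i. x i \<noteq> 0}"
    have J: "finite ?J" "?J \<subseteq> I" using Xfin[OF x] .
    have "\<forall>i\<in>?J. \<exists>B. finite B \<and> B \<subseteq> wcar (Y i) \<and> cv.independent B \<and> cv.span B = wcar (Y i)"
    proof
      fix i assume "i \<in> ?J"
      then have "fin_dim (wcar (Y i))" using J(2) simple_amod_fin_dim[OF fd_alg_A simple] by blast
      then show "\<exists>B. finite B \<and> B \<subseteq> wcar (Y i) \<and> cv.independent B \<and> cv.span B = wcar (Y i)"
        by (rule fin_dim_basis) (intro exI conjI)
    qed
    from bchoice[OF this] obtain B where B': "\<forall>i\<in>?J. finite (B i) \<and> B i \<subseteq> wcar (Y i) \<and>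
        cv.independent (B i) \<and> cv.span (B i) = wcar (Y i)" ..
    have B: "finite (B i)" "B i \<subseteq> wcar (Y i)" "cv.independent (B i)" "cv.span (B i) = wcar (Y i)"
      if "i \<in> ?J" for i using bspec[OF B' that] by simp_all
    have "\<forall>i\<in>?J. \<exists>h. (\<forall>b\<in>B i. h b \<in> mcar (N i)) \<and> x i = (\<Sum>b\<in>B i. pure_tensor (F i) b (h b))"
    proof
      fix i assume i: "i \<in> ?J"
      then have "i \<in> I" using J(2) by blast
      from tensor_basis_expand[OF B(1,3)[OF i] Nsub[OF this this], of "x i"] XT[OF x this] B(4)[OF i]
      show "\<exists>h. (\<forall>b\<in>B i. h b \<in> mcar (N i)) \<and> x i = (\<Sum>b\<in>B i. pure_tensor (F i) b (h b))"
        by (simp add: T_def F_def)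
    qed
    from bchoice[OF this] obtain h where h': "\<forall>i\<in>?J. (\<forall>b\<in>B i. h i b \<in> mcar (N i)) \<and>
        x i = (\<Sum>b\<in>B i. pure_tensor (F i) b (h i b))" ..
    have hN: "h i b \<in> mcar (N i)" if "i \<in> ?J" "b \<in> B i" for i b
      using bspec[OF h' that(1)] that(2) by simp
    have hx: "x i = (\<Sum>b\<in>B i. pure_tensor (F i) b (h i b))" if "i \<in> ?J" for i
      using bspec[OF h' that] by simp
    let ?K = "Sigma ?J B"
    have K: "finite ?K" using J(1) B(1) by (intro finite_SigmaI)
    have "(\<Sum>(i, b)\<in>?K. e i (h i b) b) = (\<Sum>i\<in>?J. \<Sum>b\<in>B i. e i (h i b) b)"
      using J(1) B(1) by (intro sum.Sigma[symmetric]) auto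
    also have "\<dots> = (\<Sum>i\<in>?J. ev i (x i))"
    proof (rule sum.cong)
      fix i assume i: "i \<in> ?J"
      then have iI: "i \<in> I" using J(2) by blast
      have bY: "b \<in> wcar (Y i)" if "b \<in> B i" for b using B(2)[OF i] that by blast
      show "(\<Sum>b\<in>B i. e i (h i b) b) = ev i (x i)"
        unfolding hx[OF i]
        by (subst lin_on_sum[OF evl[OF iI] Tsub])
          (simp_all add: pure_in bY hN[OF i] evp[OF iI])
    qed simp
    also have "\<dots> = 0" using x0 by (simp add: \<Phi>_def)
    finally have rel: "(\<Sum>(i, b)\<in>?K. e i (h i b) b) = 0" .
    have hz: "h i0 b0 = 0" if i0: "i0 \<in> ?J" and b0: "b0 \<in> B i0" for i0 b0
    proof -
      have i0I: "i0 \<in> I" using i0 J(2) by blast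
      have "e i0 (h i0 b0) c = 0" if c: "c \<in> wcar (Y i0)" for c
      proof -
        let ?y = "\<lambda>p. if p = (i0, b0) then c else 0"
        have "\<exists>a\<in>acar A. \<forall>p\<in>?K. wact (Y (fst p)) a (snd p) = ?y p"
        proof (rule algebra_density[OF fd_alg_A K])
          show "simple_amod A (Y (fst p))" if "p \<in> ?K" for p
            using that J(2) simple by auto
          show "Y (fst p) = Y (fst q)" if "p \<in> ?K" "q \<in> ?K" "amod_iso A (Y (fst p)) (Y (fst q))" for p q
          proof -
            have "fst p \<in> I" "fst q \<in> I" using that(1,2) J(2) by auto
            from ineq[OF this that(3)] show ?thesis by simp
          qed
          show "snd p \<in> wcar (Y (fst p))" if "p \<in> ?K" for p
            using that B(2) by (cases p) (auto simp: subset_iff)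
          show "?y p \<in> wcar (Y (fst p))" if p: "p \<in> ?K" for p
          proof (cases "p = (i0, b0)")
            case False
            have "fst p \<in> I" using p J(2) by auto
            then show ?thesis using False cv.subspace_0[OF alg_moduleD(1)[OF Ymod]] by simp
          qed (use c in simp)
          show "\<forall>p\<in>?K. u p = 0" if k: "k \<in> ?K" and supp: "\<And>p. p \<in> ?K \<Longrightarrow> u p \<noteq> 0 \<Longrightarrow> Y (fst p) = Y (fst k)"
            and urel: "(\<Sum>p\<in>?K. cscale (u p) (snd p)) = 0" for u k
          proof -
            have kJ: "fst k \<in> ?J" using k by auto
            \<comment> \<open>Equal modules have equal indices by inequivalence, so the relation
              concerns the basis of a single \<open>Y i\<close>.\<close>
            have only: "fst p = fst k" if p: "p \<in> ?K" "u p \<noteq> 0" for p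
            proof -
              have "fst p \<in> I" "fst k \<in> I" using p(1) k J(2) by auto
              moreover have "amod_iso A (Y (fst p)) (Y (fst k))"
                unfolding supp[OF p] amod_iso_ops
                by (intro exI[of _ "\<lambda>x. x"]) (simp add: ops_hom_def lin_on_def bij_betw_def)
              ultimately show ?thesis by (rule ineq)
            qed
            have "(\<Sum>p\<in>?K. cscale (u p) (snd p)) = (\<Sum>p\<in>Pair (fst k) ` B (fst k). cscale (u p) (snd p))"
            proof (rule sum.mono_neutral_right[OF K])
              show "Pair (fst k) ` B (fst k) \<subseteq> ?K" using kJ by auto
              show "\<forall>p\<in>?K - Pair (fst k) ` B (fst k). cscale (u p) (snd p) = 0"
              proof
                fix p assume p: "p \<in> ?K - Pair (fst k) ` B (fst k)"
                have "u p = 0"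
                proof (rule ccontr)
                  assume "u p \<noteq> 0"
                  then have "fst p = fst k" using only p by blast
                  then show False using p by (cases p) auto
                qed
                then show "cscale (u p) (snd p) = 0" by simp
              qed
            qed
            also have "\<dots> = (\<Sum>b\<in>B (fst k). cscale (u (fst k, b)) b)"
              by (subst sum.reindex) (simp_all add: inj_on_def)
            finally have "(\<Sum>b\<in>B (fst k). cscale (u (fst k, b)) b) = 0" using urel by simp
            from cv.independentD[OF B(3)[OF kJ] B(1)[OF kJ] subset_refl this]
            have z: "u (fst k, b) = 0" if "b \<in> B (fst k)" for b
              using that .
            show ?thesis
            proof
              fix p assume p: "p \<in> ?K"
              show "u p = 0"
              proof (rule ccontr)
                assume "u p \<noteq> 0"
                moreover from this have "fst p = fst k" using only p by blast
                moreover have "snd p \<in> B (fst p)" using p by auto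
                ultimately show False using z[of "snd p"] by (metis prod.collapse)
              qed
            qed
          qed
        qed
        then obtain a where a: "a \<in> acar A" "\<forall>p\<in>?K. wact (Y (fst p)) a (snd p) = ?y p" by blast
        have "0 = wact MA a (\<Sum>(i, b)\<in>?K. e i (h i b) b)"
          unfolding rel using lin_on_zero[OF wact_lin MV_subspace] by simp
        also have "\<dots> = (\<Sum>(i, b)\<in>?K. wact MA a (e i (h i b) b))"
          unfolding split_def
        proof (rule lin_on_sum[OF wact_lin MV_subspace])
          fix p assume p: "p \<in> ?K"
          then have "fst p \<in> I" "h (fst p) (snd p) \<in> mcar (N (fst p))" "snd p \<in> wcar (Y (fst p))"
            using J(2) hN B(2) by (auto simp: subset_iff)
          then show "e (fst p) (h (fst p) (snd p)) (snd p) \<in> mcar MV" by (intro homs_in[OF eh])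
        qed
        also have "\<dots> = (\<Sum>p\<in>?K. if p = (i0, b0) then e i0 (h i0 b0) c else 0)"
          unfolding split_def
        proof (rule sum.cong)
          fix p assume p: "p \<in> ?K"
          then have pI: "fst p \<in> I" and hp: "h (fst p) (snd p) \<in> mcar (N (fst p))" and bp: "snd p \<in> wcar (Y (fst p))"
            using J(2) hN B(2) by (auto simp: subset_iff)
          have "wact MA a (e (fst p) (h (fst p) (snd p)) (snd p))
              = e (fst p) (h (fst p) (snd p)) (wact (Y (fst p)) a (snd p))"
            using homs_act[OF eh[OF pI hp] a(1) bp] by simp
          also have "\<dots> = e (fst p) (h (fst p) (snd p)) (?y p)"
            by (rule arg_cong[OF bspec[OF a(2) p]])
          also have "\<dots> = (if p = (i0, b0) then e i0 (h i0 b0) c else 0)"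
            using lin_on_zero[OF homs_lin[OF eh[OF pI hp]] alg_moduleD(1)[OF Ymod[OF pI]]] by simp
          finally show "wact MA a (e (fst p) (h (fst p) (snd p)) (snd p))
              = (if p = (i0, b0) then e i0 (h i0 b0) c else 0)" .
        qed simp
        also have "\<dots> = e i0 (h i0 b0) c" using K i0 b0 by simp
        finally show ?thesis by simp
      qed
      then have "e i0 (h i0 b0) = 0"
        using homs_off[OF eh[OF i0I hN[OF i0 b0]]] by (intro ext) (metis zero_fun_apply)
      moreover have "e i0 0 = 0" by (rule lin_on_zero[OF elin[OF i0I] Nsub[OF i0I i0I]])
      moreover have "inj_on (e i0) (mcar (N i0))" using ebij[OF i0I] by (simp add: bij_betw_def)
      ultimately show ?thesis
        using hN[OF i0 b0] cv.subspace_0[OF Nsub[OF i0I i0I]] by (simp add: inj_on_def)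
    qed
    have "x i = 0" for i
    proof (rule ccontr)
      assume "x i \<noteq> 0"
      then have i: "i \<in> ?J" by simp
      then have iI: "i \<in> I" using J(2) by blast
      have "pure_tensor (F i) b (h i b) = 0" if b: "b \<in> B i" for b
        unfolding hz[OF i b]
        by (rule lin_on_zero[OF pure_tensor_lin_right[where D = "wcar (Y i)" and W = "mcar (N i)"] Nsub[OF iI iI]])
          (use b B(2)[OF i] in \<open>auto simp: F_def\<close>)
      then have "x i = 0" unfolding hx[OF i] by simp
      with \<open>x i \<noteq> 0\<close> show False ..
    qed
    then show "x = 0" by (simp add: fun_eq_iff)
  qed

  have surj: "\<Phi> ` X = mcar MV"
  proof (rule ccontr)
    assume neq: "\<Phi> ` X \<noteq> mcar MV"
    have sub: "\<Phi> ` X \<subseteq> mcar MV" using lin_on_in[OF \<Phi>lin] by blast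
    have "asubmodule A MA (\<Phi> ` X)"
      unfolding asubmodule_def MA_car
    proof (intro conjI ballI)
      show "cv.subspace (\<Phi> ` X)" by (rule subspace_image[OF \<Phi>lin Xsub])
      show "wact MA a w \<in> \<Phi> ` X" if a: "a \<in> acar A" and w: "w \<in> \<Phi> ` X" for a w
      proof -
        obtain x where x: "x \<in> X" "w = \<Phi> x" using w by blast
        have "wact MA a w = \<Phi> (wact ?X' a x)" using \<Phi>act[OF a x(1)] x(2) by simp
        then show ?thesis using actX[OF a x(1)] by simp
      qed
    qed (rule sub)
    from maschke_complement[OF alg_module_MA this] obtain Z where Z: "asubmodule A MA Z"
      "\<Phi> ` X \<inter> Z = {0}" "{x + y | x y. x \<in> \<Phi> ` X \<and> y \<in> Z} = mcar MV"
      unfolding MA_car by (elim exE conjE)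
    have "Z \<noteq> {0}"
    proof
      assume "Z = {0}"
      then have "mcar MV \<subseteq> \<Phi> ` X" using Z(3) by auto
      with sub neq show False by blast
    qed
    moreover have "0 \<in> Z" using Z(1) by (simp add: asubmodule_def cv.subspace_0)
    ultimately obtain z where z: "z \<in> Z" "z \<noteq> 0" by blast
    have ZM: "Z \<subseteq> mcar MV" and Zsub: "cv.subspace Z" and Zact: "\<And>a y. a \<in> acar A \<Longrightarrow> y \<in> Z \<Longrightarrow> wact MA a y \<in> Z"
      using Z(1) by (simp_all add: asubmodule_def MA_car)
    have zM: "z \<in> wcar MA" using z(1) ZM MA_car by blast
    let ?C = "(\<lambda>a. wact MA a z) ` acar A"
    note cyc = cyclic_fin_dim[OF fd_alg_A alg_module_MA zM] cyclic_stable[OF fd_alg_A alg_module_MA zM]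
    have "z \<in> ?C" by (rule cyclic_in[OF fd_alg_A alg_module_MA zM])
    then have C0: "?C \<noteq> {0}" using z(2) by (metis singletonD)
    have Clin: "lin_on ?C ?C (wact MA a)" if a: "a \<in> acar A" for a
    proof (rule lin_on_mono[OF wact_lin])
      show "?C \<subseteq> mcar MV" using cyclic_sub[OF fd_alg_A alg_module_MA zM] by (simp only: MA_car)
      show "wact MA a x \<in> ?C" if "x \<in> ?C" for x using cyc(2) a that by (simp only: stable_def)
    qed
    from fin_dim_simple_submodule[OF cyc C0 Clin] obtain C
      where C: "C \<subseteq> ?C" "simple_ops (acar A) (wact MA) C" by blast
    have CZ: "C \<subseteq> Z" using C(1) Zact z(1) by blast
    let ?S = "\<lparr>wcar = C, wact = wact MA\<rparr>"
    have CM: "C \<subseteq> mcar MV" using CZ ZM by blast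
    have "alg_module A ?S"
      unfolding alg_module_def amod.simps
    proof (intro conjI ballI)
      show "cv.subspace C" by (rule simple_opsD(1)[OF C(2)])
      show "lin_on C C (wact MA a)" if "a \<in> acar A" for a by (rule simple_opsD(2)[OF C(2) that])
      show "lin_on (acar A) C (\<lambda>a. wact MA a w)" if w: "w \<in> C" for w
        by (rule lin_on_mono[OF wact_lin_alg]) (simp_all add: lin_on_in[OF simple_opsD(2)[OF C(2)] w])
      show "wact MA (amul A a c) w = wact MA a (wact MA c w)" if "a \<in> acar A" "c \<in> acar A" "w \<in> C" for a c w
        using that CM by (intro wact_amul) auto
      show "wact MA (aone A) w = w" if "w \<in> C" for w using that CM by (intro wact_one) auto
    qed
    with C(2) have "simple_amod A ?S" by (simp add: simple_amod_ops)
    from complete[OF this] obtain i where i: "i \<in> I" "amod_iso A (Y i) ?S" by blast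
    from i(2) obtain f where f: "bij_betw f (wcar (Y i)) C"
        "ops_hom (acar A) (wcar (Y i)) (wact (Y i)) C (wact MA) f"
      unfolding amod_iso_ops amod.simps by (elim exE conjE)
    have "ops_hom (acar A) (wcar (Y i)) (wact (Y i)) (mcar MV) (wact MA) f"
      using f(2) CM unfolding ops_hom_def lin_on_def by blast
    from homsI[OF this Ymod[OF i(1)]] have f0: "(\<lambda>w. if w \<in> wcar (Y i) then f w else 0) \<in> amod_hom A (Y i) MA" .
    define f1 where "f1 = (\<lambda>w. if w \<in> wcar (Y i) then f w else 0)"
    have "f1 \<in> e i ` mcar (N i)" using ebij[OF i(1)] f0 by (simp add: bij_betw_def f1_def)
    then obtain h where h: "h \<in> mcar (N i)" "f1 = e i h" by blast
    obtain t where t: "t \<in> wcar (Y i)" "t \<noteq> 0" by (rule simple_amod_nonzero[OF simple[OF i(1)]])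
    have ft: "f t \<in> C" using f(1) t(1) by (auto simp: bij_betw_def)
    have "f t = f1 t" using t(1) by (simp add: f1_def)
    also have "\<dots> = \<Phi> (single i (pure_tensor (F i) t h))"
      by (simp only: \<Phi>_single[OF i(1)] evp[OF i(1) t(1) h(1)] h(2))
    also have "\<dots> \<in> \<Phi> ` X" using single_X[OF i(1) pure_in[OF t(1) h(1)]] by blast
    finally have "f t = 0" using ft CZ Z(2) by blast
    moreover have "lin_on (wcar (Y i)) C f" using f(2) by (simp add: ops_hom_def)
    from lin_on_zero[OF this alg_moduleD(1)[OF Ymod[OF i(1)]]] have "f 0 = 0" .
    ultimately show False
      using f(1) t cv.subspace_0[OF alg_moduleD(1)[OF Ymod[OF i(1)]]] by (auto simp: bij_betw_def inj_on_def)
  qed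

  have bij: "bij_betw \<Phi> X (mcar MV)" using inj surj by (simp add: bij_betw_def)
  have iso: "vmod_hom_iso U ?N' MV \<Phi>"
    unfolding vmod_hom_iso_def N'car using bij \<Phi>lin \<Phi>mode by simp
  have "vmod_hom_iso U MV ?N' (inv_into (mcar ?N') \<Phi>)"
    by (rule vmod_hom_iso_inv[OF iso]) (simp_all only: N'car Xsub modeX)
  moreover have "ops_hom (acar A) X (wact ?X') (mcar MV) (wact MA) \<Phi>"
    using \<Phi>lin \<Phi>act by (simp add: ops_hom_def)
  then have "ops_hom (acar A) (mcar MV) (wact MA) X (wact ?X') (inv_into X \<Phi>)"
    by (rule ops_hom_inv[OF _ bij Xsub actX])
  ultimately show ?thesis
    unfolding au_iso_def MA_car
    by (intro exI[of _ "inv_into X \<Phi>"]) (simp add: N'car ops_hom_def)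
qed

end

section \<open>Induced modules\<close>

context orbifold
begin

abbreviation "TGA M \<equiv> twisted_group_algebra V G S \<phi> M"
abbreviation "H M \<equiv> stabilizer V G M"
abbreviation "D M \<equiv> gs_D G M"
abbreviation "emb M \<equiv> gs_embed M"

text \<open>The basis vector of the twisted group algebra that is written as \<open>g\<close> with a
  bar.\<close>

definition dlt :: "('v \<Rightarrow> 'v) \<Rightarrow> ('v \<Rightarrow> 'v) \<Rightarrow> complex" where
  "dlt g = (\<lambda>k. if k = g then 1 else 0)"

lemma acar_TGA: "a \<in> acar (TGA M) \<longleftrightarrow> (\<forall>g. a g \<noteq> 0 \<longrightarrow> g \<in> H M)"
  by (simp add: twisted_group_algebra_def Let_def)

lemma amul_TGA: "amul (TGA M) a c = (\<Sum>g\<in>H M. \<Sum>h\<in>H M. cscale (a g * c h * \<alpha> M g h) (dlt (g \<circ> h)))"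
  by (simp add: twisted_group_algebra_def Let_def dlt_def)

lemma aone_TGA: "aone (TGA M) = dlt id"
  by (simp add: twisted_group_algebra_def Let_def dlt_def)

lemma TGA_subspace: "cv.subspace (acar (TGA M))"
proof -
  have "acar (TGA M) = {a. \<forall>g. g \<notin> H M \<longrightarrow> a g = 0}" by (auto simp: acar_TGA)
  then show ?thesis by (simp add: cv.subspace_def)
qed

lemma emb_apply: "emb M a (g, N) = (if N = M then a g else 0)"
  by (simp add: gs_embed_def)

lemma emb_lin: "lin_on UNIV UNIV (emb M)"
  by (rule lin_onI) (auto simp: fun_eq_iff emb_apply)

lemma emb_dlt: "emb M (dlt g) = b g M"
  by (auto simp: fun_eq_iff emb_apply dlt_def gs_basis_def)

lemma D_subspace: "cv.subspace (D M)"
  by (simp add: gs_D_def cv.subspace_span)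

lemma D_fin_dim: "fin_dim (D M)"
  unfolding fin_dim_def gs_D_def by (intro exI[of _ "(\<lambda>g. b g M) ` G"]) (simp add: finG)

lemma basis_in_D: "g \<in> G \<Longrightarrow> b g M \<in> D M"
  unfolding gs_D_def by (rule cv.span_base) blast

lemma D_eqI:
  assumes "lin_on (D M) X f" "lin_on (D M) Y h" "d \<in> D M"
    and "\<And>g. g \<in> G \<Longrightarrow> f (b g M) = h (b g M)"
  shows "f d = h d"
proof (rule lin_on_span_eq[of "(\<lambda>g. b g M) ` G" X f Y h d])
  show "lin_on (cv.span ((\<lambda>g. b g M) ` G)) X f" "lin_on (cv.span ((\<lambda>g. b g M) ` G)) Y h"
    "d \<in> cv.span ((\<lambda>g. b g M) ` G)"
    using assms(1-3) by (simp_all only: gs_D_def)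
  show "f c = h c" if "c \<in> (\<lambda>g. b g M) ` G" for c using that assms(4) by blast
qed

text \<open>The projection of \<open>D(M)\<close> onto \<open>S(M)\<close>; by \<open>idem_D\<close>
  it is left multiplication by the idempotent at \<open>M\<close>.\<close>

definition res :: "('v, 'm) vmod \<Rightarrow> ('v, 'm) gs \<Rightarrow> ('v \<Rightarrow> 'v) \<Rightarrow> complex" where
  "res M d = (\<lambda>g. if g \<in> H M then d (g, M) else 0)"

lemma res_in: "res M d \<in> acar (TGA M)"
  by (simp add: acar_TGA res_def)

lemma res_lin: "lin_on UNIV UNIV (res M)"
  by (rule lin_onI) (auto simp: fun_eq_iff res_def)

lemma res_emb: "s \<in> acar (TGA M) \<Longrightarrow> res M (emb M s) = s"
  by (auto simp: fun_eq_iff res_def emb_apply acar_TGA)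

context
  fixes M assumes M: "M \<in> S"
begin

lemma H_G: "g \<in> H M \<Longrightarrow> g \<in> G" and H_tgt: "g \<in> H M \<Longrightarrow> tgt M g = M"
  using stabilizer_iff[OF M] by blast+

lemma H_id: "id \<in> H M"
  using stabilizer_iff[OF M] G_id M by simp

lemma H_comp: "g \<in> H M \<Longrightarrow> h \<in> H M \<Longrightarrow> g \<circ> h \<in> H M"
  using stabilizer_iff[OF M] G_comp tgt_tgt[OF M, of g h] by simp

lemma finH: "finite (H M)"
  by (rule finite_subset[OF _ finG]) (use H_G in blast)

lemma D_acar: "D M \<subseteq> acar A"
  unfolding gs_D_def by (rule cv.span_minimal[OF _ acar_subspace]) (use M in \<open>auto simp: basis_in\<close>)

lemma TGA_expand:
  assumes "s \<in> acar (TGA M)"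
  shows "s = (\<Sum>g\<in>H M. cscale (s g) (dlt g))"
proof
  fix k
  have "(\<Sum>g\<in>H M. cscale (s g) (dlt g)) k = (\<Sum>g\<in>H M. if g = k then s g else 0)"
    unfolding sum_fun_apply by (rule sum.cong) (auto simp: dlt_def cscale_complex_def)
  also have "\<dots> = s k" using assms finH by (auto simp: acar_TGA)
  finally show "s k = (\<Sum>g\<in>H M. cscale (s g) (dlt g)) k" by simp
qed

lemma emb_expand:
  assumes "s \<in> acar (TGA M)"
  shows "emb M s = (\<Sum>g\<in>H M. cscale (s g) (b g M))"
proof -
  have "emb M s = emb M (\<Sum>g\<in>H M. cscale (s g) (dlt g))" using TGA_expand[OF assms] by simp
  also have "\<dots> = (\<Sum>g\<in>H M. emb M (cscale (s g) (dlt g)))" by (rule lin_on_sum[OF emb_lin]) auto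
  finally show ?thesis by (simp add: lin_on_scale[OF emb_lin] emb_dlt)
qed

lemma emb_in_D: "s \<in> acar (TGA M) \<Longrightarrow> emb M s \<in> D M"
  by (simp add: emb_expand cv.subspace_sum[OF D_subspace] cv.subspace_scale[OF D_subspace] basis_in_D H_G)

lemma emb_in: "s \<in> acar (TGA M) \<Longrightarrow> emb M s \<in> acar A"
  using emb_in_D D_acar by blast

lemma dlt_in: "g \<in> H M \<Longrightarrow> dlt g \<in> acar (TGA M)"
  by (simp add: acar_TGA dlt_def)

lemma amul_TGA_in: "amul (TGA M) s t \<in> acar (TGA M)"
  unfolding amul_TGA
  by (intro cv.subspace_sum[OF TGA_subspace] cv.subspace_scale[OF TGA_subspace] dlt_in H_comp)

text \<open>Stabilizer elements satisfy \<open>tgt M h = M\<close>, so no product of their basis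
  elements vanishes and both multiplications use the cocycle at \<open>M\<close>.\<close>

lemma emb_mult:
  assumes s: "s \<in> acar (TGA M)" and t: "t \<in> acar (TGA M)"
  shows "emb M (amul (TGA M) s t) = amul A (emb M s) (emb M t)"
proof -
  have inner: "amul A x (emb M t) = (\<Sum>h\<in>H M. cscale (t h) (amul A x (b h M)))" for x
    by (simp add: emb_expand[OF t] lin_on_sum[OF amul_lin_right] amul_scale)
  have outer: "amul A (emb M s) y = (\<Sum>g\<in>H M. cscale (s g) (amul A (b g M) y))" for y
    by (simp add: emb_expand[OF s] lin_on_sum[OF amul_lin_left] amul_scale)
  have "emb M (amul (TGA M) s t) = (\<Sum>g\<in>H M. \<Sum>h\<in>H M. cscale (s g * t h * \<alpha> M g h) (b (g \<circ> h) M))"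
    unfolding amul_TGA by (simp add: lin_on_sum[OF emb_lin] lin_on_scale[OF emb_lin] emb_dlt)
  also have "\<dots> = (\<Sum>g\<in>H M. \<Sum>h\<in>H M. cscale (s g) (cscale (t h) (amul A (b g M) (b h M))))"
    by (intro sum.cong refl) (simp add: amul_basis H_G H_tgt M cscale_cscale mult.assoc)
  also have "\<dots> = amul A (emb M s) (emb M t)"
    by (subst outer) (simp add: inner cv.scale_sum_right)
  finally show ?thesis .
qed

lemma emb_one: "emb M (aone (TGA M)) = b id M"
  by (simp add: aone_TGA emb_dlt)

lemma D_left:
  assumes a: "a \<in> acar A" and d: "d \<in> D M"
  shows "amul A a d \<in> D M"
proof (rule lin_on_span_in[of "(\<lambda>g. b g M) ` G" "acar A" "amul A a"])
  show "lin_on (cv.span ((\<lambda>g. b g M) ` G)) (acar A) (amul A a)"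
    by (rule lin_on_mono[OF amul_lin_right]) (simp_all add: amul_in)
  show "amul A a c \<in> D M" if c: "c \<in> (\<lambda>g. b g M) ` G" for c
  proof -
    obtain g where g: "g \<in> G" "c = b g M" using c by blast
    show ?thesis
      unfolding g(2)
    proof (rule lin_on_span_in[of "(\<lambda>(g, M). b g M) ` (G \<times> S)" "acar A" "\<lambda>a. amul A a (b g M)"])
      show "lin_on (cv.span ((\<lambda>(g, M). b g M) ` (G \<times> S))) (acar A) (\<lambda>a. amul A a (b g M))"
        by (rule lin_on_mono[OF amul_lin_left]) (simp_all add: amul_in)
      show "amul A x (b g M) \<in> D M" if "x \<in> (\<lambda>(g, M). b g M) ` (G \<times> S)" for x
        using that g(1) M
        by (auto simp: amul_basis cv.subspace_0[OF D_subspace] cv.subspace_scale[OF D_subspace] basis_in_D G_comp)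
      show "a \<in> cv.span ((\<lambda>(g, M). b g M) ` (G \<times> S))" using a by (simp only: acar_span)
    qed (rule D_subspace)
  qed
qed (use d D_subspace in \<open>simp_all add: gs_D_def\<close>)

lemma D_right: "d \<in> D M \<Longrightarrow> s \<in> acar (TGA M) \<Longrightarrow> amul A d (emb M s) \<in> D M"
  using D_left emb_in_D D_acar by blast

lemma D_idem: "d \<in> D M \<Longrightarrow> amul A d (b id M) = d"
proof (rule D_eqI[of M "acar A" "\<lambda>d. amul A d (b id M)" "D M" "\<lambda>d. d" d])
  show "lin_on (D M) (acar A) (\<lambda>d. amul A d (b id M))"
    by (rule lin_on_mono[OF amul_lin_left]) (simp_all add: amul_in)
qed (simp_all add: lin_on_def idem_mult_right M G_id)

text \<open>Among the basis elements of \<open>D(M)\<close>, left multiplication by the idempotent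
  keeps those with \<open>tgt M g = M\<close>, and these \<open>g\<close> form the
  stabilizer.\<close>

lemma idem_D: "d \<in> D M \<Longrightarrow> amul A (b id M) d = emb M (res M d)"
proof (rule D_eqI[of M "acar A" "amul A (b id M)" UNIV "\<lambda>d. emb M (res M d)" d])
  show "lin_on (D M) (acar A) (amul A (b id M))"
    by (rule lin_on_mono[OF amul_lin_right]) (simp_all add: amul_in)
  show "lin_on (D M) UNIV (\<lambda>d. emb M (res M d))"
    by (rule lin_on_mono[OF lin_on_compose[OF res_lin emb_lin]]) simp_all
  show "amul A (b id M) (b g M) = emb M (res M (b g M))" if g: "g \<in> G" for g
  proof (cases "g \<in> H M")
    case True
    have "res M (b g M) = dlt g"
      by (rule ext) (use True in \<open>auto simp: res_def dlt_def gs_basis_def\<close>)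
    then show ?thesis using idem_mult_left[OF M M g] H_tgt[OF True] by (simp add: emb_dlt)
  next
    case False
    then have "res M (b g M) = 0" by (intro ext) (auto simp: res_def gs_basis_def)
    moreover have "M \<noteq> tgt M g" using False g stabilizer_iff[OF M] by metis
    ultimately show ?thesis
      using idem_mult_left[OF M M g] lin_on_zero[OF emb_lin cv.subspace_UNIV] by simp
  qed
qed

lemma res_idem: "res M (b id M) = aone (TGA M)"
  using res_emb[OF dlt_in[OF H_id]] by (simp add: emb_dlt aone_TGA)

text \<open>This is the balancedness behind \<open>wind_retraction\<close>. Through
  \<open>idem_D\<close> it is associativity of \<open>A\<close>.\<close>

lemma res_right:
  assumes d: "d \<in> D M" and s: "s \<in> acar (TGA M)"
  shows "res M (amul A d (emb M s)) = amul (TGA M) (res M d) s"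
proof -
  have dA: "d \<in> acar A" using d D_acar by blast
  have "emb M (res M (amul A d (emb M s))) = amul A (b id M) (amul A d (emb M s))"
    using idem_D[OF D_right[OF d s]] by simp
  also have "\<dots> = amul A (emb M (res M d)) (emb M s)"
    using amul_assoc[OF basis_in[OF G_id M] dA emb_in[OF s]] idem_D[OF d] by simp
  also have "\<dots> = emb M (amul (TGA M) (res M d) s)" by (rule emb_mult[OF res_in s, symmetric])
  finally have "res M (emb M (res M (amul A d (emb M s)))) = res M (emb M (amul (TGA M) (res M d) s))" by simp
  then show ?thesis by (simp add: res_emb res_in amul_TGA_in)
qed

lemma fd_alg_TGA: "fd_alg (TGA M)"
proof -
  have "acar (TGA M) = res M ` D M"
  proof
    show "acar (TGA M) \<subseteq> res M ` D M"
    proof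
      fix s assume s: "s \<in> acar (TGA M)"
      show "s \<in> res M ` D M"
        by (rule image_eqI[of _ _ "emb M s"]) (simp_all add: res_emb emb_in_D s)
    qed
  qed (use res_in in blast)
  moreover have "fin_dim (res M ` D M)"
    by (rule fin_dim_image[OF D_fin_dim lin_on_mono[OF res_lin, where X' = "D M" and Y' = UNIV]]) simp_all
  ultimately show ?thesis
    using dlt_in[OF H_id] amul_TGA_in by (simp add: fd_alg_def aone_TGA)
qed

lemma emb_idem: "s \<in> acar (TGA M) \<Longrightarrow> amul A (emb M s) (b id M) = emb M s"
  "s \<in> acar (TGA M) \<Longrightarrow> amul A (b id M) (emb M s) = emb M s"
  by (simp_all add: D_idem emb_in_D idem_D res_emb)

end

section \<open>The tensor product over the twisted group algebra\<close>

definition wforms where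
  "wforms M W = balanced_forms (TGA M) (D M) (\<lambda>d a. amul A d (emb M a)) W"

abbreviation "Wind M W \<equiv> induced_module V G S \<phi> M W"

definition pt where "pt M W d w = pure_tensor (wforms M W) d w"

lemma wind_car: "wcar (Wind M W) = tensor_space (wforms M W) (D M) (wcar W)"
  and wind_act: "wact (Wind M W) a = tensor_map (wforms M W) (amul A a) id"
  by (simp_all add: induced_module_def Let_def wforms_def)

lemma wforms_bilinear: "wforms M W \<subseteq> bilinear_forms (D M) (wcar W)"
  by (auto simp: wforms_def balanced_forms_def)

context
  fixes M and W :: "(('v \<Rightarrow> 'v) \<Rightarrow> complex, 'w::complex_space) amod"
  assumes M: "M \<in> S" and W: "alg_module (TGA M) W"
begin

lemma pt_in: "d \<in> D M \<Longrightarrow> w \<in> wcar W \<Longrightarrow> pt M W d w \<in> wcar (Wind M W)"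
  unfolding wind_car pt_def by (rule pure_tensor_in)

lemma pt_lin_left: "w \<in> wcar W \<Longrightarrow> lin_on (D M) UNIV (\<lambda>d. pt M W d w)"
  unfolding pt_def by (rule pure_tensor_lin_left[OF wforms_bilinear])

lemma pt_lin_right: "d \<in> D M \<Longrightarrow> lin_on (wcar W) UNIV (pt M W d)"
  unfolding pt_def[abs_def] by (rule pure_tensor_lin_right[OF wforms_bilinear])

lemma pt_balanced:
  "d \<in> D M \<Longrightarrow> s \<in> acar (TGA M) \<Longrightarrow> w \<in> wcar W \<Longrightarrow> pt M W (amul A d (emb M s)) w = pt M W d (wact W s w)"
  unfolding pt_def by (rule pure_tensor_balanced[OF wforms_def])

text \<open>\<open>tensor_map\<close> pulls forms back, and it has the expected value on pure
  tensors because the pulled-back form is balanced again; that is associativity of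
  \<open>A\<close>.\<close>

lemma wind_act_pt:
  assumes a: "a \<in> acar A"
  shows "wact (Wind M W) a (pt M W d w) = pt M W (amul A a d) w"
  unfolding wind_act pt_def
proof (subst tensor_map_pure)
  fix \<beta> assume \<beta>: "\<beta> \<in> wforms M W"
  then have l: "\<And>d. d \<in> D M \<Longrightarrow> lin_on (wcar W) UNIV (\<lambda>w. \<beta> d w)"
    "\<And>w. w \<in> wcar W \<Longrightarrow> lin_on (D M) UNIV (\<lambda>d. \<beta> d w)"
    and bal: "\<And>d s w. d \<in> D M \<Longrightarrow> s \<in> acar (TGA M) \<Longrightarrow> w \<in> wcar W \<Longrightarrow>
        \<beta> (amul A d (emb M s)) w = \<beta> d (wact W s w)"
    by (simp_all add: wforms_def balanced_forms_def bilinear_forms_def)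
  have la: "lin_on (D M) (D M) (amul A a)"
    by (rule lin_on_mono[OF amul_lin_right]) (simp_all add: D_left[OF M a])
  have "\<beta> (amul A a (amul A d (emb M s))) w = \<beta> (amul A a d) (wact W s w)"
    if "d \<in> D M" "s \<in> acar (TGA M)" "w \<in> wcar W" for d s w
  proof -
    have "amul A a (amul A d (emb M s)) = amul A (amul A a d) (emb M s)"
      using amul_assoc[OF a _ emb_in[OF M that(2)]] D_acar[OF M] that(1) by (simp add: subset_iff)
    then show ?thesis using bal[OF D_left[OF M a that(1)] that(2,3)] by simp
  qed
  then show "(\<lambda>d w. \<beta> (amul A a d) (id w)) \<in> wforms M W"
    unfolding wforms_def balanced_forms_def bilinear_forms_def id_apply
    using lin_on_compose[OF la l(2)] l(1)[OF D_left[OF M a]] by simp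
qed simp

lemma wind_eqI:
  assumes "lin_on (wcar (Wind M W)) X f" "lin_on (wcar (Wind M W)) Y h" "t \<in> wcar (Wind M W)"
    and "\<And>d w. d \<in> D M \<Longrightarrow> w \<in> wcar W \<Longrightarrow> f (pt M W d w) = h (pt M W d w)"
  shows "f t = h t"
  using tensor_space_eqI[of "wforms M W" "D M" "wcar W" X f Y h t] assms
  unfolding wind_car pt_def by blast

lemma wind_map_in:
  assumes "lin_on (wcar (Wind M W)) X f" "cv.subspace Y" "t \<in> wcar (Wind M W)"
    and "\<And>d w. d \<in> D M \<Longrightarrow> w \<in> wcar W \<Longrightarrow> f (pt M W d w) \<in> Y"
  shows "f t \<in> Y"
  using tensor_space_map_in[of "wforms M W" "D M" "wcar W" X f Y t] assms
  unfolding wind_car pt_def by blast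

lemma wind_subspace: "cv.subspace (wcar (Wind M W))"
  unfolding wind_car by (rule tensor_space_subspace)

lemma wind_act_lin: "lin_on (wcar (Wind M W)) UNIV (wact (Wind M W) a)"
  unfolding wind_act by (rule lin_on_mono[OF tensor_map_lin]) simp_all

lemma wind_act_in:
  assumes a: "a \<in> acar A" and t: "t \<in> wcar (Wind M W)"
  shows "wact (Wind M W) a t \<in> wcar (Wind M W)"
  by (rule wind_map_in[OF wind_act_lin wind_subspace t])
    (simp add: wind_act_pt[OF a] pt_in D_left[OF M a])

lemma wind_act_lin': "a \<in> acar A \<Longrightarrow> lin_on (wcar (Wind M W)) (wcar (Wind M W)) (wact (Wind M W) a)"
  by (rule lin_on_mono[OF wind_act_lin]) (simp_all add: wind_act_in)

lemma wind_module: "alg_module A (Wind M W)"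
  unfolding alg_module_def
proof (intro conjI ballI)
  show "cv.subspace (wcar (Wind M W))" by (rule wind_subspace)
  show "lin_on (wcar (Wind M W)) (wcar (Wind M W)) (wact (Wind M W) a)" if "a \<in> acar A" for a
    by (rule wind_act_lin'[OF that])
  have dA: "d \<in> acar A" if "d \<in> D M" for d using D_acar[OF M] that by blast
  show "lin_on (acar A) (wcar (Wind M W)) (\<lambda>a. wact (Wind M W) a t)" if t: "t \<in> wcar (Wind M W)" for t
  proof (rule lin_onI)
    show "wact (Wind M W) a t \<in> wcar (Wind M W)" if "a \<in> acar A" for a by (rule wind_act_in[OF that t])
    fix a assume a: "a \<in> acar A"
    show "wact (Wind M W) (a + c) t = wact (Wind M W) a t + wact (Wind M W) c t" if c: "c \<in> acar A" for c
    proof (rule wind_eqI[of UNIV "wact (Wind M W) (a + c)" UNIV "\<lambda>t. wact (Wind M W) a t + wact (Wind M W) c t", OF wind_act_lin _ t])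
      show "lin_on (wcar (Wind M W)) UNIV (\<lambda>t. wact (Wind M W) a t + wact (Wind M W) c t)"
        by (rule lin_onI) (simp_all add: lin_on_add[OF wind_act_lin] lin_on_scale[OF wind_act_lin] cscale_add_right)
      show "wact (Wind M W) (a + c) (pt M W d w) = wact (Wind M W) a (pt M W d w) + wact (Wind M W) c (pt M W d w)"
        if "d \<in> D M" "w \<in> wcar W" for d w
        using lin_on_add[OF pt_lin_left[OF that(2)] D_left[OF M a that(1)] D_left[OF M c that(1)]]
        by (simp add: wind_act_pt a c cv.subspace_add[OF acar_subspace] lin_on_add[OF amul_lin_left])
    qed
    show "wact (Wind M W) (cscale c a) t = cscale c (wact (Wind M W) a t)" for c
    proof (rule wind_eqI[of UNIV "wact (Wind M W) (cscale c a)" UNIV "\<lambda>t. cscale c (wact (Wind M W) a t)", OF wind_act_lin _ t])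
      show "lin_on (wcar (Wind M W)) UNIV (\<lambda>t. cscale c (wact (Wind M W) a t))"
        by (rule lin_onI) (simp_all add: lin_on_add[OF wind_act_lin] lin_on_scale[OF wind_act_lin]
            cscale_add_right cscale_cscale mult.commute)
      show "wact (Wind M W) (cscale c a) (pt M W d w) = cscale c (wact (Wind M W) a (pt M W d w))"
        if "d \<in> D M" "w \<in> wcar W" for d w
        using lin_on_scale[OF pt_lin_left[OF that(2)] D_left[OF M a that(1)]]
        by (simp add: wind_act_pt a cv.subspace_scale[OF acar_subspace] amul_scale)
    qed
  qed
  show "wact (Wind M W) (amul A a c) t = wact (Wind M W) a (wact (Wind M W) c t)"
    if a: "a \<in> acar A" and c: "c \<in> acar A" and t: "t \<in> wcar (Wind M W)" for a c t
  proof (rule wind_eqI[of UNIV "wact (Wind M W) (amul A a c)" UNIV "\<lambda>t. wact (Wind M W) a (wact (Wind M W) c t)", OF wind_act_lin _ t])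
    show "lin_on (wcar (Wind M W)) UNIV (\<lambda>t. wact (Wind M W) a (wact (Wind M W) c t))"
      by (rule lin_on_compose[OF wind_act_lin'[OF c] wind_act_lin])
    show "wact (Wind M W) (amul A a c) (pt M W d w) = wact (Wind M W) a (wact (Wind M W) c (pt M W d w))"
      if "d \<in> D M" "w \<in> wcar W" for d w
      using that by (simp add: wind_act_pt a c amul_in amul_assoc dA)
  qed
  show "wact (Wind M W) (aone A) t = t" if t: "t \<in> wcar (Wind M W)" for t
  proof (rule wind_eqI[of UNIV "wact (Wind M W) (aone A)" UNIV "\<lambda>t. t", OF wind_act_lin _ t])
    show "lin_on (wcar (Wind M W)) UNIV (\<lambda>t. t)" by (simp add: lin_on_def)
    show "wact (Wind M W) (aone A) (pt M W d w) = pt M W d w" if "d \<in> D M" "w \<in> wcar W" for d w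
      using that by (simp add: wind_act_pt aone_in amul_one dA)
  qed
qed

text \<open>The copy \<open>e(M)\<close> \<otimes> \<open>w\<close> of \<open>W\<close> inside the
  induced module; by \<open>pt_ge\<close> it generates the whole over \<open>A\<close>.\<close>

abbreviation "ge w \<equiv> pt M W (b id M) w"

lemma ge_in: "w \<in> wcar W \<Longrightarrow> ge w \<in> wcar (Wind M W)"
  by (rule pt_in[OF basis_in_D[OF G_id]])

lemma ge_lin: "lin_on (wcar W) (wcar (Wind M W)) (\<lambda>w. ge w)"
  by (rule lin_on_mono[OF pt_lin_right[OF basis_in_D[OF G_id]]]) (simp_all add: ge_in)

lemma pt_ge: "d \<in> D M \<Longrightarrow> pt M W d w = wact (Wind M W) d (ge w)"
  using D_acar[OF M] by (simp add: wind_act_pt subset_iff D_idem[OF M])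

lemma ge_act:
  assumes s: "s \<in> acar (TGA M)" and w: "w \<in> wcar W"
  shows "ge (wact W s w) = wact (Wind M W) (emb M s) (ge w)"
  using pt_balanced[OF basis_in_D[OF G_id] s w]
  by (simp add: wind_act_pt emb_in[OF M s] emb_idem[OF M s])

lemma idem_pt:
  assumes d: "d \<in> D M" and w: "w \<in> wcar W"
  shows "wact (Wind M W) (b id M) (pt M W d w) = ge (wact W (res M d) w)"
proof -
  have "wact (Wind M W) (b id M) (pt M W d w) = pt M W (emb M (res M d)) w"
    by (simp add: wind_act_pt basis_in G_id M idem_D[OF M d])
  also have "\<dots> = wact (Wind M W) (emb M (res M d)) (ge w)"
    by (rule pt_ge[OF emb_in_D[OF M res_in]])
  finally show ?thesis by (simp add: ge_act res_in w)
qed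

lemma wind_idem:
  assumes t: "t \<in> wcar (Wind M W)"
  shows "\<exists>w\<in>wcar W. wact (Wind M W) (b id M) t = ge w"
proof -
  have "wact (Wind M W) (b id M) t \<in> (\<lambda>w. ge w) ` wcar W"
  proof (rule wind_map_in[OF wind_act_lin _ t])
    show "cv.subspace ((\<lambda>w. ge w) ` wcar W)" by (rule subspace_image[OF ge_lin alg_moduleD(1)[OF W]])
    fix d w assume d: "d \<in> D M" and w: "w \<in> wcar W"
    have "wact W (res M d) w \<in> wcar W" by (rule lin_on_in[OF alg_moduleD(2)[OF W res_in] w])
    then show "wact (Wind M W) (b id M) (pt M W d w) \<in> (\<lambda>w. ge w) ` wcar W"
      unfolding idem_pt[OF d w] by blast
  qed
  then show ?thesis by blast
qed

text \<open>
  The retraction of \<open>w \<mapsto> e(M) \<otimes> w\<close> induced by the projection of \<open>D(M)\<close> onto \<open>S(M)\<close>.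
\<close>

lemma wind_retraction: "\<exists>\<rho>. lin_on (wcar (Wind M W)) (wcar W) \<rho> \<and> (\<forall>w\<in>wcar W. \<rho> (ge w) = w)"
proof -
  have "\<exists>f. lin_on (tensor_space (wforms M W) (D M) (wcar W)) UNIV f \<and>
      (\<forall>d\<in>D M. \<forall>w\<in>wcar W. f (pure_tensor (wforms M W) d w) = wact W (res M d) w) \<and>
      (\<forall>f'. lin_on (tensor_space (wforms M W) (D M) (wcar W)) UNIV f' \<and>
         (\<forall>d\<in>D M. \<forall>w\<in>wcar W. f' (pure_tensor (wforms M W) d w) = wact W (res M d) w) \<longrightarrow>
         (\<forall>t\<in>tensor_space (wforms M W) (D M) (wcar W). f' t = f t))"
    unfolding wforms_def
  proof (rule tensor_universal)
    show "lin_on (wcar W) UNIV (\<lambda>w. wact W (res M d) w)" for d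
      by (rule lin_on_mono[OF alg_moduleD(2)[OF W res_in]]) simp_all
    show "lin_on (D M) UNIV (\<lambda>d. wact W (res M d) w)" if w: "w \<in> wcar W" for w
    proof -
      have "lin_on (D M) (acar (TGA M)) (res M)" by (rule lin_on_mono[OF res_lin]) (simp_all add: res_in)
      from lin_on_compose[OF this alg_moduleD(3)[OF W w]] show ?thesis by (rule lin_on_mono) simp_all
    qed
    show "wact W (res M (amul A d (emb M s))) w = wact W (res M d) (wact W s w)"
      if "d \<in> D M" "s \<in> acar (TGA M)" "w \<in> wcar W" for d s w
      using that by (simp add: res_right[OF M] alg_moduleD(4)[OF W] res_in)
  qed
  then obtain f where f: "lin_on (wcar (Wind M W)) UNIV f"
      "\<forall>d\<in>D M. \<forall>w\<in>wcar W. f (pt M W d w) = wact W (res M d) w"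
    unfolding wind_car pt_def by (elim exE conjE)
  have "f t \<in> wcar W" if t: "t \<in> wcar (Wind M W)" for t
    by (rule wind_map_in[OF f(1) alg_moduleD(1)[OF W] t])
      (simp add: f(2) lin_on_in[OF alg_moduleD(2)[OF W res_in]])
  then have "lin_on (wcar (Wind M W)) (wcar W) f" using f(1) by (simp add: lin_on_def)
  moreover have "f (ge w) = w" if "w \<in> wcar W" for w
    using bspec[OF bspec[OF f(2) basis_in_D[OF G_id]] that] that
    by (simp add: res_idem[OF M] alg_moduleD(5)[OF W])
  ultimately show ?thesis by blast
qed

lemma ge_inject:
  assumes "w \<in> wcar W" "w' \<in> wcar W" "ge w = ge w'"
  shows "w = w'"
proof -
  obtain \<rho> where "\<forall>w\<in>wcar W. \<rho> (ge w) = w" using wind_retraction by blast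
  then show ?thesis using assms by metis
qed

lemma ge_zero: "w \<in> wcar W \<Longrightarrow> ge w = 0 \<Longrightarrow> w = 0"
  using ge_inject[of w 0] lin_on_zero[OF ge_lin alg_moduleD(1)[OF W]] cv.subspace_0[OF alg_moduleD(1)[OF W]] by simp

text \<open>Sending \<open>d\<close> \<otimes> \<open>w\<close> to \<open>d\<close> applied to
  \<open>h w\<close> is balanced, because \<open>h\<close> commutes with the twisted group
  algebra.\<close>

theorem frobenius_reciprocity:
  fixes X :: "(('v, 'm) gs, 'x::complex_space) amod"
  assumes X: "alg_module A X" and h: "lin_on (wcar W) (wcar X) h"
    and hact: "\<And>s w. s \<in> acar (TGA M) \<Longrightarrow> w \<in> wcar W \<Longrightarrow> h (wact W s w) = wact X (emb M s) (h w)"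
  shows "\<exists>f. ops_hom (acar A) (wcar (Wind M W)) (wact (Wind M W)) (wcar X) (wact X) f \<and>
    (\<forall>w\<in>wcar W. f (ge w) = h w)"
proof -
  have dA: "d \<in> acar A" if "d \<in> D M" for d using D_acar[OF M] that by blast
  have hX: "h w \<in> wcar X" if "w \<in> wcar W" for w using lin_on_in[OF h that] .
  have "\<exists>f. lin_on (tensor_space (wforms M W) (D M) (wcar W)) UNIV f \<and>
      (\<forall>d\<in>D M. \<forall>w\<in>wcar W. f (pure_tensor (wforms M W) d w) = wact X d (h w)) \<and>
      (\<forall>f'. lin_on (tensor_space (wforms M W) (D M) (wcar W)) UNIV f' \<and>
         (\<forall>d\<in>D M. \<forall>w\<in>wcar W. f' (pure_tensor (wforms M W) d w) = wact X d (h w)) \<longrightarrow>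
         (\<forall>t\<in>tensor_space (wforms M W) (D M) (wcar W). f' t = f t))"
    unfolding wforms_def
  proof (rule tensor_universal)
    show "lin_on (wcar W) UNIV (\<lambda>w. wact X d (h w))" if "d \<in> D M" for d
      by (rule lin_on_mono[OF lin_on_compose[OF h alg_moduleD(2)[OF X dA[OF that]]]]) simp_all
    show "lin_on (D M) UNIV (\<lambda>d. wact X d (h w))" if "w \<in> wcar W" for w
      by (rule lin_on_mono[OF alg_moduleD(3)[OF X hX[OF that]] D_acar[OF M]]) simp
    show "wact X (amul A d (emb M s)) (h w) = wact X d (h (wact W s w))"
      if "d \<in> D M" "s \<in> acar (TGA M)" "w \<in> wcar W" for d s w
      using that by (simp add: alg_moduleD(4)[OF X] dA emb_in[OF M] hX hact)
  qed
  then obtain f where f: "lin_on (wcar (Wind M W)) UNIV f"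
      "\<forall>d\<in>D M. \<forall>w\<in>wcar W. f (pt M W d w) = wact X d (h w)"
    unfolding wind_car pt_def by (elim exE conjE)
  have fX: "f t \<in> wcar X" if t: "t \<in> wcar (Wind M W)" for t
    by (rule wind_map_in[OF f(1) alg_moduleD(1)[OF X] t])
      (simp add: f(2) lin_on_in[OF alg_moduleD(2)[OF X dA] hX])
  have fl: "lin_on (wcar (Wind M W)) (wcar X) f" using f(1) fX by (simp add: lin_on_def)
  have "f (wact (Wind M W) a t) = wact X a (f t)" if a: "a \<in> acar A" and t: "t \<in> wcar (Wind M W)" for a t
  proof (rule wind_eqI[of UNIV "\<lambda>t. f (wact (Wind M W) a t)" "wcar X" "\<lambda>t. wact X a (f t)", OF _ _ t])
    show "lin_on (wcar (Wind M W)) UNIV (\<lambda>t. f (wact (Wind M W) a t))"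
      by (rule lin_on_compose[OF wind_act_lin'[OF a] f(1)])
    show "lin_on (wcar (Wind M W)) (wcar X) (\<lambda>t. wact X a (f t))"
      by (rule lin_on_compose[OF fl alg_moduleD(2)[OF X a]])
    show "f (wact (Wind M W) a (pt M W d w)) = wact X a (f (pt M W d w))" if "d \<in> D M" "w \<in> wcar W" for d w
      using that f(2) D_left[OF M a that(1)] by (simp add: wind_act_pt[OF a] alg_moduleD(4)[OF X a dA hX])
  qed
  moreover have "f (ge w) = h w" if w: "w \<in> wcar W" for w
  proof -
    have one: "aone (TGA M) \<in> acar (TGA M)" using fd_alg_TGA[OF M] by (simp add: fd_alg_def)
    have "h w = h (wact W (aone (TGA M)) w)" using alg_moduleD(5)[OF W w] by simp
    also have "\<dots> = wact X (b id M) (h w)" using hact[OF one w] by (simp add: emb_one[OF M])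
    finally show ?thesis using bspec[OF bspec[OF f(2) basis_in_D[OF G_id]] w] by simp
  qed
  ultimately show ?thesis using fl by (intro exI[of _ f]) (simp add: ops_hom_def)
qed

lemma wind_hom_eqI:
  assumes X: "alg_module A X"
    and f: "ops_hom (acar A) (wcar (Wind M W)) (wact (Wind M W)) (wcar X) (wact X) f"
    and g: "ops_hom (acar A) (wcar (Wind M W)) (wact (Wind M W)) (wcar X) (wact X) g"
    and eq: "\<And>w. w \<in> wcar W \<Longrightarrow> f (ge w) = g (ge w)" and t: "t \<in> wcar (Wind M W)"
  shows "f t = g t"
proof (rule wind_eqI[OF _ _ t])
  show "lin_on (wcar (Wind M W)) (wcar X) f" "lin_on (wcar (Wind M W)) (wcar X) g"
    using f g by (simp_all add: ops_hom_def)
  fix d w assume d: "d \<in> D M" and w: "w \<in> wcar W"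
  have "d \<in> acar A" using D_acar[OF M] d by blast
  then show "f (pt M W d w) = g (pt M W d w)"
    using f g eq[OF w] ge_in[OF w] by (simp add: pt_ge[OF d] ops_hom_def)
qed

end

end

section \<open>Simple modules of A and induction\<close>

context orbifold
begin

lemma component_nonzero:
  assumes X: "alg_module A X" and x: "x \<in> wcar X" "x \<noteq> 0"
  shows "\<exists>N\<in>S. wact X (b id N) x \<noteq> 0"
proof (rule ccontr)
  assume "\<not> ?thesis"
  moreover have "x = (\<Sum>N\<in>S. wact X (b id N) x)"
    using lin_on_sum[OF alg_moduleD(3)[OF X x(1)] acar_subspace, of S "b id"] basis_in[OF G_id]
      alg_moduleD(5)[OF X x(1)] by (simp add: aone_eq)
  ultimately show False using x(2) by simp
qed

text \<open>\<open>binv g M\<close> carries the component at \<open>tgt M g\<close> injectively into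
  the component at \<open>M\<close>, as \<open>b g M\<close> takes it back. Components can thus be
  compared within one orbit.\<close>

lemma component_move:
  assumes X: "alg_module A X" and M: "M \<in> S" and g: "g \<in> G" and x: "x \<in> wcar X"
    and nz: "wact X (b id (tgt M g)) x \<noteq> 0"
  shows "wact X (binv g M) x \<noteq> 0" "wact X (b id M) (wact X (binv g M) x) = wact X (binv g M) x"
proof -
  have "wact X (b g M) (wact X (binv g M) x) = wact X (b id (tgt M g)) x"
    using alg_moduleD(4)[OF X basis_in[OF g M] binv_in[OF g M] x] binv_right[OF g M] by simp
  then show "wact X (binv g M) x \<noteq> 0"
    using nz lin_on_zero[OF alg_moduleD(2)[OF X basis_in[OF g M]] alg_moduleD(1)[OF X]] by auto
  have "amul A (b id M) (binv g M) = binv g M"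
    unfolding binv_def using M g by (simp add: amul_scale idem_mult_left G_inv tgt_in tgt_inv)
  then show "wact X (b id M) (wact X (binv g M) x) = wact X (binv g M) x"
    using alg_moduleD(4)[OF X basis_in[OF G_id M] binv_in[OF g M] x] by simp
qed

text \<open>Outside the orbit of \<open>M\<close> the idempotents kill \<open>D(M)\<close>, hence
  also every pure tensor.\<close>

lemma wind_component:
  fixes W :: "(('v \<Rightarrow> 'v) \<Rightarrow> complex, 'w::complex_space) amod"
  assumes M: "M \<in> S" and W: "alg_module (TGA M) W" and N: "N \<in> S"
    and t: "t \<in> wcar (Wind M W)" and nz: "wact (Wind M W) (b id N) t \<noteq> 0"
  shows "\<exists>g\<in>G. N = tgt M g"
proof (rule ccontr)
  assume neg: "\<not> ?thesis"
  have "amul A (b id N) d = (\<lambda>_. 0) d" if "d \<in> D M" for d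
  proof (rule D_eqI[of M "acar A" "amul A (b id N)" UNIV "\<lambda>_. 0" d])
    show "lin_on (D M) (acar A) (amul A (b id N))"
      by (rule lin_on_mono[OF amul_lin_right]) (simp_all add: amul_in)
    show "amul A (b id N) (b g M) = 0" if "g \<in> G" for g
      using neg that by (simp add: idem_mult_left M N)
  qed (simp_all add: that lin_on_def)
  then have "wact (Wind M W) (b id N) (pt M W d w) = 0" if "d \<in> D M" "w \<in> wcar W" for d w
    using that lin_on_zero[OF pt_lin_left[OF M W that(2)] D_subspace]
    by (simp add: wind_act_pt[OF M W basis_in[OF G_id N]])
  then have "wact (Wind M W) (b id N) t \<in> {0}"
    by (intro wind_map_in[OF M W wind_act_lin[OF M W] cv.subspace_single_0 t]) simp
  with nz show False by simp
qed

text \<open>A nonzero submodule has a nonzero component at some point of the orbit of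
  \<open>M\<close>. Moved to \<open>M\<close>, it lies in the copy of \<open>W\<close>. What the
  submodule contains of that copy is a nonzero submodule of \<open>W\<close>, therefore all of it,
  and the copy generates.\<close>

theorem wind_simple:
  fixes W :: "(('v \<Rightarrow> 'v) \<Rightarrow> complex, 'w::complex_space) amod"
  assumes M: "M \<in> S" and simple: "simple_amod (TGA M) W"
  shows "simple_amod A (Wind M W)"
  unfolding simple_amod_def
proof (intro conjI allI impI)
  have W: "alg_module (TGA M) W" using simple by (simp add: simple_amod_def)
  show mod: "alg_module A (Wind M W)" by (rule wind_module[OF M W])
  obtain w0 where w0: "w0 \<in> wcar W" "w0 \<noteq> 0" by (rule simple_amod_nonzero[OF simple])
  show "wcar (Wind M W) \<noteq> {0}"
    using ge_in[OF M W w0(1)] ge_zero[OF M W w0(1)] w0(2) by auto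
  fix N assume N: "asubmodule A (Wind M W) N"
  then have sub: "cv.subspace N" and NW: "N \<subseteq> wcar (Wind M W)"
    and Nact: "\<And>a t. a \<in> acar A \<Longrightarrow> t \<in> N \<Longrightarrow> wact (Wind M W) a t \<in> N"
    by (auto simp: asubmodule_def)
  show "N = {0} \<or> N = wcar (Wind M W)"
  proof (cases "N = {0}")
    case False
    then obtain t where t: "t \<in> N" "t \<noteq> 0" using cv.subspace_0[OF sub] by blast
    have tW: "t \<in> wcar (Wind M W)" using t(1) NW by blast
    obtain K where K: "K \<in> S" "wact (Wind M W) (b id K) t \<noteq> 0"
      using component_nonzero[OF mod tW t(2)] by blast
    obtain g where g: "g \<in> G" "K = tgt M g" using wind_component[OF M W K(1) tW K(2)] by blast
    let ?t = "wact (Wind M W) (binv g M) t"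
    have t': "?t \<noteq> 0" "wact (Wind M W) (b id M) ?t = ?t"
      using component_move[OF mod M g(1) tW] K(2) g(2) by simp_all
    have t'N: "?t \<in> N" by (rule Nact[OF binv_in[OF g(1) M] t(1)])
    obtain w where w: "w \<in> wcar W" "?t = ge M W w"
      using wind_idem[OF M W, of ?t] t'(2) t'N NW by auto
    let ?P = "{w \<in> wcar W. ge M W w \<in> N}"
    have "asubmodule (TGA M) W ?P"
      unfolding asubmodule_def
    proof (intro conjI ballI)
      note l = ge_lin[OF M W]
      show "cv.subspace ?P"
        by (rule cv.subspaceI)
          (simp_all add: cv.subspace_0[OF alg_moduleD(1)[OF W]] lin_on_zero[OF l alg_moduleD(1)[OF W]]
            cv.subspace_0[OF sub] cv.subspace_add[OF alg_moduleD(1)[OF W]] lin_on_add[OF l] cv.subspace_add[OF sub]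
            cv.subspace_scale[OF alg_moduleD(1)[OF W]] lin_on_scale[OF l] cv.subspace_scale[OF sub])
      show "wact W s x \<in> ?P" if s: "s \<in> acar (TGA M)" and x: "x \<in> ?P" for s x
        using x lin_on_in[OF alg_moduleD(2)[OF W s]] Nact[OF emb_in[OF M s]] by (simp add: ge_act[OF M W s])
    qed blast
    then have "?P = {0} \<or> ?P = wcar W" using simple by (simp only: simple_amod_def)
    moreover have "w \<in> ?P" using w t'N by simp
    moreover have "w \<noteq> 0" using w(2) t'(1) lin_on_zero[OF ge_lin[OF M W] alg_moduleD(1)[OF W]] by auto
    ultimately have P: "?P = wcar W" by blast
    have "x \<in> N" if x: "x \<in> wcar (Wind M W)" for x
    proof (rule wind_map_in[OF M W _ sub x])
      show "lin_on (wcar (Wind M W)) UNIV (\<lambda>x. x)" by (simp add: lin_on_def)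
      fix d w assume d: "d \<in> D M" and w: "w \<in> wcar W"
      have "ge M W w \<in> N" using w P by blast
      then show "pt M W d w \<in> N"
        using Nact D_acar[OF M] d by (simp add: pt_ge[OF M W d] subset_iff)
    qed
    then have "N = wcar (Wind M W)" using NW by blast
    then show ?thesis ..
  qed simp
qed

text \<open>An isomorphism commutes with the idempotent at \<open>M\<close>. As the component at
  \<open>M\<close> of the source is nonzero, \<open>M\<close> lies in the orbit of
  \<open>M'\<close>; when the two agree, the isomorphism restricts to the components at
  \<open>M\<close>, which are the copies of \<open>W\<close> and \<open>W'\<close>.\<close>

theorem wind_iso:
  fixes W W' :: "(('v \<Rightarrow> 'v) \<Rightarrow> complex, 'w::complex_space) amod"
  assumes M: "M \<in> S" and M': "M' \<in> S" and simple: "simple_amod (TGA M) W" and simple': "simple_amod (TGA M') W'"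
    and iso: "amod_iso A (Wind M W) (Wind M' W')"
  shows "\<exists>g\<in>G. M = tgt M' g" "M = M' \<Longrightarrow> amod_iso (TGA M) W W'"
proof -
  have W: "alg_module (TGA M) W" and W': "alg_module (TGA M') W'"
    using simple simple' by (simp_all add: simple_amod_def)
  obtain f where f: "bij_betw f (wcar (Wind M W)) (wcar (Wind M' W'))"
      "ops_hom (acar A) (wcar (Wind M W)) (wact (Wind M W)) (wcar (Wind M' W')) (wact (Wind M' W')) f"
    using iso unfolding amod_iso_ops by (elim exE conjE)
  have fl: "lin_on (wcar (Wind M W)) (wcar (Wind M' W')) f" using f(2) by (simp add: ops_hom_def)
  have fact: "f (wact (Wind M W) a t) = wact (Wind M' W') a (f t)" if "a \<in> acar A" "t \<in> wcar (Wind M W)" for a t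
    using f(2) that by (simp add: ops_hom_def)
  obtain w0 where w0: "w0 \<in> wcar W" "w0 \<noteq> 0" by (rule simple_amod_nonzero[OF simple])
  have fge: "f (ge M W w) \<in> wcar (Wind M' W')" if "w \<in> wcar W" for w
    by (rule lin_on_in[OF fl ge_in[OF M W that]])
  have efge: "wact (Wind M' W') (b id M) (f (ge M W w)) = f (ge M W w)" if w: "w \<in> wcar W" for w
  proof -
    have "wact (Wind M W) (b id M) (ge M W w) = ge M W w"
      using pt_ge[OF M W basis_in_D[OF G_id], of w] by simp
    then show ?thesis using fact[OF basis_in[OF G_id M] ge_in[OF M W w]] by simp
  qed
  have f0: "f (ge M W w0) \<noteq> 0"
  proof
    assume "f (ge M W w0) = 0"
    moreover have "f 0 = 0" by (rule lin_on_zero[OF fl wind_subspace[OF M W]])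
    ultimately have "ge M W w0 = 0"
      using f(1) ge_in[OF M W w0(1)] cv.subspace_0[OF wind_subspace[OF M W]] by (simp add: bij_betw_def inj_on_def)
    then show False using ge_zero[OF M W w0(1)] w0(2) by simp
  qed
  show "\<exists>g\<in>G. M = tgt M' g"
    by (rule wind_component[OF M' W' M fge[OF w0(1)]]) (simp add: efge[OF w0(1)] f0)
  assume eq: "M = M'"
  \<comment> \<open>The retraction inverts \<open>w \<mapsto> ge M W' w\<close> linearly, so that
    \<open>h\<close> is linear as a composite.\<close>
  obtain \<rho> where \<rho>: "lin_on (wcar (Wind M W')) (wcar W') \<rho>" "\<forall>w\<in>wcar W'. \<rho> (ge M W' w) = w"
    using wind_retraction[OF M' W'] unfolding eq by (elim exE conjE)
  define h where "h w = \<rho> (f (ge M W w))" for w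
  have hex: "\<exists>w'\<in>wcar W'. f (ge M W w) = ge M W' w'" if w: "w \<in> wcar W" for w
    using wind_idem[OF M' W' fge[OF w]] efge[OF w] unfolding eq by simp
  have hl: "lin_on (wcar W) (wcar W') h"
    unfolding h_def using lin_on_compose[OF lin_on_compose[OF ge_lin[OF M W] fl] \<rho>(1)[unfolded eq]] .
  have "ops_hom (acar (TGA M)) (wcar W) (wact W) (wcar W') (wact W') h"
    unfolding ops_hom_def
  proof (intro conjI ballI)
    fix s w assume s: "s \<in> acar (TGA M)" and w: "w \<in> wcar W"
    obtain w' where w': "w' \<in> wcar W'" "f (ge M W w) = ge M W' w'" using hex[OF w] by blast
    have s': "s \<in> acar (TGA M')" using s eq by simp
    have "f (ge M W (wact W s w)) = wact (Wind M' W') (emb M s) (f (ge M W w))"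
      using fact[OF emb_in[OF M s] ge_in[OF M W w]] by (simp add: ge_act[OF M W s w])
    also have "\<dots> = ge M W' (wact W' s w')"
      using ge_act[OF M' W' s' w'(1)] w'(2) eq by simp
    finally have "h (wact W s w) = \<rho> (ge M W' (wact W' s w'))" by (simp add: h_def)
    also have "\<dots> = wact W' s w'"
      using \<rho>(2) lin_on_in[OF alg_moduleD(2)[OF W' s'] w'(1)] by blast
    also have "w' = h w" using \<rho>(2) w' by (simp add: h_def)
    finally show "h (wact W s w) = wact W' s (h w)" .
  qed (rule hl)
  moreover have "h w0 \<noteq> 0"
  proof
    assume h0: "h w0 = 0"
    obtain w' where w': "w' \<in> wcar W'" "f (ge M W w0) = ge M W' w'" using hex[OF w0(1)] by blast
    then have "w' = 0" using \<rho>(2) h0 by (simp add: h_def)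
    then show False
      using f0 w'(2) lin_on_zero[OF ge_lin[OF M' W'] alg_moduleD(1)[OF W']] eq by simp
  qed
  ultimately show "amod_iso (TGA M) W W'"
    using simple_amod_hom_iso(2)[OF simple, of W' h w0] simple' w0(1) eq by simp
qed

text \<open>Undoes induction: by \<open>component_induced\<close>, a simple module with nonzero
  component at \<open>M\<close> is induced from that component.\<close>

definition component :: "('v, 'm) vmod \<Rightarrow> (('v, 'm) gs, 'x::complex_space) amod \<Rightarrow> (('v \<Rightarrow> 'v) \<Rightarrow> complex, 'x) amod" where
  "component M X = \<lparr>wcar = wact X (b id M) ` wcar X, wact = (\<lambda>s. wact X (emb M s))\<rparr>"

text \<open>For \<open>y \<noteq> 0\<close> in the component, every other element is
  \<open>a y\<close> with \<open>a\<close> in \<open>A\<close>, hence \<open>e a e y\<close> with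
  \<open>e\<close> the idempotent at \<open>M\<close>, and \<open>e a e\<close> lies in
  \<open>S(M)\<close>.\<close>

lemma component_simple:
  fixes X :: "(('v, 'm) gs, 'x::complex_space) amod"
  assumes M: "M \<in> S" and simple: "simple_amod A X" and x: "x \<in> wcar X" "wact X (b id M) x \<noteq> 0"
  shows "simple_amod (TGA M) (component M X)"
proof -
  have X: "alg_module A X" using simple by (simp add: simple_amod_def)
  let ?e = "wact X (b id M)" and ?E = "wact X (b id M) ` wcar X"
  note eA = basis_in[OF G_id M]
  have el: "lin_on (wcar X) (wcar X) ?e" by (rule alg_moduleD(2)[OF X eA])
  have EX: "?E \<subseteq> wcar X" using lin_on_in[OF el] by blast
  have Esub: "cv.subspace ?E" by (rule subspace_image[OF el alg_moduleD(1)[OF X]])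
  have ee: "?e y = y" if y: "y \<in> ?E" for y
  proof -
    obtain z where z: "z \<in> wcar X" "y = ?e z" using y by blast
    show ?thesis
      using alg_moduleD(4)[OF X eA eA z(1)] idem_mult_left[OF M M G_id] M z(2) by simp
  qed
  have embE: "wact X (emb M s) y \<in> ?E" if s: "s \<in> acar (TGA M)" and y: "y \<in> wcar X" for s y
  proof (rule image_eqI)
    show "wact X (emb M s) y = ?e (wact X (emb M s) y)"
      using alg_moduleD(4)[OF X eA emb_in[OF M s] y] emb_idem(2)[OF M s] by simp
    show "wact X (emb M s) y \<in> wcar X" by (rule lin_on_in[OF alg_moduleD(2)[OF X emb_in[OF M s]] y])
  qed
  have mod: "alg_module (TGA M) (component M X)"
    unfolding alg_module_def component_def amod.simps
  proof (intro conjI ballI)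
    show "lin_on ?E ?E (wact X (emb M s))" if "s \<in> acar (TGA M)" for s
      by (rule lin_on_mono[OF alg_moduleD(2)[OF X emb_in[OF M that]] EX]) (use embE[OF that] EX in blast)
    show "lin_on (acar (TGA M)) ?E (\<lambda>s. wact X (emb M s) y)" if y: "y \<in> ?E" for y
    proof -
      have yX: "y \<in> wcar X" using y EX by blast
      have "lin_on (acar (TGA M)) (acar A) (emb M)" by (rule lin_on_mono[OF emb_lin]) (simp_all add: emb_in[OF M])
      from lin_on_compose[OF this alg_moduleD(3)[OF X yX]] show ?thesis
        by (rule lin_on_mono) (simp_all add: embE yX)
    qed
    show "wact X (emb M (amul (TGA M) s t)) y = wact X (emb M s) (wact X (emb M t) y)"
      if "s \<in> acar (TGA M)" "t \<in> acar (TGA M)" "y \<in> ?E" for s t y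
      using that EX by (simp add: emb_mult[OF M] alg_moduleD(4)[OF X] emb_in[OF M] subset_iff)
    show "wact X (emb M (aone (TGA M))) y = y" if "y \<in> ?E" for y
      using ee[OF that] by (simp add: emb_one[OF M])
  qed (rule Esub)
  show ?thesis
    unfolding simple_amod_def
  proof (intro conjI allI impI)
    show "wcar (component M X) \<noteq> {0}" using x by (auto simp: component_def)
    fix N assume N: "asubmodule (TGA M) (component M X) N"
    then have sub: "cv.subspace N" and NE: "N \<subseteq> ?E"
      and Nact: "\<And>s y. s \<in> acar (TGA M) \<Longrightarrow> y \<in> N \<Longrightarrow> wact X (emb M s) y \<in> N"
      by (auto simp: asubmodule_def component_def)
    show "N = {0} \<or> N = wcar (component M X)"
    proof (cases "N = {0}")
      case False
      then obtain y where y: "y \<in> N" "y \<noteq> 0" using cv.subspace_0[OF sub] by blast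
      have yE: "y \<in> ?E" using y(1) NE by blast
      then have yX: "y \<in> wcar X" using EX by blast
      have "z \<in> N" if z: "z \<in> ?E" for z
      proof -
        have "z \<in> (\<lambda>a. wact X a y) ` acar A"
          using simple_amod_cyclic[OF fd_alg_A simple yX y(2)] z EX by blast
        then obtain a where a: "a \<in> acar A" "z = wact X a y" by (rule imageE)
        have ae: "amul A a (b id M) \<in> D M" by (rule D_left[OF M a(1) basis_in_D[OF G_id]])
        have "z = ?e (wact X a (?e y))" using ee[OF z] ee[OF yE] a(2) by simp
        also have "\<dots> = wact X (amul A (b id M) (amul A a (b id M))) y"
          using alg_moduleD(4)[OF X a(1) eA yX] alg_moduleD(4)[OF X eA amul_in yX] by simp
        also have "\<dots> = wact X (emb M (res M (amul A a (b id M)))) y"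
          by (simp add: idem_D[OF M ae])
        also have "\<dots> \<in> N" by (rule Nact[OF res_in y(1)])
        finally show ?thesis .
      qed
      then have "N = wcar (component M X)" using NE by (auto simp: component_def)
      then show ?thesis ..
    qed simp
  qed (rule mod)
qed

text \<open>By reciprocity the identification of \<open>W\<close> with the component extends to a
  nonzero homomorphism between simple modules.\<close>

lemma component_induced:
  fixes X :: "(('v, 'm) gs, 'x::complex_space) amod"
    and W :: "(('v \<Rightarrow> 'v) \<Rightarrow> complex, 'w::complex_space) amod"
  assumes M: "M \<in> S" and simple: "simple_amod A X" and W: "simple_amod (TGA M) W"
    and iso: "amod_iso (TGA M) W (component M X)"
  shows "amod_iso A (Wind M W) X"
proof -
  have X: "alg_module A X" and W': "alg_module (TGA M) W" using simple W by (simp_all add: simple_amod_def)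
  obtain h where h: "bij_betw h (wcar W) (wcar (component M X))"
      "ops_hom (acar (TGA M)) (wcar W) (wact W) (wcar (component M X)) (wact (component M X)) h"
    using iso unfolding amod_iso_ops by (elim exE conjE)
  have sub: "wcar (component M X) \<subseteq> wcar X"
    using lin_on_in[OF alg_moduleD(2)[OF X basis_in[OF G_id M]]] by (auto simp: component_def)
  have hl: "lin_on (wcar W) (wcar X) h"
    using h(2) sub unfolding ops_hom_def lin_on_def by blast
  have hact: "h (wact W s w) = wact X (emb M s) (h w)" if "s \<in> acar (TGA M)" "w \<in> wcar W" for s w
    using h(2) that by (simp add: ops_hom_def component_def)
  have "\<exists>f. ops_hom (acar A) (wcar (Wind M W)) (wact (Wind M W)) (wcar X) (wact X) f \<and>
      (\<forall>w\<in>wcar W. f (ge M W w) = h w)"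
    by (rule frobenius_reciprocity[OF M W' X hl]) (rule hact)
  then obtain f where
    f: "ops_hom (acar A) (wcar (Wind M W)) (wact (Wind M W)) (wcar X) (wact X) f"
      "\<forall>w\<in>wcar W. f (ge M W w) = h w" by (elim exE conjE)
  obtain w where w: "w \<in> wcar W" "w \<noteq> 0" by (rule simple_amod_nonzero[OF W])
  have "h 0 = 0" by (rule lin_on_zero[OF hl alg_moduleD(1)[OF W']])
  then have "h w \<noteq> 0"
    using h(1) w cv.subspace_0[OF alg_moduleD(1)[OF W']] unfolding bij_betw_def inj_on_def by metis
  then have "f (ge M W w) \<noteq> 0" using f(2) w(1) by simp
  then show ?thesis
    using simple_amod_hom_iso(2)[OF wind_simple[OF M W] simple f(1), of "ge M W w"] ge_in[OF M W' w(1)] by blast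
qed

text \<open>Frobenius reciprocity in coordinates: a homomorphism is restricted to the generating
  copy of \<open>W\<close>, where its values are concentrated in the summand
  \<open>M\<close>.\<close>

definition mult_map where
  "mult_map M W f = (\<lambda>w. if w \<in> wcar W then f (ge M W w) M else 0)"

lemma tga_module_act:
  assumes M: "M \<in> S" and s: "s \<in> acar (TGA M)" and w: "w \<in> mcar M"
  shows "wact MA (emb M s) (single M w) = single M (wact (tga_module V G \<phi> M) s w)"
proof -
  have "wact MA (emb M s) (single M w) = (\<Sum>g\<in>H M. wact MA (cscale (s g) (b g M)) (single M w))"
    unfolding emb_expand[OF M s] by (rule lin_on_sum[OF wact_lin_alg]) auto
  also have "\<dots> = (\<Sum>g\<in>H M. cscale (s g) (single M (\<phi> M g w)))"
    by (intro sum.cong refl)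
      (simp add: lin_on_scale[OF wact_lin_alg] wact_basis H_G[OF M] M H_tgt[OF M])
  also have "\<dots> = single M (wact (tga_module V G \<phi> M) s w)"
    by (auto simp: tga_module_def single_def fun_eq_iff sum_fun_apply)
  finally show ?thesis .
qed

text \<open>A homomorphism is determined on the generating copy of \<open>W\<close>, and by
  reciprocity every homomorphism given there extends. Modes of the fixed points act on values,
  coordinate by coordinate, so the restriction respects them.\<close>

theorem mult_module_iso:
  fixes W :: "(('v \<Rightarrow> 'v) \<Rightarrow> complex, 'w::complex_space) amod"
  assumes M: "M \<in> S" and W: "alg_module (TGA M) W"
  shows "vmod_hom_iso U (homs (Wind M W)) (mult_module V G S \<phi> M W) (mult_map M W)"
proof -
  let ?T = "tga_module V G \<phi> M"
  have Mcar: "mcar (mult_module V G S \<phi> M W) = amod_hom (TGA M) W ?T"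
    and Mmode: "\<And>v n f. mmode (mult_module V G S \<phi> M W) v n f = (\<lambda>w. if w \<in> wcar W then mmode M v n (f w) else 0)"
    by (simp_all add: mult_module_def hom_vmod_def)
  have Tcar: "wcar ?T = mcar M" by (simp add: tga_module_def)
  have mod: "alg_module A (Wind M W)" by (rule wind_module[OF M W])
  have fe: "f (ge M W w) = single M (mult_map M W f w)" if f: "f \<in> amod_hom A (Wind M W) MA" and w: "w \<in> wcar W" for f w
  proof -
    have g: "ge M W w \<in> wcar (Wind M W)" by (rule ge_in[OF M W w])
    have "f (ge M W w) = f (wact (Wind M W) (b id M) (ge M W w))"
      using pt_ge[OF M W basis_in_D[OF G_id], of w] by simp
    also have "\<dots> = wact MA (b id M) (f (ge M W w))" by (rule homs_act[OF f basis_in[OF G_id M] g])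
    also have "\<dots> = single M (f (ge M W w) M)" by (rule wact_idem[OF M homs_in[OF f g]])
    finally show ?thesis using w by (simp add: mult_map_def)
  qed
  have in_hom: "mult_map M W f \<in> amod_hom (TGA M) W ?T" if f: "f \<in> amod_hom A (Wind M W) MA" for f
    unfolding amod_hom_def Tcar
  proof (intro CollectI conjI allI impI ballI)
    have l: "lin_on (wcar W) (mcar MV) (\<lambda>w. f (ge M W w))"
      by (rule lin_on_compose[OF ge_lin[OF M W] homs_lin[OF f]])
    show "lin_on (wcar W) (mcar M) (mult_map M W f)"
      by (rule lin_onI)
        (simp_all add: mult_map_def MV_comp[OF lin_on_in[OF l] M] lin_on_add[OF l] lin_on_scale[OF l]
          cv.subspace_add[OF alg_moduleD(1)[OF W]] cv.subspace_scale[OF alg_moduleD(1)[OF W]])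
    show "mult_map M W f w = 0" if "w \<notin> wcar W" for w using that by (simp add: mult_map_def)
    fix s w assume s: "s \<in> acar (TGA M)" and w: "w \<in> wcar W"
    have sw: "wact W s w \<in> wcar W" by (rule lin_on_in[OF alg_moduleD(2)[OF W s] w])
    have wM: "mult_map M W f w \<in> mcar M"
      using w MV_comp[OF lin_on_in[OF l w] M] by (simp add: mult_map_def)
    have "single M (mult_map M W f (wact W s w)) = f (wact (Wind M W) (emb M s) (ge M W w))"
      using fe[OF f sw] by (simp add: ge_act[OF M W s w])
    also have "\<dots> = wact MA (emb M s) (single M (mult_map M W f w))"
      using homs_act[OF f emb_in[OF M s] ge_in[OF M W w]] fe[OF f w] by simp
    also have "\<dots> = single M (wact ?T s (mult_map M W f w))" by (rule tga_module_act[OF M s wM])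
    finally show "mult_map M W f (wact W s w) = wact ?T s (mult_map M W f w)" by (rule single_inject)
  qed
  have lin: "lin_on (amod_hom A (Wind M W) MA) (amod_hom (TGA M) W ?T) (mult_map M W)"
    by (rule lin_onI, rule in_hom) (auto simp: mult_map_def fun_eq_iff)
  have inj: "inj_on (mult_map M W) (amod_hom A (Wind M W) MA)"
  proof (rule inj_onI)
    fix f g assume f: "f \<in> amod_hom A (Wind M W) MA" and g: "g \<in> amod_hom A (Wind M W) MA"
      and eq: "mult_map M W f = mult_map M W g"
    show "f = g"
    proof
      fix t
      show "f t = g t"
      proof (cases "t \<in> wcar (Wind M W)")
        case True
        show ?thesis
        proof (rule wind_hom_eqI[OF M W alg_module_MA _ _ _ True])
          show "ops_hom (acar A) (wcar (Wind M W)) (wact (Wind M W)) (wcar MA) (wact MA) f"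
            "ops_hom (acar A) (wcar (Wind M W)) (wact (Wind M W)) (wcar MA) (wact MA) g"
            using f g by (simp_all add: homs_iff MA_car)
          show "f (ge M W w) = g (ge M W w)" if "w \<in> wcar W" for w
            using fe[OF f that] fe[OF g that] eq by simp
        qed
      qed (simp add: homs_off[OF f] homs_off[OF g])
    qed
  qed
  have surj: "mult_map M W ` amod_hom A (Wind M W) MA = amod_hom (TGA M) W ?T"
  proof
    show "amod_hom (TGA M) W ?T \<subseteq> mult_map M W ` amod_hom A (Wind M W) MA"
    proof
      fix h assume h: "h \<in> amod_hom (TGA M) W ?T"
      then have hl: "lin_on (wcar W) (mcar M) h" and hoff: "\<And>w. w \<notin> wcar W \<Longrightarrow> h w = 0"
        and hact: "\<And>s w. s \<in> acar (TGA M) \<Longrightarrow> w \<in> wcar W \<Longrightarrow> h (wact W s w) = wact ?T s (h w)"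
        by (auto simp: amod_hom_def Tcar)
      have sl: "lin_on (mcar M) (wcar MA) (single M)"
        by (rule lin_onI) (simp_all add: MA_car single_in[OF M] single_add single_scale)
      have sact: "single M (h (wact W s w)) = wact MA (emb M s) (single M (h w))"
        if "s \<in> acar (TGA M)" "w \<in> wcar W" for s w
        using hact[OF that] tga_module_act[OF M that(1) lin_on_in[OF hl that(2)]] by simp
      have "\<exists>f. ops_hom (acar A) (wcar (Wind M W)) (wact (Wind M W)) (wcar MA) (wact MA) f \<and>
          (\<forall>w\<in>wcar W. f (ge M W w) = single M (h w))"
        by (rule frobenius_reciprocity[OF M W alg_module_MA lin_on_compose[OF hl sl]]) (rule sact)
      then obtain f where
        f: "ops_hom (acar A) (wcar (Wind M W)) (wact (Wind M W)) (wcar MA) (wact MA) f"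
          "\<forall>w\<in>wcar W. f (ge M W w) = single M (h w)" by (elim exE conjE)
      define f' where "f' = (\<lambda>t. if t \<in> wcar (Wind M W) then f t else 0)"
      have f': "f' \<in> amod_hom A (Wind M W) MA"
        unfolding f'_def by (rule homsI[OF _ mod]) (use f(1) in \<open>simp add: MA_car\<close>)
      have "mult_map M W f' = h"
      proof
        fix w
        show "mult_map M W f' w = h w"
          using f(2) ge_in[OF M W, of w] hoff[of w] by (simp add: mult_map_def f'_def)
      qed
      with f' show "h \<in> mult_map M W ` amod_hom A (Wind M W) MA" by blast
    qed
  qed (use in_hom in blast)
  show ?thesis
    unfolding vmod_hom_iso_def homs_car Mcar
  proof (intro conjI ballI allI)
    show "bij_betw (mult_map M W) (amod_hom A (Wind M W) MA) (amod_hom (TGA M) W ?T)"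
      using inj surj by (simp add: bij_betw_def)
    show "mult_map M W (mmode (homs (Wind M W)) v n f) = mmode (mult_module V G S \<phi> M W) v n (mult_map M W f)"
      for v n f
      by (rule ext) (simp add: mult_map_def Mmode homs_mode ge_in[OF M W] MV_mode M)
  qed (rule lin)
qed

end

section \<open>The dual pair\<close>

lemma irreducible_vmod_iso:
  assumes irr: "irreducible_vmod U P" and f: "vmod_hom_iso U P Q f" and sub: "cv.subspace (mcar P)"
    and closed: "\<And>v n w. v \<in> vcar U \<Longrightarrow> w \<in> mcar P \<Longrightarrow> mmode P v n w \<in> mcar P"
  shows "irreducible_vmod U Q"
  unfolding irreducible_vmod_def
proof (intro conjI allI impI)
  have bij: "bij_betw f (mcar P) (mcar Q)" and lin: "lin_on (mcar P) (mcar Q) f"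
    and md: "\<And>v n w. v \<in> vcar U \<Longrightarrow> w \<in> mcar P \<Longrightarrow> f (mmode P v n w) = mmode Q v n (f w)"
    using f by (simp_all add: vmod_hom_iso_def)
  have im: "f ` mcar P = mcar Q" using bij by (simp add: bij_betw_def)
  have f0: "f 0 = 0" by (rule lin_on_zero[OF lin sub])
  have P0: "0 \<in> mcar P" by (rule cv.subspace_0[OF sub])
  have inj: "inj_on f (mcar P)" using bij by (simp add: bij_betw_def)
  show "mcar Q \<noteq> {0}"
  proof
    assume Q0: "mcar Q = {0}"
    have "w = 0" if w: "w \<in> mcar P" for w
      using inj_onD[OF inj _ w P0] lin_on_in[OF lin w] f0 Q0 by simp
    with irr P0 show False by (auto simp: irreducible_vmod_def)
  qed
  fix N assume N: "vsubmodule U Q N"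
  let ?N = "{w \<in> mcar P. f w \<in> N}"
  have subN: "cv.subspace N" and NQ: "N \<subseteq> mcar Q" using N by (auto simp: vsubmodule_def)
  have "vsubmodule U P ?N"
    unfolding vsubmodule_def
  proof (intro conjI ballI allI)
    show "cv.subspace ?N"
      by (rule cv.subspaceI) (use sub subN lin P0 f0 in
        \<open>auto simp: lin_on_def cv.subspace_add cv.subspace_scale cv.subspace_0\<close>)
    show "mmode P v n w \<in> ?N" if "v \<in> vcar U" "w \<in> ?N" for v n w
      using that N closed md by (auto simp: vsubmodule_def)
  qed auto
  then have "?N = {0} \<or> ?N = mcar P" using irr by (simp add: irreducible_vmod_def)
  moreover have "N = f ` ?N"
  proof
    show "N \<subseteq> f ` ?N"
    proof
      fix y assume y: "y \<in> N"
      then obtain w where "w \<in> mcar P" "y = f w" using NQ im by (metis imageE subsetD)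
      with y show "y \<in> f ` ?N" by simp
    qed
  qed auto
  ultimately show "N = {0} \<or> N = mcar Q" using f0 im by auto
qed

context orbifold
begin

abbreviation "Mult M W \<equiv> mult_module V G S \<phi> M W"

lemma homs_closed:
  assumes "simple_amod A Y" "v \<in> vcar U" "f \<in> mcar (homs Y)"
  shows "mmode (homs Y) v n f \<in> mcar (homs Y)"
proof -
  have "alg_module A Y" using assms(1) by (simp add: simple_amod_def)
  from homs_mode_in[OF this assms(2), of f n] assms(3) show ?thesis by (simp only: homs_car)
qed

lemma homs_sub: "simple_amod A Y \<Longrightarrow> cv.subspace (mcar (homs Y))"
  unfolding homs_car simple_amod_def by (rule homs_subspace) (rule conjunct1)

lemma homs_irreducible_va_module: "simple_amod A Y \<Longrightarrow> irreducible_va_module U (homs Y)"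
  by (simp add: irreducible_va_module_def homs_va_module homs_irreducible)

context
  fixes M and W :: "(('v \<Rightarrow> 'v) \<Rightarrow> complex, 'w::complex_space) amod"
  assumes M: "M \<in> S" and simple: "simple_amod (TGA M) W"
begin

lemma tga_simple_module: "alg_module (TGA M) W"
  using simple by (simp add: simple_amod_def)

lemmas mult_iso = mult_module_iso[OF M tga_simple_module]

lemma mult_iso_inv: "vmod_hom_iso U (Mult M W) (homs (Wind M W)) (inv_into (mcar (homs (Wind M W))) (mult_map M W))"
  by (rule vmod_hom_iso_inv[OF mult_iso homs_sub homs_closed]) (rule wind_simple[OF M simple])+

text \<open>Irreducibility is carried over from the multiplicity space of the induced
  module.\<close>

theorem mult_module_irreducible: "irreducible_va_module U (Mult M W)"
  unfolding irreducible_va_module_def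
proof
  note wind = wind_simple[OF M simple]
  show "irreducible_vmod U (Mult M W)"
    by (rule irreducible_vmod_iso[OF homs_irreducible[OF wind] mult_iso homs_sub[OF wind] homs_closed[OF wind]])
  have car: "mcar (Mult M W) = amod_hom (TGA M) W (tga_module V G \<phi> M)"
    by (simp add: mult_module_def hom_vmod_def)
  show "va_module U (Mult M W)"
    unfolding mult_module_def
  proof (rule hom_va_module[OF twisted_va_module[OF tmS[OF M]]])
    show "wcar (tga_module V G \<phi> M) = mcar M" by (simp add: tga_module_def)
    show "fin_dim (wcar W)" by (rule simple_amod_fin_dim[OF fd_alg_TGA[OF M] simple])
    show "cv.subspace (amod_hom (TGA M) W (tga_module V G \<phi> M))"
      using homs_iso_target(1)[OF wind mult_iso] by (simp only: car)
    show "mmode (hom_vmod (TGA M) W (tga_module V G \<phi> M) M) v n f \<in> amod_hom (TGA M) W (tga_module V G \<phi> M)"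
      if "v \<in> vcar U" "f \<in> amod_hom (TGA M) W (tga_module V G \<phi> M)" for v n f
      using lin_on_in[OF homs_iso_target(2)[OF wind mult_iso that(1)], of f n] that(2)
      unfolding mult_module_def[symmetric] car by blast
  qed
qed

end

lemma mult_module_iso_induced:
  fixes W W' :: "(('v \<Rightarrow> 'v) \<Rightarrow> complex, 'w::complex_space) amod"
  assumes M: "M \<in> S" and simple: "simple_amod (TGA M) W"
    and M': "M' \<in> S" and simple': "simple_amod (TGA M') W'"
    and iso: "vmod_iso U (Mult M W) (Mult M' W')"
  shows "amod_iso A (Wind M W) (Wind M' W')"
proof (rule homs_inequivalent[OF wind_simple[OF M simple] wind_simple[OF M' simple']])
  have "vmod_iso U (homs (Wind M W)) (Mult M W)"
    unfolding vmod_iso_def by (rule exI) (rule mult_iso[OF M simple])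
  from vmod_iso_trans[OF this iso]
  have "vmod_iso U (homs (Wind M W)) (Mult M' W')" .
  moreover have "vmod_iso U (Mult M' W') (homs (Wind M' W'))"
    unfolding vmod_iso_def by (rule exI) (rule mult_iso_inv[OF M' simple'])
  ultimately show "vmod_iso U (homs (Wind M W)) (homs (Wind M' W'))"
    by (rule vmod_iso_trans)
qed

end

section \<open>Representatives of the orbits and classification of simple modules\<close>

locale orbifold_representatives = orbifold V G \<sigma> S \<phi>
  for V :: "'v::complex_space vertex" and G \<sigma> and S :: "('v, 'm::complex_space) vmod set" and \<phi> +
  fixes rep :: "('v, 'm) vmod set \<Rightarrow> ('v, 'm) vmod"
    and W :: "('v, 'm) vmod set \<Rightarrow> ((('v \<Rightarrow> 'v) \<Rightarrow> complex) \<Rightarrow> complex) \<Rightarrow>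
              (('v \<Rightarrow> 'v) \<Rightarrow> complex, 'w::complex_space) amod"
  assumes rep: "\<forall>j\<in>orbits V G S. rep j \<in> j"
    and W: "\<forall>j\<in>orbits V G S. \<forall>\<chi>\<in>tga_irr_chars V G S \<phi> (rep j).
      simple_amod (twisted_group_algebra V G S \<phi> (rep j)) (W j \<chi>) \<and>
      character (twisted_group_algebra V G S \<phi> (rep j)) (W j \<chi>) = \<chi>"
begin

abbreviation "J \<equiv> orbits V G S"
abbreviation "\<Lambda> j \<equiv> tga_irr_chars V G S \<phi> (rep j)"
abbreviation "I \<equiv> {(j, \<chi>). j \<in> J \<and> \<chi> \<in> \<Lambda> j}"

lemma orbit_tgt:
  assumes "M \<in> S"
  shows "(\<lambda>h. mact V S M h) ` G = (\<lambda>g. tgt M g) ` G"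
proof
  show "(\<lambda>h. mact V S M h) ` G \<subseteq> (\<lambda>g. tgt M g) ` G"
    using assms by (auto simp: mact_tgt G_inv)
  show "(\<lambda>g. tgt M g) ` G \<subseteq> (\<lambda>h. mact V S M h) ` G"
    using G_inv by (auto simp: tgt_def)
qed

lemma orbit_eq:
  assumes M: "M \<in> S" and g: "g \<in> G"
  shows "(\<lambda>h. mact V S (tgt M g) h) ` G = (\<lambda>h. mact V S M h) ` G"
  unfolding orbit_tgt[OF M] orbit_tgt[OF tgt_in[OF M g]]
proof
  show "(\<lambda>h. tgt (tgt M g) h) ` G \<subseteq> (\<lambda>h. tgt M h) ` G"
    using M g by (auto simp: tgt_tgt intro!: imageI G_comp)
  show "(\<lambda>h. tgt M h) ` G \<subseteq> (\<lambda>h. tgt (tgt M g) h) ` G"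
  proof
    fix N assume "N \<in> (\<lambda>h. tgt M h) ` G"
    then obtain h where h: "h \<in> G" "N = tgt M h" by blast
    have "N = tgt (tgt M g) (h \<circ> finv g)"
      using M g h by (simp add: tgt_tgt G_comp G_inv comp_assoc)
    with g h show "N \<in> (\<lambda>h. tgt (tgt M g) h) ` G" by (blast intro: G_comp G_inv)
  qed
qed

lemma orbit_of_rep:
  assumes j: "j \<in> J"
  shows "rep j \<in> S" "j = (\<lambda>h. mact V S (rep j) h) ` G"
proof -
  obtain M where M: "M \<in> S" "j = (\<lambda>h. mact V S M h) ` G" using j by (auto simp: orbits_def)
  moreover have "rep j \<in> j" using rep j by blast
  ultimately obtain g where g: "g \<in> G" "rep j = tgt M g" unfolding orbit_tgt[OF M(1)] by blast
  show "rep j \<in> S" using M g tgt_in by simp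
  show "j = (\<lambda>h. mact V S (rep j) h) ` G" using orbit_eq[OF M(1) g(1)] g(2) M(2) by simp
qed

lemma W_simple: "j \<in> J \<Longrightarrow> \<chi> \<in> \<Lambda> j \<Longrightarrow> simple_amod (TGA (rep j)) (W j \<chi>)"
  and W_character: "j \<in> J \<Longrightarrow> \<chi> \<in> \<Lambda> j \<Longrightarrow> character (TGA (rep j)) (W j \<chi>) = \<chi>"
  using W by blast+

lemmas induced_simple = wind_simple[OF orbit_of_rep(1) W_simple]

text \<open>An isomorphism puts the two representatives into one orbit, and then the modules from
  which they are induced are isomorphic; their characters are the labels themselves.\<close>

theorem induced_inequivalent:
  assumes "j \<in> J" "\<chi> \<in> \<Lambda> j" "j' \<in> J" "\<chi>' \<in> \<Lambda> j'"
    and iso: "amod_iso A (Wind (rep j) (W j \<chi>)) (Wind (rep j') (W j' \<chi>'))"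
  shows "j = j' \<and> \<chi> = \<chi>'"
proof -
  note iso' = wind_iso[OF orbit_of_rep(1)[OF assms(1)] orbit_of_rep(1)[OF assms(3)]
      W_simple[OF assms(1,2)] W_simple[OF assms(3,4)] iso]
  obtain g where "g \<in> G" "rep j = tgt (rep j') g" using iso'(1) by blast
  then have "j = j'"
    using orbit_eq[OF orbit_of_rep(1)[OF assms(3)]] orbit_of_rep(2)[OF assms(1)] orbit_of_rep(2)[OF assms(3)]
    by metis
  then have "amod_iso (TGA (rep j)) (W j \<chi>) (W j \<chi>')" using iso'(2) by simp
  from character_iso[OF fd_alg_TGA[OF orbit_of_rep(1)[OF assms(1)]] W_simple[OF assms(1,2)] _ this]
  show ?thesis
    using W_character[OF assms(1,2)] W_character[OF assms(3,4)] W_simple[OF assms(3,4)] \<open>j = j'\<close>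
    by (simp add: simple_amod_def)
qed

text \<open>Some component of \<open>X\<close> is nonzero and can be moved to the representative of
  its orbit. There it is a simple module of the twisted group algebra, and its character identifies
  it with one of the chosen modules \<open>W j \<chi>\<close>.\<close>

theorem induced_complete:
  fixes X :: "(('v, 'm) gs, 'x::complex_space) amod"
  assumes X: "simple_amod A X"
  shows "\<exists>j\<in>J. \<exists>\<chi>\<in>\<Lambda> j. amod_iso A (Wind (rep j) (W j \<chi>)) X"
proof -
  have mX: "alg_module A X" using X by (simp add: simple_amod_def)
  obtain x where x: "x \<in> wcar X" "x \<noteq> 0" by (rule simple_amod_nonzero[OF X])
  obtain N where N: "N \<in> S" "wact X (b id N) x \<noteq> 0" using component_nonzero[OF mX x] by blast
  define j where "j = (\<lambda>h. mact V S N h) ` G"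
  have j: "j \<in> J" using N(1) by (auto simp: orbits_def j_def)
  note R = orbit_of_rep[OF j]
  have "N \<in> j" unfolding j_def orbit_tgt[OF N(1)]
    using N(1) G_id by (intro image_eqI[of _ _ id]) simp_all
  then obtain g where g: "g \<in> G" "N = tgt (rep j) g" using R(2) orbit_tgt[OF R(1)] by blast
  define y where "y = wact X (binv g (rep j)) x"
  have y: "y \<in> wcar X" "y \<noteq> 0" "wact X (b id (rep j)) y = y"
    using component_move[OF mX R(1) g(1) x(1)] N(2) g(2) lin_on_in[OF alg_moduleD(2)[OF mX binv_in[OF g(1) R(1)]] x(1)]
    by (simp_all add: y_def)
  let ?C = "component (rep j) X"
  have C: "simple_amod (TGA (rep j)) ?C"
    using component_simple[OF R(1) X y(1)] y(2,3) by simp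
  \<comment> \<open>Membership of the character in \<open>\<Lambda> j\<close> asks for a module
    carried by \<open>nat => complex\<close>.\<close>
  obtain Z :: "(('v \<Rightarrow> 'v) \<Rightarrow> complex, nat \<Rightarrow> complex) amod"
    where Z: "simple_amod (TGA (rep j)) Z" "amod_iso (TGA (rep j)) ?C Z"
    using simple_amod_nat_model[OF fd_alg_TGA[OF R(1)] C] by blast
  define \<chi> where "\<chi> = character (TGA (rep j)) ?C"
  have "\<chi> = character (TGA (rep j)) Z"
    unfolding \<chi>_def using character_iso[OF fd_alg_TGA[OF R(1)] C _ Z(2)] Z(1) by (simp add: simple_amod_def)
  then have \<chi>: "\<chi> \<in> \<Lambda> j"
    unfolding tga_irr_chars_def irreducible_characters_def using Z(1) by blast
  have "amod_iso (TGA (rep j)) (W j \<chi>) ?C"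
    by (rule same_character_iso[OF fd_alg_TGA[OF R(1)] W_simple[OF j \<chi>] C])
      (simp add: W_character[OF j \<chi>], simp add: \<chi>_def)
  from component_induced[OF R(1) X W_simple[OF j \<chi>] this] j \<chi> show ?thesis by blast
qed

abbreviation "ind \<equiv> \<lambda>(j, \<chi>). Wind (rep j) (W j \<chi>)"
abbreviation "mul \<equiv> \<lambda>(j, \<chi>). Mult (rep j) (W j \<chi>)"

lemma ind_simple: "i \<in> I \<Longrightarrow> simple_amod A (ind i)"
  using induced_simple by (auto simp del: split_paired_All)

lemma ind_inequivalent: "i \<in> I \<Longrightarrow> k \<in> I \<Longrightarrow> amod_iso A (ind i) (ind k) \<Longrightarrow> i = k"
  using induced_inequivalent by auto

lemma ind_complete: "simple_amod A X \<Longrightarrow> \<exists>i\<in>I. amod_iso A (ind i) X"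
  using induced_complete[of X] by auto

theorem orbifold_decomposition:
  "au_iso A U MA MV (amod_sum I (\<lambda>(j, \<chi>). tensor_amod (Wind (rep j) (W j \<chi>)) (Mult (rep j) (W j \<chi>))))
     (vmod_sum I (\<lambda>(j, \<chi>). tensor_vmod (Wind (rep j) (W j \<chi>)) (Mult (rep j) (W j \<chi>))))"
proof -
  have eq: "(\<lambda>(j, \<chi>). tensor_amod (Wind (rep j) (W j \<chi>)) (Mult (rep j) (W j \<chi>))) = (\<lambda>i. tensor_amod (ind i) (mul i))"
    "(\<lambda>(j, \<chi>). tensor_vmod (Wind (rep j) (W j \<chi>)) (Mult (rep j) (W j \<chi>))) = (\<lambda>i. tensor_vmod (ind i) (mul i))"
    by (auto simp: fun_eq_iff)
  have \<Psi>: "vmod_hom_iso U (homs (ind i)) (mul i) ((\<lambda>(j, \<chi>). mult_map (rep j) (W j \<chi>)) i)" if "i \<in> I" for i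
    using that mult_iso[OF orbit_of_rep(1) W_simple] by (cases i) simp
  show ?thesis
    unfolding eq by (rule multiplicity_decomposition[OF ind_simple ind_inequivalent ind_complete \<Psi>])
qed

theorem orbifold_dual_pair: "dual_pair A U MA MV I (\<lambda>(j, \<chi>). Wind (rep j) (W j \<chi>))"
  unfolding dual_pair_def
proof (intro conjI ballI impI)
  show "fin_dim (acar A)" by (rule acar_fin_dim)
  show "semisimple_algebra A" by (rule semisimple_A)
  show "complete_simple_list A I ind"
    unfolding complete_simple_list_def
  proof (intro conjI ballI impI allI)
    show "simple_amod A (ind i)" if "i \<in> I" for i by (rule ind_simple[OF that])
    show "i = k" if "i \<in> I" "k \<in> I" "amod_iso A (ind i) (ind k)" for i k
      by (rule ind_inequivalent[OF that])
    show "\<exists>i\<in>I. amod_iso A X (ind i)" if X: "simple_amod A X" for X :: "(('v, 'm) gs, nat \<Rightarrow> complex) amod"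
    proof -
      obtain i where i: "i \<in> I" "amod_iso A (ind i) X" by (rule bexE[OF ind_complete[OF X]])
      have "alg_module A (ind i)" using ind_simple[OF i(1)] by (simp only: simple_amod_def)
      from amod_iso_sym[OF this i(2)] i(1) show ?thesis by (rule bexI)
    qed
  qed
  show "au_module A U MA MV"
    using twisted_va_module[OF MV_twisted] alg_module_MA wact_fixed_mode
    by (simp add: au_module_def MA_car)
  show "irreducible_va_module U (homs (ind i))" if "i \<in> I" for i
    by (rule homs_irreducible_va_module[OF ind_simple[OF that]])
  show "i = k" if "i \<in> I" "k \<in> I" "vmod_iso U (homs (ind i)) (homs (ind k))" for i k
    by (rule ind_inequivalent[OF that(1,2) homs_inequivalent[OF ind_simple[OF that(1)] ind_simple[OF that(2)] that(3)]])
qed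

lemma Mult_irreducible: "j \<in> J \<Longrightarrow> \<chi> \<in> \<Lambda> j \<Longrightarrow> irreducible_va_module U (Mult (rep j) (W j \<chi>))"
  by (rule mult_module_irreducible[OF orbit_of_rep(1) W_simple])

theorem Mult_inequivalent:
  assumes "j \<in> J" "j' \<in> J" "\<chi> \<in> \<Lambda> j" "\<chi>' \<in> \<Lambda> j'"
  shows "vmod_iso U (Mult (rep j) (W j \<chi>)) (Mult (rep j') (W j' \<chi>')) \<longleftrightarrow> j = j' \<and> \<chi> = \<chi>'"
proof
  assume "vmod_iso U (Mult (rep j) (W j \<chi>)) (Mult (rep j') (W j' \<chi>'))"
  from mult_module_iso_induced[OF orbit_of_rep(1)[OF assms(1)] W_simple[OF assms(1,3)]
      orbit_of_rep(1)[OF assms(2)] W_simple[OF assms(2,4)] this]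
  show "j = j' \<and> \<chi> = \<chi>'" by (rule induced_inequivalent[OF assms(1,3,2,4)])
qed (simp add: vmod_iso_refl)

end

section \<open>Finite decompositions\<close>

text \<open>A simple summand either lies in the sum of the previous ones or meets it trivially.\<close>

lemma finite_sum_direct:
  fixes P :: "'i \<Rightarrow> 'm::complex_space set"
  assumes "finite F" and P: "\<And>t. t \<in> F \<Longrightarrow> P t = {0} \<or> simple_ops Ops act (P t)"
    and lin: "\<And>s. s \<in> Ops \<Longrightarrow> lin_on X X (act s)" and X: "cv.subspace X" "\<And>t. t \<in> F \<Longrightarrow> P t \<subseteq> X"
  shows "\<exists>(k::nat) Q. (\<forall>i<k. simple_ops Ops act (Q i) \<and> Q i \<subseteq> X) \<and>
    (\<forall>q. (\<forall>i<k. q i \<in> Q i) \<longrightarrow> (\<Sum>i<k. q i) = 0 \<longrightarrow> (\<forall>i<k. q i = 0)) \<and>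
    (\<forall>p. (\<forall>t\<in>F. p t \<in> P t) \<longrightarrow> (\<exists>q. (\<forall>i<k. q i \<in> Q i) \<and> (\<Sum>t\<in>F. p t) = (\<Sum>i<k. q i)))"
  using assms(1) P X(2)
proof (induction F)
  case empty
  show ?case by (rule exI[of _ 0]) simp
next
  case (insert u F)
  have "\<exists>(k::nat) Q. (\<forall>i<k. simple_ops Ops act (Q i) \<and> Q i \<subseteq> X) \<and>
    (\<forall>q. (\<forall>i<k. q i \<in> Q i) \<longrightarrow> (\<Sum>i<k. q i) = 0 \<longrightarrow> (\<forall>i<k. q i = 0)) \<and>
    (\<forall>p. (\<forall>t\<in>F. p t \<in> P t) \<longrightarrow> (\<exists>q. (\<forall>i<k. q i \<in> Q i) \<and> (\<Sum>t\<in>F. p t) = (\<Sum>i<k. q i)))"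
    by (rule insert.IH) (use insert.prems in simp_all)
  then obtain k :: nat and Q where Q: "\<And>i. i < k \<Longrightarrow> simple_ops Ops act (Q i)" "\<And>i. i < k \<Longrightarrow> Q i \<subseteq> X"
    and ind: "\<And>q i. (\<forall>i<k. q i \<in> Q i) \<Longrightarrow> (\<Sum>i<k. q i) = 0 \<Longrightarrow> i < k \<Longrightarrow> q i = 0"
    and sp: "\<And>p. (\<forall>t\<in>F. p t \<in> P t) \<Longrightarrow> \<exists>q. (\<forall>i<k. q i \<in> Q i) \<and> (\<Sum>t\<in>F. p t) = (\<Sum>i<k. q i)"
    by (elim exE conjE) blast
  have subQ: "cv.subspace (Q i)" if "i < k" for i by (rule simple_opsD(1)[OF Q(1)[OF that]])
  define Z where "Z = {\<Sum>i<k. q i | q. \<forall>i<k. q i \<in> Q i}"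
  have ZI: "(\<Sum>i<k. q i) \<in> Z" if "\<forall>i<k. q i \<in> Q i" for q using that by (auto simp: Z_def)
  have subZ: "cv.subspace Z"
  proof (rule cv.subspaceI)
    show "0 \<in> Z" using ZI[of "\<lambda>_. 0"] cv.subspace_0[OF subQ] by simp
    show "x + y \<in> Z" if "x \<in> Z" "y \<in> Z" for x y
    proof -
      obtain q r where q: "x = (\<Sum>i<k. q i)" "\<forall>i<k. q i \<in> Q i" and r: "y = (\<Sum>i<k. r i)" "\<forall>i<k. r i \<in> Q i"
        using \<open>x \<in> Z\<close> \<open>y \<in> Z\<close> unfolding Z_def by blast
      have "x + y = (\<Sum>i<k. q i + r i)" by (simp add: q(1) r(1) sum.distrib)
      then show ?thesis using ZI[of "\<lambda>i. q i + r i"] q(2) r(2) cv.subspace_add[OF subQ] by simp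
    qed
    show "cscale c x \<in> Z" if "x \<in> Z" for c x
    proof -
      obtain q where q: "x = (\<Sum>i<k. q i)" "\<forall>i<k. q i \<in> Q i"
        using \<open>x \<in> Z\<close> unfolding Z_def by blast
      have "cscale c x = (\<Sum>i<k. cscale c (q i))" by (simp add: q(1) cv.scale_sum_right)
      then show ?thesis using ZI[of "\<lambda>i. cscale c (q i)"] q(2) cv.subspace_scale[OF subQ] by simp
    qed
  qed
  have actZ: "act s x \<in> Z" if s: "s \<in> Ops" and x: "x \<in> Z" for s x
  proof -
    obtain q where q: "x = (\<Sum>i<k. q i)" "\<forall>i<k. q i \<in> Q i"
      using x unfolding Z_def by blast
    have "act s x = (\<Sum>i<k. act s (q i))"
      unfolding q(1) by (rule lin_on_sum[OF lin[OF s] X(1)]) (use q(2) Q(2) in blast)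
    then show ?thesis
      using ZI[of "\<lambda>i. act s (q i)"] q(2) lin_on_in[OF simple_opsD(2)[OF Q(1) s]] by simp
  qed
  show ?case
  proof (cases "P u \<subseteq> Z")
    case True
    have "\<exists>q. (\<forall>i<k. q i \<in> Q i) \<and> (\<Sum>t\<in>insert u F. p t) = (\<Sum>i<k. q i)"
      if p: "\<forall>t\<in>insert u F. p t \<in> P t" for p
    proof -
      obtain q where "\<forall>i<k. q i \<in> Q i" "(\<Sum>t\<in>F. p t) = (\<Sum>i<k. q i)"
        using sp[of p] p by blast
      then have "(\<Sum>t\<in>F. p t) \<in> Z" using ZI by metis
      then have "p u + (\<Sum>t\<in>F. p t) \<in> Z" using True p cv.subspace_add[OF subZ] by blast
      then show ?thesis unfolding Z_def using insert.hyps by auto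
    qed
    then show ?thesis
      using Q ind by (intro exI[of _ k] exI[of _ Q]) blast
  next
    case False
    have simple: "simple_ops Ops act (P u)"
      using insert.prems(1)[of u] False cv.subspace_0[OF subZ] by auto
    have subP: "cv.subspace (P u)" by (rule simple_opsD(1)[OF simple])
    have "stable Ops act (P u \<inter> Z)"
      using actZ lin_on_in[OF simple_opsD(2)[OF simple]] by (intro stableI cv.subspace_inter subP subZ) auto
    then have "P u \<inter> Z = {0} \<or> P u \<inter> Z = P u" by (rule simple_opsD(4)[OF simple]) simp
    then have disj: "P u \<inter> Z = {0}" using False by blast
    define Q' where "Q' = (\<lambda>i. if i = k then P u else Q i)"
    have "\<forall>i<Suc k. simple_ops Ops act (Q' i) \<and> Q' i \<subseteq> X"
      using Q simple insert.prems(2)[of u] by (auto simp: Q'_def less_Suc_eq)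
    moreover have "q i = 0"
      if q: "\<forall>i<Suc k. q i \<in> Q' i" and 0: "(\<Sum>i<Suc k. q i) = 0" and i: "i < Suc k" for q i
    proof -
      have "q i \<in> Q i" if "i < k" for i using q[rule_format, of i] that by (simp add: Q'_def)
      moreover have "q k \<in> P u" using q[rule_format, of k] by (simp add: Q'_def)
      ultimately have q': "\<forall>i<k. q i \<in> Q i" "q k \<in> P u" by simp_all
      have "q k = - (\<Sum>i<k. q i)" using 0 by (simp add: eq_neg_iff_add_eq_0 add.commute)
      then have "q k \<in> P u \<inter> Z" using q'(2) cv.subspace_neg[OF subZ ZI[OF q'(1)]] by simp
      then have "q k = 0" using disj by blast
      moreover have "q i = 0" if "i < k" by (rule ind[OF q'(1) _ that]) (use 0 \<open>q k = 0\<close> in simp)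
      ultimately show ?thesis using i by (auto simp: less_Suc_eq)
    qed
    moreover have "\<exists>q. (\<forall>i<Suc k. q i \<in> Q' i) \<and> (\<Sum>t\<in>insert u F. p t) = (\<Sum>i<Suc k. q i)"
      if p: "\<forall>t\<in>insert u F. p t \<in> P t" for p
    proof -
      obtain q where q: "\<forall>i<k. q i \<in> Q i" "(\<Sum>t\<in>F. p t) = (\<Sum>i<k. q i)"
        using sp[of p] p by blast
      have "(\<Sum>i<Suc k. if i = k then p u else q i) = (\<Sum>t\<in>F. p t) + p u"
        unfolding q(2) by simp
      then show ?thesis
        using insert.hyps p q(1)
        by (intro exI[of _ "\<lambda>i. if i = k then p u else q i"]) (auto simp: Q'_def less_Suc_eq add.commute)
    qed
    ultimately show ?thesis
      by (intro exI[of _ "Suc k"] exI[of _ Q']) blast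
  qed
qed

definition vmod_restrict :: "('v, 'm) vmod \<Rightarrow> 'm set \<Rightarrow> ('v, 'm) vmod" where
  "vmod_restrict M P = \<lparr>mcar = P, mmode = mmode M\<rparr>"

lemma vmod_restrict_simps [simp]: "mcar (vmod_restrict M P) = P" "mmode (vmod_restrict M P) = mmode M"
  by (simp_all add: vmod_restrict_def)

lemma vmod_restrict_va_module:
  assumes M: "va_module U M" and P: "vsubmodule U M P"
  shows "va_module U (vmod_restrict M P)"
proof -
  have P': "cv.subspace P" "P \<subseteq> mcar M" "\<And>v n w. v \<in> vcar U \<Longrightarrow> w \<in> P \<Longrightarrow> mmode M v n w \<in> P"
    using P by (auto simp: vsubmodule_def)
  note D = twisted_moduleD[OF M[unfolded va_module_def]]
  show ?thesis
    unfolding va_module_def twisted_module_def Let_def vmod_restrict_simps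
  proof (intro conjI ballI allI impI)
    show "lin_on P P (mmode M v n)" if "v \<in> vcar U" for v n
      by (rule lin_on_mono[OF D(2)[OF that] P'(2)]) (rule P'(3)[OF that])
    show "lin_on (vcar U) P (\<lambda>v. mmode M v n w)" if "w \<in> P" for n w
      by (rule lin_on_mono[OF D(3)]) (use that P' in auto)
  qed (use D P' in \<open>auto simp del: aut_order_id\<close>)
qed

lemma vmod_restrict_irreducible:
  assumes M: "va_module U M" and P: "simple_ops (vcar U \<times> UNIV) (vact M) P" "P \<subseteq> mcar M"
  shows "irreducible_va_module U (vmod_restrict M P)"
  unfolding irreducible_va_module_def
proof
  have "mmode M v n w \<in> P" if "v \<in> vcar U" "w \<in> P" for v n w
    using lin_on_in[OF simple_opsD(2)[OF P(1), of "(v, n)"]] that by simp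
  then have "vsubmodule U M P"
    using P simple_opsD(1)[OF P(1)] by (auto simp: vsubmodule_def)
  then show "va_module U (vmod_restrict M P)" by (rule vmod_restrict_va_module[OF M])
  have "stable (vcar U \<times> UNIV) (vact M) N \<and> N \<subseteq> P" if "vsubmodule U (vmod_restrict M P) N" for N
    using that by (auto simp: vsubmodule_def stable_def)
  then show "irreducible_vmod U (vmod_restrict M P)"
    unfolding irreducible_vmod_def using simple_opsD(3,4)[OF P(1)] by auto
qed

text \<open>The summands \<open>P t\<close> may be zero or overlap. \<open>finite_sum_direct\<close>
  provides simple submodules in direct position whose sum contains them all; addition is then an
  isomorphism from the external sum.\<close>

lemma finite_sum_decomposition:
  fixes M :: "('v::complex_space, 'm::complex_space) vmod"
  assumes M: "va_module U M" and F: "finite F"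
    and P: "\<And>t. t \<in> F \<Longrightarrow> P t = {0} \<or> simple_ops (vcar U \<times> UNIV) (vact M) (P t)"
    and PM: "\<And>t. t \<in> F \<Longrightarrow> P t \<subseteq> mcar M"
    and sp: "\<And>w. w \<in> mcar M \<Longrightarrow> \<exists>p. (\<forall>t\<in>F. p t \<in> P t) \<and> w = (\<Sum>t\<in>F. p t)"
  shows "\<exists>(k::nat) (K :: nat \<Rightarrow> ('v, 'm) vmod).
    (\<forall>i<k. irreducible_va_module U (K i)) \<and> vmod_iso U M (vmod_sum {..<k} K)"
proof -
  note D = twisted_moduleD[OF M[unfolded va_module_def]]
  have linM: "lin_on (mcar M) (mcar M) (vact M s)" if "s \<in> vcar U \<times> UNIV" for s
    using that D(2) by auto
  have "\<exists>(k::nat) Q. (\<forall>i<k. simple_ops (vcar U \<times> UNIV) (vact M) (Q i) \<and> Q i \<subseteq> mcar M) \<and>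
    (\<forall>q. (\<forall>i<k. q i \<in> Q i) \<longrightarrow> (\<Sum>i<k. q i) = 0 \<longrightarrow> (\<forall>i<k. q i = 0)) \<and>
    (\<forall>p. (\<forall>t\<in>F. p t \<in> P t) \<longrightarrow> (\<exists>q. (\<forall>i<k. q i \<in> Q i) \<and> (\<Sum>t\<in>F. p t) = (\<Sum>i<k. q i)))"
    by (rule finite_sum_direct[OF F P linM D(1) PM])
  then obtain k :: nat and Q where Q: "\<And>i. i < k \<Longrightarrow> simple_ops (vcar U \<times> UNIV) (vact M) (Q i)" "\<And>i. i < k \<Longrightarrow> Q i \<subseteq> mcar M"
    and ind: "\<And>q i. (\<forall>i<k. q i \<in> Q i) \<Longrightarrow> (\<Sum>i<k. q i) = 0 \<Longrightarrow> i < k \<Longrightarrow> q i = 0"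
    and dec: "\<And>p. (\<forall>t\<in>F. p t \<in> P t) \<Longrightarrow> \<exists>q. (\<forall>i<k. q i \<in> Q i) \<and> (\<Sum>t\<in>F. p t) = (\<Sum>i<k. q i)"
    by (elim exE conjE) blast
  define K where "K = (\<lambda>i. vmod_restrict M (Q i))"
  let ?D = "direct_sum {..<k} Q"
  let ?f = "\<lambda>x. \<Sum>i<k. x i"
  have car: "mcar (vmod_sum {..<k} K) = ?D" by (simp add: vmod_sum_def K_def)
  have mode: "mmode (vmod_sum {..<k} K) v n x = (\<lambda>i. if i < k then mmode M v n (x i) else 0)" for v n x
    by (simp add: vmod_sum_def K_def fun_eq_iff)
  have subQ: "cv.subspace (Q i)" if "i < k" for i by (rule simple_opsD(1)[OF Q(1)[OF that]])
  have subD: "cv.subspace ?D" by (rule direct_sum_subspace) (simp add: subQ)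
  have DI: "x \<in> ?D \<longleftrightarrow> (\<forall>i<k. x i \<in> Q i) \<and> (\<forall>i. k \<le> i \<longrightarrow> x i = 0)" for x
  proof
    assume x: "(\<forall>i<k. x i \<in> Q i) \<and> (\<forall>i. k \<le> i \<longrightarrow> x i = 0)"
    then have "i < k" if "x i \<noteq> 0" for i using that leI by metis
    then have "{i. x i \<noteq> 0} \<subseteq> {..<k}" by auto
    from finite_subset[OF this] x show "x \<in> ?D" by (auto simp: direct_sum_def)
  qed (auto simp: direct_sum_def)
  have f_in: "?f x \<in> mcar M" if "x \<in> ?D" for x
    using that Q(2) by (intro cv.subspace_sum[OF D(1)]) (auto simp: DI)
  have lin: "lin_on ?D (mcar M) ?f"
    using f_in by (simp add: lin_on_def sum.distrib cv.scale_sum_right)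
  have "vmod_hom_iso U (vmod_sum {..<k} K) M ?f"
    unfolding vmod_hom_iso_def car mode
  proof (intro conjI ballI allI)
    show "bij_betw ?f ?D (mcar M)"
      unfolding bij_betw_def
    proof
      show "inj_on ?f ?D"
      proof (rule inj_on_lin_on[OF lin subD])
        fix x assume x: "x \<in> ?D" "?f x = 0"
        then have "x i = 0" if "i < k" for i using ind[of x i] that by (simp add: DI)
        moreover have "x i = 0" if "k \<le> i" for i using x(1) that by (simp add: DI)
        ultimately have "x i = 0" for i using not_less by blast
        then show "x = 0" by (simp add: fun_eq_iff)
      qed
      show "?f ` ?D = mcar M"
      proof
        show "?f ` ?D \<subseteq> mcar M" using f_in by blast
        show "mcar M \<subseteq> ?f ` ?D"
        proof
          fix w assume "w \<in> mcar M"
          then obtain p where p: "\<forall>t\<in>F. p t \<in> P t" "w = (\<Sum>t\<in>F. p t)" using sp by blast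
          obtain q where q: "\<forall>i<k. q i \<in> Q i" "(\<Sum>t\<in>F. p t) = (\<Sum>i<k. q i)" using dec[OF p(1)] by blast
          show "w \<in> ?f ` ?D"
            by (rule image_eqI[of _ _ "\<lambda>i. if i < k then q i else 0"]) (use p(2) q in \<open>auto simp: DI\<close>)
        qed
      qed
    qed
    show "lin_on ?D (mcar M) ?f" by (rule lin)
    show "(\<Sum>i<k. (if i < k then mmode M v n (x i) else 0)) = mmode M v n (\<Sum>i<k. x i)"
      if v: "v \<in> vcar U" and x: "x \<in> ?D" for v n x
    proof -
      have "mmode M v n (\<Sum>i<k. x i) = (\<Sum>i<k. mmode M v n (x i))"
        by (rule lin_on_sum[OF D(2)[OF v] D(1)]) (use x Q(2) in \<open>auto simp: DI\<close>)
      then show ?thesis by simp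
    qed
  qed
  then have "vmod_hom_iso U M (vmod_sum {..<k} K) (inv_into (mcar (vmod_sum {..<k} K)) ?f)"
  proof (rule vmod_hom_iso_inv)
    show "cv.subspace (mcar (vmod_sum {..<k} K))" using subD by (simp only: car)
    show "mmode (vmod_sum {..<k} K) v n w \<in> mcar (vmod_sum {..<k} K)"
      if "v \<in> vcar U" "w \<in> mcar (vmod_sum {..<k} K)" for v n w
      using that lin_on_in[OF simple_opsD(2)[OF Q(1), of _ "(v, n)"]] by (simp add: car mode DI)
  qed
  then have "vmod_iso U M (vmod_sum {..<k} K)"
    unfolding vmod_iso_def by (rule exI[of "vmod_hom_iso U M (vmod_sum {..<k} K)"])
  moreover have "irreducible_va_module U (K i)" if "i < k" for i
    unfolding K_def by (rule vmod_restrict_irreducible[OF M Q(1)[OF that] Q(2)[OF that]])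
  ultimately show ?thesis by (intro exI[of _ k] exI[of _ K]) blast
qed

text \<open>The preimage of a stable subspace of the image is stable in \<open>X\<close>, so it is
  zero or everything.\<close>

lemma simple_ops_image:
  assumes X: "simple_ops Ops act X" and f: "ops_hom Ops X act Z act' f"
    and lin: "\<And>s. s \<in> Ops \<Longrightarrow> lin_on Z Z (act' s)"
  shows "f ` X = {0} \<or> simple_ops Ops act' (f ` X)"
proof (cases "f ` X = {0}")
  case False
  note D = simple_opsD[OF X]
  have fl: "lin_on X Z f" and fa: "\<And>s x. s \<in> Ops \<Longrightarrow> x \<in> X \<Longrightarrow> f (act s x) = act' s (f x)"
    using f by (simp_all add: ops_hom_def)
  have f0: "f 0 = 0" by (rule lin_on_zero[OF fl D(1)])
  have fZ: "f ` X \<subseteq> Z" using lin_on_in[OF fl] by blast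
  have "simple_ops Ops act' (f ` X)"
    unfolding simple_ops_def
  proof (intro conjI ballI allI impI)
    show "cv.subspace (f ` X)" by (rule subspace_image[OF fl D(1)])
    show "lin_on (f ` X) (f ` X) (act' s)" if s: "s \<in> Ops" for s
    proof (rule lin_on_mono[OF lin[OF s] fZ])
      fix y assume "y \<in> f ` X"
      then obtain x where x: "x \<in> X" "y = f x" by blast
      have "act' s y = f (act s x)" using fa[OF s x(1)] x(2) by simp
      then show "act' s y \<in> f ` X" using lin_on_in[OF D(2)[OF s] x(1)] by blast
    qed
    show "f ` X \<noteq> {0}" by (rule False)
    fix N assume N: "stable Ops act' N" "N \<subseteq> f ` X"
    have subN: "cv.subspace N" using N(1) by (simp add: stable_def)
    have "stable Ops act {x \<in> X. f x \<in> N}"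
    proof (rule stableI)
      show "cv.subspace {x \<in> X. f x \<in> N}"
        by (rule cv.subspaceI) (use D(1) subN fl f0 in
          \<open>auto simp: lin_on_def cv.subspace_add cv.subspace_scale cv.subspace_0\<close>)
      show "act s x \<in> {x \<in> X. f x \<in> N}" if "s \<in> Ops" "x \<in> {x \<in> X. f x \<in> N}" for s x
        using that N(1) fa[of s x] lin_on_in[OF D(2)[OF that(1)], of x] by (simp add: stable_def)
    qed
    then have "{x \<in> X. f x \<in> N} = {0} \<or> {x \<in> X. f x \<in> N} = X" by (rule D(4)) blast
    moreover have "N = f ` {x \<in> X. f x \<in> N}" using N(2) by auto
    ultimately show "N = {0} \<or> N = f ` X" using f0 by auto
  qed
  then show ?thesis ..
qed simp

lemma irreducible_va_module_ops:
  assumes "irreducible_va_module U P"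
  shows "simple_ops (vcar U \<times> UNIV) (vact P) (mcar P)"
proof -
  have P: "va_module U P" "irreducible_vmod U P" using assms by (simp_all add: irreducible_va_module_def)
  note D = twisted_moduleD[OF P(1)[unfolded va_module_def]]
  have "vsubmodule U P N" if "stable (vcar U \<times> UNIV) (vact P) N" "N \<subseteq> mcar P" for N
    using that by (auto simp: vsubmodule_def stable_def)
  then show ?thesis
    unfolding simple_ops_def using D(1,2) P(2) by (auto simp: irreducible_vmod_def)
qed

section \<open>Minimal left ideals and finite decompositions\<close>

context orbifold
begin

lemma simple_left_ideal:
  assumes L: "simple_ops (acar A) (amul A) L" "L \<subseteq> acar A"
  shows "simple_amod A \<lparr>wcar = L, wact = amul A\<rparr>"
proof -
  note D = simple_opsD[OF L(1)]
  have "alg_module A \<lparr>wcar = L, wact = amul A\<rparr>"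
    unfolding alg_module_def
  proof (intro conjI ballI; simp)
    show "cv.subspace L" by (rule D(1))
    show "lin_on L L (amul A a)" if "a \<in> acar A" for a by (rule D(2)[OF that])
    show "lin_on (acar A) L (\<lambda>a. amul A a w)" if "w \<in> L" for w
      by (rule lin_on_mono[OF amul_lin_left]) (use that lin_on_in[OF D(2)] in auto)
    show "amul A (amul A a c) w = amul A a (amul A c w)" if "a \<in> acar A" "c \<in> acar A" "w \<in> L" for a c w
      using amul_assoc[of a c w] that L(2) by auto
    show "amul A (aone A) w = w" if "w \<in> L" for w using amul_one(1)[of w] that L(2) by auto
  qed
  with L(1) show ?thesis by (simp add: simple_amod_ops)
qed

text \<open>The minimal left ideals span a left ideal, and a nonzero complement of it would itself
  contain a minimal left ideal.\<close>

lemma aone_in_simple_ideals: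
  "aone A \<in> cv.span (\<Union>{L. L \<subseteq> acar A \<and> simple_ops (acar A) (amul A) L})"
proof -
  let ?B = "\<Union>{L. L \<subseteq> acar A \<and> simple_ops (acar A) (amul A) L}"
  let ?R = "\<lparr>wcar = acar A, wact = amul A\<rparr>"
  have sub: "cv.span ?B \<subseteq> acar A"
    by (rule cv.span_minimal[OF _ acar_subspace]) blast
  have "amul A a x \<in> cv.span ?B" if a: "a \<in> acar A" and x: "x \<in> cv.span ?B" for a x
  proof (rule lin_on_span_in[OF _ cv.subspace_span _ x])
    show "lin_on (cv.span ?B) UNIV (amul A a)" by (rule lin_on_mono[OF amul_lin_right]) simp_all
    show "amul A a y \<in> cv.span ?B" if y: "y \<in> ?B" for y
    proof -
      obtain L where L: "L \<subseteq> acar A" "simple_ops (acar A) (amul A) L" "y \<in> L" using y by blast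
      have "amul A a y \<in> L" by (rule lin_on_in[OF simple_opsD(2)[OF L(2) a] L(3)])
      with L show ?thesis by (intro cv.span_base) blast
    qed
  qed
  then have "asubmodule A ?R (cv.span ?B)"
    using sub by (simp add: asubmodule_def cv.subspace_span)
  from maschke_complement[OF regular_module this]
  obtain Y where Y: "asubmodule A ?R Y" "cv.span ?B \<inter> Y = {0}" "{x + y | x y. x \<in> cv.span ?B \<and> y \<in> Y} = wcar ?R"
    by (elim exE conjE)
  have Y': "stable (acar A) (amul A) Y" "Y \<subseteq> acar A" using Y(1) by (auto simp: asubmodule_stable)
  have "Y = {0}"
  proof (rule ccontr)
    assume nz: "Y \<noteq> {0}"
    have "lin_on Y Y (amul A s)" if "s \<in> acar A" for s
      by (rule lin_on_mono[OF amul_lin_right]) (use that Y'(1) in \<open>auto simp: stable_def\<close>)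
    from fin_dim_simple_submodule[OF fin_dim_subspace[OF acar_fin_dim _ Y'(2)] Y'(1) nz this]
    obtain N where N: "N \<subseteq> Y" "simple_ops (acar A) (amul A) N"
      using Y'(1) by (auto simp: stable_def)
    then have "N \<subseteq> ?B" using Y'(2) by blast
    then have "N \<subseteq> cv.span ?B \<inter> Y" using N(1) cv.span_superset by blast
    then have "N = {0}" using Y(2) cv.subspace_0[OF simple_opsD(1)[OF N(2)]] by auto
    then show False using simple_opsD(3)[OF N(2)] by simp
  qed
  moreover have "aone A \<in> {x + y | x y. x \<in> cv.span ?B \<and> y \<in> Y}"
    unfolding Y(3) using aone_in by simp
  ultimately show ?thesis by auto
qed

text \<open>Evaluating homomorphisms at \<open>y\<close> and taking the coordinate at
  \<open>M\<close> commutes with the modes of \<open>U\<close>, so the image is zero or a copy of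
  the irreducible multiplicity space.\<close>

lemma evaluation_image:
  assumes Y: "simple_amod A Y" and y: "y \<in> wcar Y" and M: "M \<in> S"
  defines "P \<equiv> (\<lambda>f. f y M) ` amod_hom A Y MA"
  shows "P = {0} \<or> simple_ops (vcar U \<times> UNIV) (vact M) P" "P \<subseteq> mcar M"
proof -
  show PM: "P \<subseteq> mcar M"
    unfolding P_def using homs_in[OF _ y] MV_comp[OF _ M] by blast
  have "ops_hom (vcar U \<times> UNIV) (mcar (homs Y)) (vact (homs Y)) (mcar M) (vact M) (\<lambda>f. f y M)"
    unfolding ops_hom_def
  proof (intro conjI ballI)
    show "lin_on (mcar (homs Y)) (mcar M) (\<lambda>f. f y M)"
      using PM by (auto simp: lin_on_def P_def homs_car)
    show "vact (homs Y) s f y M = vact M s (f y M)" if "s \<in> vcar U \<times> UNIV" for s f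
      using y M by (cases s) (simp add: homs_mode MV_mode)
  qed
  moreover have "lin_on (mcar M) (mcar M) (vact M s)" for s
    by (cases s) (simp add: mmode_lin[OF tmS[OF M]])
  ultimately show "P = {0} \<or> simple_ops (vcar U \<times> UNIV) (vact M) P"
    unfolding P_def homs_car[symmetric]
    by (rule simple_ops_image[OF irreducible_va_module_ops[OF homs_irreducible_va_module[OF Y]]])
qed

theorem finite_decomposition:
  assumes M: "M \<in> S"
  shows "\<exists>(k::nat) (K :: nat \<Rightarrow> ('v, 'm) vmod).
    (\<forall>i<k. irreducible_va_module U (K i)) \<and> vmod_iso U M (vmod_sum {..<k} K)"
proof -
  obtain F r where F: "finite F" "F \<subseteq> \<Union>{L. L \<subseteq> acar A \<and> simple_ops (acar A) (amul A) L}"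
    and one: "aone A = (\<Sum>t\<in>F. cscale (r t) t)"
    using aone_in_simple_ideals unfolding cv.span_explicit by blast
  have "\<forall>t\<in>F. \<exists>L. L \<subseteq> acar A \<and> simple_ops (acar A) (amul A) L \<and> t \<in> L" using F(2) by blast
  from bchoice[OF this] obtain L where
    L: "\<And>t. t \<in> F \<Longrightarrow> L t \<subseteq> acar A" "\<And>t. t \<in> F \<Longrightarrow> simple_ops (acar A) (amul A) (L t)" "\<And>t. t \<in> F \<Longrightarrow> t \<in> L t"
    by blast
  define Y where "Y = (\<lambda>t. \<lparr>wcar = L t, wact = amul A\<rparr>)"
  have Y: "simple_amod A (Y t)" "t \<in> wcar (Y t)" if "t \<in> F" for t
    using simple_left_ideal[OF L(2,1)] L(3) that by (simp_all add: Y_def)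
  show ?thesis
  proof (rule finite_sum_decomposition[OF twisted_va_module[OF tmS[OF M]] F(1)])
    show "(\<lambda>f. f t M) ` amod_hom A (Y t) MA = {0} \<or>
        simple_ops (vcar U \<times> UNIV) (vact M) ((\<lambda>f. f t M) ` amod_hom A (Y t) MA)" if "t \<in> F" for t
      by (rule evaluation_image(1)[OF Y[OF that] M])
    show "(\<lambda>f. f t M) ` amod_hom A (Y t) MA \<subseteq> mcar M" if "t \<in> F" for t
      by (rule evaluation_image(2)[OF Y[OF that] M])
    show "\<exists>p. (\<forall>t\<in>F. p t \<in> (\<lambda>f. f t M) ` amod_hom A (Y t) MA) \<and> w = (\<Sum>t\<in>F. p t)"
      if w: "w \<in> mcar M" for w
    proof -
      let ?x = "single M w"
      have x: "?x \<in> mcar MV" by (rule single_in[OF M w])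
      have "?x = wact MA (\<Sum>t\<in>F. cscale (r t) t) ?x" using wact_one[OF x] one by simp
      also have "\<dots> = (\<Sum>t\<in>F. wact MA (cscale (r t) t) ?x)"
        by (rule lin_on_sum[OF wact_lin_alg]) simp_all
      finally have "w = (\<Sum>t\<in>F. wact MA (cscale (r t) t) ?x) M" by (metis single_same)
      then have "w = (\<Sum>t\<in>F. wact MA (cscale (r t) t) ?x M)" by (simp only: sum_fun_apply)
      \<comment> \<open>The summand is the value at \<open>t\<close> of the map sending
        \<open>l\<close> in the left ideal to \<open>r t\<close> times \<open>l\<close> applied to
        \<open>single M w\<close>. This map is \<open>A\<close>-linear because \<open>A\<close> acts
        from the left.\<close>
      moreover have "wact MA (cscale (r t) t) ?x M \<in> (\<lambda>f. f t M) ` amod_hom A (Y t) MA" if t: "t \<in> F" for t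
      proof -
        have subL: "cv.subspace (L t)" by (rule simple_opsD(1)[OF L(2)[OF t]])
        have "ops_hom (acar A) (wcar (Y t)) (wact (Y t)) (mcar MV) (wact MA) (\<lambda>l. cscale (r t) (wact MA l ?x))"
          unfolding ops_hom_def
        proof (intro conjI ballI)
          show "lin_on (wcar (Y t)) (mcar MV) (\<lambda>l. cscale (r t) (wact MA l ?x))"
            using wact_in[OF x] lin_on_add[OF wact_lin_alg] lin_on_scale[OF wact_lin_alg] cv.subspace_scale[OF MV_subspace]
            by (simp add: lin_on_def cscale_add_right cscale_cscale mult.commute)
          show "cscale (r t) (wact MA (wact (Y t) s l) ?x) = wact MA s (cscale (r t) (wact MA l ?x))"
            if "s \<in> acar A" "l \<in> wcar (Y t)" for s l
          proof -
            have "l \<in> acar A" using that(2) L(1)[OF t] by (auto simp: Y_def)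
            then show ?thesis
              using wact_amul[OF that(1) _ x, of l] lin_on_scale[OF wact_lin wact_in[OF x]] by (simp add: Y_def)
          qed
        qed
        from homsI[OF this] Y[OF t] show ?thesis
          by (intro image_eqI[where x = "\<lambda>l. if l \<in> wcar (Y t) then cscale (r t) (wact MA l ?x) else 0"])
            (simp_all add: simple_amod_def lin_on_scale[OF wact_lin_alg])
      qed
      ultimately show ?thesis
        by (intro exI[of _ "\<lambda>t. wact MA (cscale (r t) t) ?x M"]) simp
    qed
  qed
qed

end

text \<open>The claim about an arbitrary irreducible module comes without intertwiners, so they are
  chosen here.\<close>

lemma (in stable_modules) intertwining_system_exists: "\<exists>\<phi>. intertwining_system V G S \<phi>"
proof -
  define iso where "iso = (\<lambda>M h f. vmod_hom_iso V (twist M (finv h)) (tgt M h) f)"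
  have ex: "\<exists>f. iso M h f" if M: "M \<in> S" and h: "h \<in> G" for M h
  proof -
    have "vmod_iso V (mact V S M (finv h)) (twist M (finv h))" by (rule mact_iso[OF M G_inv[OF h]])
    then have "vmod_iso V (twist M (finv h)) (mact V S M (finv h))"
      by (rule iso_symS[OF mact_in[OF M G_inv[OF h]]])
    then show ?thesis unfolding iso_def tgt_def vmod_iso_def .
  qed
  \<comment> \<open>The value at \<open>id\<close> is set apart to meet the normalisation of
    intertwining systems.\<close>
  define \<phi> where "\<phi> = (\<lambda>M h. if h = id then (\<lambda>w. w) else (SOME f. iso M h f))"
  have \<phi>: "iso M h (\<phi> M h)" if M: "M \<in> S" and h: "h \<in> G" for M h
  proof (cases "h = id")
    case True
    have "finv id = (id :: 'v \<Rightarrow> 'v)" by (simp add: inv_id)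
    then show ?thesis
      using M True by (simp add: iso_def \<phi>_def vmod_hom_iso_def lin_on_def bij_betw_def)
  next
    case False
    then show ?thesis using someI_ex[OF ex[OF M h]] by (simp add: \<phi>_def)
  qed
  have "intertwining_system V G S \<phi>"
    unfolding intertwining_system_def Let_def tgt_def[symmetric]
  proof (intro conjI ballI allI)
    fix M h assume M: "M \<in> S" and h: "h \<in> G"
    note iso = \<phi>[OF M h, unfolded iso_def vmod_hom_iso_def mcar_twist mmode_twist]
    show "bij_betw (\<phi> M h) (mcar M) (mcar (tgt M h))" "lin_on (mcar M) (mcar (tgt M h)) (\<phi> M h)"
      using iso by blast+
    have "finv h (h u) = u" for u using bij_is_inj[OF G_bij[OF h]] by simp
    then show "\<phi> M h (mmode M u n w) = mmode (tgt M h) (h u) n (\<phi> M h w)" if "w \<in> mcar M" for u n w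
      using iso that VU by (metis UNIV_I)
  qed (simp add: \<phi>_def)
  then show ?thesis by (rule exI[of "intertwining_system V G S"])
qed

section \<open>Twists of an arbitrary irreducible module\<close>

context automorphism_subgroup
begin

text \<open>Since \<sigma> is central, \<open>g\<close> preserves its eigenspaces, so each axiom for
  \<open>twist M g\<close> is an axiom for \<open>M\<close> at the translated vectors.\<close>

lemma twist_twisted_module:
  assumes g: "g \<in> G" and M: "twisted_module V \<sigma> M"
  shows "twisted_module V \<sigma> (twist M g)"
proof -
  note D = twisted_moduleD[OF M, unfolded VU]
  have eig: "g u \<in> eigenspace V \<sigma> r" if "u \<in> eigenspace V \<sigma> r" for u r
    using that central g lin_on_scale[OF G_lin[OF g]] by (auto simp: eigenspace_def VU fun_eq_iff)
  have gr: "g (rmode V u n v) = rmode V (g u) n (g v)" for u n v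
    using G_mode[OF g] lin_on_zero[OF G_lin[OF g]] by (simp add: rmode_def)
  have gv: "g (vac V) = vac V" using G_aut[OF g] by (simp add: automorphism_def)
  show ?thesis
    unfolding twisted_module_def Let_def VU
  proof (intro conjI ballI allI impI)
    have eq: "mmode (twist M g) = (\<lambda>v. mmode M (g v))" by (simp add: fun_eq_iff)
    show "lin_on UNIV (mcar (twist M g)) (\<lambda>v. mmode (twist M g) v n w)" if "w \<in> mcar (twist M g)" for n w
      using lin_on_compose[OF G_lin[OF g] D(3)] that by simp
    show "jacobi_identity (of_nat r / of_nat (aut_order V \<sigma>)) (rmode V) (mmode (twist M g)) u v w"
      if "r < aut_order V \<sigma>" "u \<in> eigenspace V \<sigma> r" "w \<in> mcar (twist M g)" for r u v w
      using D(7)[OF that(1) eig[OF that(2)], of w "g v"] that(3)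
      unfolding jacobi_identity_def eq gr mcar_twist by simp
    show "lin_on (mcar (twist M g)) (mcar (twist M g)) (mmode (twist M g) v n)" for v n using D(2) by simp
    show "mmode (twist M g) (vac V) n w = (if n = -1 then w else 0)" if "w \<in> mcar (twist M g)" for n w
      using D(4) that gv by simp
    show "mmode (twist M g) u n w = 0"
      if "r < aut_order V \<sigma>" "u \<in> eigenspace V \<sigma> r" "w \<in> mcar (twist M g)"
        "n - of_nat r / of_nat (aut_order V \<sigma>) \<notin> \<int>" for r u w n
      using D(5)[OF that(1) eig[OF that(2)]] that(3,4) by simp
    show "\<exists>N. \<forall>l\<ge>N. mmode (twist M g) u l w = 0"
      if "r < aut_order V \<sigma>" "u \<in> eigenspace V \<sigma> r" "w \<in> mcar (twist M g)" for r u w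
      using D(6)[OF that(1) eig[OF that(2)]] that(3) by simp
  qed (simp add: D(1))
qed

lemma twist_irreducible:
  assumes g: "g \<in> G" and M: "irreducible_twisted_module V \<sigma> M"
  shows "irreducible_twisted_module V \<sigma> (twist M g)"
  unfolding irreducible_twisted_module_def
proof
  have "twisted_module V \<sigma> M" using M by (simp add: irreducible_twisted_module_def)
  then show "twisted_module V \<sigma> (twist M g)" by (rule twist_twisted_module[OF g])
  have "vsubmodule V M N" if N: "vsubmodule V (twist M g) N" for N
    unfolding vsubmodule_def
  proof (intro conjI ballI allI)
    fix v n w assume "w \<in> N"
    then have "mmode M (g (finv g v)) n w \<in> N" using N by (simp add: vsubmodule_def VU)
    moreover have "g (finv g v) = v" by (rule surj_f_inv_f[OF bij_is_surj[OF G_bij[OF g]]])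
    ultimately show "mmode M v n w \<in> N" by simp
  qed (use N in \<open>auto simp: vsubmodule_def\<close>)
  then show "irreducible_vmod V (twist M g)"
    using M by (auto simp: irreducible_twisted_module_def irreducible_vmod_def)
qed

text \<open>The carrier type of \<open>N\<close> is independent of that of a given set
  \<open>S\<close>, so the whole construction is instantiated anew with a stable set made from the
  twists of \<open>N\<close>.\<close>

theorem irreducible_twisted_module_decomposition:
  fixes N :: "('v, 'n::complex_space) vmod"
  assumes N: "irreducible_twisted_module V \<sigma> N"
  shows "\<exists>(k::nat) (K :: nat \<Rightarrow> ('v, 'n) vmod).
    (\<forall>i<k. irreducible_va_module U (K i)) \<and> vmod_iso U N (vmod_sum {..<k} K)"
proof -
  define R where "R = twist N ` G"
  \<comment> \<open>\<open>c\<close> picks one representative of each isomorphism class among the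
    twists. It takes equal values on isomorphic twists because the condition under the choice
    operator depends only on the class; so the image of \<open>c\<close> is pairwise inequivalent
    and still stable.\<close>
  define c :: "('v, 'n) vmod \<Rightarrow> ('v, 'n) vmod" where "c = (\<lambda>K. SOME L. L \<in> R \<and> vmod_iso V L K)"
  have irrR: "irreducible_twisted_module V \<sigma> K" if "K \<in> R" for K
    using that twist_irreducible[OF _ N] by (auto simp: R_def)
  have sym: "vmod_iso V L K" if "K \<in> R" "vmod_iso V K L" for K L :: "('v, 'n) vmod"
  proof (rule vmod_iso_sym[OF that(2)])
    have tm: "twisted_module V \<sigma> K" using irrR[OF that(1)] by (simp add: irreducible_twisted_module_def)
    show "cv.subspace (mcar K)" by (rule mcar_subspace[OF tm])
    show "mmode K v n w \<in> mcar K" if "w \<in> mcar K" for v n w by (rule mmode_in[OF tm that])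
  qed
  have c: "c K \<in> R" "vmod_iso V (c K) K" if "K \<in> R" for K
    using someI[of "\<lambda>L. L \<in> R \<and> vmod_iso V L K" K] that vmod_iso_refl by (auto simp: c_def)
  have c_eq: "c K = c L" if K: "K \<in> R" and L: "L \<in> R" and "vmod_iso V K L" for K L
  proof -
    have "vmod_iso V P K \<longleftrightarrow> vmod_iso V P L" for P :: "('v, 'n) vmod"
      using vmod_iso_trans[OF _ \<open>vmod_iso V K L\<close>, of P] vmod_iso_trans[OF _ sym[OF K \<open>vmod_iso V K L\<close>], of P] by blast
    then show ?thesis by (simp add: c_def)
  qed
  interpret stable_modules V G \<sigma> "c ` R"
  proof
    show "finite (c ` R)" using finG by (simp add: R_def)
    show "\<forall>M\<in>c ` R. irreducible_twisted_module V \<sigma> M" using irrR c(1) by blast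
    show "\<forall>M\<in>c ` R. \<forall>N\<in>c ` R. vmod_iso V M N \<longrightarrow> M = N"
    proof (intro ballI impI, elim imageE)
      fix M M' K K' assume iso: "vmod_iso V M M'" and M: "M = c K" "M' = c K'" and K: "K \<in> R" "K' \<in> R"
      have "vmod_iso V K (c K)" by (rule sym[OF c[OF K(1)]])
      from vmod_iso_trans[OF this iso[unfolded M]] have "vmod_iso V K (c K')" .
      from c_eq[OF K vmod_iso_trans[OF this c(2)[OF K(2)]]] show "M = M'" by (simp add: M)
    qed
    show "G_stable V G (c ` R)"
      unfolding G_stable_def
    proof (intro ballI)
      fix M h assume "M \<in> c ` R" and h: "h \<in> G"
      then have "M \<in> R" using c(1) by blast
      then obtain g where "g \<in> G" "M = twist N g" by (auto simp: R_def)
      then have R: "twist M h \<in> R" using h by (auto simp: R_def twist_twist intro: G_comp)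
      show "\<exists>L\<in>c ` R. vmod_iso V L (twist M h)"
        using c(2)[OF R] R by (intro bexI[of _ "c (twist M h)"]) auto
    qed
  qed
  obtain \<phi> where \<phi>: "intertwining_system V G (c ` R) \<phi>" using intertwining_system_exists by blast
  interpret orbifold V G \<sigma> "c ` R" \<phi> by unfold_locales (rule \<phi>)
  have NR: "N \<in> R" unfolding R_def using G_id by (intro image_eqI[of _ _ id]) simp_all
  have "vmod_iso V N (c N)" by (rule sym[OF c[OF NR]])
  then have iso: "vmod_iso U N (c N)" unfolding vmod_iso_def using vmod_hom_iso_fixed by blast
  obtain k :: nat and K :: "nat \<Rightarrow> ('v, 'n) vmod" where
    K: "\<forall>i<k. irreducible_va_module U (K i)" "vmod_iso U (c N) (vmod_sum {..<k} K)"
    using finite_decomposition[OF imageI[OF NR]] by (elim exE conjE)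
  show ?thesis
    by (rule exI[of _ k], rule exI[of _ K]) (intro conjI K(1) vmod_iso_trans[OF iso K(2)])
qed

end

theorem theorem7p4:
  fixes V :: "'v::complex_space vertex"
    and G :: "('v \<Rightarrow> 'v) set"
    and \<sigma> :: "'v \<Rightarrow> 'v"
    and S :: "('v, 'm::complex_space) vmod set"
    and \<phi> :: "('v, 'm) vmod \<Rightarrow> ('v \<Rightarrow> 'v) \<Rightarrow> 'm \<Rightarrow> 'm"
    and rep :: "('v, 'm) vmod set \<Rightarrow> ('v, 'm) vmod"
    and W :: "('v, 'm) vmod set \<Rightarrow> ((('v \<Rightarrow> 'v) \<Rightarrow> complex) \<Rightarrow> complex) \<Rightarrow>
              (('v \<Rightarrow> 'v) \<Rightarrow> complex, 'w::complex_space) amod"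
  defines "U \<equiv> fixed_points V G"
    and "A \<equiv> gs_algebra V G S \<phi>"
    and "J \<equiv> orbits V G S"
    and "\<Lambda> \<equiv> \<lambda>j. tga_irr_chars V G S \<phi> (rep j)"
  defines "I \<equiv> {(j, \<chi>). j \<in> J \<and> \<chi> \<in> \<Lambda> j}"
    and "Wind \<equiv> \<lambda>j \<chi>. induced_module V G S \<phi> (rep j) (W j \<chi>)"
    and "Mmult \<equiv> \<lambda>j \<chi>. mult_module V G S \<phi> (rep j) (W j \<chi>)"
    and "\<M>\<^sub>A \<equiv> gs_module V G S \<phi>"
    and "\<M>\<^sub>V \<equiv> vmod_sum S (\<lambda>M. M)"
  assumes "vcar V = UNIV"
    and "simple_vertex_algebra V"
    and "countable_dim (vcar V)"
    and "subgroup G (aut_group V)" and "finite G"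
    and "\<sigma> \<in> G" and "\<forall>g\<in>G. g \<circ> \<sigma> = \<sigma> \<circ> g"
    and "finite S"
    and "\<forall>M\<in>S. irreducible_twisted_module V \<sigma> M"
    and "\<forall>M\<in>S. \<forall>N\<in>S. vmod_iso V M N \<longrightarrow> M = N"
    and "G_stable V G S"
    and "intertwining_system V G S \<phi>"
    and "\<forall>j\<in>J. rep j \<in> j"
    and "\<forall>j\<in>J. \<forall>\<chi>\<in>\<Lambda> j. simple_amod (twisted_group_algebra V G S \<phi> (rep j)) (W j \<chi>) \<and>
           character (twisted_group_algebra V G S \<phi> (rep j)) (W j \<chi>) = \<chi>"
  shows "au_iso A U \<M>\<^sub>A \<M>\<^sub>V
           (amod_sum I (\<lambda>(j, \<chi>). tensor_amod (Wind j \<chi>) (Mmult j \<chi>)))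
           (vmod_sum I (\<lambda>(j, \<chi>). tensor_vmod (Wind j \<chi>) (Mmult j \<chi>)))
       \<and> dual_pair A U \<M>\<^sub>A \<M>\<^sub>V I (\<lambda>(j, \<chi>). Wind j \<chi>)
       \<and> (\<forall>j\<in>J. \<forall>\<chi>\<in>\<Lambda> j. mcar (Mmult j \<chi>) \<noteq> {0})
       \<and> (\<forall>j\<in>J. \<forall>\<chi>\<in>\<Lambda> j. irreducible_va_module U (Mmult j \<chi>))
       \<and> (\<forall>j\<^sub>1\<in>J. \<forall>j\<^sub>2\<in>J. \<forall>\<chi>\<^sub>1\<in>\<Lambda> j\<^sub>1. \<forall>\<chi>\<^sub>2\<in>\<Lambda> j\<^sub>2.
            vmod_iso U (Mmult j\<^sub>1 \<chi>\<^sub>1) (Mmult j\<^sub>2 \<chi>\<^sub>2) \<longleftrightarrow> j\<^sub>1 = j\<^sub>2 \<and> \<chi>\<^sub>1 = \<chi>\<^sub>2)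
       \<and> (\<forall>N :: ('v, 'n::complex_space) vmod. irreducible_twisted_module V \<sigma> N \<longrightarrow>
            (\<exists>(k::nat) (K :: nat \<Rightarrow> ('v, 'n) vmod).
               (\<forall>i<k. irreducible_va_module U (K i)) \<and> vmod_iso U N (vmod_sum {..<k} K)))"
proof -
  have "orbifold_representatives V G \<sigma> S \<phi> rep W"
    unfolding orbifold_representatives_def orbifold_representatives_axioms_def orbifold_def orbifold_axioms_def
      stable_modules_def stable_modules_axioms_def automorphism_subgroup_def
    using assms(10-) unfolding J_def \<Lambda>_def by (intro conjI)
  then interpret orbifold_representatives V G \<sigma> S \<phi> rep W .
  show ?thesis
    unfolding I_def J_def \<Lambda>_def A_def U_def Wind_def Mmult_def \<M>\<^sub>A_def \<M>\<^sub>V_def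
  proof (intro conjI)
    show "\<forall>j\<in>orbits V G S. \<forall>\<chi>\<in>tga_irr_chars V G S \<phi> (rep j). mcar (mult_module V G S \<phi> (rep j) (W j \<chi>)) \<noteq> {0}"
      using Mult_irreducible by (auto simp: irreducible_va_module_def irreducible_vmod_def)
  qed (use orbifold_decomposition orbifold_dual_pair Mult_irreducible Mult_inequivalent
      irreducible_twisted_module_decomposition in blast)+
qed

end
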